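(* Let $A\in\mathbb{R}^{n\times d}$, $B\in\mathbb{R}^{n\times d'}$, $\lambda>0$, $\varepsilon\in(0,1]$; let $X^*=\arg\min_{X\in\mathbb{R}^{d\times d'}}\|AX-B\|_F^2+\lambda\|X\|_F^2$, $\Delta_*=\|AX^*-B\|_F^2+\lambda\|X^*\|_F^2$, and let $U_1\in\mathbb{R}^{n\times d}$ consist of the first $n$ rows of a matrix in $\mathbb{R}^{(n+d)\times d}$ whose orthonormal columns span the column space of $\begin{bmatrix}A\\\sqrt\lambda I_d\end{bmatrix}$. There exist dimensions $m_1=O(\varepsilon^{-1}\mathrm{sd}_\lambda(A)+\mathrm{sd}_\lambda(A)^2)$ and $m_2=O(\varepsilon^{-1}(\mathrm{sd}_\lambda(A)+\log(1/\varepsilon))\log(\mathrm{sd}_\lambda(A)/\varepsilon))$ such that for $S_1\in\mathbb{R}^{m_1\times n}$ a sparse embedding and $S_2\in\mathbb{R}^{m_2\times m_1}$ an SRHT, $S=S_2S_1$ satisfies with constant probability $$\|U_1^\top S^\top SU_1-U_1^\top U_1\|_2\le1/4\quad\text{and}\quad\|U_1^\top S^\top S(B-AX^* )-U_1^\top(B-AX^* )\|_F\le\sqrt{\varepsilon\Delta_*},$$ and, with constant probability, $\tilde X\equiv\arg\min_X\|S(AX-B)\|_F^2+\lambda\|X\|_F^2$ satisfies $\|A\tilde X-B\|_F^2+\lambda\|\tilde X\|_F^2\le(1+\varepsilon)\Delta_*$. That is, in $O(\mathrm{nnz}(A)+\mathrm{nnz}(B))+\tilde O((d+d')(\mathrm{sd}_\lambda(A)/\varepsilon+\mathrm{sd}_\lambda(A)^2))$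 time a multiple-response ridge regression problem with $n$ rows can be reduced to one with $\tilde O(\varepsilon^{-1}\mathrm{sd}_\lambda(A))$ rows whose solution is a $(1+\varepsilon)$-approximate solution.
   Context: $\mathrm{sd}_\lambda(A)=\sum_i1/(1+\lambda/\sigma_i^2)$ over the nonzero singular values of $A$. A sparse embedding (CountSketch) matrix has in each column exactly one nonzero entry, a uniformly random sign in a uniformly random row, independently across columns. An SRHT matrix $S\in\mathbb{R}^{m\times N}$ is $\sqrt{N/m}\,PHD$ with $D$ a random diagonal sign matrix, $H$ the normalized Walsh–Hadamard matrix, and $P$ sampling $m$ rows uniformly at random. $\mathrm{nnz}$ counts nonzeros; $\tilde O$ hides polylogarithmic factors. *)

theory Defs
  imports
    "HOL-Probability.Probability"
    "HOL-Probability.Product_PMF"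
    "Jordan_Normal_Form.Char_Poly"
    "Jordan_Normal_Form.VS_Connect"
begin

hide_const (open) Finite_Cartesian_Product.mat Finite_Cartesian_Product.row
  Finite_Cartesian_Product.vec

section \<open>Norms, singular values, ridge regression\<close>

definition vec_norm2 :: "real vec \<Rightarrow> real" where
  "vec_norm2 x = sqrt (x \<bullet> x)"

definition spectral_norm :: "real mat \<Rightarrow> real" where
  "spectral_norm M =
     (SUP x \<in> {x \<in> carrier_vec (dim_col M). vec_norm2 x \<le> 1}. vec_norm2 (M *\<^sub>v x))"

definition fro_norm :: "real mat \<Rightarrow> real" where
  "fro_norm M = sqrt (\<Sum>i<dim_row M. \<Sum>j<dim_col M. (M $$ (i, j))\<^sup>2)"

text \<open>
  Square roots of the eigenvalues of \<open>A\<^sup>T A\<close>, with multiplicity.  For a wide matrix this pads the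
  usual list with zeros, which the statistical dimension ignores.
\<close>
definition singular_values :: "real mat \<Rightarrow> real multiset" where
  "singular_values A = image_mset sqrt (proots (char_poly (A\<^sup>T * A)))"

definition stat_dim :: "real \<Rightarrow> real mat \<Rightarrow> real" where
  "stat_dim lam A =
     (\<Sum>\<sigma> \<in># filter_mset (\<lambda>\<sigma>. \<sigma> \<noteq> 0) (singular_values A). 1 / (1 + lam / \<sigma>\<^sup>2))"

definition ridge_cost :: "real \<Rightarrow> real mat \<Rightarrow> real mat \<Rightarrow> real mat \<Rightarrow> real" where
  "ridge_cost lam A B X = (fro_norm (A * X - B))\<^sup>2 + lam * (fro_norm X)\<^sup>2"

text \<open>For \<open>lam > 0\<close> both minimizers below exist and are unique, so the choice made by
  \<^const>\<open>arg_min_on\<close> is immaterial.\<close>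

definition ridge_sol :: "real \<Rightarrow> real mat \<Rightarrow> real mat \<Rightarrow> real mat" where
  "ridge_sol lam A B = arg_min_on (ridge_cost lam A B) (carrier_mat (dim_col A) (dim_col B))"

definition sketched_ridge_sol :: "real \<Rightarrow> real mat \<Rightarrow> real mat \<Rightarrow> real mat \<Rightarrow> real mat" where
  "sketched_ridge_sol lam S A B =
     arg_min_on (\<lambda>X. (fro_norm (S * (A * X - B)))\<^sup>2 + lam * (fro_norm X)\<^sup>2)
       (carrier_mat (dim_col A) (dim_col B))"

definition orthonormal_basis_of_col_space :: "nat \<Rightarrow> nat \<Rightarrow> real mat \<Rightarrow> real mat \<Rightarrow> bool" where
  "orthonormal_basis_of_col_space r c U M \<longleftrightarrow>
     U \<in> carrier_mat r c \<and> U\<^sup>T * U = 1\<^sub>m c \<and>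
     vec_space.col_space r U = vec_space.col_space r M"

definition first_rows :: "nat \<Rightarrow> real mat \<Rightarrow> real mat" where
  "first_rows n U = mat n (dim_col U) (\<lambda>(i, j). U $$ (i, j))"

section \<open>Random sketching matrices\<close>

definition sparse_embedding_pmf :: "nat \<Rightarrow> nat \<Rightarrow> real mat pmf" where
  "sparse_embedding_pmf m n =
     map_pmf (\<lambda>col. mat m n (\<lambda>(i, j). if i = fst (col j) then snd (col j) else 0))
       (Pi_pmf {..<n} (0, 0) (\<lambda>_. pair_pmf (pmf_of_set {..<m}) (pmf_of_set {-1, 1})))"

text \<open>
  Natural (Hadamard) ordering: the sign of entry \<open>(i, j)\<close> is the parity of the number of common
  binary digits one.  This is a Walsh--Hadamard matrix only when \<open>N\<close> is a power of two.
\<close>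
definition walsh_hadamard :: "nat \<Rightarrow> real mat" where
  "walsh_hadamard N =
     mat N N (\<lambda>(i, j). (-1) ^ card {b. bit i b \<and> bit j b} / sqrt (real N))"

text \<open>The \<open>m\<close> row indices are drawn independently, that is, with replacement.\<close>
definition srht_pmf :: "nat \<Rightarrow> nat \<Rightarrow> real mat pmf" where
  "srht_pmf m N = do {
     sg \<leftarrow> Pi_pmf {..<N} 0 (\<lambda>_. pmf_of_set {-1, 1 :: real});
     r \<leftarrow> Pi_pmf {..<m} 0 (\<lambda>_. pmf_of_set {..<N});
     let D = mat N N (\<lambda>(i, j). if i = j then sg i else 0);
     let P = mat m N (\<lambda>(i, j). if j = r i then 1 else 0);
     return_pmf (sqrt (real N / real m) \<cdot>\<^sub>m (P * walsh_hadamard N * D))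
   }"

definition sketch_pmf :: "nat \<Rightarrow> nat \<Rightarrow> nat \<Rightarrow> real mat pmf" where
  "sketch_pmf m2 m1 n = do {
     S1 \<leftarrow> sparse_embedding_pmf m1 n;
     S2 \<leftarrow> srht_pmf m2 m1;
     return_pmf (S2 * S1)
   }"

section \<open>Randomized real RAM\<close>

text \<open>
  Running times refer to a randomized real random access machine, programmed in a structured
  language: integer variables, zero-initialized integer arrays and two-index real arrays, exact
  real arithmetic, and uniform sampling from an initial segment of the integers.  Integers admit
  addition, truncated subtraction and comparison only, so that unit costs cannot be exploited by
  building huge integers, and there is no rounding of reals to integers.
  A single statement or test costs one unit; the expressions of a fixed program have bounded
  size, so this counts elementary operations up to a constant factor that depends on the program.
\<close>

datatype iexp =
    IConst nat
  | IVar string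
  | IGet string iexp
  | IAdd iexp iexp
  | ISub iexp iexp

datatype rexp =
    ROfInt iexp
  | RGet string iexp iexp
  | RAdd rexp rexp
  | RSub rexp rexp
  | RMul rexp rexp
  | RDiv rexp rexp
  | RSqrt rexp

datatype bexp =
    ILess iexp iexp
  | RLess rexp rexp
  | BNot bexp
  | BAnd bexp bexp

datatype stmt =
    ISet string iexp
  | IPut string iexp iexp
  | RPut string iexp iexp rexp
  | Sample string iexp
  | Cond bexp "stmt list" "stmt list"
  | Loop bexp "stmt list"

record store =
  ivar :: "string \<Rightarrow> nat"
  imem :: "string \<Rightarrow> nat \<Rightarrow> nat"
  rmem :: "string \<Rightarrow> nat \<Rightarrow> nat \<Rightarrow> real"

primrec ival :: "store \<Rightarrow> iexp \<Rightarrow> nat" where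
  "ival s (IConst k) = k"
| "ival s (IVar x) = ivar s x"
| "ival s (IGet a e) = imem s a (ival s e)"
| "ival s (IAdd e f) = ival s e + ival s f"
| "ival s (ISub e f) = ival s e - ival s f"

primrec rval :: "store \<Rightarrow> rexp \<Rightarrow> real" where
  "rval s (ROfInt e) = real (ival s e)"
| "rval s (RGet a e f) = rmem s a (ival s e) (ival s f)"
| "rval s (RAdd e f) = rval s e + rval s f"
| "rval s (RSub e f) = rval s e - rval s f"
| "rval s (RMul e f) = rval s e * rval s f"
| "rval s (RDiv e f) = rval s e / rval s f"
| "rval s (RSqrt e) = sqrt (rval s e)"

primrec bval :: "store \<Rightarrow> bexp \<Rightarrow> bool" where
  "bval s (ILess e f) = (ival s e < ival s f)"
| "bval s (RLess e f) = (rval s e < rval s f)"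
| "bval s (BNot b) = (\<not> bval s b)"
| "bval s (BAnd b c) = (bval s b \<and> bval s c)"

text \<open>A configuration is the list of statements still to be executed, with the store.
  \<open>Sample x e\<close> draws uniformly from the numbers below the value of \<open>e\<close> (and yields \<open>0\<close> if there
  are none).\<close>

fun step :: "stmt list \<times> store \<Rightarrow> (stmt list \<times> store) pmf" where
  "step ([], s) = return_pmf ([], s)"
| "step (ISet x e # cs, s) = return_pmf (cs, s\<lparr>ivar := (ivar s)(x := ival s e)\<rparr>)"
| "step (IPut a e f # cs, s) =
     return_pmf (cs, s\<lparr>imem := (imem s)(a := (imem s a)(ival s e := ival s f))\<rparr>)"
| "step (RPut a e f r # cs, s) =
     return_pmf (cs, s\<lparr>rmem := (rmem s)(a := (rmem s a)(ival s e :=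
       (rmem s a (ival s e))(ival s f := rval s r)))\<rparr>)"
| "step (Sample x e # cs, s) =
     map_pmf (\<lambda>v. (cs, s\<lparr>ivar := (ivar s)(x := v)\<rparr>)) (pmf_of_set {..<max 1 (ival s e)})"
| "step (Cond b c1 c2 # cs, s) = return_pmf ((if bval s b then c1 else c2) @ cs, s)"
| "step (Loop b c # cs, s) = return_pmf (if bval s b then c @ Loop b c # cs else cs, s)"

definition run :: "nat \<Rightarrow> stmt list \<Rightarrow> store \<Rightarrow> (stmt list \<times> store) pmf" where
  "run t prog s = ((\<lambda>D. bind_pmf D step) ^^ t) (return_pmf (prog, s))"

definition halts_within :: "nat \<Rightarrow> stmt list \<Rightarrow> store \<Rightarrow> bool" where
  "halts_within t prog s \<longleftrightarrow> (\<forall>cfg \<in> set_pmf (run t prog s). fst cfg = [])"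

definition nonzeros :: "real mat \<Rightarrow> (nat \<times> nat) set" where
  "nonzeros A = {(i, j). i < dim_row A \<and> j < dim_col A \<and> A $$ (i, j) \<noteq> 0}"

definition nnz :: "real mat \<Rightarrow> nat" where
  "nnz A = card (nonzeros A)"

definition lists_nonzeros :: "(nat \<times> nat) list \<Rightarrow> real mat \<Rightarrow> bool" where
  "lists_nonzeros xs A \<longleftrightarrow> distinct xs \<and> set xs = nonzeros A"

definition pad :: "'a :: zero list \<Rightarrow> nat \<Rightarrow> 'a" where
  "pad xs k = (if k < length xs then xs ! k else 0)"

text \<open>
  Input of the reduction: \<open>A\<close> and \<open>B\<close> as coordinate lists of their nonzero entries, together with
  the matrix and sketch dimensions; all other memory is zero.
\<close>
definition input_store ::
  "nat \<Rightarrow> nat \<Rightarrow> real mat \<Rightarrow> real mat \<Rightarrow> (nat \<times> nat) list \<Rightarrow> (nat \<times> nat) list \<Rightarrow> store" where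
  "input_store m1 m2 A B xs ys =
     \<lparr>ivar = (\<lambda>_. 0)(''n'' := dim_row A, ''dA'' := dim_col A, ''dB'' := dim_col B,
        ''m1'' := m1, ''m2'' := m2, ''nnzA'' := length xs, ''nnzB'' := length ys),
      imem = (\<lambda>_ _. 0)(''rowA'' := pad (map fst xs), ''colA'' := pad (map snd xs),
        ''rowB'' := pad (map fst ys), ''colB'' := pad (map snd ys)),
      rmem = (\<lambda>_ _ _. 0)(
        ''valA'' := (\<lambda>k l. if l = 0 then pad (map (\<lambda>ij. A $$ ij) xs) k else 0),
        ''valB'' := (\<lambda>k l. if l = 0 then pad (map (\<lambda>ij. B $$ ij) ys) k else 0))\<rparr>"

definition output_problem :: "nat \<Rightarrow> nat \<Rightarrow> nat \<Rightarrow> store \<Rightarrow> real mat \<times> real mat" where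
  "output_problem m d d' s =
     (mat m d (\<lambda>(i, j). rmem s ''outA'' i j), mat m d' (\<lambda>(i, j). rmem s ''outB'' i j))"

section \<open>Soft-O\<close>

text \<open>\<open>soft_bound C k x\<close> is the generic function in \<open>\<tilde>O(x)\<close>, the polylogarithmic factor being a power
  of \<open>log x\<close>; the shift keeps the logarithm positive.\<close>
definition soft_bound :: "real \<Rightarrow> nat \<Rightarrow> real \<Rightarrow> real" where
  "soft_bound C k x = C * x * ln (2 + x) ^ k"

end

theory Submission
  imports Defs "Jordan_Normal_Form.Schur_Decomposition"
begin

text \<open>
  Let \<open>M\<close> be the augmented matrix with column space basis \<open>U\<close>, so \<open>\<parallel>U\<^sub>1\<parallel>\<^sub>F\<^sup>2\<close> is the statistical dimension.
  If \<open>U\<^sub>1\<^sup>TS\<^sup>TSU\<^sub>1\<close> and \<open>U\<^sub>1\<^sup>TS\<^sup>TSR\<close>, with \<open>R\<close> the optimal residual, are close to their unsketched values, then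
  subtracting the normal equations of the two ridge problems shows that the sketched solution is close to the
  optimal one in the norm induced by \<open>M\<close>.

  For the sparse embedding both estimates follow from second moments and Markov's inequality, and so does the
  product estimate for the SRHT.  The spectral estimate for the SRHT needs a matrix concentration argument to
  lose only a logarithm in the number of rows: the random signs make all row norms of \<open>HDW\<close> of the order of
  the average (bound the exponential moment of a Rademacher quadratic form), and sampling bounded rows is
  controlled by symmetrization and a Khintchine inequality for sums of signed rank-one forms, proved by trace
  moments.  When the statistical dimension is bounded, second moments suffice here too.

  The program hashes only the rows that occur in the input, adds the signed entries into \<open>m\<^sub>1\<close> buckets and
  applies a fast Walsh--Hadamard transform to every column.
\<close>

section \<open>Probability\<close>

subsection \<open>Expectations of finitely supported distributions\<close>

text \<open>Neither \<open>n\<close> nor \<open>d\<close> may enter the sketch sizes, so counting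
  dimensions is replaced by Frobenius norms: the trace moments are anchored at the total squared
  length of the sampled rows, not at the rank. The size of the second stage is governed by the bound
  \<open>L\<close> on the rows after flattening. A union bound over the \<open>m1\<close> rows costs
  only an additive \<open>ln m1\<close>; as \<open>m1\<close> is polynomial in
  \<open>sd / eps\<close>, this leaves \<open>L\<close> of order \<open>sd + ln (1 / eps)\<close>,
  and trace moments of order about \<open>ln L\<close> give the remaining factor
  \<open>ln (sd / eps)\<close>. For bounded \<open>sd\<close> that factor can vanish or be negative,
  which is why this range is treated apart. \<open>m1\<close> is a power of two because the sign
  matrix is orthogonal at these orders. All failure events are Markov bounds with one common
  probability \<open>\<delta>\<close>; there are seven of them, and the constants depend on
  \<open>\<delta>\<close>. The product estimate is proved with \<open>eps / 2\<close> in place of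
  \<open>eps\<close>, since passing from the sketched normal equations to the cost loses a factor
  \<open>16 / 9\<close>.\<close>

lemma expectation_bind_finite:
  fixes h :: "'b \<Rightarrow> real"
  assumes "finite (set_pmf p)" and "\<And>x. x \<in> set_pmf p \<Longrightarrow> finite (set_pmf (q x))"
  shows "measure_pmf.expectation (bind_pmf p q) h =
    measure_pmf.expectation p (\<lambda>x. measure_pmf.expectation (q x) h)"
  using assms
  by (subst pmf_expectation_bind[where A = "set_pmf p"])
    (auto simp: integral_measure_pmf[where A = "set_pmf p"])

lemma expectation_mono_finite:
  fixes f g :: "'a \<Rightarrow> real"
  assumes "finite (set_pmf p)" and "\<And>x. x \<in> set_pmf p \<Longrightarrow> f x \<le> g x"
  shows "measure_pmf.expectation p f \<le> measure_pmf.expectation p g"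
  using assms
  by (intro integral_mono_AE integrable_measure_pmf_finite) (auto simp: AE_measure_pmf_iff)

lemma expectation_cong_pmf:
  fixes f g :: "'a \<Rightarrow> real"
  assumes "\<And>x. x \<in> set_pmf p \<Longrightarrow> f x = g x"
  shows "measure_pmf.expectation p f = measure_pmf.expectation p g"
  using assms by (intro integral_cong_AE) (auto simp: AE_measure_pmf_iff)

lemma expectation_add_finite:
  fixes f g :: "'a \<Rightarrow> real"
  assumes "finite (set_pmf p)"
  shows "measure_pmf.expectation p (\<lambda>x. f x + g x) =
    measure_pmf.expectation p f + measure_pmf.expectation p g"
  using assms by (intro Bochner_Integration.integral_add integrable_measure_pmf_finite) auto

lemma expectation_sum_finite:
  fixes f :: "'i \<Rightarrow> 'a \<Rightarrow> real"
  assumes "finite (set_pmf p)"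
  shows "measure_pmf.expectation p (\<lambda>x. \<Sum>i\<in>I. f i x) =
    (\<Sum>i\<in>I. measure_pmf.expectation p (f i))"
  using assms by (intro Bochner_Integration.integral_sum integrable_measure_pmf_finite) auto

text \<open>The threshold \<open>t\<close> may be zero: the mean then forces the variable to vanish
  almost surely. Instances with statistical dimension zero or optimal cost zero thus follow the
  general path.\<close>

lemma markov_finite:
  fixes X :: "'a \<Rightarrow> real"
  assumes fin: "finite (set_pmf p)" and nonneg: "\<And>x. x \<in> set_pmf p \<Longrightarrow> 0 \<le> X x"
    and E: "measure_pmf.expectation p X \<le> a * t" and "0 \<le> t" "0 \<le> a"
  shows "measure_pmf.prob p {x. X x \<le> t} \<ge> 1 - a"
proof (cases "t = 0")
  case True
  have int: "integrable (measure_pmf p) X" using fin by (rule integrable_measure_pmf_finite)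
  have ae: "AE x in measure_pmf p. 0 \<le> X x" using nonneg by (simp add: AE_measure_pmf_iff)
  have "measure_pmf.expectation p X = 0"
    using E True integral_nonneg_AE[OF ae] by simp
  hence "AE x in measure_pmf p. X x = 0"
    using integral_nonneg_eq_0_iff_AE[OF int ae] by simp
  hence "AE x in measure_pmf p. x \<in> {x. X x \<le> t}" using True by (auto simp: AE_measure_pmf_iff)
  hence "measure_pmf.prob p {x. X x \<le> t} = 1"
    by (subst measure_pmf.prob_eq_1) auto
  thus ?thesis using \<open>0 \<le> a\<close> by simp
next
  case False
  hence t: "0 < t" using \<open>0 \<le> t\<close> by simp
  have int: "integrable (measure_pmf p) X" using fin by (rule integrable_measure_pmf_finite)
  have ae: "AE x in measure_pmf p. 0 \<le> X x" using nonneg by (simp add: AE_measure_pmf_iff)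
  have "measure_pmf.prob p {x \<in> space (measure_pmf p). t \<le> X x} \<le> measure_pmf.expectation p X / t"
    by (rule integral_Markov_inequality_measure[where A = "{}", OF int _ ae t]) auto
  also have "\<dots> \<le> a" using E t by (simp add: field_simps)
  finally have "measure_pmf.prob p {x. t \<le> X x} \<le> a" by simp
  moreover have "measure_pmf.prob p (UNIV - {x. X x \<le> t}) \<le> measure_pmf.prob p {x. t \<le> X x}"
    by (rule measure_pmf.finite_measure_mono) auto
  moreover have "measure_pmf.prob p (UNIV - {x. X x \<le> t}) = 1 - measure_pmf.prob p {x. X x \<le> t}"
    using measure_pmf.prob_compl[of "{x. X x \<le> t}" p] by simp
  ultimately show ?thesis by simp
qed

lemma prob_Int_ge:
  assumes "measure_pmf.prob p A \<ge> 1 - a" and "measure_pmf.prob p B \<ge> 1 - b"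
  shows "measure_pmf.prob p (A \<inter> B) \<ge> 1 - (a + b)"
proof -
  have "measure_pmf.prob p (- A \<union> - B) \<le> measure_pmf.prob p (- A) + measure_pmf.prob p (- B)"
    by (rule measure_Un_le) auto
  moreover have "measure_pmf.prob p (- C) = 1 - measure_pmf.prob p C" for C
    using measure_pmf.prob_compl[of C p] by (simp add: Compl_eq_Diff_UNIV)
  moreover have "- A \<union> - B = - (A \<inter> B)" by auto
  ultimately show ?thesis using assms by (smt (verit))
qed

text \<open>Condition on the first draw: \<open>(1 - a) * (1 - b)\<close> is at least
  \<open>1 - (a + b)\<close>. The second stage has to succeed only for first-stage outcomes in
  \<open>G\<close>, so the SRHT may rely on norm bounds for the already embedded matrices.\<close>

lemma prob_bind_ge:
  assumes fin: "finite (set_pmf p)"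
    and p: "measure_pmf.prob p G \<ge> 1 - a"
    and q: "\<And>x. x \<in> set_pmf p \<Longrightarrow> x \<in> G \<Longrightarrow> measure_pmf.prob (q x) H \<ge> 1 - b"
    and ab: "0 \<le> a" "0 \<le> b" "b \<le> 1"
  shows "measure_pmf.prob (bind_pmf p q) H \<ge> 1 - (a + b)"
proof -
  have "1 - (a + b) \<le> (1 - b) * (1 - a)" using ab by (simp add: algebra_simps)
  also have "\<dots> \<le> (1 - b) * measure_pmf.prob p G" using p ab by (intro mult_left_mono) auto
  also have "\<dots> = measure_pmf.expectation p (\<lambda>x. (1 - b) * indicator G x)" by simp
  also have "\<dots> \<le> measure_pmf.expectation p (\<lambda>x. measure_pmf.prob (q x) H)"
    using q ab fin by (intro expectation_mono_finite) (auto simp: indicator_def)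
  also have "\<dots> = measure_pmf.prob (bind_pmf p q) H"
    unfolding measure_pmf_bind
    by (subst measure_pmf.measure_bind[where N = "count_space UNIV"])
      (auto simp: measurable_measure_pmf measure_pmf_in_subprob_space)
  finally show ?thesis .
qed

lemma expectation_Pi_insert:
  fixes F :: "('i \<Rightarrow> 'a) \<Rightarrow> real"
  assumes "finite I" "k \<notin> I" "\<And>i. finite (set_pmf (q i))"
  shows "measure_pmf.expectation (Pi_pmf (insert k I) dflt q) F =
    measure_pmf.expectation (q k) (\<lambda>y. measure_pmf.expectation (Pi_pmf I dflt q) (\<lambda>f. F (f(k := y))))"
proof -
  have fin: "finite (set_pmf (Pi_pmf I dflt q))"
    using assms by (auto simp: set_Pi_pmf intro!: finite_PiE_dflt)
  show ?thesis
    using assms fin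
    by (simp add: Pi_pmf_insert' expectation_bind_finite)
qed

lemma finite_set_Pi_pmf:
  assumes "finite I" "\<And>i. finite (set_pmf (q i))"
  shows "finite (set_pmf (Pi_pmf I dflt q))"
  using assms by (auto simp: set_Pi_pmf intro!: finite_PiE_dflt)

lemma expectation_swap_finite:
  fixes F :: "'a \<Rightarrow> 'b \<Rightarrow> real"
  assumes "finite (set_pmf p)" "finite (set_pmf q)"
  shows "measure_pmf.expectation p (\<lambda>x. measure_pmf.expectation q (F x)) =
    measure_pmf.expectation q (\<lambda>y. measure_pmf.expectation p (\<lambda>x. F x y))"
proof -
  have "measure_pmf.expectation p (\<lambda>x. measure_pmf.expectation q (F x)) =
    (\<Sum>x\<in>set_pmf p. \<Sum>y\<in>set_pmf q. pmf p x * (pmf q y * F x y))"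
    using assms by (simp add: integral_measure_pmf sum_distrib_left)
  also have "\<dots> = (\<Sum>y\<in>set_pmf q. \<Sum>x\<in>set_pmf p. pmf p x * (pmf q y * F x y))"
    by (rule sum.swap)
  also have "\<dots> = measure_pmf.expectation q (\<lambda>y. measure_pmf.expectation p (\<lambda>x. F x y))"
    using assms by (simp add: integral_measure_pmf sum_distrib_left mult_ac)
  finally show ?thesis .
qed

subsection \<open>Second moments of degenerate U-statistics\<close>

text \<open>Induction exposes one coordinate at a time; its cross term with the older coordinates
  carries the mean of \<open>f\<close> and vanishes.\<close>

lemma second_moment_linear:
  fixes f :: "'a \<Rightarrow> real" and a :: "'i \<Rightarrow> real"
  assumes q: "finite (set_pmf q)" and mean: "measure_pmf.expectation q f = 0"
    and I: "finite I"
  shows "measure_pmf.expectation (Pi_pmf I dflt (\<lambda>_. q)) (\<lambda>x. (\<Sum>i\<in>I. a i * f (x i))\<^sup>2) =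
    (\<Sum>i\<in>I. (a i)\<^sup>2) * measure_pmf.expectation q (\<lambda>y. (f y)\<^sup>2)"
  using I
proof induction
  case empty
  show ?case by simp
next
  case (insert k I)
  let ?P = "Pi_pmf I dflt (\<lambda>_. q)"
  let ?L = "\<lambda>x. \<Sum>i\<in>I. a i * f (x i)"
  have fin: "finite (set_pmf ?P)" using insert q by (intro finite_set_Pi_pmf) auto
  have eq: "(\<Sum>i\<in>insert k I. a i * f ((x(k := y)) i)) = a k * f y + ?L x" for x y
    using insert by (subst sum.insert) (auto intro!: sum.cong)
  have "measure_pmf.expectation (Pi_pmf (insert k I) dflt (\<lambda>_. q))
      (\<lambda>x. (\<Sum>i\<in>insert k I. a i * f (x i))\<^sup>2) =
    measure_pmf.expectation q (\<lambda>y. measure_pmf.expectation ?P (\<lambda>x. (a k * f y + ?L x)\<^sup>2))"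
    using insert q by (subst expectation_Pi_insert) (auto simp: eq simp del: fun_upd_apply)
  also have "\<dots> = measure_pmf.expectation q (\<lambda>y. (a k)\<^sup>2 * (f y)\<^sup>2 +
      (f y * (2 * a k * measure_pmf.expectation ?P ?L) + measure_pmf.expectation ?P (\<lambda>x. (?L x)\<^sup>2)))"
  proof (intro Bochner_Integration.integral_cong refl)
    fix y
    have "measure_pmf.expectation ?P (\<lambda>x. (a k * f y + ?L x)\<^sup>2) =
      measure_pmf.expectation ?P (\<lambda>x. (a k)\<^sup>2 * (f y)\<^sup>2 + ((2 * a k * f y) * ?L x + (?L x)\<^sup>2))"
      by (simp add: power2_sum power_mult_distrib mult_ac add_ac)
    also have "\<dots> = (a k)\<^sup>2 * (f y)\<^sup>2 +
      ((2 * a k * f y) * measure_pmf.expectation ?P ?L + measure_pmf.expectation ?P (\<lambda>x. (?L x)\<^sup>2))"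
      using fin by (simp only: expectation_add_finite integral_mult_right_zero) simp
    finally show "measure_pmf.expectation ?P (\<lambda>x. (a k * f y + ?L x)\<^sup>2) = (a k)\<^sup>2 * (f y)\<^sup>2 +
      (f y * (2 * a k * measure_pmf.expectation ?P ?L) + measure_pmf.expectation ?P (\<lambda>x. (?L x)\<^sup>2))"
      by (simp add: mult_ac)
  qed
  also have "\<dots> = (a k)\<^sup>2 * measure_pmf.expectation q (\<lambda>y. (f y)\<^sup>2) +
      measure_pmf.expectation ?P (\<lambda>x. (?L x)\<^sup>2)"
    using q mean by (simp add: expectation_add_finite)
  also have "\<dots> = (\<Sum>i\<in>insert k I. (a i)\<^sup>2) * measure_pmf.expectation q (\<lambda>y. (f y)\<^sup>2)"
    using insert by (simp add: algebra_simps)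
  finally show ?case .
qed

lemma sum_pairs_insert:
  fixes g :: "'i \<Rightarrow> 'i \<Rightarrow> real"
  assumes "finite I" "k \<notin> I"
  shows "(\<Sum>i\<in>insert k I. \<Sum>j\<in>insert k I - {i}. g i j) =
    (\<Sum>i\<in>I. \<Sum>j\<in>I - {i}. g i j) + (\<Sum>i\<in>I. g i k + g k i)"
proof -
  have "(\<Sum>j\<in>insert k I - {i}. g i j) = g i k + (\<Sum>j\<in>I - {i}. g i j)" if "i \<in> I" for i
  proof -
    have "insert k I - {i} = insert k (I - {i})" using that assms by auto
    thus ?thesis using assms by simp
  qed
  moreover have "insert k I - {k} = I" using assms by auto
  ultimately show ?thesis using assms by (simp add: sum.distrib)
qed

text \<open>\<open>K\<close> is degenerate: its mean over one argument vanishes for every value of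
  the other. A new point therefore adds a term uncorrelated with the old sum, whose second moment is
  the sum of \<open>(c i k + c k i)\<^sup>2\<close> times the mean square of \<open>K\<close>;
  splitting these squares gives the factor 2. The errors of both sketches contain sums of this kind,
  with \<open>c\<close> not symmetric when the two sketched matrices differ.\<close>

lemma second_moment_chaos:
  fixes K :: "'a \<Rightarrow> 'a \<Rightarrow> real" and c :: "'i \<Rightarrow> 'i \<Rightarrow> real"
  assumes q: "finite (set_pmf q)" and sym: "\<And>x y. K x y = K y x"
    and mean: "\<And>y. measure_pmf.expectation q (K y) = 0"
    and I: "finite I"
  shows "measure_pmf.expectation (Pi_pmf I dflt (\<lambda>_. q))
      (\<lambda>x. (\<Sum>i\<in>I. \<Sum>j\<in>I - {i}. c i j * K (x i) (x j))\<^sup>2)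
    \<le> 2 * measure_pmf.expectation q (\<lambda>y. measure_pmf.expectation q (\<lambda>x. (K x y)\<^sup>2)) *
        (\<Sum>i\<in>I. \<Sum>j\<in>I - {i}. (c i j)\<^sup>2)"
  using I
proof induction
  case empty
  show ?case by simp
next
  case (insert k I)
  let ?P = "Pi_pmf I dflt (\<lambda>_. q)"
  let ?\<kappa> = "measure_pmf.expectation q (\<lambda>y. measure_pmf.expectation q (\<lambda>x. (K x y)\<^sup>2))"
  let ?Z = "\<lambda>x. \<Sum>i\<in>I. \<Sum>j\<in>I - {i}. c i j * K (x i) (x j)"
  let ?a = "\<lambda>i. c i k + c k i"
  let ?L = "\<lambda>y x. \<Sum>i\<in>I. ?a i * K (x i) y"
  have fin: "finite (set_pmf ?P)" using insert q by (intro finite_set_Pi_pmf) auto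
  have eq: "(\<Sum>i\<in>insert k I. \<Sum>j\<in>insert k I - {i}. c i j * K ((x(k := y)) i) ((x(k := y)) j))
      = ?Z x + ?L y x" for x y
  proof -
    have "(\<Sum>i\<in>I. \<Sum>j\<in>I - {i}. c i j * K ((x(k := y)) i) ((x(k := y)) j)) = ?Z x"
      using insert by (intro sum.cong) auto
    moreover have "(\<Sum>i\<in>I. c i k * K ((x(k := y)) i) ((x(k := y)) k) +
        c k i * K ((x(k := y)) k) ((x(k := y)) i)) = ?L y x"
      using insert sym by (intro sum.cong) (auto simp: algebra_simps)
    ultimately show ?thesis using insert by (subst sum_pairs_insert) auto
  qed
  \<comment> \<open>Averaging over the new point \<open>y\<close> with the old points fixed
    annihilates \<open>?L y x\<close>, hence the exchange of the expectations.\<close>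
  have cross: "measure_pmf.expectation q (\<lambda>y. measure_pmf.expectation ?P (\<lambda>x. ?Z x * ?L y x)) = 0"
  proof -
    have "measure_pmf.expectation q (\<lambda>y. ?L y x) = 0" for x
      using mean q by (simp add: expectation_sum_finite)
    thus ?thesis using q fin by (subst expectation_swap_finite) simp_all
  qed
  have kap: "0 \<le> ?\<kappa>" by (intro integral_nonneg_AE) auto
  have "measure_pmf.expectation (Pi_pmf (insert k I) dflt (\<lambda>_. q))
      (\<lambda>x. (\<Sum>i\<in>insert k I. \<Sum>j\<in>insert k I - {i}. c i j * K (x i) (x j))\<^sup>2) =
    measure_pmf.expectation q (\<lambda>y. measure_pmf.expectation ?P (\<lambda>x. (?Z x + ?L y x)\<^sup>2))"
    using insert q by (subst expectation_Pi_insert) (auto simp: eq simp del: fun_upd_apply)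
  also have "\<dots> = measure_pmf.expectation q (\<lambda>y. measure_pmf.expectation ?P (\<lambda>x. (?Z x)\<^sup>2) +
      (2 * measure_pmf.expectation ?P (\<lambda>x. ?Z x * ?L y x) + measure_pmf.expectation ?P (\<lambda>x. (?L y x)\<^sup>2)))"
  proof (intro Bochner_Integration.integral_cong refl)
    fix y
    have "measure_pmf.expectation ?P (\<lambda>x. (?Z x + ?L y x)\<^sup>2) =
      measure_pmf.expectation ?P (\<lambda>x. (?Z x)\<^sup>2 + (2 * (?Z x * ?L y x) + (?L y x)\<^sup>2))"
      by (simp add: power2_sum add_ac mult_ac)
    thus "measure_pmf.expectation ?P (\<lambda>x. (?Z x + ?L y x)\<^sup>2) =
      measure_pmf.expectation ?P (\<lambda>x. (?Z x)\<^sup>2) +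
      (2 * measure_pmf.expectation ?P (\<lambda>x. ?Z x * ?L y x) + measure_pmf.expectation ?P (\<lambda>x. (?L y x)\<^sup>2))"
      using fin by (simp only: expectation_add_finite integral_mult_right_zero)
  qed
  also have "\<dots> = measure_pmf.expectation ?P (\<lambda>x. (?Z x)\<^sup>2) +
      measure_pmf.expectation q (\<lambda>y. measure_pmf.expectation ?P (\<lambda>x. (?L y x)\<^sup>2))"
    using q cross by (simp add: expectation_add_finite)
  also have "measure_pmf.expectation q (\<lambda>y. measure_pmf.expectation ?P (\<lambda>x. (?L y x)\<^sup>2)) =
      (\<Sum>i\<in>I. (?a i)\<^sup>2) * ?\<kappa>"
  proof -
    have "measure_pmf.expectation ?P (\<lambda>x. (?L y x)\<^sup>2) =
      (\<Sum>i\<in>I. (?a i)\<^sup>2) * measure_pmf.expectation q (\<lambda>x. (K x y)\<^sup>2)" for y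
    proof (rule second_moment_linear[OF q _ insert(1)])
      have "(\<lambda>x. K x y) = K y" using sym by auto
      thus "measure_pmf.expectation q (\<lambda>x. K x y) = 0" using mean by simp
    qed
    thus ?thesis by simp
  qed
  also have "measure_pmf.expectation ?P (\<lambda>x. (?Z x)\<^sup>2) + (\<Sum>i\<in>I. (?a i)\<^sup>2) * ?\<kappa> \<le>
      2 * ?\<kappa> * (\<Sum>i\<in>I. \<Sum>j\<in>I - {i}. (c i j)\<^sup>2) + (\<Sum>i\<in>I. 2 * ((c i k)\<^sup>2 + (c k i)\<^sup>2)) * ?\<kappa>"
  proof (intro add_mono insert.IH mult_right_mono sum_mono kap)
    fix i
    have "0 \<le> (c i k - c k i)\<^sup>2" by simp
    thus "(?a i)\<^sup>2 \<le> 2 * ((c i k)\<^sup>2 + (c k i)\<^sup>2)" by (simp add: power2_eq_square algebra_simps)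
  qed
  also have "\<dots> = 2 * ?\<kappa> * (\<Sum>i\<in>insert k I. \<Sum>j\<in>insert k I - {i}. (c i j)\<^sup>2)"
  proof -
    have "(\<Sum>i\<in>I. 2 * ((c i k)\<^sup>2 + (c k i)\<^sup>2)) = 2 * (\<Sum>i\<in>I. (c i k)\<^sup>2 + (c k i)\<^sup>2)"
      by (simp only: sum_distrib_left)
    thus ?thesis unfolding sum_pairs_insert[OF insert(1,2)] by (simp add: algebra_simps)
  qed
  finally show ?case .
qed

subsection \<open>Rademacher sums in inner product spaces\<close>

lemma cosh_le_exp_square: "(exp t + exp (- t)) / 2 \<le> exp (t\<^sup>2 / 2)" for t :: real
proof -
  have pos: "(exp t + exp (- t)) / 2 \<le> exp (t\<^sup>2 / 2)" if t: "0 \<le> t" for t :: real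
  proof -
    \<comment> \<open>Hoeffding's lemma for a fair coin with values \<open>0\<close> and
      \<open>2 * t\<close>; centring by \<open>exp (- t)\<close> turns its moment generating
      function into a hyperbolic cosine.\<close>
    have "- (2 * t) * (1 / 2) + ln (1 + 1 / 2 * (exp (2 * t) - 1)) \<le> (2 * t)\<^sup>2 / 8"
      using Hoeffdings_lemma_aux[of "2 * t" "1 / 2"] t by simp
    hence "ln (1 + 1 / 2 * (exp (2 * t) - 1)) \<le> t + t\<^sup>2 / 2"
      by (simp add: power2_eq_square algebra_simps)
    moreover have "1 + 1 / 2 * (exp (2 * t) - 1) = (exp (2 * t) + 1) / 2" by (simp add: field_simps)
    ultimately have "ln ((exp (2 * t) + 1) / 2) \<le> t + t\<^sup>2 / 2" by (simp only:)
    hence "exp (ln ((exp (2 * t) + 1) / 2)) \<le> exp (t + t\<^sup>2 / 2)"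
      by (simp only: exp_le_cancel_iff)
    moreover have "0 < (exp (2 * t) + 1) / 2" by (simp add: add_pos_pos)
    ultimately have "(exp (2 * t) + 1) / 2 \<le> exp (t + t\<^sup>2 / 2)"
      by (simp only: exp_ln)
    hence "exp (- t) * ((exp (2 * t) + 1) / 2) \<le> exp (- t) * exp (t + t\<^sup>2 / 2)"
      by (intro mult_left_mono) auto
    moreover have "exp (- t) * ((exp (2 * t) + 1) / 2) = (exp t + exp (- t)) / 2"
      by (simp add: algebra_simps add_divide_distrib flip: exp_add)
    moreover have "exp (- t) * exp (t + t\<^sup>2 / 2) = exp (t\<^sup>2 / 2)" by (simp flip: exp_add)
    ultimately show ?thesis by simp
  qed
  show ?thesis using pos[of t] pos[of "- t"] by (cases "0 \<le> t") (auto simp: add.commute)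
qed

definition rademacher :: "'i set \<Rightarrow> ('i \<Rightarrow> real) pmf" where
  "rademacher I = Pi_pmf I 0 (\<lambda>_. pmf_of_set {-1, 1})"

lemma expectation_sign:
  "measure_pmf.expectation (pmf_of_set {-1, 1 :: real}) f = (f (-1) + f 1) / 2" for f :: "real \<Rightarrow> real"
  by (subst integral_pmf_of_set) auto

lemma finite_rademacher: "finite I \<Longrightarrow> finite (set_pmf (rademacher I))"
  unfolding rademacher_def by (intro finite_set_Pi_pmf) auto

lemma expectation_rademacher_insert:
  fixes F :: "('i \<Rightarrow> real) \<Rightarrow> real"
  assumes "finite I" "k \<notin> I"
  shows "measure_pmf.expectation (rademacher (insert k I)) F =
    measure_pmf.expectation (rademacher I) (\<lambda>s. (F (s(k := 1)) + F (s(k := -1))) / 2)"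
proof -
  have "measure_pmf.expectation (rademacher (insert k I)) F =
    (measure_pmf.expectation (rademacher I) (\<lambda>s. F (s(k := -1))) +
      measure_pmf.expectation (rademacher I) (\<lambda>s. F (s(k := 1)))) / 2"
    unfolding rademacher_def using assms
    by (subst expectation_Pi_insert) (auto simp: expectation_sign)
  thus ?thesis
    using finite_rademacher[OF assms(1)] by (simp add: expectation_add_finite)
qed

text \<open>The hypothesis says that \<open>M\<close> is dominated by the inverse of \<open>2 + 2 \<Sum> x\<^sub>i x\<^sub>i\<^sup>T\<close>.
  Averaging over one sign replaces \<open>M\<close> by \<open>M + 2 M x x\<^sup>T M\<close>, which by the Sherman--Morrison formula
  is dominated by the inverse of the form without the summand of \<open>x\<close>.\<close>

lemma rademacher_exp_quadratic_form:
  fixes x :: "'i \<Rightarrow> 'a :: real_inner" and M :: "'a \<Rightarrow> 'a"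
  assumes "finite I" and "linear M" and "\<And>u v. inner u (M v) = inner (M u) v"
    and "\<And>v. 2 * (norm (M v))\<^sup>2 + 2 * (\<Sum>i\<in>I. (inner (x i) (M v))\<^sup>2) \<le> inner v (M v)"
  shows "measure_pmf.expectation (rademacher I)
      (\<lambda>s. exp (inner (\<Sum>i\<in>I. s i *\<^sub>R x i) (M (\<Sum>i\<in>I. s i *\<^sub>R x i))))
    \<le> exp (1 / 2 * (\<Sum>i\<in>I. (norm (x i))\<^sup>2))"
  using assms
proof (induction I arbitrary: M)
  case empty
  interpret linear M by fact
  show ?case by (simp add: zero)
next
  case (insert k I)
  interpret M: linear M by fact
  note sym = insert.prems(2)
  note dom = insert.prems(3)
  let ?S = "\<lambda>s. \<Sum>i\<in>I. s i *\<^sub>R x i"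
  define M' where "M' = (\<lambda>v. M v + (2 * inner (x k) (M v)) *\<^sub>R M (x k))"
  \<comment> \<open>Without its sum the domination hypothesis says that \<open>M\<close> is at most
    \<open>1 / 2\<close> as a form. This bounds the diagonal contribution of \<open>x k\<close> and
    is the origin of the exponent in the statement.\<close>
  have quad: "inner v (M v) \<le> 1 / 2 * (norm v)\<^sup>2" for v
  proof -
    have "0 \<le> (\<Sum>i\<in>insert k I. (inner (x i) (M v))\<^sup>2)" by (intro sum_nonneg) auto
    hence 1: "2 * (norm (M v))\<^sup>2 \<le> inner v (M v)" using dom[of v] by simp
    have "0 \<le> (norm (v - 2 *\<^sub>R M v))\<^sup>2" by simp
    hence "0 \<le> (norm v)\<^sup>2 - 4 * inner v (M v) + 4 * (norm (M v))\<^sup>2"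
      by (simp add: power2_norm_eq_inner inner_diff_left inner_diff_right inner_commute algebra_simps)
    thus ?thesis using 1 by simp
  qed
  have pos: "0 \<le> inner v (M v)" for v
    using dom[of v] by (smt (verit) sum_nonneg zero_le_power2)
  have lin': "linear M'"
    unfolding M'_def
    by (rule linearI) (simp_all add: M.add M.scale inner_add_right algebra_simps scaleR_add_left)
  have sym': "inner u (M' v) = inner (M' u) v" for u v
    using sym[of u v] sym[of u "x k"] sym[of "x k" v] sym[of "x k" u] sym[of "v" "x k"]
    by (simp add: M'_def inner_add_left inner_add_right inner_commute mult_ac)
  have dom': "2 * (norm (M' v))\<^sup>2 + 2 * (\<Sum>i\<in>I. (inner (x i) (M' v))\<^sup>2) \<le> inner v (M' v)" for v
  proof -
    define a where "a = inner (x k) (M v)"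
    define g where "g = inner (x k) (M (x k))"
    \<comment> \<open>\<open>w\<close> is chosen so that \<open>M' v = M w\<close>. In the
      domination of \<open>M\<close> at \<open>w\<close> the summand of \<open>x k\<close> is
      \<open>2 * (a + 2 * a * g)\<^sup>2\<close>; moved to the right, it brings
      \<open>inner w (M w)\<close> down to at most \<open>inner v (M' v)\<close>.\<close>
    define w where "w = v + (2 * a) *\<^sub>R x k"
    have M'w: "M' v = M w" by (simp add: M'_def w_def M.add M.scale a_def)
    have xw: "inner (x k) (M w) = a + 2 * a * g"
      by (simp add: w_def M.add M.scale inner_add_right a_def g_def)
    have vx: "inner v (M (x k)) = a" using sym[of v "x k"] by (simp add: a_def inner_commute)
    have ww: "inner w (M w) = inner v (M v) + 4 * a\<^sup>2 + 4 * a\<^sup>2 * g"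
      by (simp add: w_def M.add M.scale inner_add_right inner_add_left vx flip: a_def g_def)
        (simp add: power2_eq_square algebra_simps)
    have "2 * (norm (M w))\<^sup>2 + 2 * (\<Sum>i\<in>I. (inner (x i) (M w))\<^sup>2) \<le>
        inner w (M w) - 2 * (a + 2 * a * g)\<^sup>2"
      using dom[of w] insert.hyps by (simp add: xw)
    also have "\<dots> = inner v (M v) + 2 * a\<^sup>2 - (4 * g * a\<^sup>2 + 8 * g\<^sup>2 * a\<^sup>2)"
      unfolding ww by (simp add: power2_eq_square algebra_simps)
    also have "\<dots> \<le> inner v (M v) + 2 * a\<^sup>2"
    proof -
      have "0 \<le> g" using pos[of "x k"] by (simp add: g_def)
      hence "0 \<le> 4 * g * a\<^sup>2 + 8 * g\<^sup>2 * a\<^sup>2"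
        by (intro add_nonneg_nonneg mult_nonneg_nonneg) auto
      thus ?thesis by linarith
    qed
    also have "\<dots> = inner v (M' v)"
      by (simp add: M'_def inner_add_right vx flip: a_def) (simp add: power2_eq_square)
    finally show ?thesis by (simp add: M'w)
  qed
  have step: "(exp (inner (x k + S) (M (x k + S))) + exp (inner (- x k + S) (M (- x k + S)))) / 2 \<le>
      exp (1 / 2 * (norm (x k))\<^sup>2) * exp (inner S (M' S))" for S
  proof -
    define a where "a = inner (x k) (M S)"
    have Sx: "inner S (M (x k)) = a" using sym[of S "x k"] by (simp add: a_def inner_commute)
    have e1: "inner (x k + S) (M (x k + S)) = (inner (x k) (M (x k)) + inner S (M S)) + 2 * a"
      by (simp add: M.add inner_add_left inner_add_right Sx flip: a_def)
    have e2: "inner (- x k + S) (M (- x k + S)) = (inner (x k) (M (x k)) + inner S (M S)) + - (2 * a)"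
      by (simp add: M.add M.diff M.neg inner_add_left inner_add_right inner_diff_left inner_diff_right
        Sx flip: a_def)
    have e3: "inner S (M' S) = inner S (M S) + 2 * a\<^sup>2"
      by (simp add: M'_def inner_add_right Sx flip: a_def) (simp add: power2_eq_square)
    have "(exp (inner (x k + S) (M (x k + S))) + exp (inner (- x k + S) (M (- x k + S)))) / 2 =
        exp (inner (x k) (M (x k)) + inner S (M S)) * ((exp (2 * a) + exp (- (2 * a))) / 2)"
      unfolding e1 e2 exp_add[of _ "2 * a"] exp_add[of _ "- (2 * a)"] by (simp add: algebra_simps)
    also have "\<dots> \<le> exp (inner (x k) (M (x k)) + inner S (M S)) * exp ((2 * a)\<^sup>2 / 2)"
      by (intro mult_left_mono cosh_le_exp_square) auto
    also have "\<dots> = exp (inner (x k) (M (x k))) * exp (inner S (M' S))"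
      by (simp add: e3 power2_eq_square flip: exp_add)
    also have "\<dots> \<le> exp (1 / 2 * (norm (x k))\<^sup>2) * exp (inner S (M' S))"
      using quad[of "x k"] by (intro mult_right_mono) auto
    finally show ?thesis .
  qed
  have upd: "(\<Sum>i\<in>insert k I. (s(k := c)) i *\<^sub>R x i) = c *\<^sub>R x k + ?S s" for s c
    using insert.hyps by (auto intro!: sum.cong)
  have "measure_pmf.expectation (rademacher (insert k I))
      (\<lambda>s. exp (inner (\<Sum>i\<in>insert k I. s i *\<^sub>R x i) (M (\<Sum>i\<in>insert k I. s i *\<^sub>R x i)))) =
    measure_pmf.expectation (rademacher I) (\<lambda>s.
      (exp (inner (x k + ?S s) (M (x k + ?S s))) + exp (inner (- x k + ?S s) (M (- x k + ?S s)))) / 2)"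
    unfolding expectation_rademacher_insert[OF insert.hyps(1,2)] upd by simp
  also have "\<dots> \<le> measure_pmf.expectation (rademacher I)
      (\<lambda>s. exp (1 / 2 * (norm (x k))\<^sup>2) * exp (inner (?S s) (M' (?S s))))"
    using insert.hyps by (intro expectation_mono_finite finite_rademacher step)
  also have "\<dots> \<le> exp (1 / 2 * (norm (x k))\<^sup>2) * exp (1 / 2 * (\<Sum>i\<in>I. (norm (x i))\<^sup>2))"
    using insert.IH[OF lin' sym' dom'] by simp
  also have "\<dots> = exp (1 / 2 * (\<Sum>i\<in>insert k I. (norm (x i))\<^sup>2))"
    using insert.hyps by (simp add: algebra_simps flip: exp_add)
  finally show ?case .
qed

text \<open>The scalar \<open>M = 1 / 6\<close> just satisfies the domination hypothesis: for the
  frame bound 2 its left side is at most \<open>(2 + 4) / 36\<close> times the squared norm.\<close>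

lemma rademacher_exp_norm_square:
  fixes x :: "'i \<Rightarrow> 'a :: real_inner"
  assumes "finite I" and "\<And>v. (\<Sum>i\<in>I. (inner (x i) v)\<^sup>2) \<le> 2 * (norm v)\<^sup>2"
  shows "measure_pmf.expectation (rademacher I) (\<lambda>s. exp ((norm (\<Sum>i\<in>I. s i *\<^sub>R x i))\<^sup>2 / 6))
    \<le> exp (1 / 2 * (\<Sum>i\<in>I. (norm (x i))\<^sup>2))"
proof -
  have "2 * (norm ((1 / 6) *\<^sub>R v))\<^sup>2 + 2 * (\<Sum>i\<in>I. (inner (x i) ((1 / 6) *\<^sub>R v))\<^sup>2) \<le>
      inner v ((1 / 6) *\<^sub>R v)" for v
  proof -
    have "2 * (norm ((1 / 6) *\<^sub>R v))\<^sup>2 + 2 * (\<Sum>i\<in>I. (inner (x i) ((1 / 6) *\<^sub>R v))\<^sup>2) =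
      1 / 18 * (norm v)\<^sup>2 + 1 / 18 * (\<Sum>i\<in>I. (inner (x i) v)\<^sup>2)"
      by (simp add: power_mult_distrib power_divide flip: sum_divide_distrib)
    thus ?thesis using assms(2)[of v] by (simp add: power2_norm_eq_inner)
  qed
  from rademacher_exp_quadratic_form[OF assms(1) _ _ this]
  show ?thesis by (simp add: linear_scale_self power2_norm_eq_inner)
qed

subsection \<open>Rank-one Khintchine inequality\<close>

text \<open>A log-convex sequence lies below the geometric chord between its ends. The power form
  \<open>chain\<close> avoids logarithms and so admits vanishing terms; \<open>down\<close> then
  descends from \<open>k\<close> one index at a time.\<close>

lemma log_convex_interpolate:
  fixes c :: "nat \<Rightarrow> real"
  assumes nonneg: "\<And>j. 0 \<le> c j" and conv: "\<And>j. (c (Suc j))\<^sup>2 \<le> c j * c (Suc (Suc j))"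
    and k: "c k \<le> c 0 * y ^ k" and y: "0 \<le> y" and "j \<le> k"
  shows "c j \<le> c 0 * y ^ j"
proof -
  have chain: "c n ^ Suc n \<le> c 0 * c (Suc n) ^ n" for n
  proof (induction n)
    case (Suc n)
    show ?case
    proof (cases "c (Suc n) = 0")
      case True
      thus ?thesis using nonneg by simp
    next
      case False
      hence pos: "0 < c (Suc n) ^ n" using nonneg[of "Suc n"] by simp
      have "c (Suc n) ^ n * c (Suc n) ^ Suc (Suc n) = ((c (Suc n))\<^sup>2) ^ Suc n"
        by (simp add: power2_eq_square power_mult_distrib)
      also have "\<dots> \<le> (c n * c (Suc (Suc n))) ^ Suc n"
        by (intro power_mono conv) auto
      also have "\<dots> = c n ^ Suc n * c (Suc (Suc n)) ^ Suc n" by (rule power_mult_distrib)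
      also have "\<dots> \<le> (c 0 * c (Suc n) ^ n) * c (Suc (Suc n)) ^ Suc n"
        using Suc nonneg by (intro mult_right_mono) auto
      also have "\<dots> = c (Suc n) ^ n * (c 0 * c (Suc (Suc n)) ^ Suc n)" by simp
      finally show ?thesis using pos by (simp only: mult_le_cancel_left_pos)
    qed
  qed simp
  have down: "c n \<le> c 0 * y ^ n" if "c (Suc n) \<le> c 0 * y ^ Suc n" for n
  proof (rule power_le_imp_le_base)
    have "c n ^ Suc n \<le> c 0 * c (Suc n) ^ n" by (rule chain)
    also have "\<dots> \<le> c 0 * (c 0 * y ^ Suc n) ^ n"
      using that nonneg by (intro mult_left_mono power_mono) auto
    also have "\<dots> = (c 0 * y ^ n) ^ Suc n"
      by (simp add: power_mult_distrib)
    finally show "c n ^ Suc n \<le> (c 0 * y ^ n) ^ Suc n" .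
    show "0 \<le> c 0 * y ^ n" using nonneg y by simp
  qed
  show ?thesis using \<open>j \<le> k\<close> k by (induction rule: inc_induct) (auto intro: down)
qed

lemma funpow_symmetric:
  assumes "\<And>u v. inner u (T v) = inner (T u) v"
  shows "inner u ((T ^^ n) v) = inner ((T ^^ n) u) v"
proof (induction n arbitrary: u)
  case (Suc n)
  have "inner u ((T ^^ Suc n) v) = inner (T u) ((T ^^ n) v)" using assms by simp
  also have "\<dots> = inner ((T ^^ n) (T u)) v" by (rule Suc)
  also have "(T ^^ n) (T u) = (T ^^ Suc n) u" by (simp add: funpow_swap1)
  finally show ?case .
qed simp

text \<open>For symmetric \<open>T\<close> the numbers \<open>(norm ((T ^^ j) h))\<^sup>2\<close>
  are log-convex by Cauchy--Schwarz. This takes the place of a spectral decomposition: on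
  \<open>h\<close>, the powers of \<open>T\<close> up to \<open>k\<close> are no larger than those
  of a single number \<open>x\<close>.\<close>

lemma norm_funpow_interpolate:
  fixes T :: "'a :: real_inner \<Rightarrow> 'a"
  assumes sym: "\<And>u v. inner u (T v) = inner (T u) v"
    and k: "norm ((T ^^ k) h) \<le> norm h * x ^ k" and x: "0 \<le> x" and "j \<le> k"
  shows "norm ((T ^^ j) h) \<le> norm h * x ^ j"
proof -
  let ?c = "\<lambda>j. (norm ((T ^^ j) h))\<^sup>2"
  have "?c j \<le> ?c 0 * (x\<^sup>2) ^ j"
  proof (rule log_convex_interpolate[where c = ?c and k = k])
    fix n
    have "?c (Suc n) = inner ((T ^^ n) h) ((T ^^ Suc (Suc n)) h)"
      using sym[of "(T ^^ n) h" "(T ^^ Suc n) h"] by (simp add: power2_norm_eq_inner)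
    also have "\<dots> \<le> norm ((T ^^ n) h) * norm ((T ^^ Suc (Suc n)) h)" by (rule norm_cauchy_schwarz)
    finally have "(?c (Suc n))\<^sup>2 \<le> (norm ((T ^^ n) h) * norm ((T ^^ Suc (Suc n)) h))\<^sup>2"
      by (intro power_mono) auto
    thus "(?c (Suc n))\<^sup>2 \<le> ?c n * ?c (Suc (Suc n))" by (simp only: power_mult_distrib)
  next
    have "?c k \<le> (norm h * x ^ k)\<^sup>2" using k by (intro power_mono) auto
    thus "?c k \<le> ?c 0 * (x\<^sup>2) ^ k" by (simp add: power_mult_distrib mult.commute flip: power_mult)
  qed (use assms in auto)
  hence "(norm ((T ^^ j) h))\<^sup>2 \<le> (norm h * x ^ j)\<^sup>2"
    by (simp add: power_mult_distrib mult.commute flip: power_mult)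
  thus ?thesis using x by (auto intro: power2_le_imp_le)
qed

lemma interpolation_base_ex:
  fixes T :: "'a :: real_inner \<Rightarrow> 'a"
  assumes "h \<noteq> 0" "0 < k"
  obtains x where "0 \<le> x" "norm ((T ^^ k) h) = norm h * x ^ k"
proof
  let ?x = "root k (norm ((T ^^ k) h) / norm h)"
  show "0 \<le> ?x" by (rule real_root_ge_zero) simp
  have "?x ^ k = norm ((T ^^ k) h) / norm h" using assms by (intro real_root_pow_pos2) auto
  thus "norm ((T ^^ k) h) = norm h * ?x ^ k" using assms by simp
qed

text \<open>Pair the terms \<open>q\<close> and \<open>n - q\<close>: the differences
  \<open>x ^ q - y ^ q\<close> and \<open>x ^ (n - q) - y ^ (n - q)\<close> have the same
  sign.\<close>

lemma sum_powers_rearrange: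
  fixes x y :: real
  assumes "0 \<le> x" "0 \<le> y"
  shows "(\<Sum>q\<le>n. x ^ q * y ^ (n - q)) \<le> (1 + real n) / 2 * (x ^ n + y ^ n)"
proof -
  have pair: "x ^ q * y ^ (n - q) + x ^ (n - q) * y ^ q \<le> x ^ n + y ^ n" if "q \<le> n" for q
  proof -
    have "0 \<le> (x ^ q - y ^ q) * (x ^ (n - q) - y ^ (n - q))"
    proof (cases "x \<le> y")
      case True
      thus ?thesis using assms by (intro mult_nonpos_nonpos) (auto intro: power_mono)
    next
      case False
      thus ?thesis using assms by (intro mult_nonneg_nonneg) (auto intro: power_mono)
    qed
    moreover have "x ^ q * x ^ (n - q) = x ^ n" "y ^ q * y ^ (n - q) = y ^ n"
      using that by (simp_all flip: power_add)
    ultimately show ?thesis by (simp add: algebra_simps)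
  qed
  have "(\<Sum>q\<le>n. x ^ q * y ^ (n - q)) = (\<Sum>q\<le>n. x ^ (n - q) * y ^ q)"
    by (rule sum.reindex_bij_witness[where i = "\<lambda>q. n - q" and j = "\<lambda>q. n - q"]) auto
  hence "2 * (\<Sum>q\<le>n. x ^ q * y ^ (n - q)) = (\<Sum>q\<le>n. x ^ q * y ^ (n - q) + x ^ (n - q) * y ^ q)"
    by (simp add: sum.distrib)
  also have "\<dots> \<le> (\<Sum>q\<le>n. x ^ n + y ^ n)" by (intro sum_mono pair) simp
  also have "\<dots> = (1 + real n) * (x ^ n + y ^ n)" by simp
  finally show ?thesis by (simp add: field_simps)
qed

text \<open>\<open>T1\<close> and \<open>T2\<close> need not commute, but only scalar moments at the
  one vector \<open>h\<close> occur. Each operator is replaced by the number that reproduces the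
  norm of its \<open>k\<close>-th power at \<open>h\<close>, which leaves the two-variable sum of
  \<open>sum_powers_rearrange\<close>.\<close>

lemma sum_mixed_moments_le:
  fixes T1 T2 :: "'a :: real_inner \<Rightarrow> 'a"
  assumes sym1: "\<And>u v. inner u (T1 v) = inner (T1 u) v" and sym2: "\<And>u v. inner u (T2 v) = inner (T2 u) v"
  shows "(\<Sum>q\<le>2 * k. inner h ((T1 ^^ q) h) * inner h ((T2 ^^ (2 * k - q)) h)) \<le>
    (1 + 2 * real k) / 2 * (norm h)\<^sup>2 * ((norm ((T1 ^^ k) h))\<^sup>2 + (norm ((T2 ^^ k) h))\<^sup>2)"
proof (cases "h = 0 \<or> k = 0")
  case True
  thus ?thesis by (auto simp: power2_norm_eq_inner)
next
  case False
  then obtain x where x: "0 \<le> x" "norm ((T1 ^^ k) h) = norm h * x ^ k"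
    by (metis interpolation_base_ex neq0_conv)
  from False obtain y where y: "0 \<le> y" "norm ((T2 ^^ k) h) = norm h * y ^ k"
    by (metis interpolation_base_ex neq0_conv)
  have moment: "\<bar>inner h ((T ^^ q) h)\<bar> \<le> (norm h)\<^sup>2 * z ^ q"
    if "\<And>u v. inner u (T v) = inner (T u) v" "norm ((T ^^ k) h) = norm h * z ^ k" "0 \<le> z" "q \<le> 2 * k"
    for T :: "'a \<Rightarrow> 'a" and z q
  proof -
    \<comment> \<open>Interpolation reaches powers up to \<open>k\<close> only, so a moment of order
      up to \<open>2 * k\<close> is written as an inner product of two powers of half the
      order.\<close>
    define i j where "i = q div 2" and "j = q - q div 2"
    have ij: "q = i + j" "i \<le> k" "j \<le> k" using that(4) by (auto simp: i_def j_def)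
    have "inner h ((T ^^ q) h) = inner ((T ^^ i) h) ((T ^^ j) h)"
      unfolding ij(1) funpow_add comp_apply by (rule funpow_symmetric[OF that(1)])
    hence "\<bar>inner h ((T ^^ q) h)\<bar> \<le> norm ((T ^^ i) h) * norm ((T ^^ j) h)"
      by (metis Cauchy_Schwarz_ineq2)
    also have "\<dots> \<le> (norm h * z ^ i) * (norm h * z ^ j)"
      using that(3) ij
        norm_funpow_interpolate[OF that(1) eq_refl[OF that(2)] that(3), of i]
        norm_funpow_interpolate[OF that(1) eq_refl[OF that(2)] that(3), of j]
      by (intro mult_mono) simp_all
    finally show ?thesis by (simp add: ij(1) power_add power2_eq_square mult_ac)
  qed
  have "(\<Sum>q\<le>2 * k. inner h ((T1 ^^ q) h) * inner h ((T2 ^^ (2 * k - q)) h)) \<le>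
      (\<Sum>q\<le>2 * k. ((norm h)\<^sup>2 * x ^ q) * ((norm h)\<^sup>2 * y ^ (2 * k - q)))"
  proof (rule sum_mono)
    fix q assume "q \<in> {..2 * k}"
    hence "\<bar>inner h ((T1 ^^ q) h)\<bar> * \<bar>inner h ((T2 ^^ (2 * k - q)) h)\<bar> \<le>
      ((norm h)\<^sup>2 * x ^ q) * ((norm h)\<^sup>2 * y ^ (2 * k - q))"
      using x y by (intro mult_mono moment sym1 sym2) auto
    thus "inner h ((T1 ^^ q) h) * inner h ((T2 ^^ (2 * k - q)) h) \<le>
      ((norm h)\<^sup>2 * x ^ q) * ((norm h)\<^sup>2 * y ^ (2 * k - q))"
      unfolding abs_mult[symmetric] by (rule order_trans[OF abs_ge_self])
  qed
  also have "\<dots> = (norm h)\<^sup>2 * (norm h)\<^sup>2 * (\<Sum>q\<le>2 * k. x ^ q * y ^ (2 * k - q))"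
    by (simp add: sum_distrib_left mult_ac)
  also have "\<dots> \<le> (norm h)\<^sup>2 * (norm h)\<^sup>2 * ((1 + real (2 * k)) / 2 * (x ^ (2 * k) + y ^ (2 * k)))"
    using x y by (intro mult_left_mono sum_powers_rearrange) auto
  also have "\<dots> = (1 + 2 * real k) / 2 * (norm h)\<^sup>2 * ((norm h * x ^ k)\<^sup>2 + (norm h * y ^ k)\<^sup>2)"
    by (simp add: power_mult_distrib algebra_simps flip: power_mult)
  finally show ?thesis by (simp only: x y)
qed

text \<open>Telescoping over the position at which the two powers start to differ. The hypothesis
  describes two signed rank-one sums that differ in one sign, \<open>1\<close> against
  \<open>-1\<close>; each telescoped term then factors through \<open>h\<close>.\<close>

lemma funpow_rank_one_difference:
  fixes T1 T2 :: "'a :: real_inner \<Rightarrow> 'a"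
  assumes T1: "linear T1" and rank_one: "\<And>v. T1 v - T2 v = (2 * inner h v) *\<^sub>R h"
  shows "(T1 ^^ n) v - (T2 ^^ n) v = (\<Sum>q<n. (2 * inner h ((T2 ^^ (n - 1 - q)) v)) *\<^sub>R (T1 ^^ q) h)"
proof (induction n)
  case (Suc n)
  interpret linear T1 by fact
  have "(T1 ^^ Suc n) v - (T2 ^^ Suc n) v =
      T1 ((T1 ^^ n) v - (T2 ^^ n) v) + (T1 ((T2 ^^ n) v) - T2 ((T2 ^^ n) v))"
    by (simp add: diff)
  also have "\<dots> = (\<Sum>q<n. (2 * inner h ((T2 ^^ (n - 1 - q)) v)) *\<^sub>R (T1 ^^ Suc q) h) +
      (2 * inner h ((T2 ^^ n) v)) *\<^sub>R h"
    unfolding Suc assms(2) by (simp add: sum scale)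
  also have "\<dots> = (\<Sum>q<Suc n. (2 * inner h ((T2 ^^ (Suc n - 1 - q)) v)) *\<^sub>R (T1 ^^ q) h)"
    unfolding sum.lessThan_Suc_shift by (simp add: add.commute)
  finally show ?case .
qed simp

section \<open>Trace moments of signed rank-one sums\<close>

definition rank_one_sum :: "('i \<Rightarrow> 'a :: real_inner) \<Rightarrow> 'i set \<Rightarrow> ('i \<Rightarrow> real) \<Rightarrow> 'a \<Rightarrow> 'a" where
  "rank_one_sum h I s v = (\<Sum>i\<in>I. (s i * inner (h i) v) *\<^sub>R h i)"

lemma linear_rank_one_sum: "linear (rank_one_sum h I s)"
  unfolding rank_one_sum_def
  by (rule linearI) (simp_all add: inner_add_right algebra_simps sum.distrib scaleR_sum_right)

lemma bounded_linear_rank_one_sum: "bounded_linear (rank_one_sum h I s)"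
proof -
  have "bounded_linear (\<lambda>v. (s i * inner (h i) v) *\<^sub>R h i)" for i
    by (rule bounded_linear_compose[OF bounded_linear_scaleR_left
      bounded_linear_compose[OF bounded_linear_mult_right bounded_linear_inner_right]])
  thus ?thesis unfolding rank_one_sum_def[abs_def] by (rule bounded_linear_sum)
qed

lemma rank_one_sum_symmetric: "inner u (rank_one_sum h I s v) = inner (rank_one_sum h I s u) v"
  by (simp add: rank_one_sum_def inner_sum_left inner_sum_right inner_commute mult_ac)

lemma rank_one_sum_insert:
  assumes "finite I" "k \<notin> I"
  shows "rank_one_sum h (insert k I) (s(k := c)) v =
    (c * inner (h k) v) *\<^sub>R h k + rank_one_sum h I s v"
  unfolding rank_one_sum_def using assms by (auto intro!: sum.cong)

text \<open>Integration by parts for one sign: \<open>s k\<close> times a function of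
  \<open>s k\<close> averages to half the difference of its values at \<open>1\<close> and
  \<open>-1\<close>. That difference telescopes into products of moments at \<open>h k\<close>,
  which \<open>sum_mixed_moments_le\<close> collects into the middle power \<open>n\<close>; its
  values at the two signs average to an expectation again.\<close>

lemma rademacher_rank_one_step:
  fixes h :: "'i \<Rightarrow> 'a :: real_inner"
  assumes I: "finite I" "k \<in> I"
  shows "measure_pmf.expectation (rademacher I)
      (\<lambda>s. s k * inner (h k) ((rank_one_sum h I s ^^ (2 * n + 1)) (h k)))
    \<le> (1 + 2 * real n) * (norm (h k))\<^sup>2 * measure_pmf.expectation (rademacher I)
        (\<lambda>s. (norm ((rank_one_sum h I s ^^ n) (h k)))\<^sup>2)"
proof -
  obtain J where J: "I = insert k J" "k \<notin> J" "finite J"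
    using I by (metis finite_insert mk_disjoint_insert)
  let ?X = "\<lambda>s. rank_one_sum h (insert k J) s"
  have step: "(inner (h k) ((?X (s(k := 1)) ^^ (2 * n + 1)) (h k)) -
        inner (h k) ((?X (s(k := -1)) ^^ (2 * n + 1)) (h k))) / 2
    \<le> (1 + 2 * real n) * (norm (h k))\<^sup>2 * (((norm ((?X (s(k := 1)) ^^ n) (h k)))\<^sup>2 +
        (norm ((?X (s(k := -1)) ^^ n) (h k)))\<^sup>2) / 2)" for s
  proof -
    let ?T1 = "?X (s(k := 1))" and ?T2 = "?X (s(k := -1))"
    have diff: "?T1 v - ?T2 v = (2 * inner (h k) v) *\<^sub>R h k" for v
      unfolding rank_one_sum_insert[OF J(3,2)] by (simp flip: scaleR_add_left)
    have "inner (h k) ((?T1 ^^ (2 * n + 1)) (h k)) - inner (h k) ((?T2 ^^ (2 * n + 1)) (h k)) =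
        (\<Sum>q<2 * n + 1. 2 * (inner (h k) ((?T1 ^^ q) (h k)) * inner (h k) ((?T2 ^^ (2 * n - q)) (h k))))"
      unfolding inner_diff_right[symmetric] funpow_rank_one_difference[OF linear_rank_one_sum diff]
      by (simp only: inner_sum_right inner_scaleR_right) (rule sum.cong; simp)
    also have "\<dots> = 2 * (\<Sum>q\<le>2 * n. inner (h k) ((?T1 ^^ q) (h k)) * inner (h k) ((?T2 ^^ (2 * n - q)) (h k)))"
      by (simp only: sum_distrib_left Suc_eq_plus1[symmetric] lessThan_Suc_atMost)
    also have "\<dots> \<le> 2 * ((1 + 2 * real n) / 2 * (norm (h k))\<^sup>2 *
        ((norm ((?T1 ^^ n) (h k)))\<^sup>2 + (norm ((?T2 ^^ n) (h k)))\<^sup>2))"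
      by (intro mult_left_mono sum_mixed_moments_le rank_one_sum_symmetric) auto
    finally show ?thesis by simp
  qed
  have "measure_pmf.expectation (rademacher I)
      (\<lambda>s. s k * inner (h k) ((rank_one_sum h I s ^^ (2 * n + 1)) (h k))) =
    measure_pmf.expectation (rademacher J) (\<lambda>s. (inner (h k) ((?X (s(k := 1)) ^^ (2 * n + 1)) (h k)) -
        inner (h k) ((?X (s(k := -1)) ^^ (2 * n + 1)) (h k))) / 2)"
    unfolding J(1) expectation_rademacher_insert[OF J(3,2)] by simp
  also have "\<dots> \<le> measure_pmf.expectation (rademacher J) (\<lambda>s. (1 + 2 * real n) * (norm (h k))\<^sup>2 *
      (((norm ((?X (s(k := 1)) ^^ n) (h k)))\<^sup>2 + (norm ((?X (s(k := -1)) ^^ n) (h k)))\<^sup>2) / 2))"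
    using J by (intro expectation_mono_finite finite_rademacher step)
  also have "\<dots> = (1 + 2 * real n) * (norm (h k))\<^sup>2 * measure_pmf.expectation (rademacher I)
        (\<lambda>s. (norm ((rank_one_sum h I s ^^ n) (h k)))\<^sup>2)"
    unfolding J(1) expectation_rademacher_insert[OF J(3,2)] by simp
  finally show ?thesis .
qed

text \<open>The Parseval expansion of \<open>w\<close> along \<open>B\<close>, the property of an
  orthonormal basis on which the trace arguments rest. It is asked of single vectors, so the ambient
  space may be infinite-dimensional.\<close>

definition spanned_by_frame :: "'a :: real_inner set \<Rightarrow> 'a \<Rightarrow> bool" where
  "spanned_by_frame B w \<longleftrightarrow> w = (\<Sum>e\<in>B. inner w e *\<^sub>R e)"

lemma frame_inner:
  assumes "spanned_by_frame B w"
  shows "inner u w = (\<Sum>e\<in>B. inner u e * inner w e)"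
proof -
  have "inner u w = inner u (\<Sum>e\<in>B. inner w e *\<^sub>R e)"
    using assms by (simp add: spanned_by_frame_def)
  thus ?thesis by (simp add: inner_sum_right mult.commute)
qed

lemma frame_rank_one_sum:
  assumes "\<And>i. i \<in> I \<Longrightarrow> spanned_by_frame B (h i)"
  shows "spanned_by_frame B (rank_one_sum h I s v)"
proof -
  have "rank_one_sum h I s v = (\<Sum>i\<in>I. (s i * inner (h i) v) *\<^sub>R (\<Sum>e\<in>B. inner (h i) e *\<^sub>R e))"
    unfolding rank_one_sum_def using assms
    by (intro sum.cong refl) (simp add: spanned_by_frame_def)
  also have "\<dots> = (\<Sum>e\<in>B. \<Sum>i\<in>I. (s i * inner (h i) v * inner (h i) e) *\<^sub>R e)"
    by (subst sum.swap) (simp add: scaleR_sum_right)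
  also have "\<dots> = (\<Sum>e\<in>B. inner (rank_one_sum h I s v) e *\<^sub>R e)"
    by (simp only: rank_one_sum_def inner_sum_left scaleR_sum_left inner_scaleR_left)
  finally show ?thesis unfolding spanned_by_frame_def .
qed

lemma frame_funpow_rank_one_sum:
  assumes "\<And>i. i \<in> I \<Longrightarrow> spanned_by_frame B (h i)" and "0 < n \<or> spanned_by_frame B v"
  shows "spanned_by_frame B ((rank_one_sum h I s ^^ n) v)"
  using assms by (cases n) (auto intro: frame_rank_one_sum)

text \<open>For symmetric \<open>T\<close> and orthonormal \<open>B\<close> this is the trace of
  \<open>T ^^ (2 * n)\<close> over the span of \<open>B\<close>.\<close>

definition even_trace :: "'a :: real_inner set \<Rightarrow> ('a \<Rightarrow> 'a) \<Rightarrow> nat \<Rightarrow> real" where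
  "even_trace B T n = (\<Sum>e\<in>B. (norm ((T ^^ n) e))\<^sup>2)"

text \<open>Peel one factor off the power \<open>2 * n + 2\<close> and expand it as a sum over
  \<open>i\<close>; Parseval then closes the trace around \<open>h i\<close>. Each summand carries
  its own sign, the shape that \<open>rademacher_rank_one_step\<close> needs.\<close>

lemma even_trace_rank_one_sum:
  fixes h :: "'i \<Rightarrow> 'a :: real_inner" and s :: "'i \<Rightarrow> real"
  assumes "\<And>i. i \<in> I \<Longrightarrow> spanned_by_frame B (h i)"
  shows "even_trace B (rank_one_sum h I s) (Suc n) = (\<Sum>i\<in>I. s i * inner (h i) ((rank_one_sum h I s ^^ (2 * n + 1)) (h i)))"
proof -
  define X where "X = rank_one_sum h I s"
  have sym: "inner u (X v) = inner (X u) v" for u v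
    unfolding X_def by (rule rank_one_sum_symmetric)
  have "(norm ((X ^^ Suc n) e))\<^sup>2 =
      (\<Sum>i\<in>I. s i * (inner ((X ^^ (2 * n + 1)) (h i)) e * inner (h i) e))" for e
  proof -
    have "(norm ((X ^^ Suc n) e))\<^sup>2 = inner e ((X ^^ Suc n) ((X ^^ Suc n) e))"
      unfolding power2_norm_eq_inner by (rule funpow_symmetric[symmetric]) (rule sym)
    also have "(X ^^ Suc n) ((X ^^ Suc n) e) = X ((X ^^ (2 * n + 1)) e)"
    proof -
      have "(X ^^ Suc n) ((X ^^ Suc n) e) = (X ^^ (Suc n + Suc n)) e" by (simp only: funpow_add comp_apply)
      also have "Suc n + Suc n = Suc (2 * n + 1)" by simp
      finally show ?thesis by simp
    qed
    also have "inner e (X ((X ^^ (2 * n + 1)) e)) =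
        (\<Sum>i\<in>I. s i * (inner (h i) ((X ^^ (2 * n + 1)) e) * inner (h i) e))"
      unfolding X_def rank_one_sum_def[of _ _ _ "(rank_one_sum h I s ^^ (2 * n + 1)) e"]
      by (simp add: inner_sum_right inner_commute mult_ac)
    also have "\<dots> = (\<Sum>i\<in>I. s i * (inner ((X ^^ (2 * n + 1)) (h i)) e * inner (h i) e))"
      by (simp only: funpow_symmetric[OF sym])
    finally show ?thesis .
  qed
  hence "even_trace B X (Suc n) =
      (\<Sum>e\<in>B. \<Sum>i\<in>I. s i * (inner ((X ^^ (2 * n + 1)) (h i)) e * inner (h i) e))"
    by (simp only: even_trace_def)
  also have "\<dots> = (\<Sum>i\<in>I. s i * (\<Sum>e\<in>B. inner ((X ^^ (2 * n + 1)) (h i)) e * inner (h i) e))"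
    by (subst sum.swap) (simp only: sum_distrib_left)
  also have "\<dots> = (\<Sum>i\<in>I. s i * inner (h i) ((X ^^ (2 * n + 1)) (h i)))"
    by (intro sum.cong refl arg_cong2[where f = "(*)"]) (metis frame_inner assms(1) inner_commute)
  finally show ?thesis unfolding X_def .
qed

text \<open>With \<open>X\<close> the signed sum, the left side is the trace of
  \<open>X ^^ n\<close>, then the unsigned sum, then \<open>X ^^ n\<close> again, and the unsigned
  sum is at most \<open>\<beta>\<close> times the identity.\<close>

lemma sum_norm_funpow_le_even_trace:
  fixes h :: "'i \<Rightarrow> 'a :: real_inner" and s :: "'i \<Rightarrow> real"
  assumes frame: "\<And>i. i \<in> I \<Longrightarrow> spanned_by_frame B (h i)"
    and beta: "\<And>v. (\<Sum>i\<in>I. (inner (h i) v)\<^sup>2) \<le> \<beta> * (norm v)\<^sup>2"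
  shows "(\<Sum>i\<in>I. (norm ((rank_one_sum h I s ^^ n) (h i)))\<^sup>2) \<le> \<beta> * even_trace B (rank_one_sum h I s) n"
proof -
  define X where "X = rank_one_sum h I s"
  have sym: "inner u (X v) = inner (X u) v" for u v
    unfolding X_def by (rule rank_one_sum_symmetric)
  have "(norm ((X ^^ n) (h i)))\<^sup>2 = (\<Sum>e\<in>B. (inner (h i) ((X ^^ n) e))\<^sup>2)" if "i \<in> I" for i
  proof -
    have fr: "spanned_by_frame B ((X ^^ n) (h i))"
      unfolding X_def using frame that by (intro frame_funpow_rank_one_sum) auto
    show ?thesis
      unfolding power2_norm_eq_inner frame_inner[OF fr] funpow_symmetric[OF sym, symmetric]
      by (simp add: power2_eq_square)
  qed
  hence "(\<Sum>i\<in>I. (norm ((X ^^ n) (h i)))\<^sup>2) = (\<Sum>e\<in>B. \<Sum>i\<in>I. (inner (h i) ((X ^^ n) e))\<^sup>2)"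
    by (subst sum.swap) simp
  also have "\<dots> \<le> (\<Sum>e\<in>B. \<beta> * (norm ((X ^^ n) e))\<^sup>2)" by (intro sum_mono beta)
  finally show ?thesis by (simp add: even_trace_def sum_distrib_left X_def)
qed

text \<open>The trace bounds the norm of \<open>X ^^ p\<close>, and interpolation carries this back
  to \<open>X\<close> itself. Positivity of \<open>p\<close> puts the power into the range of
  \<open>X\<close>, where the expansion along \<open>B\<close> is available.\<close>

lemma onorm_power_le_even_trace:
  fixes h :: "'i \<Rightarrow> 'a :: real_inner" and s :: "'i \<Rightarrow> real"
  assumes frame: "\<And>i. i \<in> I \<Longrightarrow> spanned_by_frame B (h i)" and p: "0 < p"
  shows "onorm (rank_one_sum h I s) ^ (2 * p) \<le> even_trace B (rank_one_sum h I s) p"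
proof -
  define X where "X = rank_one_sum h I s"
  have sym: "inner u (X v) = inner (X u) v" for u v
    unfolding X_def by (rule rank_one_sum_symmetric)
  have tr: "0 \<le> even_trace B X p" unfolding even_trace_def by (intro sum_nonneg) auto
  define x where "x = root (2 * p) (even_trace B X p)"
  have x: "0 \<le> x" "x ^ (2 * p) = even_trace B X p"
    using p tr unfolding x_def by (auto intro!: real_root_ge_zero real_root_pow_pos2)
  have "norm (X v) \<le> x * norm v" for v
  proof -
    have fr: "spanned_by_frame B ((X ^^ p) v)"
      unfolding X_def using frame p by (intro frame_funpow_rank_one_sum) auto
    have "(norm ((X ^^ p) v))\<^sup>2 = (\<Sum>e\<in>B. (inner v ((X ^^ p) e))\<^sup>2)"
      unfolding power2_norm_eq_inner frame_inner[OF fr] funpow_symmetric[OF sym, symmetric]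
      by (simp add: power2_eq_square)
    also have "\<dots> \<le> (\<Sum>e\<in>B. (norm v)\<^sup>2 * (norm ((X ^^ p) e))\<^sup>2)"
      using Cauchy_Schwarz_ineq by (intro sum_mono) (simp add: power2_norm_eq_inner)
    also have "\<dots> = (norm v)\<^sup>2 * x ^ (2 * p)" by (simp add: x even_trace_def sum_distrib_left)
    also have "\<dots> = (norm v * x ^ p)\<^sup>2" by (simp add: power_mult_distrib mult.commute flip: power_mult)
    finally have "norm ((X ^^ p) v) \<le> norm v * x ^ p"
      using x by (auto intro: power2_le_imp_le)
    from norm_funpow_interpolate[OF sym this x(1), of 1] p show ?thesis by (simp add: mult.commute)
  qed
  hence "onorm X \<le> x" using x by (intro onorm_bound) auto
  hence "onorm X ^ (2 * p) \<le> x ^ (2 * p)"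
    unfolding X_def by (intro power_mono onorm_pos_le bounded_linear_rank_one_sum)
  thus ?thesis by (simp add: x X_def)
qed

text \<open>Each round multiplies the trace by at most \<open>(1 + 2 * n) * l * \<beta>\<close>, and
  \<open>1 + 2 * n\<close> is below \<open>2 * p\<close>. The recursion ends at the total squared
  length of the vectors, not at the size of \<open>B\<close>; this keeps the dimension out of the
  final bound.\<close>

lemma rademacher_even_trace_le:
  fixes h :: "'i \<Rightarrow> 'a :: real_inner"
  assumes I: "finite I" and frame: "\<And>i. i \<in> I \<Longrightarrow> spanned_by_frame B (h i)"
    and beta: "\<And>v. (\<Sum>i\<in>I. (inner (h i) v)\<^sup>2) \<le> \<beta> * (norm v)\<^sup>2" and "1 \<le> \<beta>"
    and len: "\<And>i. i \<in> I \<Longrightarrow> (norm (h i))\<^sup>2 \<le> l" and "0 \<le> l" and "n < p"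
  shows "measure_pmf.expectation (rademacher I) (\<lambda>s. even_trace B (rank_one_sum h I s) (Suc n))
    \<le> (2 * real p * l * \<beta>) ^ Suc n * (\<Sum>i\<in>I. (norm (h i))\<^sup>2)"
  using \<open>n < p\<close>
proof (induction n)
  note fin = finite_rademacher[OF I]
  have step: "measure_pmf.expectation (rademacher I) (\<lambda>s. even_trace B (rank_one_sum h I s) (Suc n)) \<le>
      (1 + 2 * real n) * l * measure_pmf.expectation (rademacher I)
        (\<lambda>s. \<Sum>i\<in>I. (norm ((rank_one_sum h I s ^^ n) (h i)))\<^sup>2)" for n
  proof -
    have "measure_pmf.expectation (rademacher I) (\<lambda>s. even_trace B (rank_one_sum h I s) (Suc n)) =
      (\<Sum>i\<in>I. measure_pmf.expectation (rademacher I)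
        (\<lambda>s. s i * inner (h i) ((rank_one_sum h I s ^^ (2 * n + 1)) (h i))))"
      by (subst even_trace_rank_one_sum) (simp_all only: frame expectation_sum_finite[OF fin])
    also have "\<dots> \<le> (\<Sum>i\<in>I. (1 + 2 * real n) * (norm (h i))\<^sup>2 * measure_pmf.expectation (rademacher I)
        (\<lambda>s. (norm ((rank_one_sum h I s ^^ n) (h i)))\<^sup>2))"
      by (intro sum_mono rademacher_rank_one_step I)
    also have "\<dots> \<le> (\<Sum>i\<in>I. (1 + 2 * real n) * l * measure_pmf.expectation (rademacher I)
        (\<lambda>s. (norm ((rank_one_sum h I s ^^ n) (h i)))\<^sup>2))"
      using len by (intro sum_mono mult_right_mono mult_left_mono integral_nonneg_AE) auto
    also have "\<dots> = (1 + 2 * real n) * l * measure_pmf.expectation (rademacher I)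
        (\<lambda>s. \<Sum>i\<in>I. (norm ((rank_one_sum h I s ^^ n) (h i)))\<^sup>2)"
      by (simp only: expectation_sum_finite[OF fin] sum_distrib_left)
    finally show ?thesis .
  qed
  let ?t = "\<Sum>i\<in>I. (norm (h i))\<^sup>2"
  have t: "0 \<le> ?t" by (intro sum_nonneg) auto
  {
    case 0
    \<comment> \<open>The first round produces no factor \<open>\<beta>\<close>; the assumption
      \<open>1 \<le> \<beta>\<close> inserts it so that all rounds look alike.\<close>
    have "l \<le> 2 * real p * l * \<beta>"
    proof -
      have "1 * 1 \<le> (2 * real p) * \<beta>" using 0 \<open>1 \<le> \<beta>\<close> by (intro mult_mono) auto
      hence "1 * l \<le> (2 * real p * \<beta>) * l" using \<open>0 \<le> l\<close> by (intro mult_right_mono) auto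
      thus ?thesis by (simp add: mult_ac)
    qed
    hence "l * ?t \<le> 2 * real p * l * \<beta> * ?t" using t by (rule mult_right_mono)
    thus ?case using step[of 0] by simp
  next
    case (Suc n)
    have "measure_pmf.expectation (rademacher I)
        (\<lambda>s. \<Sum>i\<in>I. (norm ((rank_one_sum h I s ^^ Suc n) (h i)))\<^sup>2) \<le>
      measure_pmf.expectation (rademacher I) (\<lambda>s. \<beta> * even_trace B (rank_one_sum h I s) (Suc n))"
      by (intro expectation_mono_finite fin sum_norm_funpow_le_even_trace frame beta)
    also have "\<dots> \<le> \<beta> * ((2 * real p * l * \<beta>) ^ Suc n * ?t)"
      using Suc \<open>1 \<le> \<beta>\<close> by (simp only: integral_mult_right_zero) (intro mult_left_mono; simp)
    finally have "measure_pmf.expectation (rademacher I)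
        (\<lambda>s. \<Sum>i\<in>I. (norm ((rank_one_sum h I s ^^ Suc n) (h i)))\<^sup>2) \<le>
        \<beta> * ((2 * real p * l * \<beta>) ^ Suc n * ?t)" .
    hence "(1 + 2 * real (Suc n)) * l * measure_pmf.expectation (rademacher I)
        (\<lambda>s. \<Sum>i\<in>I. (norm ((rank_one_sum h I s ^^ Suc n) (h i)))\<^sup>2) \<le>
        (2 * real p * l) * (\<beta> * ((2 * real p * l * \<beta>) ^ Suc n * ?t))"
      using Suc \<open>0 \<le> l\<close> \<open>1 \<le> \<beta>\<close> t
      by (intro mult_mono) (auto intro!: integral_nonneg_AE sum_nonneg mult_nonneg_nonneg)
    also have "\<dots> = (2 * real p * l * \<beta>) ^ Suc (Suc n) * ?t" by (simp add: mult_ac)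
    finally show ?case using step[of "Suc n"] by linarith
  }
qed

text \<open>Passing from the moment to the mean uses \<open>t \<le> \<sigma> + t\<^sup>q / \<sigma>\<^sup>q\<^sup>-\<^sup>1\<close>; the hypothesis on \<open>p\<close>
  makes the dimensional factor of the trace at most \<open>e\<^sup>p\<close>.\<close>

lemma rademacher_onorm_le:
  fixes h :: "'i \<Rightarrow> 'a :: real_inner"
  assumes I: "finite I" and frame: "\<And>i. i \<in> I \<Longrightarrow> spanned_by_frame B (h i)"
    and beta: "\<And>v. (\<Sum>i\<in>I. (inner (h i) v)\<^sup>2) \<le> \<beta> * (norm v)\<^sup>2" and "1 \<le> \<beta>"
    and len: "\<And>i. i \<in> I \<Longrightarrow> (norm (h i))\<^sup>2 \<le> l" and "0 < l" and p: "0 < p"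
    and total: "(\<Sum>i\<in>I. (norm (h i))\<^sup>2) \<le> exp (real p)"
  shows "measure_pmf.expectation (rademacher I) (\<lambda>s. onorm (rank_one_sum h I s))
    \<le> 2 * sqrt (2 * exp 1 * real p * l * \<beta>)"
proof -
  note fin = finite_rademacher[OF I]
  \<comment> \<open>The factor \<open>exp 1\<close> under the root absorbs the bound
    \<open>exp (real p)\<close> on the total length, so that the trace moment is at most
    \<open>\<sigma> ^ (2 * p)\<close>.\<close>
  define \<sigma> where "\<sigma> = sqrt (2 * exp 1 * real p * l * \<beta>)"
  have arg: "0 < 2 * exp 1 * real p * l * \<beta>" using assms by simp
  hence sig: "0 < \<sigma>" by (simp add: \<sigma>_def)
  obtain n where n: "p = Suc n" using p by (cases p) auto
  have pt: "t \<le> \<sigma> + t ^ (2 * p) / \<sigma> ^ (2 * p - 1)" if "0 \<le> t" for t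
  proof (cases "t \<le> \<sigma>")
    case True
    thus ?thesis using sig that by (simp add: add_increasing2)
  next
    case False
    have "t * \<sigma> ^ (2 * p - 1) \<le> t * t ^ (2 * p - 1)"
      using False sig that by (intro mult_left_mono power_mono) auto
    also have "\<dots> = t ^ (2 * p)" using p by (simp add: n)
    finally have "t \<le> t ^ (2 * p) / \<sigma> ^ (2 * p - 1)" using sig by (simp add: field_simps)
    thus ?thesis using sig by linarith
  qed
  have "measure_pmf.expectation (rademacher I) (\<lambda>s. even_trace B (rank_one_sum h I s) (Suc n))
      \<le> (2 * real p * l * \<beta>) ^ Suc n * (\<Sum>i\<in>I. (norm (h i))\<^sup>2)"
    using assms n by (intro rademacher_even_trace_le) auto
  also have "\<dots> \<le> (2 * real p * l * \<beta>) ^ Suc n * exp (real p)"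
    using assms by (intro mult_left_mono) auto
  also have "\<dots> = (\<sigma>\<^sup>2) ^ p"
    using arg by (simp add: \<sigma>_def n power_mult_distrib exp_of_nat_mult[of "Suc n" 1, simplified] mult_ac)
  also have "\<dots> = \<sigma> * \<sigma> ^ (2 * p - 1)"
    using p by (metis Suc_diff_1 nat_0_less_mult_iff power_Suc power_mult zero_less_numeral)
  finally have tr: "measure_pmf.expectation (rademacher I)
      (\<lambda>s. even_trace B (rank_one_sum h I s) p) \<le> \<sigma> * \<sigma> ^ (2 * p - 1)" by (simp only: n)
  have "measure_pmf.expectation (rademacher I) (\<lambda>s. onorm (rank_one_sum h I s)) \<le>
      measure_pmf.expectation (rademacher I)
        (\<lambda>s. \<sigma> + even_trace B (rank_one_sum h I s) p / \<sigma> ^ (2 * p - 1))"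
  proof (intro expectation_mono_finite fin)
    fix s
    have "onorm (rank_one_sum h I s) \<le>
        \<sigma> + onorm (rank_one_sum h I s) ^ (2 * p) / \<sigma> ^ (2 * p - 1)"
      by (intro pt onorm_pos_le bounded_linear_rank_one_sum)
    also have "\<dots> \<le> \<sigma> + even_trace B (rank_one_sum h I s) p / \<sigma> ^ (2 * p - 1)"
      using sig frame p by (intro add_left_mono divide_right_mono onorm_power_le_even_trace) auto
    finally show "onorm (rank_one_sum h I s) \<le>
      \<sigma> + even_trace B (rank_one_sum h I s) p / \<sigma> ^ (2 * p - 1)" .
  qed
  also have "\<dots> = \<sigma> + measure_pmf.expectation (rademacher I)
      (\<lambda>s. even_trace B (rank_one_sum h I s) p) / \<sigma> ^ (2 * p - 1)"
    by (simp add: expectation_add_finite[OF fin])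
  also have "\<dots> \<le> \<sigma> + \<sigma>" using tr sig by (simp add: field_simps)
  finally show ?thesis by (simp add: \<sigma>_def)
qed

subsection \<open>Sampling rank-one forms\<close>

lemma expectation_uniform_PiE:
  fixes F :: "(nat \<Rightarrow> nat) \<Rightarrow> real"
  assumes "0 < N"
  shows "measure_pmf.expectation (Pi_pmf {..<m} 0 (\<lambda>_. pmf_of_set {..<N})) F =
    (\<Sum>r\<in>PiE_dflt {..<m} 0 (\<lambda>_. {..<N}). F r) / real (card (PiE_dflt {..<m} 0 (\<lambda>_. {..<N})))"
proof -
  have "PiE_dflt {..<m} 0 (\<lambda>_. {..<N}) \<noteq> {}" using assms by auto
  thus ?thesis
    using assms by (simp add: Pi_pmf_of_set lessThan_empty_iff integral_pmf_of_set finite_PiE_dflt)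
qed

text \<open>Exchanging the two samples at the positions not marked by \<open>b\<close> is an
  involution on pairs of sample vectors, and it preserves the uniform measure.\<close>

lemma expectation_uniform_swap:
  fixes F :: "(nat \<Rightarrow> nat) \<Rightarrow> (nat \<Rightarrow> nat) \<Rightarrow> real"
  assumes N: "0 < N" and R: "R = Pi_pmf {..<m} 0 (\<lambda>_. pmf_of_set {..<N})"
  shows "measure_pmf.expectation R (\<lambda>r. measure_pmf.expectation R (F r)) =
    measure_pmf.expectation R (\<lambda>r. measure_pmf.expectation R (\<lambda>r'.
      F (\<lambda>i. if b i then r i else r' i) (\<lambda>i. if b i then r' i else r i)))"
proof -
  let ?\<Omega> = "PiE_dflt {..<m} 0 (\<lambda>_. {..<N})"
  let ?\<sigma> = "\<lambda>(r, r'). ((\<lambda>i. if b i then r i else r' i), (\<lambda>i. if b i then r' i else r i))"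
  have mem: "?\<sigma> z \<in> ?\<Omega> \<times> ?\<Omega>" if "z \<in> ?\<Omega> \<times> ?\<Omega>" for z
    using that by (auto simp: PiE_dflt_def)
  have inv: "?\<sigma> (?\<sigma> z) = z" for z by (cases z) auto
  have "(\<Sum>z\<in>?\<Omega> \<times> ?\<Omega>. case_prod F z) = (\<Sum>z\<in>?\<Omega> \<times> ?\<Omega>. case_prod F (?\<sigma> z))"
    by (rule sum.reindex_bij_witness[where i = ?\<sigma> and j = ?\<sigma>]) (simp_all only: inv mem)
  hence "(\<Sum>r\<in>?\<Omega>. \<Sum>r'\<in>?\<Omega>. F r r') = (\<Sum>r\<in>?\<Omega>. \<Sum>r'\<in>?\<Omega>.
      F (\<lambda>i. if b i then r i else r' i) (\<lambda>i. if b i then r' i else r i))"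
    by (simp add: sum.cartesian_product case_prod_unfold)
  thus ?thesis
    unfolding R expectation_uniform_PiE[OF N] by (simp flip: sum_divide_distrib)
qed

lemma expectation_Pi_component:
  fixes f :: "'a \<Rightarrow> real"
  assumes "finite I" "i \<in> I"
  shows "measure_pmf.expectation (Pi_pmf I dflt q) (\<lambda>r. f (r i)) = measure_pmf.expectation (q i) f"
proof -
  have "measure_pmf.expectation (map_pmf (\<lambda>r. r i) (Pi_pmf I dflt q)) f =
      measure_pmf.expectation (q i) f"
    using assms by (simp add: Pi_pmf_component)
  thus ?thesis by simp
qed

lemma norm_le_by_duality:
  fixes z :: "'a :: real_inner"
  assumes "\<And>u. inner u z \<le> c * norm u" "0 \<le> c"
  shows "norm z \<le> c"
proof (cases "z = 0")
  case False
  have "norm z * norm z \<le> c * norm z"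
    using assms(1)[of z] by (simp add: power2_norm_eq_inner flip: power2_eq_square)
  thus ?thesis using False by simp
qed (use assms in simp)

text \<open>Symmetrization reduces to random signs, and \<open>rademacher_onorm_le\<close> then bounds the mean
  deviation by a multiple of the norm of the sampled form itself, hence of the deviation again.\<close>

lemma sampled_form_deviation:
  fixes z :: "nat \<Rightarrow> 'a :: real_inner"
  assumes N: "0 < N" and m: "0 < m"
    and frame: "\<And>r. r < N \<Longrightarrow> spanned_by_frame B (z r)"
    and len: "\<And>r. r < N \<Longrightarrow> (norm (z r))\<^sup>2 \<le> l" and l: "0 < l" and p: "0 < p"
    and total: "real m * l \<le> exp (real p)"
    and form: "\<And>v. real m / real N * (\<Sum>r<N. (inner (z r) v)\<^sup>2) \<le> 2 * (norm v)\<^sup>2"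
    and small: "2 * exp 1 * real p * l \<le> 1 / 64"
  shows "measure_pmf.expectation (Pi_pmf {..<m} 0 (\<lambda>_. pmf_of_set {..<N}))
      (\<lambda>r. onorm (\<lambda>v. rank_one_sum (\<lambda>i. z (r i)) {..<m} (\<lambda>_. 1) v -
        rank_one_sum z {..<N} (\<lambda>_. real m / real N) v))
    \<le> 16 * sqrt (2 * exp 1 * real p * l)"
proof -
  define R where "R = Pi_pmf {..<m} (0 :: nat) (\<lambda>_. pmf_of_set {..<N})"
  define Q where "Q = (\<lambda>r s. rank_one_sum (\<lambda>i. z (r i)) {..<m} s)"
  define M where "M = rank_one_sum z {..<N} (\<lambda>_. real m / real N)"
  define one :: "nat \<Rightarrow> real" where "one = (\<lambda>_. 1)"
  define \<kappa> where "\<kappa> = sqrt (2 * exp 1 * real p * l)"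
  let ?D = "\<lambda>r. onorm (\<lambda>v. Q r one v - M v)"
  let ?S = "rademacher {..<m}"
  have \<Omega>: "{..<N} \<noteq> {}" using N by auto
  have finR: "finite (set_pmf R)" unfolding R_def using \<Omega> by (intro finite_set_Pi_pmf) auto
  have setR: "r i < N" if "r \<in> set_pmf R" "i < m" for r i
    using that \<Omega> by (auto simp: R_def set_Pi_pmf PiE_dflt_def)
  have finS: "finite (set_pmf ?S)" by (rule finite_rademacher) simp
  have setS: "s i = 1 \<or> s i = -1" if "s \<in> set_pmf ?S" "i < m" for s i
    using that by (auto simp: rademacher_def set_Pi_pmf PiE_dflt_def)
  have blQ: "bounded_linear (Q r s)" for r s unfolding Q_def by (rule bounded_linear_rank_one_sum)
  have blM: "bounded_linear M" unfolding M_def by (rule bounded_linear_rank_one_sum)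
  note bl = bounded_linear_sub[OF blQ blM] bounded_linear_sub[OF blQ blQ]
  have kap: "0 < \<kappa>" "\<kappa> \<le> 1 / 8"
  proof -
    show "0 < \<kappa>" using p l by (simp add: \<kappa>_def)
    have "\<kappa> \<le> sqrt (1 / 64)" unfolding \<kappa>_def by (intro real_sqrt_le_mono small)
    also have "sqrt (1 / 64) = 1 / 8" by (simp add: real_sqrt_divide)
    finally show "\<kappa> \<le> 1 / 8" .
  qed
  have mean: "measure_pmf.expectation R (\<lambda>r'. inner u (Q r' one v)) = inner u (M v)" for u v
  proof -
    have "measure_pmf.expectation R (\<lambda>r'. inner u (Q r' one v)) =
      (\<Sum>i<m. measure_pmf.expectation R (\<lambda>r'. inner (z (r' i)) v * inner u (z (r' i))))"
      unfolding Q_def rank_one_sum_def inner_sum_right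
      by (subst expectation_sum_finite[OF finR]) (simp add: one_def)
    also have "\<dots> = (\<Sum>i<m. (\<Sum>r<N. inner (z r) v * inner u (z r)) / real N)"
      unfolding R_def
      by (intro sum.cong refl)
        (subst expectation_Pi_component[where f = "\<lambda>r. inner (z r) v * inner u (z r)"],
          use \<Omega> in \<open>auto simp: integral_pmf_of_set\<close>)
    also have "\<dots> = inner u (M v)"
      by (simp add: M_def rank_one_sum_def inner_sum_right sum_divide_distrib sum_distrib_left
          mult.assoc)
    finally show ?thesis .
  qed
  \<comment> \<open>Jensen's inequality for the operator norm, run through pairings with
    \<open>u\<close> so that only real expectations occur.\<close>
  have sym1: "?D r \<le> measure_pmf.expectation R (\<lambda>r'. onorm (\<lambda>v. Q r one v - Q r' one v))" for r
  proof (rule onorm_bound)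
    let ?E = "measure_pmf.expectation R (\<lambda>r'. onorm (\<lambda>v. Q r one v - Q r' one v))"
    show E0: "0 \<le> ?E" by (intro integral_nonneg_AE) (auto intro: onorm_pos_le bl)
    fix v
    show "norm (Q r one v - M v) \<le> ?E * norm v"
    proof (rule norm_le_by_duality)
      fix u
      have "inner u (Q r one v - M v) =
          measure_pmf.expectation R (\<lambda>r'. inner u (Q r one v)) +
          measure_pmf.expectation R (\<lambda>r'. (-1) * inner u (Q r' one v))"
        by (subst integral_mult_right_zero) (simp add: mean inner_diff_right)
      also have "\<dots> = measure_pmf.expectation R (\<lambda>r'. inner u (Q r one v - Q r' one v))"
        by (subst expectation_add_finite[OF finR, symmetric]) (simp add: inner_diff_right)
      also have "\<dots> \<le> measure_pmf.expectation R
          (\<lambda>r'. onorm (\<lambda>v. Q r one v - Q r' one v) * (norm v * norm u))"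
      proof (intro expectation_mono_finite finR)
        fix r'
        have "inner u (Q r one v - Q r' one v) \<le> norm u * norm (Q r one v - Q r' one v)"
          by (rule norm_cauchy_schwarz)
        also have "\<dots> \<le> norm u * (onorm (\<lambda>v. Q r one v - Q r' one v) * norm v)"
          by (intro mult_left_mono onorm[OF bl(2)]) auto
        finally show "inner u (Q r one v - Q r' one v) \<le>
          onorm (\<lambda>v. Q r one v - Q r' one v) * (norm v * norm u)" by (simp add: mult_ac)
      qed
      finally show "inner u (Q r one v - M v) \<le> ?E * norm v * norm u" by simp
    qed (use E0 in simp)
  qed
  \<comment> \<open>A sign \<open>-1\<close> at \<open>i\<close> amounts to exchanging the two
    samples at \<open>i\<close>.\<close>
  have swap: "measure_pmf.expectation R (\<lambda>r. measure_pmf.expectation R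
        (\<lambda>r'. onorm (\<lambda>v. Q r one v - Q r' one v))) =
      measure_pmf.expectation R (\<lambda>r. measure_pmf.expectation R
        (\<lambda>r'. onorm (\<lambda>v. Q r s v - Q r' s v)))" if s: "s \<in> set_pmf ?S" for s
  proof -
    have "Q (\<lambda>i. if s i = 1 then r i else r' i) one v - Q (\<lambda>i. if s i = 1 then r' i else r i) one v =
        Q r s v - Q r' s v" for r r' v
      unfolding Q_def rank_one_sum_def sum_subtractf[symmetric]
    proof (intro sum.cong refl)
      fix i assume "i \<in> {..<m}"
      hence "s i = 1 \<or> s i = -1" using s setS by simp
      thus "(one i * inner (z (if s i = 1 then r i else r' i)) v) *\<^sub>R z (if s i = 1 then r i else r' i) -
          (one i * inner (z (if s i = 1 then r' i else r i)) v) *\<^sub>R z (if s i = 1 then r' i else r i) =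
          (s i * inner (z (r i)) v) *\<^sub>R z (r i) - (s i * inner (z (r' i)) v) *\<^sub>R z (r' i)"
        by (auto simp: one_def)
    qed
    thus ?thesis
      using expectation_uniform_swap[OF N R_def, of "\<lambda>r r'. onorm (\<lambda>v. Q r one v - Q r' one v)" "\<lambda>i. s i = 1"]
      by simp
  qed
  have signs: "measure_pmf.expectation ?S (\<lambda>s. onorm (Q r s)) \<le> 2 * \<kappa> * (2 + ?D r)"
    if r: "r \<in> set_pmf R" for r
  proof -
    have D: "0 \<le> ?D r" by (intro onorm_pos_le bl)
    have "measure_pmf.expectation ?S (\<lambda>s. onorm (rank_one_sum (\<lambda>i. z (r i)) {..<m} s)) \<le>
        2 * sqrt (2 * exp 1 * real p * l * (2 + ?D r))"
    proof (rule rademacher_onorm_le)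
      fix v
      have "(\<Sum>i<m. (inner (z (r i)) v)\<^sup>2) = inner v (Q r one v)"
        by (simp add: Q_def rank_one_sum_def one_def inner_sum_right inner_commute power2_eq_square)
      also have "\<dots> = inner v (Q r one v - M v) + real m / real N * (\<Sum>r<N. (inner (z r) v)\<^sup>2)"
        by (simp add: M_def rank_one_sum_def inner_diff_right inner_sum_right inner_commute
            power2_eq_square sum_distrib_left mult_ac)
      also have "\<dots> \<le> norm v * (?D r * norm v) + 2 * (norm v)\<^sup>2"
        by (intro add_mono form order_trans[OF norm_cauchy_schwarz] mult_left_mono onorm[OF bl(1)]) auto
      finally show "(\<Sum>i<m. (inner (z (r i)) v)\<^sup>2) \<le> (2 + ?D r) * (norm v)\<^sup>2"
        by (simp add: power2_eq_square algebra_simps)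
    next
      have "(\<Sum>i<m. (norm (z (r i)))\<^sup>2) \<le> (\<Sum>i<m. l)"
        using setR r by (intro sum_mono len) auto
      thus "(\<Sum>i<m. (norm (z (r i)))\<^sup>2) \<le> exp (real p)" using total by simp
    qed (use frame len l p setR r D in auto)
    also have "sqrt (2 * exp 1 * real p * l * (2 + ?D r)) = \<kappa> * sqrt (2 + ?D r)"
      by (simp add: \<kappa>_def real_sqrt_mult)
    \<comment> \<open>Replacing the root by its argument, which exceeds one, makes the
      self-referential bound linear: the mean deviation is at most \<open>8 * \<kappa>\<close> plus
      \<open>4 * \<kappa>\<close> times itself, and \<open>\<kappa> \<le> 1 / 8\<close> lets the
      second term be absorbed.\<close>
    also have "\<kappa> * sqrt (2 + ?D r) \<le> \<kappa> * (2 + ?D r)"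
      using kap D by (intro mult_left_mono real_le_lsqrt) (auto simp: power2_eq_square algebra_simps)
    finally show ?thesis by (simp add: Q_def)
  qed
  have diff: "onorm (\<lambda>v. Q r s v - Q r' s v) \<le> onorm (Q r s) + onorm (Q r' s)" for r r' s
    using onorm_triangle[OF blQ bounded_linear_minus[OF blQ], of r s r' s] onorm_neg[of "Q r' s"] by simp
  define \<E> where "\<E> = measure_pmf.expectation R ?D"
  have "\<E> \<le> measure_pmf.expectation R (\<lambda>r. measure_pmf.expectation R
      (\<lambda>r'. onorm (\<lambda>v. Q r one v - Q r' one v)))"
    unfolding \<E>_def by (intro expectation_mono_finite finR sym1)
  also have "\<dots> = measure_pmf.expectation ?S (\<lambda>s. measure_pmf.expectation R (\<lambda>r.
      measure_pmf.expectation R (\<lambda>r'. onorm (\<lambda>v. Q r s v - Q r' s v))))"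
    by (subst expectation_cong_pmf[OF swap[symmetric]]) simp_all
  also have "\<dots> \<le> measure_pmf.expectation ?S (\<lambda>s. measure_pmf.expectation R (\<lambda>r.
      measure_pmf.expectation R (\<lambda>r'. onorm (Q r s) + onorm (Q r' s))))"
    by (intro expectation_mono_finite finR finS diff)
  also have "\<dots> = 2 * measure_pmf.expectation ?S (\<lambda>s. measure_pmf.expectation R (\<lambda>r. onorm (Q r s)))"
    by (simp add: expectation_add_finite finR)
  also have "measure_pmf.expectation ?S (\<lambda>s. measure_pmf.expectation R (\<lambda>r. onorm (Q r s))) =
      measure_pmf.expectation R (\<lambda>r. measure_pmf.expectation ?S (\<lambda>s. onorm (Q r s)))"
    by (rule expectation_swap_finite[OF finS finR])
  also have "\<dots> \<le> measure_pmf.expectation R (\<lambda>r. 2 * \<kappa> * (2 + ?D r))"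
    by (intro expectation_mono_finite finR signs)
  also have "measure_pmf.expectation R (\<lambda>r. 2 * \<kappa> * (2 + ?D r)) = 2 * \<kappa> * (2 + \<E>)"
    by (simp add: expectation_add_finite finR \<E>_def)
  finally have "\<E> \<le> 8 * \<kappa> + (4 * \<kappa>) * \<E>" by (simp add: algebra_simps)
  moreover have "(4 * \<kappa>) * \<E> \<le> 1 / 2 * \<E>"
    using kap unfolding \<E>_def by (intro mult_right_mono integral_nonneg_AE) (auto intro: onorm_pos_le bl)
  ultimately have "\<E> \<le> 16 * \<kappa>" by linarith
  thus ?thesis by (simp only: \<E>_def R_def Q_def M_def one_def \<kappa>_def)
qed

section \<open>Execution of the sketching program\<close>

subsection \<open>Composition rules\<close>

text \<open>The continuation \<open>cs\<close> is quantified so that blocks compose. All random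
  branches take the same number \<open>t\<close> of steps; times are therefore additive, and no
  joint distribution of time and store has to be tracked.\<close>

definition exec :: "nat \<Rightarrow> stmt list \<Rightarrow> store \<Rightarrow> store pmf \<Rightarrow> bool" where
  "exec t c s D \<longleftrightarrow> (\<forall>cs. run t (c @ cs) s = map_pmf (Pair cs) D)"

lemma run_0: "run 0 p s = return_pmf (p, s)"
  by (simp add: run_def)

lemma run_Suc: "run (Suc t) p s = bind_pmf (run t p s) step"
  by (simp add: run_def)

lemma run_add: "run (t1 + t2) p s = bind_pmf (run t1 p s) (\<lambda>(p', s'). run t2 p' s')"
proof (induction t2)
  case 0
  show ?case by (simp add: run_0 bind_return_pmf')
next
  case (Suc t2)
  have "run (t1 + Suc t2) p s = bind_pmf (run (t1 + t2) p s) step" by (simp add: run_Suc)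
  also have "\<dots> = bind_pmf (run t1 p s) (\<lambda>(p', s'). bind_pmf (run t2 p' s') step)"
    by (simp add: Suc bind_assoc_pmf case_prod_unfold)
  finally show ?case by (simp add: run_Suc)
qed

lemma run_Suc_step: "run (Suc t) p s = bind_pmf (step (p, s)) (\<lambda>(p', s'). run t p' s')"
  using run_add[of 1 t p s] by (simp add: run_Suc run_0 bind_return_pmf)

lemma exec_Nil: "exec 0 [] s (return_pmf s)"
  by (simp add: exec_def run_0)

text \<open>Intermediate stores are written as images \<open>S f\<close> of the random data
  \<open>f\<close> drawn so far. The second block is then analysed for each \<open>f\<close>
  separately, and the distributions of the data compose without mention of stores.\<close>

lemma exec_append:
  assumes "exec t1 c1 s (map_pmf S F)" and "\<And>f. f \<in> set_pmf F \<Longrightarrow> exec t2 c2 (S f) (E f)"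
  shows "exec (t1 + t2) (c1 @ c2) s (bind_pmf F E)"
  unfolding exec_def
proof
  fix cs
  have "run (t1 + t2) ((c1 @ c2) @ cs) s = bind_pmf F (\<lambda>f. run t2 (c2 @ cs) (S f))"
    using assms(1) by (simp add: run_add exec_def map_pmf_def bind_assoc_pmf bind_return_pmf)
  also have "\<dots> = bind_pmf F (\<lambda>f. map_pmf (Pair cs) (E f))"
    using assms(2) by (intro bind_pmf_cong refl) (simp add: exec_def)
  finally show "run (t1 + t2) ((c1 @ c2) @ cs) s = map_pmf (Pair cs) (bind_pmf F E)"
    by (simp add: map_bind_pmf)
qed

lemma exec_append_det:
  assumes "exec t1 c1 s (return_pmf s')" and "exec t2 c2 s' E"
  shows "exec (t1 + t2) (c1 @ c2) s E"
  using exec_append[where F = "return_pmf s'" and S = "\<lambda>x. x" and E = "\<lambda>_. E"] assms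
  by (simp add: bind_return_pmf)

lemma exec_ISet:
  assumes "exec t cs (s\<lparr>ivar := (ivar s)(x := ival s e)\<rparr>) D"
  shows "exec (Suc t) (ISet x e # cs) s D"
  using assms by (simp add: exec_def run_Suc_step bind_return_pmf)

lemma exec_IPut:
  assumes "exec t cs (s\<lparr>imem := (imem s)(a := (imem s a)(ival s e := ival s f))\<rparr>) D"
  shows "exec (Suc t) (IPut a e f # cs) s D"
  using assms by (simp add: exec_def run_Suc_step bind_return_pmf)

lemma exec_RPut:
  assumes "exec t cs (s\<lparr>rmem := (rmem s)(a := (rmem s a)(ival s e :=
       (rmem s a (ival s e))(ival s f := rval s r)))\<rparr>) D"
  shows "exec (Suc t) (RPut a e f r # cs) s D"
  using assms by (simp add: exec_def run_Suc_step bind_return_pmf)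

lemma exec_Sample:
  assumes "\<And>v. exec t cs (s\<lparr>ivar := (ivar s)(x := v)\<rparr>) (D v)" and "n = ival s e" and "0 < n"
  shows "exec (Suc t) (Sample x e # cs) s (bind_pmf (pmf_of_set {..<n}) D)"
proof -
  have "max 1 (ival s e) = n" using assms by simp
  thus ?thesis
    using assms by (simp add: exec_def run_Suc_step bind_map_pmf map_bind_pmf)
qed

text \<open>\<open>F k\<close> is the distribution of the data after \<open>k\<close> rounds and
  \<open>H k\<close> the kernel of one round. The time counts one test per round and the final
  failing test.\<close>

lemma exec_Loop:
  assumes body: "\<And>k f. k < K \<Longrightarrow> f \<in> set_pmf (F k) \<Longrightarrow>
      bval (S k f) b \<and> exec t c (S k f) (map_pmf (S (Suc k)) (H k f))"
    and F: "\<And>k. k < K \<Longrightarrow> F (Suc k) = bind_pmf (F k) (H k)"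
    and stop: "\<And>f. f \<in> set_pmf (F K) \<Longrightarrow> \<not> bval (S K f) b"
    and init: "map_pmf (S 0) (F 0) = return_pmf s0"
  shows "exec (K * (t + 1) + 1) [Loop b c] s0 (map_pmf (S K) (F K))"
  unfolding exec_def
proof
  fix cs
  let ?L = "Loop b c # cs"
  have iter: "j \<le> K \<Longrightarrow> run (j * (t + 1)) ?L s0 = map_pmf (Pair ?L) (map_pmf (S j) (F j))" for j
  proof (induction j)
    case 0
    show ?case by (simp add: run_0 init)
  next
    case (Suc j)
    have "Suc j * (t + 1) = j * (t + 1) + Suc t" by simp
    hence "run (Suc j * (t + 1)) ?L s0 = bind_pmf (F j) (\<lambda>f. run (Suc t) ?L (S j f))"
      using Suc by (simp only: run_add) (simp add: bind_map_pmf)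
    also have "\<dots> = bind_pmf (F j) (\<lambda>f. map_pmf (Pair ?L) (map_pmf (S (Suc j)) (H j f)))"
      using body[of j] Suc by (intro bind_pmf_cong refl) (auto simp: run_Suc_step bind_return_pmf exec_def)
    also have "\<dots> = map_pmf (Pair ?L) (map_pmf (S (Suc j)) (F (Suc j)))"
      using F[of j] Suc by (simp add: map_bind_pmf)
    finally show ?case .
  qed
  have "run (K * (t + 1) + 1) ?L s0 = bind_pmf (F K) (\<lambda>f. run 1 ?L (S K f))"
    by (simp only: run_add iter[OF order_refl]) (simp add: bind_map_pmf)
  also have "\<dots> = bind_pmf (F K) (\<lambda>f. return_pmf (cs, S K f))"
    using stop by (intro bind_pmf_cong refl) (simp add: run_Suc run_0 bind_return_pmf)
  finally show "run (K * (t + 1) + 1) ([Loop b c] @ cs) s0 = map_pmf (Pair cs) (map_pmf (S K) (F K))"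
    by (simp add: map_pmf_def bind_assoc_pmf bind_return_pmf)
qed

lemma exec_Loop_det:
  assumes "\<And>k. k < K \<Longrightarrow> bval (st k) b" "\<And>k. k < K \<Longrightarrow> exec t c (st k) (return_pmf (st (Suc k)))"
    and "\<not> bval (st K) b" "s0 = st 0"
  shows "exec (K * (t + 1) + 1) [Loop b c] s0 (return_pmf (st K))"
  using exec_Loop[of K "\<lambda>_. return_pmf ()" "\<lambda>k _. st k" b t c "\<lambda>_ _. return_pmf ()" s0] assms
  by (simp add: bind_return_pmf)

lemma run_after_halt: "run t [] s = return_pmf ([], s)"
  by (induction t) (simp_all add: run_0 run_Suc bind_return_pmf)

lemma exec_halts:
  assumes "exec t c s D" and "t \<le> T"
  shows "run T c s = map_pmf (Pair []) D"
proof -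
  obtain u where T: "T = t + u" using assms(2) le_Suc_ex by blast
  have "run t c s = map_pmf (Pair []) D" using assms(1) unfolding exec_def by (metis append_Nil2)
  thus ?thesis by (simp add: T run_add bind_map_pmf run_after_halt map_pmf_def bind_assoc_pmf bind_return_pmf)
qed

subsection \<open>The Walsh--Hadamard sign matrix\<close>

definition wh_sign :: "nat \<Rightarrow> nat \<Rightarrow> real" where
  "wh_sign i j = (-1) ^ card {b. bit i b \<and> bit j b}"

lemma finite_common_bits: "finite {b. bit (i :: nat) b \<and> bit j b}"
proof (rule finite_subset)
  show "{b. bit i b \<and> bit j b} \<subseteq> {..i}"
  proof clarsimp
    fix b assume "bit i b"
    hence "2 ^ b \<le> i" by (metis bit_nat_def div_less even_zero not_less)
    moreover have "b < 2 ^ b" by (rule less_exp)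
    ultimately show "b \<le> i" by linarith
  qed
qed simp

lemma wh_sign_rec: "wh_sign i j = (if odd i \<and> odd j then -1 else 1) * wh_sign (i div 2) (j div 2)"
proof -
  let ?B = "{b. bit (i div 2) b \<and> bit (j div 2) b}"
  have "{b. bit i b \<and> bit j b} = (if odd i \<and> odd j then {0} else {}) \<union> Suc ` ?B"
  proof (intro Set.set_eqI iffI)
    fix b assume "b \<in> {b. bit i b \<and> bit j b}"
    thus "b \<in> (if odd i \<and> odd j then {0} else {}) \<union> Suc ` ?B"
      by (cases b) (auto simp: bit_Suc bit_0)
  next
    fix b assume "b \<in> (if odd i \<and> odd j then {0} else {}) \<union> Suc ` ?B"
    thus "b \<in> {b. bit i b \<and> bit j b}"
      by (auto simp: bit_Suc bit_0 split: if_splits)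
  qed
  moreover have "card (Suc ` ?B) = card ?B" by (simp add: card_image)
  ultimately show ?thesis
    by (auto simp: wh_sign_def card_insert_if finite_common_bits)
qed

lemma wh_sign_double:
  assumes "s < 2" "e < 2"
  shows "wh_sign (2 * i + s) (2 * j + e) = (if s = 1 \<and> e = 1 then -1 else 1) * wh_sign i j"
  using assms by (subst wh_sign_rec) (auto simp: less_2_cases_iff)

lemma wh_sign_0: "wh_sign 0 j = 1" "wh_sign i 0 = 1"
  by (simp_all add: wh_sign_def)

lemma wh_sign_square: "wh_sign i j * wh_sign i j = 1"
  by (simp add: wh_sign_def flip: power_mult_distrib)

text \<open>\<open>wh_sign_rec\<close> peels the lowest bits, whereas a level of the fast transform
  fixes the top bit of the output position by the half that it writes to. This is the recursion from
  the top.\<close>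

lemma wh_sign_high_bit:
  assumes "a < 2 ^ t" "c < 2 ^ t" "s < 2" "e < 2"
  shows "wh_sign (s * 2 ^ t + a) (e * 2 ^ t + c) = (if s = 1 \<and> e = 1 then -1 else 1) * wh_sign a c"
  using assms(1,2)
proof (induction t arbitrary: a c)
  case 0
  thus ?case using wh_sign_double[OF assms(3,4), of 0 0] by (simp add: wh_sign_0)
next
  case (Suc t)
  have a: "s * 2 ^ Suc t + a = 2 * (s * 2 ^ t + a div 2) + a mod 2" and
    c: "e * 2 ^ Suc t + c = 2 * (e * 2 ^ t + c div 2) + c mod 2" by simp_all
  have "wh_sign (s * 2 ^ Suc t + a) (e * 2 ^ Suc t + c) =
      (if a mod 2 = 1 \<and> c mod 2 = 1 then -1 else 1) * ((if s = 1 \<and> e = 1 then -1 else 1) * wh_sign (a div 2) (c div 2))"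
    unfolding a c using Suc by (subst wh_sign_double) auto
  also have "\<dots> = (if s = 1 \<and> e = 1 then -1 else 1) * wh_sign a c"
    by (subst (2) wh_sign_rec) (simp add: odd_iff_mod_2_eq_one)
  finally show ?case .
qed

lemma sum_double_split: "(\<Sum>i<2 * n. f i) = (\<Sum>i<n. f (2 * i) + f (2 * i + 1))"
  for f :: "nat \<Rightarrow> real"
  by (induction n) (simp_all add: algebra_simps)

lemma wh_sign_orthogonal:
  assumes "i < 2 ^ q" "j < 2 ^ q"
  shows "(\<Sum>r<2 ^ q. wh_sign r i * wh_sign r j) = (if i = j then 2 ^ q else 0)"
  using assms
proof (induction q arbitrary: i j)
  case 0
  thus ?case by (simp add: wh_sign_0)
next
  case (Suc q)
  have rec: "wh_sign (2 * r) k = wh_sign r (k div 2)"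
    "wh_sign (2 * r + 1) k = (if odd k then -1 else 1) * wh_sign r (k div 2)" for r k
    using wh_sign_rec[of "2 * r" k] wh_sign_rec[of "2 * r + 1" k] by simp_all
  \<comment> \<open>Rows \<open>2 * r\<close> and \<open>2 * r + 1\<close> differ only by the signs
    of the odd columns, so their contributions cancel unless \<open>i\<close> and \<open>j\<close>
    have the same parity.\<close>
  have "wh_sign (2 * r) i * wh_sign (2 * r) j + wh_sign (2 * r + 1) i * wh_sign (2 * r + 1) j =
      (if odd i = odd j then 2 else 0) * (wh_sign r (i div 2) * wh_sign r (j div 2))" for r
    unfolding rec by auto
  hence "(\<Sum>r<2 ^ Suc q. wh_sign r i * wh_sign r j) =
      (if odd i = odd j then 2 else 0) * (\<Sum>r<2 ^ q. wh_sign r (i div 2) * wh_sign r (j div 2))"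
    unfolding power_Suc sum_double_split by (simp only: sum_distrib_left)
  also have "\<dots> = (if odd i = odd j then 2 else 0) * (if i div 2 = j div 2 then 2 ^ q else 0)"
    using Suc.prems Suc.IH[of "i div 2" "j div 2"] by (simp add: less_mult_imp_div_less)
  also have "\<dots> = (if i = j then 2 ^ Suc q else 0)"
    unfolding bit_eq_rec[of i j] by auto
  finally show ?case .
qed

text \<open>Constant-geometry fast transform: every level reads adjacent pairs and writes the two halves.\<close>

fun fwht_level :: "nat \<Rightarrow> (nat \<Rightarrow> real) \<Rightarrow> nat \<Rightarrow> nat \<Rightarrow> real" where
  "fwht_level h v 0 i = v i"
| "fwht_level h v (Suc t) i =
    (if i < h then fwht_level h v t (2 * i) + fwht_level h v t (2 * i + 1)
     else fwht_level h v t (2 * (i - h)) - fwht_level h v t (2 * (i - h) + 1))"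

text \<open>Level invariant: read a position as coefficient \<open>a\<close> of the transform of
  length \<open>2 ^ t\<close> of input block \<open>b\<close>. One more level merges blocks
  \<open>2 * b\<close> and \<open>2 * b + 1\<close>, and the half it writes to becomes the new top
  bit of \<open>a\<close>.\<close>

lemma fwht_level_eq:
  assumes "t \<le> Suc q" "a < 2 ^ t" "b < 2 ^ (Suc q - t)"
  shows "fwht_level (2 ^ q) v t (a * 2 ^ (Suc q - t) + b) =
    (\<Sum>c<2 ^ t. wh_sign a c * v (b * 2 ^ t + c))"
  using assms
proof (induction t arbitrary: a b)
  case 0
  thus ?case by (simp add: wh_sign_0)
next
  case (Suc t)
  define s a' where "s = a div 2 ^ t" and "a' = a mod 2 ^ t"
  have a: "a = s * 2 ^ t + a'" unfolding s_def a'_def by (rule div_mult_mod_eq[symmetric])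
  have s: "s < 2" using Suc.prems unfolding s_def by (simp add: less_mult_imp_div_less)
  have a': "a' < 2 ^ t" by (simp add: a'_def)
  have exps: "Suc q - t = Suc (Suc q - Suc t)" "q = t + (Suc q - Suc t)" using Suc.prems by simp_all
  define u where "u = Suc q - Suc t"
  have q: "q = t + u" and qt: "Suc q - t = Suc u" using exps by (simp_all add: u_def)
  have b: "b < 2 ^ u" using Suc.prems by (simp add: u_def)
  have lt: "a' * 2 ^ u + b < 2 ^ q"
  proof -
    have "a' * 2 ^ u + b < (a' + 1) * 2 ^ u" using b by simp
    also have "\<dots> \<le> 2 ^ t * 2 ^ u" using a' by (intro mult_right_mono) auto
    finally show ?thesis by (simp add: q power_add)
  qed
  have idx: "a * 2 ^ u + b = s * 2 ^ q + (a' * 2 ^ u + b)"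
    by (simp add: a q power_add algebra_simps)
  have IH: "fwht_level (2 ^ q) v t (2 * (a' * 2 ^ u + b) + e) =
      (\<Sum>c<2 ^ t. wh_sign a' c * v (b * 2 ^ Suc t + (e * 2 ^ t + c)))" if "e < 2" for e
  proof -
    have i: "2 * (a' * 2 ^ u + b) + e = a' * 2 ^ (Suc q - t) + (2 * b + e)" by (simp add: qt)
    have "2 * b + e < 2 ^ (Suc q - t)" using that b by (simp add: qt)
    thus ?thesis
      unfolding i using Suc.IH[of a' "2 * b + e"] Suc.prems a' by (simp add: algebra_simps)
  qed
  have split: "(\<Sum>c<2 ^ Suc t. f c) = (\<Sum>c<2 ^ t. f c) + (\<Sum>c<2 ^ t. f (2 ^ t + c))" for f :: "nat \<Rightarrow> real"
  proof -
    have "(\<Sum>c<2 ^ t + 2 ^ t. f c) = (\<Sum>c<2 ^ t. f c) + (\<Sum>c<2 ^ t. f (2 ^ t + c))"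
      by (simp add: lessThan_atLeast0 sum.atLeastLessThan_concat[of 0 "2 ^ t" "2 ^ t + 2 ^ t", symmetric]
          sum.shift_bounds_nat_ivl[of f 0 "2 ^ t" "2 ^ t", simplified] add.commute)
    thus ?thesis by (simp add: mult_2)
  qed
  have sg0: "wh_sign a c = wh_sign a' c" if "c < 2 ^ t" for c
    using wh_sign_high_bit[OF a' that s, of 0] by (simp add: a)
  have sg1: "wh_sign a (2 ^ t + c) = (if s = 1 then -1 else 1) * wh_sign a' c" if "c < 2 ^ t" for c
    using wh_sign_high_bit[OF a' that s, of 1] by (simp add: a)
  have "fwht_level (2 ^ q) v (Suc t) (a * 2 ^ u + b) =
      fwht_level (2 ^ q) v t (2 * (a' * 2 ^ u + b) + 0) +
      (if s = 1 then -1 else 1) * fwht_level (2 ^ q) v t (2 * (a' * 2 ^ u + b) + 1)"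
    unfolding idx using s lt by (auto simp: less_2_cases_iff)
  also have "\<dots> = (\<Sum>c<2 ^ t. wh_sign a' c * v (b * 2 ^ Suc t + c)) +
      (\<Sum>c<2 ^ t. (if s = 1 then -1 else 1) * wh_sign a' c * v (b * 2 ^ Suc t + (2 ^ t + c)))"
    using IH[of 0] IH[of 1] by (simp add: sum_distrib_left mult.assoc)
  also have "\<dots> = (\<Sum>c<2 ^ Suc t. wh_sign a c * v (b * 2 ^ Suc t + c))"
    unfolding split by (intro arg_cong2[where f = "(+)"] sum.cong refl) (simp_all add: sg0 sg1)
  finally show ?case by (simp add: u_def)
qed

lemma fwht_level_full:
  assumes "i < 2 ^ q"
  shows "fwht_level (2 ^ (q - 1)) v q i = (\<Sum>j<2 ^ q. wh_sign i j * v j)"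
proof (cases q)
  case 0
  thus ?thesis using assms by (simp add: wh_sign_0)
next
  case (Suc q')
  thus ?thesis using fwht_level_eq[of q q' i 0 v] assms by simp
qed

subsection \<open>The program\<close>

definition incr :: "string \<Rightarrow> stmt" where
  "incr x = ISet x (IAdd (IVar x) (IConst 1))"

definition sign_exp :: "iexp \<Rightarrow> rexp" where
  "sign_exp e = RSub (ROfInt (IAdd e e)) (ROfInt (IConst 1))"

text \<open>A row with several nonzero entries is drawn again at each of them and the last draw
  stands. This avoids a test for rows already seen, and by \<open>Pi_pmf_resample\<close> the
  distribution is the same. The scratch variable is cleared so that the store depends on the tables
  and the counter alone.\<close>

definition bucket_body :: "string \<Rightarrow> stmt list" where
  "bucket_body rw =
    [Sample ''x'' (IVar ''m1''), IPut ''h'' (IGet rw (IVar ''k'')) (IVar ''x''),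
     Sample ''x'' (IConst 2), IPut ''s'' (IGet rw (IVar ''k'')) (IVar ''x''),
     ISet ''x'' (IConst 0), incr ''k'']"

definition bucket_prog :: "string \<Rightarrow> string \<Rightarrow> stmt list" where
  "bucket_prog nz rw =
    [Loop (ILess (IVar ''k'') (IVar nz)) (bucket_body rw), ISet ''k'' (IConst 0)]"

definition draw_prog :: "string \<Rightarrow> string \<Rightarrow> iexp \<Rightarrow> stmt list" where
  "draw_prog arr cnt e =
    [Loop (ILess (IVar ''k'') (IVar cnt))
       [Sample ''x'' e, IPut arr (IVar ''k'') (IVar ''x''), ISet ''x'' (IConst 0), incr ''k''],
     ISet ''k'' (IConst 0)]"

text \<open>The machine has no integer division, and counting up costs time linear in
  \<open>m1\<close>. For \<open>m1 = 1\<close> the result is 1, matching \<open>2 ^ (q - 1)\<close>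
  at \<open>q = 0\<close>.\<close>

definition half_prog :: "stmt list" where
  "half_prog =
    [Loop (ILess (IAdd (IVar ''half'') (IVar ''half'')) (IVar ''m1'')) [incr ''half''],
     ISet ''len'' (IConst 1)]"

text \<open>The bucket sign \<open>g\<close> belongs to the diagonal matrix of the second stage;
  multiplying it in here saves a pass over the buckets.\<close>

definition accumulate_prog :: "string \<Rightarrow> string \<Rightarrow> string \<Rightarrow> string \<Rightarrow> string \<Rightarrow> stmt list" where
  "accumulate_prog nz rw cl val w =
    (let r = IGet rw (IVar ''k''); h = IGet ''h'' r; c = IGet cl (IVar ''k'') in
    [Loop (ILess (IVar ''k'') (IVar nz))
       [RPut w h c (RAdd (RGet w h c)
          (RMul (RMul (sign_exp (IGet ''g'' h)) (sign_exp (IGet ''s'' r))) (RGet val (IVar ''k'') (IConst 0)))),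
        incr ''k''],
     ISet ''k'' (IConst 0)])"

text \<open>Constant geometry is not in place: a level reads the block of \<open>m1\<close> rows at
  offset \<open>b\<close> and writes the block after it.\<close>

definition butterfly_body :: "string \<Rightarrow> stmt list" where
  "butterfly_body w =
    (let c = IVar ''c''; b = IVar ''b''; i = IVar ''i''; j = IAdd b (IAdd i i);
         x = RGet w j c; y = RGet w (IAdd j (IConst 1)) c; t = IAdd b (IAdd (IVar ''m1'') i) in
    [RPut w t c (RAdd x y), RPut w (IAdd t (IVar ''half'')) c (RSub x y), incr ''i''])"

definition level_body :: "string \<Rightarrow> stmt list" where
  "level_body w =
    [Loop (ILess (IAdd (IVar ''i'') (IVar ''i'')) (IVar ''m1'')) (butterfly_body w),
     ISet ''i'' (IConst 0), ISet ''b'' (IAdd (IVar ''b'') (IVar ''m1'')),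
     ISet ''len'' (IAdd (IVar ''len'') (IVar ''len''))]"

text \<open>The scale \<open>sqrt (N / m)\<close> of the SRHT and the normalization
  \<open>1 / sqrt N\<close> of the transform combine to \<open>1 / sqrt m2\<close>.\<close>

definition sample_rows_body :: "string \<Rightarrow> string \<Rightarrow> stmt list" where
  "sample_rows_body w out =
    [RPut out (IVar ''k'') (IVar ''c'')
       (RDiv (RGet w (IAdd (IVar ''b'') (IGet ''r'' (IVar ''k''))) (IVar ''c'')) (RSqrt (ROfInt (IVar ''m2'')))),
     incr ''k'']"

definition column_body :: "string \<Rightarrow> string \<Rightarrow> stmt list" where
  "column_body w out =
    [Loop (ILess (IVar ''len'') (IVar ''m1'')) (level_body w),
     Loop (ILess (IVar ''k'') (IVar ''m2'')) (sample_rows_body w out),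
     ISet ''k'' (IConst 0), ISet ''b'' (IConst 0), ISet ''len'' (IConst 1), incr ''c'']"

definition transform_prog :: "string \<Rightarrow> string \<Rightarrow> string \<Rightarrow> stmt list" where
  "transform_prog n w out =
    [Loop (ILess (IVar ''c'') (IVar n)) (column_body w out), ISet ''c'' (IConst 0)]"

definition sketch_prog :: "stmt list" where
  "sketch_prog =
    bucket_prog ''nnzA'' ''rowA'' @ bucket_prog ''nnzB'' ''rowB'' @
    draw_prog ''g'' ''m1'' (IConst 2) @ draw_prog ''r'' ''m2'' (IVar ''m1'') @ half_prog @
    accumulate_prog ''nnzA'' ''rowA'' ''colA'' ''valA'' ''wA'' @
    accumulate_prog ''nnzB'' ''rowB'' ''colB'' ''valB'' ''wB'' @
    transform_prog ''dA'' ''wA'' ''outA'' @ transform_prog ''dB'' ''wB'' ''outB''"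

subsection \<open>The sampling phase\<close>

text \<open>Inside \<open>A\<close> a coordinate is overwritten by an independent fresh copy,
  outside \<open>A\<close> a new factor joins; both leave a product distribution. This is why
  hashing a row repeatedly is harmless.\<close>

lemma Pi_pmf_resample:
  assumes "finite A"
  shows "bind_pmf (Pi_pmf A d (\<lambda>_. q)) (\<lambda>f. map_pmf (\<lambda>v. f(a := v)) q) = Pi_pmf (insert a A) d (\<lambda>_. q)"
proof -
  have new: "bind_pmf (Pi_pmf B d (\<lambda>_. q)) (\<lambda>f. map_pmf (\<lambda>v. f(a := v)) q) = Pi_pmf (insert a B) d (\<lambda>_. q)"
    if "finite B" "a \<notin> B" for B
    using that
    by (subst Pi_pmf_insert') (auto simp: map_pmf_def intro: bind_commute_pmf)
  show ?thesis
  proof (cases "a \<in> A")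
    case True
    define B where "B = A - {a}"
    have B: "A = insert a B" "a \<notin> B" "finite B" using True assms by (auto simp: B_def)
    have "bind_pmf (Pi_pmf A d (\<lambda>_. q)) (\<lambda>f. map_pmf (\<lambda>v. f(a := v)) q) =
        bind_pmf (Pi_pmf B d (\<lambda>_. q)) (\<lambda>f. bind_pmf q (\<lambda>_. map_pmf (\<lambda>v. f(a := v)) q))"
    proof -
      have "fun_upd (f(a := u)) a = fun_upd f a" for f :: "'a \<Rightarrow> 'b" and u by (rule ext) simp
      thus ?thesis
        unfolding B(1) new[OF B(3,2), symmetric] by (simp add: bind_assoc_pmf bind_map_pmf)
    qed
    also have "\<dots> = Pi_pmf (insert a A) d (\<lambda>_. q)" using new[OF B(3,2)] by (simp add: B(1))
    finally show ?thesis .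
  qed (use new assms in simp)
qed

definition with_buckets :: "store \<Rightarrow> (nat \<Rightarrow> nat \<times> nat) \<Rightarrow> store" where
  "with_buckets s f = s\<lparr>imem := (imem s)(''h'' := fst \<circ> f, ''s'' := snd \<circ> f)\<rparr>"

definition with_array :: "store \<Rightarrow> string \<Rightarrow> (nat \<Rightarrow> nat) \<Rightarrow> store" where
  "with_array s a f = s\<lparr>imem := (imem s)(a := f)\<rparr>"

definition with_ivar :: "store \<Rightarrow> string \<Rightarrow> nat \<Rightarrow> store" where
  "with_ivar s x v = s\<lparr>ivar := (ivar s)(x := v)\<rparr>"

definition bucket_pmf :: "nat \<Rightarrow> (nat \<times> nat) pmf" where
  "bucket_pmf m = pair_pmf (pmf_of_set {..<m}) (pmf_of_set {..<2})"

lemma with_ivar_same: "ivar s x = v \<Longrightarrow> with_ivar s x v = s"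
  by (simp add: with_ivar_def fun_upd_idem)

text \<open>The pass over the second matrix starts from the tables left by the first, so the result
  is a kernel \<open>E\<close> from old to new tables. It takes a closed form once composed with the
  product distribution on the set \<open>A\<close> of rows hashed before.\<close>

lemma exec_bucket_prog:
  assumes k: "ivar s ''k'' = 0" and x: "ivar s ''x'' = 0" and m: "ivar s ''m1'' = m" "0 < m"
    and K: "ivar s nz = K" and nz: "nz \<noteq> ''k''" "nz \<noteq> ''x''" and rw: "rw \<noteq> ''h''" "rw \<noteq> ''s''"
    and fin: "finite A"
  shows "\<exists>E. (\<forall>f. exec (7 * K + 2) (bucket_prog nz rw) (with_buckets s f) (map_pmf (with_buckets s) (E f))) \<and>
    bind_pmf (Pi_pmf A (0, 0) (\<lambda>_. bucket_pmf m)) E =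
      Pi_pmf (imem s rw ` {..<K} \<union> A) (0, 0) (\<lambda>_. bucket_pmf m)"
proof -
  let ?q = "bucket_pmf m" and ?rw = "imem s rw"
  define E where "E = rec_nat return_pmf (\<lambda>k E f. bind_pmf (E f) (\<lambda>f. map_pmf (\<lambda>v. f(?rw k := v)) ?q))"
  have E0: "E 0 f = return_pmf f" and ESuc: "E (Suc k) f = bind_pmf (E k f) (\<lambda>f. map_pmf (\<lambda>v. f(?rw k := v)) ?q)"
    for k f by (simp_all add: E_def)
  let ?st = "\<lambda>k f. with_ivar (with_buckets s f) ''k'' k"
  have body: "exec 6 (bucket_body rw) (?st k f) (map_pmf (?st (Suc k)) (map_pmf (\<lambda>v. f(?rw k := v)) ?q))" for k f
  proof -
    have eq: "map_pmf (?st (Suc k)) (map_pmf (\<lambda>v. f(?rw k := v)) ?q) =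
      bind_pmf (pmf_of_set {..<m}) (\<lambda>v1. bind_pmf (pmf_of_set {..<2}) (\<lambda>v2.
        return_pmf (?st (Suc k) (f(?rw k := (v1, v2))))))"
      by (simp add: bucket_pmf_def pair_pmf_def map_pmf_def bind_assoc_pmf bind_return_pmf)
    have upd: "fst \<circ> f(?rw k := (v1, v2)) = (fst \<circ> f)(?rw k := v1)"
      "snd \<circ> f(?rw k := (v1, v2)) = (snd \<circ> f)(?rw k := v2)" for v1 v2 by auto
    have "exec (Suc (Suc (Suc (Suc (Suc (Suc 0)))))) (bucket_body rw) (?st k f)
      (bind_pmf (pmf_of_set {..<m}) (\<lambda>v1. bind_pmf (pmf_of_set {..<2}) (\<lambda>v2.
        return_pmf (?st (Suc k) (f(?rw k := (v1, v2)))))))"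
      unfolding bucket_body_def incr_def
    proof (rule exec_Sample, rule exec_IPut, rule exec_Sample, rule exec_IPut, rule exec_ISet, rule exec_ISet)
      fix v1 v2
      let ?s1 = "(?st k f)\<lparr>ivar := (ivar (?st k f))(''x'' := v1)\<rparr>"
      let ?s2 = "?s1\<lparr>imem := (imem ?s1)(''h'' := (imem ?s1 ''h'')
        (ival ?s1 (IGet rw (IVar ''k'')) := ival ?s1 (IVar ''x'')))\<rparr>"
      let ?s3 = "?s2\<lparr>ivar := (ivar ?s2)(''x'' := v2)\<rparr>"
      let ?s4 = "?s3\<lparr>imem := (imem ?s3)(''s'' := (imem ?s3 ''s'')
        (ival ?s3 (IGet rw (IVar ''k'')) := ival ?s3 (IVar ''x'')))\<rparr>"
      let ?s5 = "?s4\<lparr>ivar := (ivar ?s4)(''x'' := ival ?s4 (IConst 0))\<rparr>"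
      let ?s6 = "?s5\<lparr>ivar := (ivar ?s5)(''k'' := ival ?s5 (IAdd (IVar ''k'') (IConst 1)))\<rparr>"
      have "?s6 = ?st (Suc k) (f(?rw k := (v1, v2)))"
        unfolding upd with_ivar_def with_buckets_def
        using rw x by (intro store.equality) (auto simp: fun_eq_iff)
      thus "exec 0 [] ?s6 (return_pmf (?st (Suc k) (f(?rw k := (v1, v2)))))"
        using exec_Nil[of ?s6] by simp
    qed (use m in \<open>auto simp: with_ivar_def with_buckets_def\<close>)
    thus ?thesis unfolding eq by (simp add: eval_nat_numeral)
  qed
  have run: "exec (7 * K + 2) (bucket_prog nz rw) (with_buckets s f) (map_pmf (with_buckets s) (E K f))" for f
  proof -
    have "exec (K * (6 + 1) + 1) [Loop (ILess (IVar ''k'') (IVar nz)) (bucket_body rw)] (with_buckets s f)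
      (map_pmf (?st K) (E K f))"
    proof (rule exec_Loop[where F = "\<lambda>k. E k f" and S = ?st])
      fix k g
      assume "k < K"
      thus "bval (?st k g) (ILess (IVar ''k'') (IVar nz)) \<and>
          exec 6 (bucket_body rw) (?st k g) (map_pmf (?st (Suc k)) (map_pmf (\<lambda>v. g(?rw k := v)) ?q))"
        using body[where k = k and f = g] nz K by (simp add: with_ivar_def with_buckets_def)
    next
      fix g
      show "\<not> bval (?st K g) (ILess (IVar ''k'') (IVar nz))"
        using nz K by (simp add: with_ivar_def with_buckets_def)
    next
      have "?st 0 f = with_buckets s f" using k by (intro with_ivar_same) (simp add: with_buckets_def)
      thus "map_pmf (?st 0) (E 0 f) = return_pmf (with_buckets s f)" by (simp add: E0)
    qed (simp add: ESuc)
    from exec_append[OF this, of 1 "[ISet ''k'' (IConst 0)]" "\<lambda>f. return_pmf (with_buckets s f)"]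
    have "exec (K * (6 + 1) + 1 + 1) (bucket_prog nz rw) (with_buckets s f) (bind_pmf (E K f) (\<lambda>f. return_pmf (with_buckets s f)))"
    proof -
      have "exec 1 [ISet ''k'' (IConst 0)] (?st K f) (return_pmf (with_buckets s f))" for f
      proof -
        have "(?st K f)\<lparr>ivar := (ivar (?st K f))(''k'' := ival (?st K f) (IConst 0))\<rparr> = with_buckets s f"
          using k by (intro store.equality) (auto simp: with_ivar_def with_buckets_def)
        moreover have "exec (Suc 0) [ISet ''k'' (IConst 0)] (?st K f)
            (return_pmf ((?st K f)\<lparr>ivar := (ivar (?st K f))(''k'' := ival (?st K f) (IConst 0))\<rparr>))"
          by (intro exec_ISet exec_Nil)
        ultimately show ?thesis by simp
      qed
      thus ?thesis
        using \<open>(\<And>g. g \<in> set_pmf (E K f) \<Longrightarrow> exec 1 _ (?st K g) _) \<Longrightarrow> _\<close>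
        by (simp add: bucket_prog_def)
    qed
    thus ?thesis by (simp add: map_pmf_def mult.commute)
  qed
  have dist: "bind_pmf (Pi_pmf A (0, 0) (\<lambda>_. ?q)) (E k) = Pi_pmf (?rw ` {..<k} \<union> A) (0, 0) (\<lambda>_. ?q)" for k
  proof (induction k)
    case 0
    have "E 0 = return_pmf" by (simp add: E_def)
    thus ?case by (simp add: bind_return_pmf')
  next
    case (Suc k)
    have "bind_pmf (Pi_pmf A (0, 0) (\<lambda>_. ?q)) (E (Suc k)) =
      bind_pmf (bind_pmf (Pi_pmf A (0, 0) (\<lambda>_. ?q)) (E k)) (\<lambda>f. map_pmf (\<lambda>v. f(?rw k := v)) ?q)"
      by (simp add: ESuc[abs_def] bind_assoc_pmf)
    also have "\<dots> = Pi_pmf (insert (?rw k) (?rw ` {..<k} \<union> A)) (0, 0) (\<lambda>_. ?q)"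
      unfolding Suc using fin by (intro Pi_pmf_resample) auto
    finally show ?case by (simp add: lessThan_Suc)
  qed
  show ?thesis using run dist by blast
qed

lemma exec_draw_prog:
  assumes k: "ivar s ''k'' = 0" and x: "ivar s ''x'' = 0"
    and m: "\<And>u v f. ival (with_ivar (with_array s arr f) ''k'' u) e = m" "0 < m"
    and K: "ivar s cnt = K" and cnt: "cnt \<noteq> ''k''" and init: "imem s arr = (\<lambda>_. 0)"
  shows "exec (5 * K + 2) (draw_prog arr cnt e) s
    (map_pmf (with_array s arr) (Pi_pmf {..<K} 0 (\<lambda>_. pmf_of_set {..<m})))"
proof -
  let ?q = "pmf_of_set {..<m}"
  let ?st = "\<lambda>k f. with_ivar (with_array s arr f) ''k'' k"
  let ?F = "\<lambda>k. Pi_pmf {..<k} 0 (\<lambda>_. ?q)"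
  let ?body = "[Sample ''x'' e, IPut arr (IVar ''k'') (IVar ''x''), ISet ''x'' (IConst 0), incr ''k'']"
  have body: "exec 4 ?body (?st k f) (map_pmf (?st (Suc k)) (map_pmf (\<lambda>v. f(k := v)) ?q))" for k f
  proof -
    have "exec (Suc (Suc (Suc (Suc 0)))) ?body (?st k f)
      (bind_pmf ?q (\<lambda>v. return_pmf (?st (Suc k) (f(k := v)))))"
      unfolding incr_def
    proof (rule exec_Sample, rule exec_IPut, rule exec_ISet, rule exec_ISet)
      fix v
      let ?s1 = "(?st k f)\<lparr>ivar := (ivar (?st k f))(''x'' := v)\<rparr>"
      let ?s2 = "?s1\<lparr>imem := (imem ?s1)(arr := (imem ?s1 arr)
        (ival ?s1 (IVar ''k'') := ival ?s1 (IVar ''x'')))\<rparr>"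
      let ?s5 = "?s2\<lparr>ivar := (ivar ?s2)(''x'' := ival ?s2 (IConst 0))\<rparr>"
      let ?s6 = "?s5\<lparr>ivar := (ivar ?s5)(''k'' := ival ?s5 (IAdd (IVar ''k'') (IConst 1)))\<rparr>"
      have "?s6 = ?st (Suc k) (f(k := v))"
        unfolding with_ivar_def with_array_def
        using x by (intro store.equality) (auto simp: fun_eq_iff)
      thus "exec 0 [] ?s6 (return_pmf (?st (Suc k) (f(k := v))))"
        using exec_Nil[of ?s6] by simp
    qed (use m in auto)
    thus ?thesis by (simp add: eval_nat_numeral map_pmf_def bind_assoc_pmf bind_return_pmf)
  qed
  have loop: "exec (K * (4 + 1) + 1) [Loop (ILess (IVar ''k'') (IVar cnt)) ?body] s (map_pmf (?st K) (?F K))"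
  proof (rule exec_Loop[where H = "\<lambda>k f. map_pmf (\<lambda>v. f(k := v)) ?q"])
    fix k f
    assume "k < K"
    thus "bval (?st k f) (ILess (IVar ''k'') (IVar cnt)) \<and>
        exec 4 ?body (?st k f) (map_pmf (?st (Suc k)) (map_pmf (\<lambda>v. f(k := v)) ?q))"
      using body cnt K by (simp add: with_ivar_def with_array_def)
  next
    fix k
    show "?F (Suc k) = bind_pmf (?F k) (\<lambda>f. map_pmf (\<lambda>v. f(k := v)) ?q)"
      by (simp add: lessThan_Suc Pi_pmf_resample)
  next
    fix f
    show "\<not> bval (?st K f) (ILess (IVar ''k'') (IVar cnt))"
      using cnt K by (simp add: with_ivar_def with_array_def)
  next
    have "?st 0 (\<lambda>_. 0) = s" using k init
      by (intro store.equality) (auto simp: with_ivar_def with_array_def fun_eq_iff)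
    thus "map_pmf (?st 0) (?F 0) = return_pmf s" by simp
  qed
  have reset: "exec 1 [ISet ''k'' (IConst 0)] (?st K f) (return_pmf (with_array s arr f))" for f
  proof -
    have "(?st K f)\<lparr>ivar := (ivar (?st K f))(''k'' := ival (?st K f) (IConst 0))\<rparr> = with_array s arr f"
      using k by (intro store.equality) (auto simp: with_ivar_def with_array_def)
    moreover have "exec (Suc 0) [ISet ''k'' (IConst 0)] (?st K f)
        (return_pmf ((?st K f)\<lparr>ivar := (ivar (?st K f))(''k'' := ival (?st K f) (IConst 0))\<rparr>))"
      by (intro exec_ISet exec_Nil)
    ultimately show ?thesis by simp
  qed
  have "exec (K * (4 + 1) + 1 + 1) (draw_prog arr cnt e) s (bind_pmf (?F K) (\<lambda>f. return_pmf (with_array s arr f)))"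
    unfolding draw_prog_def using exec_append[OF loop reset] by simp
  thus ?thesis by (simp add: map_pmf_def mult.commute)
qed

subsection \<open>The arithmetic phase\<close>

definition with_matrix :: "store \<Rightarrow> string \<Rightarrow> (nat \<Rightarrow> nat \<Rightarrow> real) \<Rightarrow> store" where
  "with_matrix s a X = s\<lparr>rmem := (rmem s)(a := X)\<rparr>"

lemmas with_defs = with_ivar_def with_matrix_def with_array_def with_buckets_def

lemma exec_half_prog:
  assumes "ivar s ''half'' = 0" and "ivar s ''m1'' = 2 ^ q"
  shows "exec (2 * 2 ^ (q - 1) + 2) half_prog s
    (return_pmf (with_ivar (with_ivar s ''half'' (2 ^ (q - 1))) ''len'' 1))"
proof -
  let ?st = "\<lambda>k. with_ivar s ''half'' k"
  have bound: "2 * k < (2 :: nat) ^ q" if "k < 2 ^ (q - 1)" for k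
    using that by (cases q) auto
  have bound': "\<not> 2 * (2 :: nat) ^ (q - 1) < 2 ^ q" by (cases q) auto
  have loop: "exec (2 ^ (q - 1) * (1 + 1) + 1)
      [Loop (ILess (IAdd (IVar ''half'') (IVar ''half'')) (IVar ''m1'')) [incr ''half'']] s
      (return_pmf (?st (2 ^ (q - 1))))"
  proof (rule exec_Loop_det[where st = ?st])
    fix k
    have "(?st k)\<lparr>ivar := (ivar (?st k))(''half'' := ival (?st k) (IAdd (IVar ''half'') (IConst 1)))\<rparr> = ?st (Suc k)"
      by (simp add: with_defs)
    thus "exec 1 [incr ''half''] (?st k) (return_pmf (?st (Suc k)))"
      unfolding incr_def One_nat_def by (intro exec_ISet) (simp only: exec_Nil)
  next
    show "s = ?st 0" using assms by (simp add: with_ivar_same)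
  qed (use assms bound bound' in \<open>auto simp: with_defs mult_2\<close>)
  have "exec (Suc 0) [ISet ''len'' (IConst 1)] (?st (2 ^ (q - 1)))
      (return_pmf (with_ivar (?st (2 ^ (q - 1))) ''len'' 1))"
  proof (rule exec_ISet)
    have "(?st (2 ^ (q - 1)))\<lparr>ivar := (ivar (?st (2 ^ (q - 1))))(''len'' := ival (?st (2 ^ (q - 1))) (IConst 1))\<rparr> =
      with_ivar (?st (2 ^ (q - 1))) ''len'' 1" by (simp add: with_defs)
    thus "exec 0 [] ((?st (2 ^ (q - 1)))\<lparr>ivar := (ivar (?st (2 ^ (q - 1))))(''len'' := ival (?st (2 ^ (q - 1))) (IConst 1))\<rparr>)
      (return_pmf (with_ivar (?st (2 ^ (q - 1))) ''len'' 1))" by (simp only: exec_Nil)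
  qed
  from exec_append_det[OF loop this] show ?thesis by (simp add: half_prog_def mult_2)
qed

definition bit_sign :: "nat \<Rightarrow> real" where
  "bit_sign b = 2 * real b - 1"

lemma rval_sign_exp: "rval s (sign_exp e) = bit_sign (ival s e)"
  by (simp add: sign_exp_def bit_sign_def)

lemma exec_accumulate_prog:
  assumes k: "ivar s ''k'' = 0" and K: "ivar s nz = K" and nz: "nz \<noteq> ''k''" and val: "val \<noteq> w"
    and p: "\<And>l. l < K \<Longrightarrow> imem s ''h'' (imem s rw l) = p l"
    and c: "\<And>l. l < K \<Longrightarrow> imem s cl l = c l"
    and v: "\<And>l. l < K \<Longrightarrow>
      bit_sign (imem s ''g'' (p l)) * bit_sign (imem s ''s'' (imem s rw l)) * rmem s val l 0 = v l"
  shows "exec (3 * K + 2) (accumulate_prog nz rw cl val w) s (return_pmf (with_matrix s w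
    (\<lambda>i j. rmem s w i j + (\<Sum>l<K. if p l = i \<and> c l = j then v l else 0))))"
proof -
  let ?X = "\<lambda>n i j. rmem s w i j + (\<Sum>l<n. if p l = i \<and> c l = j then v l else 0)"
  let ?st = "\<lambda>k. with_ivar (with_matrix s w (?X k)) ''k'' k"
  define r h cc e where "r = IGet rw (IVar ''k'')" and "h = IGet ''h'' r" and "cc = IGet cl (IVar ''k'')"
    and "e = RAdd (RGet w h cc) (RMul (RMul (sign_exp (IGet ''g'' h)) (sign_exp (IGet ''s'' r))) (RGet val (IVar ''k'') (IConst 0)))"
  have prog: "accumulate_prog nz rw cl val w =
      [Loop (ILess (IVar ''k'') (IVar nz)) [RPut w h cc e, incr ''k'']] @ [ISet ''k'' (IConst 0)]"
    by (simp add: accumulate_prog_def r_def h_def cc_def e_def Let_def)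
  have loop: "exec (K * (2 + 1) + 1) [Loop (ILess (IVar ''k'') (IVar nz)) [RPut w h cc e, incr ''k'']] s
      (return_pmf (?st K))"
  proof (rule exec_Loop_det[where st = ?st])
    fix n assume "n < K"
    have vals: "ival (?st n) h = p n" "ival (?st n) cc = c n" "rval (?st n) e = ?X n (p n) (c n) + v n"
      using val p[OF \<open>n < K\<close>] c[OF \<open>n < K\<close>] v[OF \<open>n < K\<close>]
      by (simp_all add: h_def cc_def e_def r_def rval_sign_exp with_defs)
    let ?s1 = "(?st n)\<lparr>rmem := (rmem (?st n))(w := (rmem (?st n) w)(ival (?st n) h :=
       (rmem (?st n) w (ival (?st n) h))(ival (?st n) cc := rval (?st n) e)))\<rparr>"
    let ?s2 = "?s1\<lparr>ivar := (ivar ?s1)(''k'' := ival ?s1 (IAdd (IVar ''k'') (IConst 1)))\<rparr>"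
    have "?s2 = ?st (Suc n)"
      unfolding vals unfolding with_defs
      by (intro store.equality) (auto simp: fun_eq_iff)
    hence "exec (Suc (Suc 0)) [RPut w h cc e, incr ''k''] (?st n) (return_pmf (?st (Suc n)))"
      unfolding incr_def by (intro exec_RPut exec_ISet) (simp only: exec_Nil)
    thus "exec 2 [RPut w h cc e, incr ''k''] (?st n) (return_pmf (?st (Suc n)))"
      by (simp only: numeral_2_eq_2)
  next
    show "s = ?st 0" using k by (intro store.equality) (auto simp: with_defs fun_eq_iff)
  qed (use K nz in \<open>auto simp: with_defs\<close>)
  have "exec (Suc 0) [ISet ''k'' (IConst 0)] (?st K) (return_pmf (with_matrix s w (?X K)))"
  proof (rule exec_ISet)
    have "(?st K)\<lparr>ivar := (ivar (?st K))(''k'' := ival (?st K) (IConst 0))\<rparr> = with_matrix s w (?X K)"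
      using k by (intro store.equality) (auto simp: with_defs fun_eq_iff)
    thus "exec 0 [] ((?st K)\<lparr>ivar := (ivar (?st K))(''k'' := ival (?st K) (IConst 0))\<rparr>)
      (return_pmf (with_matrix s w (?X K)))" by (simp only: exec_Nil)
  qed
  from exec_append_det[OF loop this] show ?thesis by (simp add: prog mult.commute)
qed

text \<open>The memory after the first \<open>n\<close> butterflies of the level that reads at
  offset \<open>b\<close>, in closed form so as to serve as loop invariant.\<close>

definition fwht_store_level :: "nat \<Rightarrow> nat \<Rightarrow> nat \<Rightarrow> nat \<Rightarrow> nat \<Rightarrow> (nat \<Rightarrow> nat \<Rightarrow> real) \<Rightarrow> nat \<Rightarrow> nat \<Rightarrow> real" where
  "fwht_store_level N h b c n X i j =
    (if j = c \<and> b + N \<le> i \<and> i < b + N + n then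
       X (b + 2 * (i - (b + N))) c + X (b + 2 * (i - (b + N)) + 1) c
     else if j = c \<and> b + N + h \<le> i \<and> i < b + N + h + n then
       X (b + 2 * (i - (b + N + h))) c - X (b + 2 * (i - (b + N + h)) + 1) c
     else X i j)"

lemma exec_level_body:
  assumes i: "ivar s ''i'' = 0" and m1: "ivar s ''m1'' = 2 * h"
    and half: "ivar s ''half'' = h" and b: "ivar s ''b'' = b" and c: "ivar s ''c'' = c" and len: "ivar s ''len'' = l"
  shows "exec (4 * h + 4) (level_body w) s (return_pmf (with_ivar (with_ivar
    (with_matrix s w (fwht_store_level (2 * h) h b c h (rmem s w))) ''b'' (b + 2 * h)) ''len'' (2 * l)))"
proof -
  let ?X = "\<lambda>n. fwht_store_level (2 * h) h b c n (rmem s w)"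
  let ?st = "\<lambda>n. with_ivar (with_matrix s w (?X n)) ''i'' n"
  define ce j t where "ce = IVar ''c''" and "j = IAdd (IVar ''b'') (IAdd (IVar ''i'') (IVar ''i''))"
    and "t = IAdd (IVar ''b'') (IAdd (IVar ''m1'') (IVar ''i''))"
  define x y where "x = RGet w j ce" and "y = RGet w (IAdd j (IConst 1)) ce"
  have body: "butterfly_body w = [RPut w t ce (RAdd x y), RPut w (IAdd t (IVar ''half'')) ce (RSub x y), incr ''i'']"
    by (simp add: butterfly_body_def ce_def j_def t_def x_def y_def Let_def)
  have X0: "?X 0 = rmem s w" by (auto simp: fwht_store_level_def fun_eq_iff)
  \<comment> \<open>All writes of the level go to rows from \<open>b + 2 * h\<close> on, beyond the
    rows still to be read.\<close>
  have read: "?X n (b + 2 * n + u) c = rmem s w (b + 2 * n + u) c" if "n < h" "u < 2" for n u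
    using that by (auto simp: fwht_store_level_def)
  have XSuc: "?X (Suc n) = (?X n)(b + 2 * h + n := (?X n (b + 2 * h + n))(c := ?X n (b + 2 * n) c + ?X n (b + 2 * n + 1) c),
      b + 2 * h + n + h := (?X n (b + 2 * h + n + h))(c := ?X n (b + 2 * n) c - ?X n (b + 2 * n + 1) c))"
    if n: "n < h" for n
    using read[OF n, of 0] read[OF n, of 1] n
    by (auto simp: fwht_store_level_def fun_eq_iff less_Suc_eq)
  have loop: "exec (h * (3 + 1) + 1) [Loop (ILess (IAdd (IVar ''i'') (IVar ''i'')) (IVar ''m1'')) (butterfly_body w)] s
      (return_pmf (?st h))"
  proof (rule exec_Loop_det[where st = ?st])
    fix n assume n: "n < h"
    let ?s1 = "(?st n)\<lparr>rmem := (rmem (?st n))(w := (rmem (?st n) w)(ival (?st n) t :=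
       (rmem (?st n) w (ival (?st n) t))(ival (?st n) ce := rval (?st n) (RAdd x y))))\<rparr>"
    let ?s2 = "?s1\<lparr>rmem := (rmem ?s1)(w := (rmem ?s1 w)(ival ?s1 (IAdd t (IVar ''half'')) :=
       (rmem ?s1 w (ival ?s1 (IAdd t (IVar ''half''))))(ival ?s1 ce := rval ?s1 (RSub x y))))\<rparr>"
    let ?s3 = "?s2\<lparr>ivar := (ivar ?s2)(''i'' := ival ?s2 (IAdd (IVar ''i'') (IConst 1)))\<rparr>"
    have st: "ival (?st n) t = b + 2 * h + n" "ival (?st n) ce = c"
      "rval (?st n) (RAdd x y) = ?X n (b + 2 * n) c + ?X n (b + 2 * n + 1) c"
      using m1 b c by (simp_all add: t_def ce_def x_def y_def j_def with_defs mult_2 add_ac)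
    have s1: "ival ?s1 (IAdd t (IVar ''half'')) = b + 2 * h + n + h" "ival ?s1 ce = c"
      "rval ?s1 (RSub x y) = ?X n (b + 2 * n) c - ?X n (b + 2 * n + 1) c"
      unfolding st
      using m1 b c half n by (simp_all add: t_def ce_def x_def y_def j_def with_defs mult_2 add_ac)
    have "?s3 = ?st (Suc n)"
      unfolding s1 unfolding st unfolding XSuc[OF n] unfolding with_defs using n
      by (intro store.equality) (auto simp: fun_eq_iff)
    hence "exec (Suc (Suc (Suc 0))) (butterfly_body w) (?st n) (return_pmf (?st (Suc n)))"
      unfolding body incr_def by (intro exec_RPut exec_ISet) (simp only: exec_Nil)
    thus "exec 3 (butterfly_body w) (?st n) (return_pmf (?st (Suc n)))"
      by (simp only: numeral_3_eq_3)
  next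
    show "s = ?st 0" using i by (intro store.equality) (auto simp: with_defs X0)
  qed (use m1 in \<open>auto simp: with_defs\<close>)
  let ?fin = "with_ivar (with_ivar (with_matrix s w (?X h)) ''b'' (b + 2 * h)) ''len'' (2 * l)"
  have "exec (Suc (Suc (Suc 0))) [ISet ''i'' (IConst 0), ISet ''b'' (IAdd (IVar ''b'') (IVar ''m1'')),
     ISet ''len'' (IAdd (IVar ''len'') (IVar ''len''))] (?st h) (return_pmf ?fin)"
  proof (rule exec_ISet, rule exec_ISet, rule exec_ISet)
    let ?s1 = "(?st h)\<lparr>ivar := (ivar (?st h))(''i'' := ival (?st h) (IConst 0))\<rparr>"
    let ?s2 = "?s1\<lparr>ivar := (ivar ?s1)(''b'' := ival ?s1 (IAdd (IVar ''b'') (IVar ''m1'')))\<rparr>"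
    let ?s3 = "?s2\<lparr>ivar := (ivar ?s2)(''len'' := ival ?s2 (IAdd (IVar ''len'') (IVar ''len'')))\<rparr>"
    have "?s3 = ?fin"
      using i b m1 len by (intro store.equality) (auto simp: with_defs fun_eq_iff)
    thus "exec 0 [] ?s3 (return_pmf ?fin)" by (simp only: exec_Nil)
  qed
  moreover have "h * (3 + 1) + 1 + Suc (Suc (Suc 0)) = 4 * h + 4" by simp
  ultimately show ?thesis
    using exec_append_det[OF loop] by (metis level_body_def append_Cons append_Nil)
qed

fun fwht_store :: "nat \<Rightarrow> nat \<Rightarrow> nat \<Rightarrow> nat \<Rightarrow> (nat \<Rightarrow> nat \<Rightarrow> real) \<Rightarrow> nat \<Rightarrow> nat \<Rightarrow> real" where
  "fwht_store N h c 0 X = X"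
| "fwht_store N h c (Suc t) X = fwht_store_level N h (t * N) c h (fwht_store N h c t X)"

lemma fwht_store_other_column: "j \<noteq> c \<Longrightarrow> fwht_store N h c t X i j = X i j"
  by (induction t) (simp_all add: fwht_store_level_def)

text \<open>The alternative \<open>t = 0\<close> covers the transform of length one, where
  \<open>N = 2 * h\<close> fails and no level is executed.\<close>

lemma fwht_store_column:
  assumes "t = 0 \<or> N = 2 * h" and "i < N"
  shows "fwht_store N h c t X (t * N + i) c = fwht_level h (\<lambda>j. X j c) t i"
  using assms
proof (induction t arbitrary: i)
  case (Suc t)
  have N: "N = 2 * h" using Suc by simp
  have IH: "fwht_store N h c t X (t * N + j) c = fwht_level h (\<lambda>j. X j c) t j" if "j < N" for j
    using Suc.IH[OF _ that] N by simp
  show ?case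
  proof (cases "i < h")
    case True
    thus ?thesis
      using IH[of "2 * i"] IH[of "2 * i + 1"] N by (simp add: fwht_store_level_def add_ac)
  next
    case False
    moreover define k where "k = i - h"
    ultimately have i: "i = h + k" by simp
    have k: "k < h" using i Suc.prems N by simp
    show ?thesis
      using IH[of "2 * k"] IH[of "2 * k + 1"] N k unfolding i by (simp add: fwht_store_level_def add_ac)
  qed
qed simp

definition ready :: "store \<Rightarrow> nat \<Rightarrow> nat \<Rightarrow> (nat \<Rightarrow> nat) \<Rightarrow> bool" where
  "ready s q m2 r \<longleftrightarrow> ivar s ''i'' = 0 \<and> ivar s ''k'' = 0 \<and> ivar s ''b'' = 0 \<and> ivar s ''len'' = 1 \<and>
    ivar s ''m1'' = 2 ^ q \<and> ivar s ''half'' = 2 ^ (q - 1) \<and> ivar s ''m2'' = m2 \<and> imem s ''r'' = r"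

definition column_time :: "nat \<Rightarrow> nat \<Rightarrow> nat" where
  "column_time q m2 = q * (4 * 2 ^ (q - 1) + 5) + 3 * m2 + 6"

lemma exec_column_body:
  assumes rd: "ready s q m2 r" and c: "ivar s ''c'' = c" and out: "out \<noteq> w"
    and r: "\<And>i. i < m2 \<Longrightarrow> r i < 2 ^ q"
  shows "exec (column_time q m2) (column_body w out) s
    (return_pmf (with_ivar (with_matrix (with_matrix s w (fwht_store (2 ^ q) (2 ^ (q - 1)) c q (rmem s w))) out
      (\<lambda>i j. if i < m2 \<and> j = c then (\<Sum>l<2 ^ q. wh_sign (r i) l * rmem s w l c) / sqrt (real m2) else rmem s out i j))
      ''c'' (Suc c)))"
proof -
  let ?N = "2 ^ q :: nat" and ?h = "2 ^ (q - 1) :: nat"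
  let ?X = "\<lambda>t. fwht_store ?N ?h c t (rmem s w)"
  let ?st = "\<lambda>t. with_ivar (with_ivar (with_matrix s w (?X t)) ''b'' (t * ?N)) ''len'' (2 ^ t)"
  note rds = rd[unfolded ready_def]
  have loop1: "exec (q * ((4 * ?h + 4) + 1) + 1) [Loop (ILess (IVar ''len'') (IVar ''m1'')) (level_body w)] s
      (return_pmf (?st q))"
  proof (rule exec_Loop_det[where st = ?st])
    fix t assume t: "t < q"
    have N: "?N = 2 * ?h" using t by (cases q) auto
    let ?fin = "with_ivar (with_ivar
      (with_matrix (?st t) w (fwht_store_level (2 * ?h) ?h (t * ?N) c ?h (rmem (?st t) w))) ''b'' (t * ?N + 2 * ?h)) ''len'' (2 * 2 ^ t)"
    have "exec (4 * ?h + 4) (level_body w) (?st t) (return_pmf ?fin)"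
      using rds c N by (intro exec_level_body) (simp_all add: with_defs)
    moreover have "?fin = ?st (Suc t)"
      using N by (intro store.equality) (auto simp: with_defs fun_eq_iff)
    ultimately show "exec (4 * ?h + 4) (level_body w) (?st t) (return_pmf (?st (Suc t)))" by simp
  next
    show "s = ?st 0" using rds by (intro store.equality) (auto simp: with_defs fun_eq_iff)
  qed (use rds in \<open>auto simp: with_defs\<close>)
  let ?s = "?st q"
  let ?v = "\<lambda>i. (\<Sum>l<2 ^ q. wh_sign (r i) l * rmem s w l c) / sqrt (real m2)"
  let ?Y = "\<lambda>k i j. if i < k \<and> j = c then ?v i else rmem s out i j"
  let ?su = "\<lambda>k. with_ivar (with_matrix ?s out (?Y k)) ''k'' k"
  have loop2: "exec (m2 * (2 + 1) + 1) [Loop (ILess (IVar ''k'') (IVar ''m2'')) (sample_rows_body w out)] ?s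
      (return_pmf (?su m2))"
  proof (rule exec_Loop_det[where st = ?su])
    fix k assume k: "k < m2"
    have col: "?X q (q * ?N + r k) c = (\<Sum>l<?N. wh_sign (r k) l * rmem s w l c)"
    proof -
      have "q = 0 \<or> ?N = 2 * ?h" by (cases q) auto
      thus ?thesis
        using fwht_store_column[OF _ r[OF k], of q ?h c "rmem s w"]
          fwht_level_full[OF r[OF k], of "\<lambda>j. rmem s w j c"] by simp
    qed
    let ?e = "RDiv (RGet w (IAdd (IVar ''b'') (IGet ''r'' (IVar ''k''))) (IVar ''c'')) (RSqrt (ROfInt (IVar ''m2'')))"
    let ?s1 = "(?su k)\<lparr>rmem := (rmem (?su k))(out := (rmem (?su k) out)(ival (?su k) (IVar ''k'') :=
       (rmem (?su k) out (ival (?su k) (IVar ''k'')))(ival (?su k) (IVar ''c'') := rval (?su k) ?e)))\<rparr>"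
    let ?s2 = "?s1\<lparr>ivar := (ivar ?s1)(''k'' := ival ?s1 (IAdd (IVar ''k'') (IConst 1)))\<rparr>"
    have vals: "ival (?su k) (IVar ''k'') = k" "ival (?su k) (IVar ''c'') = c" "rval (?su k) ?e = ?v k"
      using rds c out col by (simp_all add: with_defs)
    have "?s2 = ?su (Suc k)"
      unfolding vals unfolding with_defs
      by (intro store.equality) (auto simp: fun_eq_iff less_Suc_eq)
    hence "exec (Suc (Suc 0)) (sample_rows_body w out) (?su k) (return_pmf (?su (Suc k)))"
      unfolding sample_rows_body_def incr_def by (intro exec_RPut exec_ISet) (simp only: exec_Nil)
    thus "exec 2 (sample_rows_body w out) (?su k) (return_pmf (?su (Suc k)))"
      by (simp only: numeral_2_eq_2)
  next
    show "?s = ?su 0" using rds out by (intro store.equality) (auto simp: with_defs fun_eq_iff)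
  qed (use rds in \<open>auto simp: with_defs\<close>)
  let ?fin = "with_ivar (with_matrix (with_matrix s w (?X q)) out (?Y m2)) ''c'' (Suc c)"
  have reset: "exec (Suc (Suc (Suc (Suc 0)))) [ISet ''k'' (IConst 0), ISet ''b'' (IConst 0),
      ISet ''len'' (IConst 1), incr ''c''] (?su m2) (return_pmf ?fin)"
    unfolding incr_def
  proof (rule exec_ISet, rule exec_ISet, rule exec_ISet, rule exec_ISet)
    let ?s1 = "(?su m2)\<lparr>ivar := (ivar (?su m2))(''k'' := ival (?su m2) (IConst 0))\<rparr>"
    let ?s2 = "?s1\<lparr>ivar := (ivar ?s1)(''b'' := ival ?s1 (IConst 0))\<rparr>"
    let ?s3 = "?s2\<lparr>ivar := (ivar ?s2)(''len'' := ival ?s2 (IConst 1))\<rparr>"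
    let ?s4 = "?s3\<lparr>ivar := (ivar ?s3)(''c'' := ival ?s3 (IAdd (IVar ''c'') (IConst 1)))\<rparr>"
    have "?s4 = ?fin"
      using rds c out by (intro store.equality) (auto simp: with_defs fun_eq_iff)
    thus "exec 0 [] ?s4 (return_pmf ?fin)" by (simp only: exec_Nil)
  qed
  have "q * ((4 * ?h + 4) + 1) + 1 + (m2 * (2 + 1) + 1 + Suc (Suc (Suc (Suc 0)))) = column_time q m2"
    by (simp add: column_time_def)
  thus ?thesis
    using exec_append_det[OF loop1 exec_append_det[OF loop2 reset]] by (simp add: column_body_def)
qed

lemma exec_transform_prog:
  assumes rd: "ready s q m2 r" and c: "ivar s ''c'' = 0" and n: "ivar s nv = n" "nv \<noteq> ''c''" and out: "out \<noteq> w"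
    and r: "\<And>i. i < m2 \<Longrightarrow> r i < 2 ^ q"
  shows "\<exists>X. exec (n * (column_time q m2 + 1) + 2) (transform_prog nv w out) s
    (return_pmf (with_matrix (with_matrix s w X) out
      (\<lambda>i j. if i < m2 \<and> j < n then (\<Sum>l<2 ^ q. wh_sign (r i) l * rmem s w l j) / sqrt (real m2) else rmem s out i j)))"
proof -
  define W where "W = rec_nat (rmem s w) (\<lambda>c X. fwht_store (2 ^ q) (2 ^ (q - 1)) c q X)"
  have W0: "W 0 = rmem s w" and WSuc: "W (Suc c) = fwht_store (2 ^ q) (2 ^ (q - 1)) c q (W c)" for c
    by (simp_all add: W_def)
  \<comment> \<open>Columns are independent: those not yet transformed still hold their input, which
    is what the next round reads.\<close>
  have Wcol: "c \<le> j \<Longrightarrow> W c l j = rmem s w l j" for c l j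
    by (induction c) (simp_all add: W0 WSuc fwht_store_other_column)
  let ?Y = "\<lambda>c i j. if i < m2 \<and> j < c then (\<Sum>l<2 ^ q. wh_sign (r i) l * rmem s w l j) / sqrt (real m2) else rmem s out i j"
  let ?st = "\<lambda>c. with_ivar (with_matrix (with_matrix s w (W c)) out (?Y c)) ''c'' c"
  have loop: "exec (n * (column_time q m2 + 1) + 1) [Loop (ILess (IVar ''c'') (IVar nv)) (column_body w out)] s
      (return_pmf (?st n))"
  proof (rule exec_Loop_det[where st = ?st])
    fix c assume "c < n"
    have rd': "ready (?st c) q m2 r" using rd by (simp add: ready_def with_defs)
    have c': "ivar (?st c) ''c'' = c" by (simp add: with_defs)
    let ?fin = "with_ivar (with_matrix (with_matrix (?st c) w (fwht_store (2 ^ q) (2 ^ (q - 1)) c q (rmem (?st c) w))) out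
      (\<lambda>i j. if i < m2 \<and> j = c then (\<Sum>l<2 ^ q. wh_sign (r i) l * rmem (?st c) w l c) / sqrt (real m2) else rmem (?st c) out i j))
      ''c'' (Suc c)"
    have mem: "rmem (?st c) w = W c" "rmem (?st c) out = ?Y c" using out by (simp_all add: with_defs)
    have "?fin = ?st (Suc c)"
      unfolding mem unfolding WSuc Wcol[OF order_refl] unfolding with_defs
      by (intro store.equality) (auto simp: fun_eq_iff less_Suc_eq)
    thus "exec (column_time q m2) (column_body w out) (?st c) (return_pmf (?st (Suc c)))"
      using exec_column_body[OF rd' c' out r] by simp
  next
    have "rmem s out = ?Y 0" by (auto simp: fun_eq_iff)
    thus "s = ?st 0" using c by (intro store.equality) (auto simp: with_defs fun_eq_iff W0)
  qed (use n in \<open>auto simp: with_defs\<close>)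
  let ?fin = "with_matrix (with_matrix s w (W n)) out (?Y n)"
  have "exec (Suc 0) [ISet ''c'' (IConst 0)] (?st n) (return_pmf ?fin)"
  proof (rule exec_ISet)
    have "(?st n)\<lparr>ivar := (ivar (?st n))(''c'' := ival (?st n) (IConst 0))\<rparr> = ?fin"
      using c by (intro store.equality) (auto simp: with_defs fun_eq_iff)
    thus "exec 0 [] ((?st n)\<lparr>ivar := (ivar (?st n))(''c'' := ival (?st n) (IConst 0))\<rparr>) (return_pmf ?fin)"
      by (simp only: exec_Nil)
  qed
  from exec_append_det[OF loop this] show ?thesis
    by (intro exI[of _ "W n"]) (simp add: transform_prog_def)
qed

subsection \<open>The output distribution\<close>

definition sketch_time :: "nat \<Rightarrow> nat \<Rightarrow> nat \<Rightarrow> nat \<Rightarrow> nat" where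
  "sketch_time q m2 k d = 10 * k + 5 * 2 ^ q + 5 * m2 + 2 * 2 ^ (q - 1) + d * (column_time q m2 + 1) + 18"

text \<open>The value that the program computes, summed over the coordinate list because the machine
  sees the matrix only through it; \<open>sketch_entry_correct\<close> identifies it with an entry
  of the sketched matrix.\<close>

definition sketch_entry :: "nat \<Rightarrow> nat \<Rightarrow> (nat \<times> nat) list \<Rightarrow> real mat \<Rightarrow>
    (nat \<Rightarrow> nat \<times> nat) \<Rightarrow> (nat \<Rightarrow> nat) \<Rightarrow> (nat \<Rightarrow> nat) \<Rightarrow> nat \<Rightarrow> nat \<Rightarrow> real" where
  "sketch_entry q m2 xs A f g r i j =
    (\<Sum>l<2 ^ q. wh_sign (r i) l * (\<Sum>t<length xs. if fst (f (fst (xs ! t))) = l \<and> snd (xs ! t) = j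
      then bit_sign (g l) * bit_sign (snd (f (fst (xs ! t)))) * A $$ (xs ! t) else 0)) / sqrt (real m2)"

definition sampled_store :: "store \<Rightarrow> (nat \<Rightarrow> nat \<times> nat) \<Rightarrow> (nat \<Rightarrow> nat) \<Rightarrow> (nat \<Rightarrow> nat) \<Rightarrow> store" where
  "sampled_store s f g r = with_array (with_array (with_buckets s f) ''g'' g) ''r'' r"

lemma exec_arithmetic_phase:
  assumes r: "\<And>i. i < m2 \<Longrightarrow> r i < 2 ^ q"
    and s0_def: "s0 = input_store (2 ^ q) m2 A B xs ys"
  shows "\<exists>s'. exec ((2 * 2 ^ (q - 1) + 2) + ((3 * length xs + 2) + ((3 * length ys + 2) +
      ((dim_col A * (column_time q m2 + 1) + 2) + (dim_col B * (column_time q m2 + 1) + 2)))))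
    (half_prog @ accumulate_prog ''nnzA'' ''rowA'' ''colA'' ''valA'' ''wA'' @
      accumulate_prog ''nnzB'' ''rowB'' ''colB'' ''valB'' ''wB'' @
      transform_prog ''dA'' ''wA'' ''outA'' @ transform_prog ''dB'' ''wB'' ''outB'')
    (sampled_store s0 f g r) (return_pmf s') \<and>
    output_problem m2 (dim_col A) (dim_col B) s' =
      (mat m2 (dim_col A) (\<lambda>(i, j). sketch_entry q m2 xs A f g r i j),
       mat m2 (dim_col B) (\<lambda>(i, j). sketch_entry q m2 ys B f g r i j))"
proof -
  let ?s = "sampled_store s0 f g r"
  let ?s1 = "with_ivar (with_ivar ?s ''half'' (2 ^ (q - 1))) ''len'' 1"
  let ?W = "\<lambda>xs A i j. \<Sum>t<length xs. if fst (f (fst (xs ! t))) = i \<and> snd (xs ! t) = j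
      then bit_sign (g i) * bit_sign (snd (f (fst (xs ! t)))) * A $$ (xs ! t) else 0"
  let ?s2 = "with_matrix ?s1 ''wA'' (?W xs A)"
  let ?s3 = "with_matrix ?s2 ''wB'' (?W ys B)"
  note simps = s0_def input_store_def sampled_store_def with_defs
  have e1: "exec (2 * 2 ^ (q - 1) + 2) half_prog ?s (return_pmf ?s1)"
    by (rule exec_half_prog) (simp_all add: simps)
  have "exec (3 * length xs + 2) (accumulate_prog ''nnzA'' ''rowA'' ''colA'' ''valA'' ''wA'') ?s1
    (return_pmf (with_matrix ?s1 ''wA'' (\<lambda>i j. rmem ?s1 ''wA'' i j + (\<Sum>t<length xs.
      if fst (f (fst (xs ! t))) = i \<and> snd (xs ! t) = j
      then bit_sign (g (fst (f (fst (xs ! t))))) * bit_sign (snd (f (fst (xs ! t)))) * A $$ (xs ! t) else 0))))"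
    by (rule exec_accumulate_prog) (simp_all add: simps pad_def)
  moreover have "(\<lambda>i j. rmem ?s1 ''wA'' i j + (\<Sum>t<length xs.
      if fst (f (fst (xs ! t))) = i \<and> snd (xs ! t) = j
      then bit_sign (g (fst (f (fst (xs ! t))))) * bit_sign (snd (f (fst (xs ! t)))) * A $$ (xs ! t) else 0)) = ?W xs A"
    by (auto simp: fun_eq_iff simps intro!: sum.cong)
  ultimately have e2: "exec (3 * length xs + 2) (accumulate_prog ''nnzA'' ''rowA'' ''colA'' ''valA'' ''wA'') ?s1
    (return_pmf ?s2)" by simp
  have "exec (3 * length ys + 2) (accumulate_prog ''nnzB'' ''rowB'' ''colB'' ''valB'' ''wB'') ?s2
    (return_pmf (with_matrix ?s2 ''wB'' (\<lambda>i j. rmem ?s2 ''wB'' i j + (\<Sum>t<length ys.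
      if fst (f (fst (ys ! t))) = i \<and> snd (ys ! t) = j
      then bit_sign (g (fst (f (fst (ys ! t))))) * bit_sign (snd (f (fst (ys ! t)))) * B $$ (ys ! t) else 0))))"
    by (rule exec_accumulate_prog) (simp_all add: simps pad_def)
  moreover have "(\<lambda>i j. rmem ?s2 ''wB'' i j + (\<Sum>t<length ys.
      if fst (f (fst (ys ! t))) = i \<and> snd (ys ! t) = j
      then bit_sign (g (fst (f (fst (ys ! t))))) * bit_sign (snd (f (fst (ys ! t)))) * B $$ (ys ! t) else 0)) = ?W ys B"
    by (auto simp: fun_eq_iff simps intro!: sum.cong)
  ultimately have e3: "exec (3 * length ys + 2) (accumulate_prog ''nnzB'' ''rowB'' ''colB'' ''valB'' ''wB'') ?s2
    (return_pmf ?s3)" by simp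
  have rd3: "ready ?s3 q m2 r" by (simp add: ready_def simps)
  have "ivar ?s3 ''c'' = 0" "ivar ?s3 ''dA'' = dim_col A" by (simp_all add: simps)
  from exec_transform_prog[OF rd3 this _ _ r, where w = "''wA''" and out = "''outA''"]
  obtain X where e4: "exec (dim_col A * (column_time q m2 + 1) + 2) (transform_prog ''dA'' ''wA'' ''outA'') ?s3
    (return_pmf (with_matrix (with_matrix ?s3 ''wA'' X) ''outA''
      (\<lambda>i j. if i < m2 \<and> j < dim_col A then (\<Sum>l<2 ^ q. wh_sign (r i) l * rmem ?s3 ''wA'' l j) / sqrt (real m2) else rmem ?s3 ''outA'' i j)))"
    (is "exec _ _ _ (return_pmf ?s4)") by auto
  have rd4: "ready ?s4 q m2 r" using rd3 by (simp add: ready_def with_matrix_def)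
  have "ivar ?s4 ''c'' = 0" "ivar ?s4 ''dB'' = dim_col B" by (simp_all add: simps)
  from exec_transform_prog[OF rd4 this _ _ r, where w = "''wB''" and out = "''outB''"]
  obtain Y where e5: "exec (dim_col B * (column_time q m2 + 1) + 2) (transform_prog ''dB'' ''wB'' ''outB'') ?s4
    (return_pmf (with_matrix (with_matrix ?s4 ''wB'' Y) ''outB''
      (\<lambda>i j. if i < m2 \<and> j < dim_col B then (\<Sum>l<2 ^ q. wh_sign (r i) l * rmem ?s4 ''wB'' l j) / sqrt (real m2) else rmem ?s4 ''outB'' i j)))"
    (is "exec _ _ _ (return_pmf ?s5)") by auto
  have "output_problem m2 (dim_col A) (dim_col B) ?s5 =
      (mat m2 (dim_col A) (\<lambda>(i, j). sketch_entry q m2 xs A f g r i j),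
       mat m2 (dim_col B) (\<lambda>(i, j). sketch_entry q m2 ys B f g r i j))"
    unfolding output_problem_def by (auto simp: with_matrix_def sketch_entry_def)
  thus ?thesis
    using exec_append_det[OF e1 exec_append_det[OF e2 exec_append_det[OF e3 exec_append_det[OF e4 e5]]]] by blast
qed

lemma pad_image: "pad zs ` {..<length zs} = set zs"
  by (auto simp: pad_def set_conv_nth image_def)

lemma run_sketch_prog:
  assumes m2: "0 < m2" and T: "sketch_time q m2 (length xs + length ys) (dim_col A + dim_col B) \<le> T"
    and s0_def: "s0 = input_store (2 ^ q) m2 A B xs ys"
  shows "\<exists>D. run T sketch_prog s0 = map_pmf (Pair []) D \<and>
    map_pmf (output_problem m2 (dim_col A) (dim_col B)) D =
      bind_pmf (Pi_pmf (fst ` set xs \<union> fst ` set ys) (0, 0) (\<lambda>_. bucket_pmf (2 ^ q))) (\<lambda>f.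
      bind_pmf (Pi_pmf {..<2 ^ q} 0 (\<lambda>_. pmf_of_set {..<2})) (\<lambda>g.
      bind_pmf (Pi_pmf {..<m2} 0 (\<lambda>_. pmf_of_set {..<2 ^ q})) (\<lambda>r.
        return_pmf (mat m2 (dim_col A) (\<lambda>(i, j). sketch_entry q m2 xs A f g r i j),
          mat m2 (dim_col B) (\<lambda>(i, j). sketch_entry q m2 ys B f g r i j)))))"
proof -
  let ?N = "2 ^ q :: nat"
  note simps = s0_def input_store_def with_defs
  have rowsA: "imem s0 ''rowA'' ` {..<length xs} = fst ` set xs"
    using pad_image[of "map fst xs"] by (simp add: simps)
  have rowsB: "imem s0 ''rowB'' ` {..<length ys} = fst ` set ys"
    using pad_image[of "map fst ys"] by (simp add: simps)
  let ?F1 = "Pi_pmf (fst ` set xs) (0, 0) (\<lambda>_. bucket_pmf ?N)"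
  let ?F = "Pi_pmf (fst ` set xs \<union> fst ` set ys) (0, 0) (\<lambda>_. bucket_pmf ?N)"
  let ?G = "Pi_pmf {..<?N} (0 :: nat) (\<lambda>_. pmf_of_set {..<2 :: nat})"
  let ?R = "Pi_pmf {..<m2} (0 :: nat) (\<lambda>_. pmf_of_set {..<?N})"
  have init: "with_buckets s0 (\<lambda>_. (0, 0)) = s0"
    by (intro store.equality) (auto simp: simps fun_eq_iff)
  have iv: "ivar s0 ''k'' = 0" "ivar s0 ''x'' = 0" "ivar s0 ''m1'' = ?N"
    "ivar s0 ''nnzA'' = length xs" "ivar s0 ''nnzB'' = length ys" by (simp_all add: simps)
  obtain EA where EA: "\<And>f. exec (7 * length xs + 2) (bucket_prog ''nnzA'' ''rowA'') (with_buckets s0 f) (map_pmf (with_buckets s0) (EA f))"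
    "bind_pmf (Pi_pmf {} (0, 0) (\<lambda>_. bucket_pmf ?N)) EA = ?F1"
    using exec_bucket_prog[OF iv(1-3) _ iv(4), where rw = "''rowA''" and A = "{}"]
    unfolding rowsA by (auto simp del: pmf_Pi_empty)
  obtain EB where EB: "\<And>f. exec (7 * length ys + 2) (bucket_prog ''nnzB'' ''rowB'') (with_buckets s0 f) (map_pmf (with_buckets s0) (EB f))"
    "bind_pmf ?F1 EB = ?F"
    using exec_bucket_prog[OF iv(1-3) _ iv(5), where rw = "''rowB''" and A = "fst ` set xs"]
    unfolding rowsB by (auto simp: Un_commute)
  have e1: "exec (7 * length xs + 2) (bucket_prog ''nnzA'' ''rowA'') s0 (map_pmf (with_buckets s0) ?F1)"
    using EA(1)[of "\<lambda>_. (0, 0)"] EA(2) by (simp add: init bind_return_pmf)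
  define T1 where "T1 = (2 * 2 ^ (q - 1) + 2) + ((3 * length xs + 2) + ((3 * length ys + 2) +
      ((dim_col A * (column_time q m2 + 1) + 2) + (dim_col B * (column_time q m2 + 1) + 2))))"
  define rest where "rest = half_prog @ accumulate_prog ''nnzA'' ''rowA'' ''colA'' ''valA'' ''wA'' @
      accumulate_prog ''nnzB'' ''rowB'' ''colB'' ''valB'' ''wB'' @
      transform_prog ''dA'' ''wA'' ''outA'' @ transform_prog ''dB'' ''wB'' ''outB''"
  let ?out = "\<lambda>f g r. (mat m2 (dim_col A) (\<lambda>(i, j). sketch_entry q m2 xs A f g r i j),
       mat m2 (dim_col B) (\<lambda>(i, j). sketch_entry q m2 ys B f g r i j))"
  \<comment> \<open>After the draws the program is deterministic, so the final store can be chosen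
    as a function of the three tables. The row indices are restricted to their support to stay below
    \<open>2 ^ q\<close>.\<close>
  have "\<forall>f g r. \<exists>s'. r \<in> set_pmf ?R \<longrightarrow>
    exec T1 rest (sampled_store s0 f g r) (return_pmf s') \<and> output_problem m2 (dim_col A) (dim_col B) s' = ?out f g r"
  proof (intro allI)
    fix f g r
    show "\<exists>s'. r \<in> set_pmf ?R \<longrightarrow> exec T1 rest (sampled_store s0 f g r) (return_pmf s') \<and>
      output_problem m2 (dim_col A) (dim_col B) s' = ?out f g r"
    proof (cases "r \<in> set_pmf ?R")
      case True
      have "{..<?N} \<noteq> {}" by (simp add: lessThan_empty_iff)
      hence lt: "r i < ?N" if "i < m2" for i
        using True that by (auto simp: set_Pi_pmf PiE_dflt_def)
      from lt exec_arithmetic_phase[where r = r, OF _ s0_def, where f = f and g = g]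
      show ?thesis
        unfolding T1_def rest_def by blast
    qed auto
  qed
  then obtain fin where fin: "\<And>f g r. r \<in> set_pmf ?R \<Longrightarrow> exec T1 rest (sampled_store s0 f g r) (return_pmf (fin f g r))"
    "\<And>f g r. r \<in> set_pmf ?R \<Longrightarrow> output_problem m2 (dim_col A) (dim_col B) (fin f g r) = ?out f g r"
    by metis
  have e4: "exec ((5 * m2 + 2) + T1) (draw_prog ''r'' ''m2'' (IVar ''m1'') @ rest) (with_array (with_buckets s0 f) ''g'' g)
    (bind_pmf ?R (\<lambda>r. return_pmf (fin f g r)))" for f g
  proof (rule exec_append)
    show "exec (5 * m2 + 2) (draw_prog ''r'' ''m2'' (IVar ''m1'')) (with_array (with_buckets s0 f) ''g'' g)
      (map_pmf (with_array (with_array (with_buckets s0 f) ''g'' g) ''r'') ?R)"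
      by (rule exec_draw_prog) (simp_all add: simps)
  qed (use fin(1) in \<open>simp add: sampled_store_def\<close>)
  have e3: "exec ((5 * ?N + 2) + ((5 * m2 + 2) + T1)) (draw_prog ''g'' ''m1'' (IConst 2) @ draw_prog ''r'' ''m2'' (IVar ''m1'') @ rest)
    (with_buckets s0 f) (bind_pmf ?G (\<lambda>g. bind_pmf ?R (\<lambda>r. return_pmf (fin f g r))))" for f
  proof (rule exec_append)
    show "exec (5 * ?N + 2) (draw_prog ''g'' ''m1'' (IConst 2)) (with_buckets s0 f)
      (map_pmf (with_array (with_buckets s0 f) ''g'') ?G)"
      by (rule exec_draw_prog) (simp_all add: simps)
  qed (rule e4)
  have e2: "exec ((7 * length ys + 2) + ((5 * ?N + 2) + ((5 * m2 + 2) + T1)))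
    (bucket_prog ''nnzB'' ''rowB'' @ draw_prog ''g'' ''m1'' (IConst 2) @ draw_prog ''r'' ''m2'' (IVar ''m1'') @ rest)
    (with_buckets s0 f) (bind_pmf (EB f) (\<lambda>f. bind_pmf ?G (\<lambda>g. bind_pmf ?R (\<lambda>r. return_pmf (fin f g r)))))" for f
    by (rule exec_append[OF EB(1) e3])
  define D where "D = bind_pmf ?F (\<lambda>f. bind_pmf ?G (\<lambda>g. bind_pmf ?R (\<lambda>r. return_pmf (fin f g r))))"
  have "exec ((7 * length xs + 2) + ((7 * length ys + 2) + ((5 * ?N + 2) + ((5 * m2 + 2) + T1)))) sketch_prog s0
    (bind_pmf ?F1 (\<lambda>f. bind_pmf (EB f) (\<lambda>f. bind_pmf ?G (\<lambda>g. bind_pmf ?R (\<lambda>r. return_pmf (fin f g r))))))"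
    unfolding sketch_prog_def rest_def[symmetric] by (rule exec_append[OF e1 e2])
  moreover have "bind_pmf ?F1 (\<lambda>f. bind_pmf (EB f) (\<lambda>f. bind_pmf ?G (\<lambda>g. bind_pmf ?R (\<lambda>r. return_pmf (fin f g r))))) = D"
    unfolding D_def EB(2)[symmetric] by (simp add: bind_assoc_pmf)
  ultimately have "exec ((7 * length xs + 2) + ((7 * length ys + 2) + ((5 * ?N + 2) + ((5 * m2 + 2) + T1)))) sketch_prog s0 D"
    by simp
  hence "run T sketch_prog s0 = map_pmf (Pair []) D"
    by (rule exec_halts) (use T in \<open>simp add: T1_def sketch_time_def algebra_simps\<close>)
  moreover have "map_pmf (output_problem m2 (dim_col A) (dim_col B)) D =
      bind_pmf ?F (\<lambda>f. bind_pmf ?G (\<lambda>g. bind_pmf ?R (\<lambda>r. return_pmf (?out f g r))))"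
    unfolding D_def map_bind_pmf by (intro bind_pmf_cong refl) (simp add: fin(2))
  ultimately show ?thesis by blast
qed

section \<open>Finitely supported vectors\<close>

text \<open>The dimension \<open>d\<close> is a variable of the theorem, while an instance of
  \<open>real_inner\<close> needs a fixed type. Finitely supported sequences contain every
  coordinate space, so the inner product space lemmas apply with this single type.\<close>

typedef fvec = "{f :: nat \<Rightarrow> real. finite {i. f i \<noteq> 0}}"
  morphisms coord Fvec
  by (rule exI[of _ "\<lambda>_. 0"]) simp

lemma finite_support: "finite {i. coord x i \<noteq> 0}"
  using coord[of x] by simp

lemma fvec_eqI: "(\<And>i. coord x i = coord y i) \<Longrightarrow> x = y"
  by (metis coord_inject ext)

lemma coord_Fvec: "finite {i. f i \<noteq> 0} \<Longrightarrow> coord (Fvec f) = f"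
  by (simp add: Fvec_inverse)

instantiation fvec :: real_inner
begin

definition zero_fvec :: fvec where "0 = Fvec (\<lambda>_. 0)"
definition plus_fvec :: "fvec \<Rightarrow> fvec \<Rightarrow> fvec" where "x + y = Fvec (\<lambda>i. coord x i + coord y i)"
definition uminus_fvec :: "fvec \<Rightarrow> fvec" where "- x = Fvec (\<lambda>i. - coord x i)"
definition minus_fvec :: "fvec \<Rightarrow> fvec \<Rightarrow> fvec" where "x - y = Fvec (\<lambda>i. coord x i - coord y i)"
definition scaleR_fvec :: "real \<Rightarrow> fvec \<Rightarrow> fvec" where "c *\<^sub>R x = Fvec (\<lambda>i. c * coord x i)"
definition inner_fvec :: "fvec \<Rightarrow> fvec \<Rightarrow> real" where
  "inner x y = (\<Sum>i | coord x i \<noteq> 0. coord x i * coord y i)"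
definition norm_fvec :: "fvec \<Rightarrow> real" where "norm (x :: fvec) = sqrt (inner x x)"
definition sgn_fvec :: "fvec \<Rightarrow> fvec" where "sgn (x :: fvec) = inverse (norm x) *\<^sub>R x"
definition dist_fvec :: "fvec \<Rightarrow> fvec \<Rightarrow> real" where "dist (x :: fvec) y = norm (x - y)"
definition uniformity_fvec :: "(fvec \<times> fvec) filter" where
  "uniformity = (INF e\<in>{0 <..}. principal {(x :: fvec, y). dist x y < e})"
definition open_fvec :: "fvec set \<Rightarrow> bool" where
  "open U = (\<forall>x\<in>U. eventually (\<lambda>(x', y). x' = x \<longrightarrow> y \<in> U) (uniformity :: (fvec \<times> fvec) filter))"

lemma coord_zero': "coord 0 i = 0"
  by (simp add: zero_fvec_def coord_Fvec)

lemma coord_plus': "coord (x + y) i = coord x i + coord y i"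
proof -
  have "finite {i. coord x i + coord y i \<noteq> 0}"
    by (rule finite_subset[of _ "{i. coord x i \<noteq> 0} \<union> {i. coord y i \<noteq> 0}"])
      (auto simp: finite_support)
  thus ?thesis by (simp add: plus_fvec_def coord_Fvec)
qed

lemma coord_uminus': "coord (- x) i = - coord x i"
  by (simp add: uminus_fvec_def coord_Fvec finite_support)

lemma coord_minus': "coord (x - y) i = coord x i - coord y i"
proof -
  have "finite {i. coord x i - coord y i \<noteq> 0}"
    by (rule finite_subset[of _ "{i. coord x i \<noteq> 0} \<union> {i. coord y i \<noteq> 0}"])
      (auto simp: finite_support)
  thus ?thesis by (simp add: minus_fvec_def coord_Fvec)
qed

lemma coord_scaleR': "coord (c *\<^sub>R x) i = c * coord x i"
  by (simp add: scaleR_fvec_def coord_Fvec finite_support)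

lemma inner_fvec_superset:
  assumes "finite A" "{i. coord x i \<noteq> 0} \<subseteq> A"
  shows "inner x y = (\<Sum>i\<in>A. coord x i * coord y i)"
  unfolding inner_fvec_def using assms by (intro sum.mono_neutral_left) auto

instance
proof
  fix x y z :: fvec and a b :: real
  show "a *\<^sub>R (x + y) = a *\<^sub>R x + a *\<^sub>R y" "(a + b) *\<^sub>R x = a *\<^sub>R x + b *\<^sub>R x"
    "a *\<^sub>R b *\<^sub>R x = (a * b) *\<^sub>R x" "1 *\<^sub>R x = x" "x + y + z = x + (y + z)" "x + y = y + x"
    "0 + x = x" "- x + x = 0" "x - y = x + - y"
    by (auto intro!: fvec_eqI simp: coord_plus' coord_scaleR' coord_zero' coord_uminus' coord_minus' algebra_simps)
  have xyz: "finite ({i. coord x i \<noteq> 0} \<union> {i. coord y i \<noteq> 0})" by (simp add: finite_support)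
  have "inner x y = (\<Sum>i\<in>{i. coord x i \<noteq> 0} \<union> {i. coord y i \<noteq> 0}. coord x i * coord y i)"
    using xyz by (intro inner_fvec_superset) auto
  moreover have "inner y x = (\<Sum>i\<in>{i. coord x i \<noteq> 0} \<union> {i. coord y i \<noteq> 0}. coord y i * coord x i)"
    using xyz by (intro inner_fvec_superset) auto
  ultimately show "inner x y = inner y x" by (simp add: mult.commute)
  have "inner (x + y) z = (\<Sum>i\<in>{i. coord x i \<noteq> 0} \<union> {i. coord y i \<noteq> 0}. coord (x + y) i * coord z i)"
    using xyz by (intro inner_fvec_superset) (auto simp: coord_plus')
  moreover have "inner x z = (\<Sum>i\<in>{i. coord x i \<noteq> 0} \<union> {i. coord y i \<noteq> 0}. coord x i * coord z i)"
    using xyz by (intro inner_fvec_superset) auto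
  moreover have "inner y z = (\<Sum>i\<in>{i. coord x i \<noteq> 0} \<union> {i. coord y i \<noteq> 0}. coord y i * coord z i)"
    using xyz by (intro inner_fvec_superset) auto
  ultimately show "inner (x + y) z = inner x z + inner y z"
    by (simp add: coord_plus' algebra_simps sum.distrib)
  have "inner (a *\<^sub>R x) y = (\<Sum>i\<in>{i. coord x i \<noteq> 0}. coord (a *\<^sub>R x) i * coord y i)"
    by (intro inner_fvec_superset) (auto simp: coord_scaleR' finite_support)
  thus "inner (a *\<^sub>R x) y = a * inner x y"
    by (simp add: inner_fvec_def coord_scaleR' sum_distrib_left mult.assoc)
  show "0 \<le> inner x x" unfolding inner_fvec_def by (intro sum_nonneg) simp
  show "(inner x x = 0) = (x = 0)"
  proof
    assume "inner x x = 0"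
    hence "\<forall>i\<in>{i. coord x i \<noteq> 0}. coord x i * coord x i = 0"
      unfolding inner_fvec_def by (subst (asm) sum_nonneg_eq_0_iff) (auto simp: finite_support)
    thus "x = 0" by (intro fvec_eqI) (auto simp: coord_zero')
  qed (simp add: inner_fvec_def coord_zero')
qed (simp_all add: norm_fvec_def sgn_fvec_def dist_fvec_def uniformity_fvec_def open_fvec_def)

end

lemmas coord_simps = coord_zero' coord_plus' coord_minus' coord_scaleR'

lemma coord_sum: "coord (sum f A) i = (\<Sum>a\<in>A. coord (f a) i)"
  by (induction A rule: infinite_finite_induct) (simp_all add: coord_simps)

definition fvec_of :: "nat \<Rightarrow> (nat \<Rightarrow> real) \<Rightarrow> fvec" where
  "fvec_of d f = Fvec (\<lambda>i. if i < d then f i else 0)"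

lemma coord_fvec_of: "coord (fvec_of d f) i = (if i < d then f i else 0)"
proof -
  have "finite {i. (if i < d then f i else 0) \<noteq> 0}"
    by (rule finite_subset[of _ "{..<d}"]) auto
  thus ?thesis by (simp add: fvec_of_def coord_Fvec)
qed

lemma inner_fvec_of: "inner (fvec_of d f) x = (\<Sum>i<d. f i * coord x i)"
proof -
  have "inner (fvec_of d f) x = (\<Sum>i\<in>{..<d}. coord (fvec_of d f) i * coord x i)"
    by (intro inner_fvec_superset) (auto simp: coord_fvec_of split: if_splits)
  thus ?thesis by (simp add: coord_fvec_of)
qed

lemma norm_fvec_of: "(norm (fvec_of d f))\<^sup>2 = (\<Sum>i<d. (f i)\<^sup>2)"
  unfolding power2_norm_eq_inner inner_fvec_of by (simp add: coord_fvec_of power2_eq_square)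

lemma norm_fvec_of_coord_le: "norm (fvec_of d (coord x)) \<le> norm x"
proof -
  let ?y = "fvec_of d (coord x)"
  have "(norm ?y)\<^sup>2 = inner ?y x"
    unfolding norm_fvec_of inner_fvec_of by (simp add: power2_eq_square)
  also have "\<dots> \<le> norm ?y * norm x" by (rule norm_cauchy_schwarz)
  finally have "norm ?y * norm ?y \<le> norm ?y * norm x" by (simp add: power2_eq_square)
  thus ?thesis by (cases "norm ?y = 0") (auto simp: mult_le_cancel_left)
qed

lemma fvec_of_spanned:
  "spanned_by_frame ((\<lambda>k. fvec_of d (\<lambda>i. if i = k then 1 else 0)) ` {..<d}) (fvec_of d f)"
proof -
  let ?e = "\<lambda>k. fvec_of d (\<lambda>i. if i = k then 1 else 0)"
  have ce: "coord (?e k) i = (if i = k \<and> k < d then 1 else 0)" for i k by (auto simp: coord_fvec_of)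
  have inj: "inj_on ?e {..<d}"
  proof (rule inj_onI)
    fix k l assume "k \<in> {..<d}" "?e k = ?e l"
    hence "coord (?e l) k = 1" using ce[of k k] by simp
    thus "k = l" by (simp add: ce split: if_splits)
  qed
  have inn: "inner (fvec_of d f) (?e k) = f k" if "k < d" for k
  proof -
    have "inner (fvec_of d f) (?e k) = (\<Sum>i<d. if i = k then f i else 0)"
      unfolding inner_fvec_of using that by (intro sum.cong) (auto simp: ce)
    thus ?thesis using that by simp
  qed
  have "fvec_of d f = (\<Sum>k<d. f k *\<^sub>R ?e k)"
  proof (rule fvec_eqI)
    fix i
    have "coord (\<Sum>k<d. f k *\<^sub>R ?e k) i = (\<Sum>k<d. if i = k then f k else 0)"
      unfolding coord_sum coord_scaleR' ce by (intro sum.cong) auto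
    thus "coord (fvec_of d f) i = coord (\<Sum>k<d. f k *\<^sub>R ?e k) i" by (simp add: coord_fvec_of)
  qed
  also have "\<dots> = (\<Sum>e\<in>?e ` {..<d}. inner (fvec_of d f) e *\<^sub>R e)"
    using inj by (simp add: sum.reindex inn)
  finally show ?thesis unfolding spanned_by_frame_def .
qed

section \<open>Matrix norms\<close>

lemma fro_norm_nonneg: "0 \<le> fro_norm M"
  by (simp add: fro_norm_def sum_nonneg)

lemma fro_norm_sq: "(fro_norm M)\<^sup>2 = (\<Sum>i<dim_row M. \<Sum>j<dim_col M. (M $$ (i, j))\<^sup>2)"
  by (simp add: fro_norm_def sum_nonneg)

lemma vec_norm2_sq: "(vec_norm2 x)\<^sup>2 = (\<Sum>i<dim_vec x. (x $ i)\<^sup>2)"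
  by (simp add: vec_norm2_def scalar_prod_def sum_nonneg lessThan_atLeast0 power2_eq_square)

lemma vec_norm2_nonneg: "0 \<le> vec_norm2 x"
  by (simp add: vec_norm2_def scalar_prod_def sum_nonneg)

lemma spectral_norm_le:
  assumes "0 \<le> c" and "\<And>x. x \<in> carrier_vec (dim_col M) \<Longrightarrow> vec_norm2 (M *\<^sub>v x) \<le> c * vec_norm2 x"
  shows "spectral_norm M \<le> c"
  unfolding spectral_norm_def
proof (rule cSUP_least)
  have "vec_norm2 (0\<^sub>v (dim_col M)) = 0" by (simp add: vec_norm2_def)
  thus "{x \<in> carrier_vec (dim_col M). vec_norm2 x \<le> 1} \<noteq> {}" by (auto intro!: exI[of _ "0\<^sub>v (dim_col M)"])
next
  fix x assume x: "x \<in> {x \<in> carrier_vec (dim_col M). vec_norm2 x \<le> 1}"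
  hence "vec_norm2 (M *\<^sub>v x) \<le> c * vec_norm2 x" using assms by auto
  also have "\<dots> \<le> c * 1" using x assms by (intro mult_left_mono) auto
  finally show "vec_norm2 (M *\<^sub>v x) \<le> c" by simp
qed

lemma mult_mat_vec_entry:
  "i < dim_row M \<Longrightarrow> dim_vec x = dim_col M \<Longrightarrow> (M *\<^sub>v x) $ i = (\<Sum>j<dim_col M. M $$ (i, j) * x $ j)"
  by (simp add: scalar_prod_def lessThan_atLeast0)

lemma mult_mat_entry:
  "i < dim_row M \<Longrightarrow> j < dim_col L \<Longrightarrow> dim_row L = dim_col M \<Longrightarrow>
    (M * L) $$ (i, j) = (\<Sum>k<dim_col M. M $$ (i, k) * L $$ (k, j))"
  by (simp add: scalar_prod_def lessThan_atLeast0)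

lemma vec_norm2_mult_le_fro:
  assumes "x \<in> carrier_vec (dim_col M)"
  shows "vec_norm2 (M *\<^sub>v x) \<le> fro_norm M * vec_norm2 x"
proof (rule power2_le_imp_le)
  have "(vec_norm2 (M *\<^sub>v x))\<^sup>2 = (\<Sum>i<dim_row M. (\<Sum>j<dim_col M. M $$ (i, j) * x $ j)\<^sup>2)"
    unfolding vec_norm2_sq using assms
    by (intro sum.cong) (simp_all add: mult_mat_vec_entry del: index_mult_mat_vec)
  also have "\<dots> \<le> (\<Sum>i<dim_row M. (\<Sum>j<dim_col M. (M $$ (i, j))\<^sup>2) * (\<Sum>j<dim_col M. (x $ j)\<^sup>2))"
    by (intro sum_mono Cauchy_Schwarz_ineq_sum)
  also have "\<dots> = (fro_norm M * vec_norm2 x)\<^sup>2"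
    using assms by (simp add: power_mult_distrib fro_norm_sq vec_norm2_sq sum_distrib_right)
  finally show "(vec_norm2 (M *\<^sub>v x))\<^sup>2 \<le> (fro_norm M * vec_norm2 x)\<^sup>2" .
  show "0 \<le> fro_norm M * vec_norm2 x" by (intro mult_nonneg_nonneg fro_norm_nonneg vec_norm2_nonneg)
qed

lemma spectral_norm_le_fro: "spectral_norm M \<le> fro_norm M"
  by (intro spectral_norm_le fro_norm_nonneg vec_norm2_mult_le_fro)

lemma spectral_norm_bound:
  assumes x: "x \<in> carrier_vec (dim_col M)"
  shows "vec_norm2 (M *\<^sub>v x) \<le> spectral_norm M * vec_norm2 x"
proof (cases "vec_norm2 x = 0")
  case True
  hence "vec_norm2 (M *\<^sub>v x) \<le> 0" using vec_norm2_mult_le_fro[OF x] by simp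
  thus ?thesis using True by simp
next
  case False
  hence pos: "0 < vec_norm2 x" using vec_norm2_nonneg[of x] by simp
  let ?y = "(1 / vec_norm2 x) \<cdot>\<^sub>v x"
  have norm_smult: "vec_norm2 (c \<cdot>\<^sub>v y) = \<bar>c\<bar> * vec_norm2 y" for c y
  proof -
    have "(vec_norm2 (c \<cdot>\<^sub>v y))\<^sup>2 = (\<bar>c\<bar> * vec_norm2 y)\<^sup>2"
      by (simp add: power_mult_distrib vec_norm2_sq sum_distrib_left)
    thus ?thesis by (simp add: power2_eq_iff_nonneg vec_norm2_nonneg)
  qed
  have y: "?y \<in> {x \<in> carrier_vec (dim_col M). vec_norm2 x \<le> 1}"
    using x pos by (simp add: norm_smult)
  have "bdd_above ((\<lambda>x. vec_norm2 (M *\<^sub>v x)) ` {x \<in> carrier_vec (dim_col M). vec_norm2 x \<le> 1})"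
  proof (rule bdd_aboveI2)
    fix x assume x: "x \<in> {x \<in> carrier_vec (dim_col M). vec_norm2 x \<le> 1}"
    hence "vec_norm2 (M *\<^sub>v x) \<le> fro_norm M * vec_norm2 x" by (intro vec_norm2_mult_le_fro) auto
    also have "\<dots> \<le> fro_norm M * 1" using x by (intro mult_left_mono fro_norm_nonneg) auto
    finally show "vec_norm2 (M *\<^sub>v x) \<le> fro_norm M" by simp
  qed
  hence "vec_norm2 (M *\<^sub>v ?y) \<le> spectral_norm M"
    unfolding spectral_norm_def by (intro cSUP_upper y)
  moreover have "M *\<^sub>v ?y = (1 / vec_norm2 x) \<cdot>\<^sub>v (M *\<^sub>v x)"
    using x by (intro mult_mat_vec) auto
  ultimately show ?thesis using pos by (simp add: norm_smult field_simps)
qed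

lemma vec_norm2_add_le:
  assumes "x \<in> carrier_vec n" "y \<in> carrier_vec n"
  shows "vec_norm2 (x + y) \<le> vec_norm2 x + vec_norm2 y"
proof -
  have nf: "vec_norm2 z = norm (fvec_of n (\<lambda>i. z $ i))" if "z \<in> carrier_vec n" for z
  proof -
    have "(vec_norm2 z)\<^sup>2 = (norm (fvec_of n (\<lambda>i. z $ i)))\<^sup>2"
      using that by (simp add: vec_norm2_sq norm_fvec_of)
    thus ?thesis by (simp add: power2_eq_iff_nonneg vec_norm2_nonneg)
  qed
  have "fvec_of n (\<lambda>i. (x + y) $ i) = fvec_of n (\<lambda>i. x $ i) + fvec_of n (\<lambda>i. y $ i)"
    using assms by (intro fvec_eqI) (auto simp: coord_simps coord_fvec_of)
  thus ?thesis using assms by (simp add: nf norm_triangle_ineq)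
qed

lemma spectral_norm_add_le:
  assumes "M \<in> carrier_mat m n" "L \<in> carrier_mat m n"
  shows "spectral_norm (M + L) \<le> spectral_norm M + spectral_norm L"
proof (rule spectral_norm_le)
  have pos: "0 \<le> spectral_norm K" for K
  proof -
    have "vec_norm2 (K *\<^sub>v 0\<^sub>v (dim_col K)) \<le> spectral_norm K"
      unfolding spectral_norm_def
    proof (rule cSUP_upper)
      show "0\<^sub>v (dim_col K) \<in> {x \<in> carrier_vec (dim_col K). vec_norm2 x \<le> 1}" by (simp add: vec_norm2_def)
      show "bdd_above ((\<lambda>x. vec_norm2 (K *\<^sub>v x)) ` {x \<in> carrier_vec (dim_col K). vec_norm2 x \<le> 1})"
      proof (rule bdd_aboveI2)
        fix x assume x: "x \<in> {x \<in> carrier_vec (dim_col K). vec_norm2 x \<le> 1}"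
        hence "vec_norm2 (K *\<^sub>v x) \<le> fro_norm K * vec_norm2 x" by (intro vec_norm2_mult_le_fro) auto
        also have "\<dots> \<le> fro_norm K * 1" using x by (intro mult_left_mono fro_norm_nonneg) auto
        finally show "vec_norm2 (K *\<^sub>v x) \<le> fro_norm K" by simp
      qed
    qed
    thus ?thesis using vec_norm2_nonneg order_trans by blast
  qed
  thus "0 \<le> spectral_norm M + spectral_norm L" by (intro add_nonneg_nonneg)
  fix x :: "real vec" assume "x \<in> carrier_vec (dim_col (M + L))"
  hence x: "x \<in> carrier_vec n" using assms by simp
  have "vec_norm2 ((M + L) *\<^sub>v x) = vec_norm2 (M *\<^sub>v x + L *\<^sub>v x)"
    using assms x by (simp add: add_mult_distrib_mat_vec)
  also have "\<dots> \<le> vec_norm2 (M *\<^sub>v x) + vec_norm2 (L *\<^sub>v x)"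
    using assms x by (intro vec_norm2_add_le[of _ m]) auto
  also have "\<dots> \<le> spectral_norm M * vec_norm2 x + spectral_norm L * vec_norm2 x"
    using assms x by (intro add_mono spectral_norm_bound) auto
  finally show "vec_norm2 ((M + L) *\<^sub>v x) \<le> (spectral_norm M + spectral_norm L) * vec_norm2 x"
    by (simp add: algebra_simps)
qed

lemma fro_norm_add_le:
  assumes "M \<in> carrier_mat m n" "L \<in> carrier_mat m n"
  shows "fro_norm (M + L) \<le> fro_norm M + fro_norm L"
proof -
  have "L2_set (\<lambda>ij. M $$ ij + L $$ ij) ({..<m} \<times> {..<n}) \<le>
      L2_set (\<lambda>ij. M $$ ij) ({..<m} \<times> {..<n}) + L2_set (\<lambda>ij. L $$ ij) ({..<m} \<times> {..<n})"
    by (rule L2_set_triangle_ineq)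
  moreover have "fro_norm K = L2_set (\<lambda>ij. K $$ ij) ({..<m} \<times> {..<n})" if "K \<in> carrier_mat m n" for K
    using that by (simp add: fro_norm_def L2_set_def sum.cartesian_product case_prod_unfold)
  moreover have "L2_set (\<lambda>ij. (M + L) $$ ij) ({..<m} \<times> {..<n}) = L2_set (\<lambda>ij. M $$ ij + L $$ ij) ({..<m} \<times> {..<n})"
    using assms by (intro L2_set_cong) auto
  ultimately show ?thesis using assms by simp
qed

section \<open>Second moments of the sketches\<close>

declare index_mult_mat(1) [simp del]

lemma gram_assoc:
  fixes S U V :: "real mat"
  assumes "S \<in> carrier_mat m n" "U \<in> carrier_mat n a" "V \<in> carrier_mat n b"
  shows "U\<^sup>T * S\<^sup>T * S * V = (S * U)\<^sup>T * (S * V)"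
proof -
  have "U\<^sup>T * S\<^sup>T = (S * U)\<^sup>T" using assms by (simp add: transpose_mult)
  moreover have "(S * U)\<^sup>T * S * V = (S * U)\<^sup>T * (S * V)"
    using assms by (intro assoc_mult_mat[where n\<^sub>1 = a and n\<^sub>2 = m and n\<^sub>3 = n and n\<^sub>4 = b]) auto
  ultimately show ?thesis by simp
qed

lemma transpose_mult_entry:
  fixes U V :: "real mat"
  assumes "U \<in> carrier_mat n a" "V \<in> carrier_mat n b" "x < a" "y < b"
  shows "(U\<^sup>T * V) $$ (x, y) = (\<Sum>i<n. U $$ (i, x) * V $$ (i, y))"
  using assms by (simp add: mult_mat_entry del: index_mult_mat(1))

lemma gram_entry:
  fixes S U V :: "real mat"
  assumes "S \<in> carrier_mat m n" "U \<in> carrier_mat n a" "V \<in> carrier_mat n b" "x < a" "y < b"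
  shows "(U\<^sup>T * S\<^sup>T * S * V) $$ (x, y) = (\<Sum>t<m. (S * U) $$ (t, x) * (S * V) $$ (t, y))"
  unfolding gram_assoc[OF assms(1-3)] using assms by (intro transpose_mult_entry) auto

lemma fro_norm_sq_col_row:
  assumes "M \<in> carrier_mat n a"
  shows "(fro_norm M)\<^sup>2 = (\<Sum>x<a. \<Sum>i<n. (M $$ (i, x))\<^sup>2)"
  using assms by (subst sum.swap) (simp add: fro_norm_sq)

lemma expectation_pair_finite:
  fixes F :: "'a \<times> 'b \<Rightarrow> real"
  assumes "finite (set_pmf p)" "finite (set_pmf q)"
  shows "measure_pmf.expectation (pair_pmf p q) F =
    measure_pmf.expectation p (\<lambda>x. measure_pmf.expectation q (\<lambda>y. F (x, y)))"
  using assms by (simp add: pair_pmf_def expectation_bind_finite)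

text \<open>Second moments of this product form sum to the product of the two squared Frobenius
  norms. Both sketches can thus be treated one entry at a time.\<close>

lemma expectation_error_fro_le:
  fixes G :: "'w \<Rightarrow> real mat" and U V :: "real mat"
  assumes fin: "finite (set_pmf P)" and U: "U \<in> carrier_mat n a" and V: "V \<in> carrier_mat n b"
    and G: "\<And>w. w \<in> set_pmf P \<Longrightarrow> G w \<in> carrier_mat a b"
    and entry: "\<And>x y. x < a \<Longrightarrow> y < b \<Longrightarrow> measure_pmf.expectation P (\<lambda>w. (G w $$ (x, y) - E $$ (x, y))\<^sup>2)
      \<le> \<kappa> * ((\<Sum>i<n. (U $$ (i, x))\<^sup>2) * (\<Sum>i<n. (V $$ (i, y))\<^sup>2))"
    and E: "E \<in> carrier_mat a b"
  shows "measure_pmf.expectation P (\<lambda>w. (fro_norm (G w - E))\<^sup>2) \<le> \<kappa> * ((fro_norm U)\<^sup>2 * (fro_norm V)\<^sup>2)"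
proof -
  have "measure_pmf.expectation P (\<lambda>w. (fro_norm (G w - E))\<^sup>2) =
      measure_pmf.expectation P (\<lambda>w. \<Sum>x<a. \<Sum>y<b. (G w $$ (x, y) - E $$ (x, y))\<^sup>2)"
    using G E by (intro expectation_cong_pmf) (auto simp: fro_norm_sq)
  also have "\<dots> = (\<Sum>x<a. \<Sum>y<b. measure_pmf.expectation P (\<lambda>w. (G w $$ (x, y) - E $$ (x, y))\<^sup>2))"
    using fin by (simp add: expectation_sum_finite)
  also have "\<dots> \<le> (\<Sum>x<a. \<Sum>y<b. \<kappa> * ((\<Sum>i<n. (U $$ (i, x))\<^sup>2) * (\<Sum>i<n. (V $$ (i, y))\<^sup>2)))"
    by (intro sum_mono entry) auto
  also have "\<dots> = \<kappa> * ((fro_norm U)\<^sup>2 * (fro_norm V)\<^sup>2)"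
    unfolding fro_norm_sq_col_row[OF U] fro_norm_sq_col_row[OF V] sum_product
    by (simp only: sum_distrib_left)
  finally show ?thesis .
qed

subsection \<open>Sparse embeddings\<close>

definition embedding_mat :: "nat \<Rightarrow> nat \<Rightarrow> (nat \<Rightarrow> nat \<times> real) \<Rightarrow> real mat" where
  "embedding_mat m n c = mat m n (\<lambda>(i, j). if i = fst (c j) then snd (c j) else 0)"

definition column_pmf :: "nat \<Rightarrow> (nat \<times> real) pmf" where
  "column_pmf m = pair_pmf (pmf_of_set {..<m}) (pmf_of_set {-1, 1})"

lemma sparse_embedding_alt:
  "sparse_embedding_pmf m n = map_pmf (embedding_mat m n) (Pi_pmf {..<n} (0, 0) (\<lambda>_. column_pmf m))"
  unfolding sparse_embedding_pmf_def column_pmf_def embedding_mat_def[abs_def] ..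

lemma embedding_carrier: "embedding_mat m n c \<in> carrier_mat m n"
  by (simp add: embedding_mat_def)

lemma finite_column_pmf: "0 < m \<Longrightarrow> finite (set_pmf (column_pmf m))"
  by (simp add: column_pmf_def lessThan_empty_iff)

lemma finite_sparse_embedding: "0 < m \<Longrightarrow> finite (set_pmf (sparse_embedding_pmf m n))"
  by (simp add: sparse_embedding_alt finite_set_Pi_pmf finite_column_pmf)

lemma expectation_column:
  fixes F :: "nat \<times> real \<Rightarrow> real"
  assumes "0 < m"
  shows "measure_pmf.expectation (column_pmf m) F = (\<Sum>h<m. (F (h, -1) + F (h, 1)) / 2) / real m"
proof -
  have "{..<m} \<noteq> {}" using assms by auto
  thus ?thesis
    unfolding column_pmf_def
    by (subst expectation_pair_finite)
      (simp_all add: expectation_sign integral_pmf_of_set sum.distrib flip: sum_divide_distrib)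
qed

text \<open>The inner product of two columns of the embedding, each given by its row and its
  sign.\<close>

definition collision_kernel :: "nat \<times> real \<Rightarrow> nat \<times> real \<Rightarrow> real" where
  "collision_kernel x y = (if fst x = fst y then snd x * snd y else 0)"

lemma embedding_mult_entry:
  assumes "U \<in> carrier_mat n a" "t < m" "x < a"
  shows "(embedding_mat m n c * U) $$ (t, x) = (\<Sum>i<n. U $$ (i, x) * (if t = fst (c i) then snd (c i) else 0))"
proof -
  have "(embedding_mat m n c * U) $$ (t, x) = (\<Sum>i<n. embedding_mat m n c $$ (t, i) * U $$ (i, x))"
    using assms by (subst mult_mat_entry) (auto simp: embedding_mat_def)
  thus ?thesis using assms by (simp add: embedding_mat_def mult.commute)
qed

text \<open>Every column of the embedding has norm one, so equal indices reproduce the exact product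
  and the error is a degenerate chaos over pairs of distinct columns.\<close>

lemma embedding_gram_entry:
  assumes U: "U \<in> carrier_mat n a" and V: "V \<in> carrier_mat n b" and xy: "x < a" "y < b"
    and c: "\<And>i. i < n \<Longrightarrow> fst (c i) < m \<and> snd (c i) * snd (c i) = 1"
    and S_def: "S = embedding_mat m n c"
  shows "(U\<^sup>T * S\<^sup>T * S * V) $$ (x, y) = (U\<^sup>T * V) $$ (x, y) +
    (\<Sum>i<n. \<Sum>j\<in>{..<n} - {i}. (U $$ (i, x) * V $$ (j, y)) * collision_kernel (c i) (c j))"
proof -
  have S: "S \<in> carrier_mat m n" by (simp add: S_def embedding_carrier)
  let ?u = "\<lambda>t i. U $$ (i, x) * (if t = fst (c i) then snd (c i) else 0)"
  let ?v = "\<lambda>t i. V $$ (i, y) * (if t = fst (c i) then snd (c i) else 0)"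
  have pair: "(\<Sum>t<m. ?u t i * ?v t j) = (U $$ (i, x) * V $$ (j, y)) * collision_kernel (c i) (c j)"
    if "i < n" for i j
  proof -
    have "(\<Sum>t<m. ?u t i * ?v t j) =
        (\<Sum>t<m. if t = fst (c i) then (U $$ (i, x) * V $$ (j, y)) * collision_kernel (c i) (c j) else 0)"
      by (intro sum.cong) (auto simp: collision_kernel_def)
    thus ?thesis using c[OF that] by simp
  qed
  have "(U\<^sup>T * S\<^sup>T * S * V) $$ (x, y) = (\<Sum>t<m. (\<Sum>i<n. ?u t i) * (\<Sum>j<n. ?v t j))"
    unfolding gram_entry[OF S U V xy] unfolding S_def using U V xy
    by (intro sum.cong refl) (simp only: embedding_mult_entry lessThan_iff)
  also have "\<dots> = (\<Sum>t<m. \<Sum>i<n. \<Sum>j<n. ?u t i * ?v t j)" by (simp only: sum_product)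
  also have "\<dots> = (\<Sum>i<n. \<Sum>j<n. \<Sum>t<m. ?u t i * ?v t j)"
    by (subst sum.swap) (intro sum.cong refl sum.swap)
  also have "\<dots> = (\<Sum>i<n. \<Sum>j<n. (U $$ (i, x) * V $$ (j, y)) * collision_kernel (c i) (c j))"
    by (intro sum.cong refl pair) simp
  also have "\<dots> = (\<Sum>i<n. U $$ (i, x) * V $$ (i, y) +
      (\<Sum>j\<in>{..<n} - {i}. (U $$ (i, x) * V $$ (j, y)) * collision_kernel (c i) (c j)))"
  proof (intro sum.cong refl)
    fix i assume i: "i \<in> {..<n}"
    thus "(\<Sum>j<n. (U $$ (i, x) * V $$ (j, y)) * collision_kernel (c i) (c j)) = U $$ (i, x) * V $$ (i, y) +
      (\<Sum>j\<in>{..<n} - {i}. (U $$ (i, x) * V $$ (j, y)) * collision_kernel (c i) (c j))"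
      using c[of i] by (subst sum.remove[OF _ i]) (auto simp: collision_kernel_def)
  qed
  finally show ?thesis by (simp only: sum.distrib transpose_mult_entry[OF U V xy])
qed

lemma column_support:
  fixes n :: nat
  assumes "0 < m" "c \<in> set_pmf (Pi_pmf {..<n} (0, 0) (\<lambda>_. column_pmf m))" "i < n"
  shows "fst (c i) < m \<and> snd (c i) * snd (c i) = 1"
proof -
  have "c i \<in> set_pmf (column_pmf m)"
    using assms(2,3) unfolding set_Pi_pmf[OF finite_lessThan] by (auto simp: PiE_dflt_def)
  moreover have "{..<m} \<noteq> {}" using assms by auto
  ultimately show ?thesis by (auto simp: column_pmf_def)
qed

text \<open>Two columns collide with probability \<open>1 / m\<close>, the mean square of the
  kernel. For \<open>U = V\<close> this Frobenius error also controls the spectral error; the price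
  is the square of the statistical dimension in \<open>m1\<close>, the gain is that no matrix
  concentration enters the first stage.\<close>

lemma sparse_embedding_product:
  assumes m: "0 < m" and U: "U \<in> carrier_mat n a" and V: "V \<in> carrier_mat n b"
  shows "measure_pmf.expectation (sparse_embedding_pmf m n) (\<lambda>S. (fro_norm (U\<^sup>T * S\<^sup>T * S * V - U\<^sup>T * V))\<^sup>2)
    \<le> 2 / real m * ((fro_norm U)\<^sup>2 * (fro_norm V)\<^sup>2)"
proof -
  let ?P = "Pi_pmf {..<n} (0, 0) (\<lambda>_. column_pmf m)"
  let ?S = "embedding_mat m n"
  note finq = finite_column_pmf[OF m]
  have finP: "finite (set_pmf ?P)" using finq by (intro finite_set_Pi_pmf) auto
  have mean: "measure_pmf.expectation (column_pmf m) (collision_kernel y) = 0" for y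
    unfolding expectation_column[OF m] by (auto simp: collision_kernel_def intro!: sum.neutral)
  have var: "measure_pmf.expectation (column_pmf m) (\<lambda>y. measure_pmf.expectation (column_pmf m)
      (\<lambda>x. (collision_kernel x y)\<^sup>2)) = 1 / real m"
  proof -
    have "((collision_kernel (h, -1) (h', s))\<^sup>2 + (collision_kernel (h, 1) (h', s))\<^sup>2) / 2 =
      (if h = h' then 1 else 0)" if "s\<^sup>2 = 1" for h h' s
      using that by (simp add: collision_kernel_def power_mult_distrib)
    hence "measure_pmf.expectation (column_pmf m) (\<lambda>x. (collision_kernel x (h', s))\<^sup>2) = 1 / real m"
      if "h' < m" "s\<^sup>2 = 1" for h' s
      using that unfolding expectation_column[OF m] by simp
    thus ?thesis using m unfolding expectation_column[OF m, of "\<lambda>y. measure_pmf.expectation _ (\<lambda>x. (collision_kernel x y)\<^sup>2)"]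
      by simp
  qed
  have "measure_pmf.expectation ?P (\<lambda>c. (fro_norm (U\<^sup>T * (?S c)\<^sup>T * ?S c * V - U\<^sup>T * V))\<^sup>2)
    \<le> 2 / real m * ((fro_norm U)\<^sup>2 * (fro_norm V)\<^sup>2)"
  proof (rule expectation_error_fro_le[OF finP U V])
    show "U\<^sup>T * (?S c)\<^sup>T * ?S c * V \<in> carrier_mat a b" for c
      using U V embedding_carrier[of m n c] by (intro mult_carrier_mat) auto
    show "U\<^sup>T * V \<in> carrier_mat a b" using U V by auto
    fix x y assume xy: "x < a" "y < b"
    have "measure_pmf.expectation ?P (\<lambda>c. ((U\<^sup>T * (?S c)\<^sup>T * ?S c * V) $$ (x, y) - (U\<^sup>T * V) $$ (x, y))\<^sup>2) =
      measure_pmf.expectation ?P (\<lambda>c. (\<Sum>i<n. \<Sum>j\<in>{..<n} - {i}.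
        (U $$ (i, x) * V $$ (j, y)) * collision_kernel (c i) (c j))\<^sup>2)"
      by (intro expectation_cong_pmf)
        (subst embedding_gram_entry[OF U V xy _ refl], use column_support[OF m] in auto)
    also have "\<dots> \<le> 2 * (1 / real m) * (\<Sum>i<n. \<Sum>j\<in>{..<n} - {i}. (U $$ (i, x) * V $$ (j, y))\<^sup>2)"
      unfolding var[symmetric]
      by (rule second_moment_chaos[OF finq _ mean]) (simp_all add: collision_kernel_def)
    also have "\<dots> \<le> 2 * (1 / real m) * (\<Sum>i<n. \<Sum>j<n. (U $$ (i, x) * V $$ (j, y))\<^sup>2)"
      by (intro mult_left_mono sum_mono sum_mono2) auto
    also have "\<dots> = 2 / real m * ((\<Sum>i<n. (U $$ (i, x))\<^sup>2) * (\<Sum>i<n. (V $$ (i, y))\<^sup>2))"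
      by (simp add: power_mult_distrib sum_product)
    finally show "measure_pmf.expectation ?P (\<lambda>c. ((U\<^sup>T * (?S c)\<^sup>T * ?S c * V) $$ (x, y) - (U\<^sup>T * V) $$ (x, y))\<^sup>2) \<le>
      2 / real m * ((\<Sum>i<n. (U $$ (i, x))\<^sup>2) * (\<Sum>i<n. (V $$ (i, y))\<^sup>2))" .
  qed
  thus ?thesis by (simp add: sparse_embedding_alt)
qed

text \<open>Exactness on average lets Markov's inequality bound the matrices handed to the second
  stage, up to a factor \<open>1 / \<delta>\<close> in the squared norm.\<close>

lemma sparse_embedding_fro:
  assumes m: "0 < m" and U: "U \<in> carrier_mat n a"
  shows "measure_pmf.expectation (sparse_embedding_pmf m n) (\<lambda>S. (fro_norm (S * U))\<^sup>2) = (fro_norm U)\<^sup>2"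
proof -
  let ?P = "Pi_pmf {..<n} (0, 0) (\<lambda>_. column_pmf m)"
  note finq = finite_column_pmf[OF m]
  have finP: "finite (set_pmf ?P)" using finq by (intro finite_set_Pi_pmf) auto
  let ?f = "\<lambda>t z :: nat \<times> real. if t = fst z then snd z else 0"
  have entry: "measure_pmf.expectation ?P (\<lambda>c. ((embedding_mat m n c * U) $$ (t, x))\<^sup>2) =
      (\<Sum>i<n. (U $$ (i, x))\<^sup>2) / real m" if "t < m" "x < a" for t x
  proof -
    have "measure_pmf.expectation (column_pmf m) (?f t) = 0"
      unfolding expectation_column[OF m] by (auto intro!: sum.neutral)
    moreover have "measure_pmf.expectation (column_pmf m) (\<lambda>z. (?f t z)\<^sup>2) = 1 / real m"
    proof -
      have "((?f t (h, -1))\<^sup>2 + (?f t (h, 1))\<^sup>2) / 2 = (if t = h then 1 else 0)" for h by simp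
      thus ?thesis unfolding expectation_column[OF m] using that by simp
    qed
    ultimately show ?thesis
      using second_moment_linear[OF finq, of "?f t" "{..<n}" "(0, 0)" "\<lambda>i. U $$ (i, x)"] that
      by (simp add: embedding_mult_entry[OF U])
  qed
  have "measure_pmf.expectation ?P (\<lambda>c. (fro_norm (embedding_mat m n c * U))\<^sup>2) =
      measure_pmf.expectation ?P (\<lambda>c. \<Sum>t<m. \<Sum>x<a. ((embedding_mat m n c * U) $$ (t, x))\<^sup>2)"
    using U by (simp add: fro_norm_sq embedding_mat_def)
  also have "\<dots> = (\<Sum>t<m. \<Sum>x<a. (\<Sum>i<n. (U $$ (i, x))\<^sup>2) / real m)"
    unfolding expectation_sum_finite[OF finP] by (intro sum.cong refl) (simp only: entry lessThan_iff)
  also have "\<dots> = (fro_norm U)\<^sup>2"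
    using m unfolding fro_norm_sq_col_row[OF U] by (simp flip: sum_divide_distrib)
  finally show ?thesis by (simp add: sparse_embedding_alt)
qed

subsection \<open>Subsampled randomized Hadamard transforms\<close>

definition srht_mat :: "nat \<Rightarrow> nat \<Rightarrow> (nat \<Rightarrow> real) \<Rightarrow> (nat \<Rightarrow> nat) \<Rightarrow> real mat" where
  "srht_mat m N sg r = sqrt (real N / real m) \<cdot>\<^sub>m (mat m N (\<lambda>(i, j). if j = r i then 1 else 0) *
     walsh_hadamard N * mat N N (\<lambda>(i, j). if i = j then sg i else 0))"

lemma srht_pmf_alt:
  "srht_pmf m N = bind_pmf (rademacher {..<N}) (\<lambda>sg.
    map_pmf (srht_mat m N sg) (Pi_pmf {..<m} 0 (\<lambda>_. pmf_of_set {..<N})))"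
  by (simp add: srht_pmf_def rademacher_def map_pmf_def srht_mat_def Let_def)

lemma srht_carrier: "srht_mat m N sg r \<in> carrier_mat m N"
  by (intro carrier_matI) (simp_all add: srht_mat_def)

lemma finite_rows_pmf:
  assumes "0 < N"
  shows "finite (set_pmf (Pi_pmf {..<m :: nat} 0 (\<lambda>_. pmf_of_set {..<N :: nat})))"
proof -
  have "{..<N} \<noteq> {}" using assms by auto
  thus ?thesis by (intro finite_set_Pi_pmf) auto
qed

lemma rows_support:
  fixes m N :: nat
  assumes "0 < N" "r \<in> set_pmf (Pi_pmf {..<m} 0 (\<lambda>_. pmf_of_set {..<N}))" "i < m"
  shows "r i < N"
proof -
  have "{..<N} \<noteq> {}" using assms by auto
  thus ?thesis using assms by (auto simp: set_Pi_pmf PiE_dflt_def)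
qed

lemma rademacher_support:
  assumes "finite I" "s \<in> set_pmf (rademacher I)" "i \<in> I"
  shows "s i * s i = 1"
  using assms by (auto simp: rademacher_def set_Pi_pmf PiE_dflt_def)

lemma finite_srht: "0 < N \<Longrightarrow> finite (set_pmf (srht_pmf m N))"
  by (simp add: srht_pmf_alt finite_rademacher finite_rows_pmf)

lemma srht_entry:
  assumes "i < m" "j < N" "r i < N"
  shows "srht_mat m N sg r $$ (i, j) = wh_sign (r i) j * sg j / sqrt (real m)"
proof -
  let ?P = "mat m N (\<lambda>(i, j). if j = r i then 1 else 0) :: real mat"
  let ?D = "mat N N (\<lambda>(i, j). if i = j then sg i else 0)"
  have "0 < N" using assms by simp
  have PH: "(?P * walsh_hadamard N) $$ (i, k) = wh_sign (r i) k / sqrt (real N)" if "k < N" for k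
  proof -
    have "(?P * walsh_hadamard N) $$ (i, k) = (\<Sum>l<N. ?P $$ (i, l) * walsh_hadamard N $$ (l, k))"
      using assms that by (subst mult_mat_entry) (auto simp: walsh_hadamard_def)
    also have "\<dots> = (\<Sum>l<N. if l = r i then walsh_hadamard N $$ (l, k) else 0)"
      using assms by (intro sum.cong) auto
    finally have "(?P * walsh_hadamard N) $$ (i, k) = (\<Sum>l<N. if l = r i then walsh_hadamard N $$ (l, k) else 0)" .
    thus ?thesis using assms that by (simp add: walsh_hadamard_def wh_sign_def)
  qed
  have "(?P * walsh_hadamard N * ?D) $$ (i, j) = (\<Sum>k<N. (?P * walsh_hadamard N) $$ (i, k) * ?D $$ (k, j))"
    using assms by (subst mult_mat_entry) (auto simp: walsh_hadamard_def)
  also have "\<dots> = (\<Sum>k<N. if k = j then wh_sign (r i) j / sqrt (real N) * sg j else 0)"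
    using assms by (intro sum.cong) (auto simp: PH)
  also have "\<dots> = wh_sign (r i) j / sqrt (real N) * sg j" using assms by simp
  finally have "srht_mat m N sg r $$ (i, j) = sqrt (real N / real m) * (wh_sign (r i) j / sqrt (real N) * sg j)"
    using assms by (simp add: srht_mat_def walsh_hadamard_def)
  thus ?thesis using \<open>0 < N\<close> by (simp add: real_sqrt_divide)
qed

text \<open>Row \<open>\<rho>\<close> of the flattened matrix before normalization:
  \<open>sqrt N\<close> times the entry of the product of the Hadamard matrix, the diagonal of signs
  and \<open>W\<close>.\<close>

definition wht :: "nat \<Rightarrow> (nat \<Rightarrow> real) \<Rightarrow> real mat \<Rightarrow> nat \<Rightarrow> nat \<Rightarrow> real" where
  "wht N sg W \<rho> x = (\<Sum>j<N. sg j * (wh_sign \<rho> j * W $$ (j, x)))"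

lemma srht_mult_entry:
  assumes "W \<in> carrier_mat N a" "i < m" "x < a" "r i < N"
  shows "(srht_mat m N sg r * W) $$ (i, x) = wht N sg W (r i) x / sqrt (real m)"
proof -
  have "(srht_mat m N sg r * W) $$ (i, x) = (\<Sum>j<N. srht_mat m N sg r $$ (i, j) * W $$ (j, x))"
    using assms srht_carrier[of m N sg r] by (subst mult_mat_entry) auto
  also have "\<dots> = (\<Sum>j<N. sg j * (wh_sign (r i) j * W $$ (j, x)) / sqrt (real m))"
    using assms by (intro sum.cong) (auto simp: srht_entry)
  finally show ?thesis by (simp only: wht_def sum_divide_distrib)
qed

lemma srht_gram_entry:
  assumes "W \<in> carrier_mat N a" "V \<in> carrier_mat N b" "x < a" "y < b" "\<And>i. i < m \<Longrightarrow> r i < N"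
    and S: "S = srht_mat m N sg r"
  shows "(W\<^sup>T * S\<^sup>T * S * V) $$ (x, y) = (\<Sum>i<m. wht N sg W (r i) x * wht N sg V (r i) y) / real m"
proof -
  have "(W\<^sup>T * S\<^sup>T * S * V) $$ (x, y) = (\<Sum>t<m. (S * W) $$ (t, x) * (S * V) $$ (t, y))"
    using assms srht_carrier by (intro gram_entry) auto
  also have "\<dots> = (\<Sum>i<m. wht N sg W (r i) x * wht N sg V (r i) y / real m)"
    unfolding S using assms by (intro sum.cong) (auto simp: srht_mult_entry)
  finally show ?thesis by (simp only: sum_divide_distrib)
qed

lemma wht_parseval:
  assumes "W \<in> carrier_mat N a" "V \<in> carrier_mat N b" "x < a" "y < b" "N = 2 ^ q"
    and sg: "\<And>i. i < N \<Longrightarrow> sg i * sg i = 1"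
  shows "(\<Sum>\<rho><N. wht N sg W \<rho> x * wht N sg V \<rho> y) = real N * (W\<^sup>T * V) $$ (x, y)"
proof -
  have "(\<Sum>\<rho><N. wht N sg W \<rho> x * wht N sg V \<rho> y) =
      (\<Sum>\<rho><N. \<Sum>j<N. \<Sum>k<N. (sg j * W $$ (j, x)) * (sg k * V $$ (k, y)) * (wh_sign \<rho> j * wh_sign \<rho> k))"
    unfolding wht_def sum_product by (simp add: mult_ac)
  also have "\<dots> = (\<Sum>j<N. \<Sum>k<N. \<Sum>\<rho><N. (sg j * W $$ (j, x)) * (sg k * V $$ (k, y)) * (wh_sign \<rho> j * wh_sign \<rho> k))"
    by (subst sum.swap) (intro sum.cong refl sum.swap)
  also have "\<dots> = (\<Sum>j<N. \<Sum>k<N. if k = j then real N * (W $$ (j, x) * V $$ (j, y)) else 0)"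
  proof (intro sum.cong refl)
    fix j k assume jk: "j \<in> {..<N}" "k \<in> {..<N}"
    have "(\<Sum>\<rho><N. (sg j * W $$ (j, x)) * (sg k * V $$ (k, y)) * (wh_sign \<rho> j * wh_sign \<rho> k)) =
        (sg j * W $$ (j, x)) * (sg k * V $$ (k, y)) * (if j = k then real N else 0)"
      using jk wh_sign_orthogonal[of j q k] assms(5) by (simp flip: sum_distrib_left)
    also have "\<dots> = (if k = j then real N * (W $$ (j, x) * V $$ (j, y)) else 0)"
    proof (cases "k = j")
      case True
      have "(sg j * W $$ (j, x)) * (sg j * V $$ (j, y)) * real N =
          (sg j * sg j) * (real N * (W $$ (j, x) * V $$ (j, y)))" by (simp add: mult_ac)
      thus ?thesis using sg[of j] jk True by simp
    qed auto
    finally show "(\<Sum>\<rho><N. (sg j * W $$ (j, x)) * (sg k * V $$ (k, y)) * (wh_sign \<rho> j * wh_sign \<rho> k)) =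
      (if k = j then real N * (W $$ (j, x) * V $$ (j, y)) else 0)" .
  qed
  also have "\<dots> = real N * (W\<^sup>T * V) $$ (x, y)"
    using assms by (simp add: transpose_mult_entry sum_distrib_left)
  finally show ?thesis .
qed

text \<open>The product of the two sums is a constant, the inner product of \<open>a\<close> and
  \<open>b\<close>, plus a degenerate chaos. Their second moments are at most 1 and 2 times the
  product of the squared norms, and splitting the square of the sum doubles both, which gives
  6.\<close>

lemma rademacher_product_second_moment:
  fixes a b :: "nat \<Rightarrow> real"
  shows "measure_pmf.expectation (rademacher {..<N}) (\<lambda>s. ((\<Sum>i<N. s i * a i) * (\<Sum>j<N. s j * b j))\<^sup>2)
    \<le> 6 * ((\<Sum>i<N. (a i)\<^sup>2) * (\<Sum>i<N. (b i)\<^sup>2))"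
proof -
  let ?P = "rademacher {..<N}"
  let ?q = "pmf_of_set {-1, 1 :: real}"
  let ?ab = "(\<Sum>i<N. (a i)\<^sup>2) * (\<Sum>i<N. (b i)\<^sup>2)"
  have finP: "finite (set_pmf ?P)" by (rule finite_rademacher) simp
  let ?Z = "\<lambda>s. \<Sum>i<N. \<Sum>j\<in>{..<N} - {i}. (a i * b j) * (s i * s j)"
  have split: "(\<Sum>i<N. s i * a i) * (\<Sum>j<N. s j * b j) = (\<Sum>i<N. a i * b i) + ?Z s"
    if s: "s \<in> set_pmf ?P" for s
  proof -
    have "(\<Sum>i<N. s i * a i) * (\<Sum>j<N. s j * b j) = (\<Sum>i<N. \<Sum>j<N. (a i * b j) * (s i * s j))"
      by (simp add: sum_product mult_ac)
    also have "\<dots> = (\<Sum>i<N. a i * b i + (\<Sum>j\<in>{..<N} - {i}. (a i * b j) * (s i * s j)))"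
    proof (intro sum.cong refl)
      fix i assume i: "i \<in> {..<N}"
      show "(\<Sum>j<N. (a i * b j) * (s i * s j)) = a i * b i + (\<Sum>j\<in>{..<N} - {i}. (a i * b j) * (s i * s j))"
        using rademacher_support[OF _ s i] by (subst sum.remove[OF _ i]) auto
    qed
    finally show ?thesis by (simp only: sum.distrib)
  qed
  have "measure_pmf.expectation ?P (\<lambda>s. ((\<Sum>i<N. s i * a i) * (\<Sum>j<N. s j * b j))\<^sup>2) \<le>
      measure_pmf.expectation ?P (\<lambda>s. 2 * (\<Sum>i<N. a i * b i)\<^sup>2 + 2 * (?Z s)\<^sup>2)"
  proof (intro expectation_mono_finite finP)
    fix s assume "s \<in> set_pmf ?P"
    have "0 \<le> ((\<Sum>i<N. a i * b i) - ?Z s)\<^sup>2" by simp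
    thus "((\<Sum>i<N. s i * a i) * (\<Sum>j<N. s j * b j))\<^sup>2 \<le> 2 * (\<Sum>i<N. a i * b i)\<^sup>2 + 2 * (?Z s)\<^sup>2"
      unfolding split[OF \<open>s \<in> set_pmf ?P\<close>] power2_sum power2_diff by linarith
  qed
  also have "\<dots> = 2 * (\<Sum>i<N. a i * b i)\<^sup>2 + 2 * measure_pmf.expectation ?P (\<lambda>s. (?Z s)\<^sup>2)"
    by (simp add: expectation_add_finite[OF finP])
  also have "\<dots> \<le> 2 * ?ab + 2 * (2 * ?ab)"
  proof (intro add_mono mult_left_mono Cauchy_Schwarz_ineq_sum)
    have "measure_pmf.expectation ?P (\<lambda>s. (?Z s)\<^sup>2) \<le>
        2 * measure_pmf.expectation ?q (\<lambda>y. measure_pmf.expectation ?q (\<lambda>x. (x * y)\<^sup>2)) *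
        (\<Sum>i<N. \<Sum>j\<in>{..<N} - {i}. (a i * b j)\<^sup>2)"
      unfolding rademacher_def
      by (rule second_moment_chaos[where K = "(*)"]) (simp_all add: expectation_sign mult.commute)
    also have "\<dots> = 2 * (\<Sum>i<N. \<Sum>j\<in>{..<N} - {i}. (a i * b j)\<^sup>2)"
      by (simp add: expectation_sign)
    also have "\<dots> \<le> 2 * (\<Sum>i<N. \<Sum>j<N. (a i * b j)\<^sup>2)"
      by (intro mult_left_mono sum_mono sum_mono2) auto
    also have "\<dots> = 2 * ?ab" by (simp add: sum_product power_mult_distrib)
    finally show "measure_pmf.expectation ?P (\<lambda>s. (?Z s)\<^sup>2) \<le> 2 * ?ab" .
  qed auto
  finally show ?thesis by simp
qed

lemma sampling_variance:
  fixes g :: "nat \<Rightarrow> real"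
  assumes N: "0 < N" and m: "0 < m"
  shows "measure_pmf.expectation (Pi_pmf {..<m} 0 (\<lambda>_. pmf_of_set {..<N}))
      (\<lambda>r. ((\<Sum>i<m. g (r i)) / real m - (\<Sum>\<rho><N. g \<rho>) / real N)\<^sup>2) \<le>
    (\<Sum>\<rho><N. (g \<rho>)\<^sup>2) / real N / real m"
proof -
  let ?q = "pmf_of_set {..<N}"
  have ne: "{..<N} \<noteq> {}" using N by auto
  hence finq: "finite (set_pmf ?q)" by simp
  define \<mu> where "\<mu> = (\<Sum>\<rho><N. g \<rho>) / real N"
  have sumg: "(\<Sum>\<rho><N. g \<rho>) = real N * \<mu>" using N by (simp add: \<mu>_def)
  have unif: "measure_pmf.expectation ?q f = (\<Sum>\<rho><N. f \<rho>) / real N" for f :: "nat \<Rightarrow> real"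
    using ne by (simp add: integral_pmf_of_set)
  have mean: "measure_pmf.expectation ?q (\<lambda>\<rho>. g \<rho> - \<mu>) = 0"
    unfolding unif by (simp add: sum_subtractf sumg)
  have "measure_pmf.expectation (Pi_pmf {..<m} 0 (\<lambda>_. ?q))
      (\<lambda>r. ((\<Sum>i<m. g (r i)) / real m - \<mu>)\<^sup>2) =
    measure_pmf.expectation (Pi_pmf {..<m} 0 (\<lambda>_. ?q)) (\<lambda>r. (\<Sum>i<m. 1 / real m * (g (r i) - \<mu>))\<^sup>2)"
    using m by (simp add: sum_subtractf diff_divide_distrib flip: sum_divide_distrib)
  also have "\<dots> = (\<Sum>i<m. (1 / real m)\<^sup>2) * measure_pmf.expectation ?q (\<lambda>\<rho>. (g \<rho> - \<mu>)\<^sup>2)"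
    by (rule second_moment_linear[OF finq mean]) simp
  also have "\<dots> = (\<Sum>\<rho><N. (g \<rho> - \<mu>)\<^sup>2) / real N / real m"
    using m unfolding unif by (simp add: power2_eq_square)
  also have "(\<Sum>\<rho><N. (g \<rho> - \<mu>)\<^sup>2) = (\<Sum>\<rho><N. (g \<rho>)\<^sup>2) - real N * \<mu>\<^sup>2"
  proof -
    have "(\<Sum>\<rho><N. (g \<rho> - \<mu>)\<^sup>2) = (\<Sum>\<rho><N. (g \<rho>)\<^sup>2 + (\<mu>\<^sup>2 - 2 * \<mu> * g \<rho>))"
      by (simp add: power2_diff algebra_simps)
    also have "\<dots> = (\<Sum>\<rho><N. (g \<rho>)\<^sup>2) + (real N * \<mu>\<^sup>2 - 2 * \<mu> * (\<Sum>\<rho><N. g \<rho>))"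
      by (simp only: sum.distrib sum_subtractf sum_distrib_left) simp
    finally show ?thesis by (simp add: sumg power2_eq_square)
  qed
  also have "((\<Sum>\<rho><N. (g \<rho>)\<^sup>2) - real N * \<mu>\<^sup>2) / real N / real m \<le> (\<Sum>\<rho><N. (g \<rho>)\<^sup>2) / real N / real m"
    by (intro divide_right_mono) auto
  finally show ?thesis by (simp only: \<mu>_def)
qed

text \<open>Given the signs, the error is a sampling error whose variance is at most the mean of the
  squared summands; averaging over the signs reduces that to a fourth-order Rademacher moment. Rows
  enter only on average, which is why this estimate carries no logarithm.\<close>

lemma srht_product:
  assumes m: "0 < m" and N: "N = 2 ^ q" and W: "W \<in> carrier_mat N a" and V: "V \<in> carrier_mat N b"
  shows "measure_pmf.expectation (srht_pmf m N) (\<lambda>S. (fro_norm (W\<^sup>T * S\<^sup>T * S * V - W\<^sup>T * V))\<^sup>2)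
    \<le> 6 / real m * ((fro_norm W)\<^sup>2 * (fro_norm V)\<^sup>2)"
proof (rule expectation_error_fro_le[OF finite_srht W V])
  show "0 < N" using N by simp
  note finS = finite_rademacher[OF finite_lessThan, of N]
  note finR = finite_rows_pmf[OF \<open>0 < N\<close>, of m]
  let ?R = "Pi_pmf {..<m} 0 (\<lambda>_. pmf_of_set {..<N})"
  show "W\<^sup>T * S\<^sup>T * S * V \<in> carrier_mat a b" if "S \<in> set_pmf (srht_pmf m N)" for S
  proof -
    have "S \<in> carrier_mat m N" using that by (auto simp: srht_pmf_alt srht_carrier)
    thus ?thesis using W V by (intro mult_carrier_mat) auto
  qed
  show "W\<^sup>T * V \<in> carrier_mat a b" using W V by auto
  fix x y assume xy: "x < a" "y < b"
  let ?g = "\<lambda>sg \<rho>. wht N sg W \<rho> x * wht N sg V \<rho> y"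
  let ?ab = "(\<Sum>i<N. (W $$ (i, x))\<^sup>2) * (\<Sum>i<N. (V $$ (i, y))\<^sup>2)"
  have inner: "measure_pmf.expectation ?R (\<lambda>r. (((W\<^sup>T * (srht_mat m N sg r)\<^sup>T * srht_mat m N sg r * V) $$ (x, y) -
        (W\<^sup>T * V) $$ (x, y)))\<^sup>2) \<le> (\<Sum>\<rho><N. (?g sg \<rho>)\<^sup>2) / real N / real m"
    if sg: "sg \<in> set_pmf (rademacher {..<N})" for sg
  proof -
    have "(W\<^sup>T * V) $$ (x, y) = (\<Sum>\<rho><N. ?g sg \<rho>) / real N"
      using \<open>0 < N\<close> rademacher_support[OF _ sg] by (subst wht_parseval[OF W V xy N]) auto
    moreover have "measure_pmf.expectation ?R (\<lambda>r. (((W\<^sup>T * (srht_mat m N sg r)\<^sup>T * srht_mat m N sg r * V) $$ (x, y) -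
        (\<Sum>\<rho><N. ?g sg \<rho>) / real N))\<^sup>2) =
      measure_pmf.expectation ?R (\<lambda>r. ((\<Sum>i<m. ?g sg (r i)) / real m - (\<Sum>\<rho><N. ?g sg \<rho>) / real N)\<^sup>2)"
      by (intro expectation_cong_pmf)
        (subst srht_gram_entry[OF W V xy _ refl], use rows_support[OF \<open>0 < N\<close>] in auto)
    ultimately show ?thesis using sampling_variance[OF \<open>0 < N\<close> m, of "?g sg"] by simp
  qed
  have "measure_pmf.expectation (srht_pmf m N) (\<lambda>S. ((W\<^sup>T * S\<^sup>T * S * V) $$ (x, y) - (W\<^sup>T * V) $$ (x, y))\<^sup>2) =
      measure_pmf.expectation (rademacher {..<N}) (\<lambda>sg. measure_pmf.expectation ?R
        (\<lambda>r. (((W\<^sup>T * (srht_mat m N sg r)\<^sup>T * srht_mat m N sg r * V) $$ (x, y) - (W\<^sup>T * V) $$ (x, y)))\<^sup>2))"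
    unfolding srht_pmf_alt using finS finR by (subst expectation_bind_finite) auto
  also have "\<dots> \<le> measure_pmf.expectation (rademacher {..<N}) (\<lambda>sg. (\<Sum>\<rho><N. (?g sg \<rho>)\<^sup>2) / real N / real m)"
    by (intro expectation_mono_finite finS inner)
  also have "\<dots> = (\<Sum>\<rho><N. measure_pmf.expectation (rademacher {..<N}) (\<lambda>sg. (?g sg \<rho>)\<^sup>2)) / real N / real m"
    by (simp add: expectation_sum_finite[OF finS])
  also have "\<dots> \<le> (\<Sum>\<rho><N. 6 * ?ab) / real N / real m"
  proof (intro divide_right_mono sum_mono)
    fix \<rho>
    have sq: "(wh_sign \<rho> i * c)\<^sup>2 = c\<^sup>2" for i c
      using wh_sign_square[of \<rho> i] by (simp add: power_mult_distrib power2_eq_square)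
    show "measure_pmf.expectation (rademacher {..<N}) (\<lambda>sg. (?g sg \<rho>)\<^sup>2) \<le> 6 * ?ab"
      using rademacher_product_second_moment[of N "\<lambda>i. wh_sign \<rho> i * W $$ (i, x)" "\<lambda>i. wh_sign \<rho> i * V $$ (i, y)"]
      by (simp add: wht_def sq)
  qed auto
  also have "\<dots> = 6 / real m * ?ab" using \<open>0 < N\<close> by simp
  finally show "measure_pmf.expectation (srht_pmf m N)
      (\<lambda>S. ((W\<^sup>T * S\<^sup>T * S * V) $$ (x, y) - (W\<^sup>T * V) $$ (x, y))\<^sup>2) \<le> 6 / real m * ?ab" .
qed

section \<open>Flattening by random signs and the spectral estimate\<close>

lemma vec_norm2_fvec:
  "x \<in> carrier_vec n \<Longrightarrow> vec_norm2 x = norm (fvec_of n (\<lambda>i. x $ i))"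
proof -
  assume "x \<in> carrier_vec n"
  hence "(vec_norm2 x)\<^sup>2 = (norm (fvec_of n (\<lambda>i. x $ i)))\<^sup>2"
    by (simp add: vec_norm2_sq norm_fvec_of)
  thus ?thesis by (simp add: power2_eq_iff_nonneg vec_norm2_nonneg)
qed

text \<open>A flattened row is a Rademacher sum of the rows of \<open>W\<close> up to signs, so the
  exponential moment of its squared norm is at most \<open>exp ((fro_norm W)\<^sup>2 / 2)\<close>;
  \<open>contr\<close> provides the frame bound 2 for this. Summing the exponentials over the
  \<open>N\<close> rows before Markov's inequality costs an additive \<open>ln N\<close> in
  \<open>L\<close> instead of a factor.\<close>

lemma wht_bounded:
  assumes N: "N = 2 ^ q" and W: "W \<in> carrier_mat N d"
    and contr: "\<And>v. v \<in> carrier_vec d \<Longrightarrow> (vec_norm2 (W *\<^sub>v v))\<^sup>2 \<le> 2 * (vec_norm2 v)\<^sup>2"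
    and fail: "real N * exp ((fro_norm W)\<^sup>2 / 2) \<le> \<delta> * exp (L / 6)" and "0 \<le> \<delta>"
  shows "measure_pmf.prob (rademacher {..<N}) {sg. \<forall>\<rho><N. (\<Sum>x<d. (wht N sg W \<rho> x)\<^sup>2) \<le> L} \<ge> 1 - \<delta>"
proof -
  note fin = finite_rademacher[OF finite_lessThan, of N]
  let ?X = "\<lambda>sg. \<Sum>\<rho><N. exp ((\<Sum>x<d. (wht N sg W \<rho> x)\<^sup>2) / 6)"
  have row: "measure_pmf.expectation (rademacher {..<N}) (\<lambda>sg. exp ((\<Sum>x<d. (wht N sg W \<rho> x)\<^sup>2) / 6)) \<le>
      exp ((fro_norm W)\<^sup>2 / 2)" for \<rho>
  proof -
    let ?x = "\<lambda>i. fvec_of d (\<lambda>x. wh_sign \<rho> i * W $$ (i, x))"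
    have sq: "(wh_sign \<rho> i * c)\<^sup>2 = c\<^sup>2" for i c
      using wh_sign_square[of \<rho> i] by (simp add: power_mult_distrib power2_eq_square)
    have sum: "(\<Sum>i<N. sg i *\<^sub>R ?x i) = fvec_of d (wht N sg W \<rho>)" for sg
      by (rule fvec_eqI) (simp add: coord_sum coord_simps coord_fvec_of wht_def)
    have form: "(\<Sum>i<N. (inner (?x i) v)\<^sup>2) \<le> 2 * (norm v)\<^sup>2" for v
    proof -
      let ?v = "vec d (coord v)"
      have "(\<Sum>i<N. (inner (?x i) v)\<^sup>2) = (\<Sum>i<N. (\<Sum>x<d. W $$ (i, x) * coord v x)\<^sup>2)"
        by (simp add: inner_fvec_of mult.assoc sq flip: sum_distrib_left)
      also have "\<dots> = (vec_norm2 (W *\<^sub>v ?v))\<^sup>2"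
        using W unfolding vec_norm2_sq
        by (intro sum.cong) (simp_all add: mult_mat_vec_entry del: index_mult_mat_vec)
      also have "\<dots> \<le> 2 * (vec_norm2 ?v)\<^sup>2" by (intro contr) simp
      also have "(vec_norm2 ?v)\<^sup>2 = (norm (fvec_of d (coord v)))\<^sup>2"
        by (simp add: vec_norm2_sq norm_fvec_of)
      also have "\<dots> \<le> (norm v)\<^sup>2" by (intro power_mono norm_fvec_of_coord_le) auto
      finally show ?thesis by simp
    qed
    have "(\<Sum>i<N. (norm (?x i))\<^sup>2) = (fro_norm W)\<^sup>2"
      using W by (simp add: norm_fvec_of sq fro_norm_sq)
    thus ?thesis using rademacher_exp_norm_square[where I = "{..<N}" and x = ?x, OF _ form]
      by (simp add: sum norm_fvec_of)
  qed
  have "measure_pmf.expectation (rademacher {..<N}) ?X \<le> real N * exp ((fro_norm W)\<^sup>2 / 2)"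
  proof -
    have "measure_pmf.expectation (rademacher {..<N}) ?X \<le> (\<Sum>\<rho><N. exp ((fro_norm W)\<^sup>2 / 2))"
      unfolding expectation_sum_finite[OF fin] by (intro sum_mono row)
    thus ?thesis by simp
  qed
  hence "measure_pmf.prob (rademacher {..<N}) {sg. ?X sg \<le> exp (L / 6)} \<ge> 1 - \<delta>"
    using fail \<open>0 \<le> \<delta>\<close> by (intro markov_finite fin) (auto intro: sum_nonneg)
  also have "measure_pmf.prob (rademacher {..<N}) {sg. ?X sg \<le> exp (L / 6)} \<le>
      measure_pmf.prob (rademacher {..<N}) {sg. \<forall>\<rho><N. (\<Sum>x<d. (wht N sg W \<rho> x)\<^sup>2) \<le> L}"
  proof (rule measure_pmf.finite_measure_mono)
    show "{sg. ?X sg \<le> exp (L / 6)} \<subseteq> {sg. \<forall>\<rho><N. (\<Sum>x<d. (wht N sg W \<rho> x)\<^sup>2) \<le> L}"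
    proof clarify
      fix sg \<rho> assume X: "?X sg \<le> exp (L / 6)" and \<rho>: "\<rho> < N"
      have "exp ((\<Sum>x<d. (wht N sg W \<rho> x)\<^sup>2) / 6) \<le> ?X sg"
        using \<rho> by (intro member_le_sum[where f = "\<lambda>\<rho>. exp ((\<Sum>x<d. (wht N sg W \<rho> x)\<^sup>2) / 6)"]) auto
      hence "exp ((\<Sum>x<d. (wht N sg W \<rho> x)\<^sup>2) / 6) \<le> exp (L / 6)" using X by (rule order_trans)
      hence "(\<Sum>x<d. (wht N sg W \<rho> x)\<^sup>2) / 6 \<le> L / 6" by (simp only: exp_le_cancel_iff)
      thus "(\<Sum>x<d. (wht N sg W \<rho> x)\<^sup>2) \<le> L" by simp
    qed
  qed simp
  finally show ?thesis .
qed

text \<open>Once the signs have made all rows short, \<open>sampled_form_deviation\<close> applies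
  to the rows scaled by \<open>1 / sqrt m\<close>, with \<open>l = L / m\<close>. Their total
  squared length is then at most \<open>L\<close>, which is why \<open>p\<close> must dominate
  \<open>ln L\<close>. One \<open>\<delta>\<close> is spent on the signs and one on the
  sampling.\<close>

lemma srht_spectral:
  assumes m: "0 < m" and N: "N = 2 ^ q" and W: "W \<in> carrier_mat N d"
    and contr: "\<And>v. v \<in> carrier_vec d \<Longrightarrow> (vec_norm2 (W *\<^sub>v v))\<^sup>2 \<le> 2 * (vec_norm2 v)\<^sup>2"
    and fail: "real N * exp ((fro_norm W)\<^sup>2 / 2) \<le> \<delta> * exp (L / 6)" and \<delta>: "0 < \<delta>" "\<delta> \<le> 1"
    and L: "0 < L" "L \<le> exp (real p)" and p: "0 < p"
    and m_ge: "2 * exp 1 * real p * (L / real m) \<le> (\<delta> / 128)\<^sup>2"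
  shows "measure_pmf.prob (srht_pmf m N) {S. spectral_norm (W\<^sup>T * S\<^sup>T * S * W - W\<^sup>T * W) \<le> 1 / 8} \<ge> 1 - (\<delta> + \<delta>)"
  unfolding srht_pmf_alt
proof (rule prob_bind_ge)
  show "finite (set_pmf (rademacher {..<N}))" by (simp add: finite_rademacher)
  show "1 - \<delta> \<le> measure_pmf.prob (rademacher {..<N}) {sg. \<forall>\<rho><N. (\<Sum>x<d. (wht N sg W \<rho> x)\<^sup>2) \<le> L}"
    using assms by (intro wht_bounded) auto
  fix sg assume sg: "sg \<in> set_pmf (rademacher {..<N})"
    and flat: "sg \<in> {sg. \<forall>\<rho><N. (\<Sum>x<d. (wht N sg W \<rho> x)\<^sup>2) \<le> L}"
  have N0: "0 < N" using N by simp
  have sg1: "sg i * sg i = 1" if "i < N" for i using rademacher_support[OF _ sg] that by simp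
  let ?R = "Pi_pmf {..<m} 0 (\<lambda>_. pmf_of_set {..<N})"
  note finR = finite_rows_pmf[OF N0, of m]
  let ?y = "wht N sg W"
  let ?z = "\<lambda>\<rho>. fvec_of d (\<lambda>x. ?y \<rho> x / sqrt (real m))"
  let ?D = "\<lambda>r v. rank_one_sum (\<lambda>i. ?z (r i)) {..<m} (\<lambda>_. 1) v -
        rank_one_sum ?z {..<N} (\<lambda>_. real m / real N) v"
  have bl: "bounded_linear (?D r)" for r
    by (intro bounded_linear_sub bounded_linear_rank_one_sum)
  have inner_z: "inner (?z \<rho>) v = (\<Sum>x<d. ?y \<rho> x * coord v x) / sqrt (real m)" for \<rho> v
    by (simp add: inner_fvec_of sum_divide_distrib)
  have gramW: "(W\<^sup>T * W) $$ (a, b) = (\<Sum>\<rho><N. ?y \<rho> a * ?y \<rho> b) / real N" if "a < d" "b < d" for a b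
    using N0 sg1 by (subst wht_parseval[OF W W that N]) auto
  \<comment> \<open>Averaged over all \<open>N\<close> rows the sampled form is that of
    \<open>W\<^sup>T * W\<close>, by orthogonality of the transform, and \<open>contr\<close> bounds
    it by 2.\<close>
  have form: "real m / real N * (\<Sum>\<rho><N. (inner (?z \<rho>) v)\<^sup>2) \<le> 2 * (norm v)\<^sup>2" for v
  proof -
    let ?v = "vec d (coord v)"
    have "real m / real N * (\<Sum>\<rho><N. (inner (?z \<rho>) v)\<^sup>2) = (\<Sum>\<rho><N. (\<Sum>x<d. ?y \<rho> x * coord v x)\<^sup>2) / real N"
      using m by (simp add: inner_z power_divide flip: sum_divide_distrib)
    also have "(\<Sum>\<rho><N. (\<Sum>x<d. ?y \<rho> x * coord v x)\<^sup>2) =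
        (\<Sum>\<rho><N. \<Sum>a<d. \<Sum>b<d. coord v a * coord v b * (?y \<rho> a * ?y \<rho> b))"
      by (simp add: power2_eq_square sum_product mult_ac)
    also have "\<dots> = (\<Sum>a<d. \<Sum>b<d. \<Sum>\<rho><N. coord v a * coord v b * (?y \<rho> a * ?y \<rho> b))"
      by (subst sum.swap) (intro sum.cong refl sum.swap)
    also have "\<dots> / real N = (\<Sum>a<d. \<Sum>b<d. coord v a * coord v b * (W\<^sup>T * W) $$ (a, b))"
      unfolding sum_divide_distrib[of _ _ "real N"]
      by (intro sum.cong refl) (simp add: gramW flip: sum_distrib_left sum_divide_distrib)
    also have "\<dots> = (\<Sum>a<d. \<Sum>b<d. \<Sum>i<N. coord v a * coord v b * (W $$ (i, a) * W $$ (i, b)))"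
      by (intro sum.cong refl) (simp add: transpose_mult_entry[OF W W] sum_distrib_left)
    also have "\<dots> = (\<Sum>i<N. \<Sum>a<d. \<Sum>b<d. coord v a * coord v b * (W $$ (i, a) * W $$ (i, b)))"
      by (subst (2) sum.swap) (intro sum.cong refl sum.swap)
    also have "\<dots> = (\<Sum>i<N. (\<Sum>a<d. W $$ (i, a) * coord v a)\<^sup>2)"
      by (simp add: power2_eq_square sum_product mult_ac)
    also have "\<dots> = (vec_norm2 (W *\<^sub>v ?v))\<^sup>2"
      using W unfolding vec_norm2_sq
      by (intro sum.cong) (simp_all add: mult_mat_vec_entry del: index_mult_mat_vec)
    also have "\<dots> \<le> 2 * (vec_norm2 ?v)\<^sup>2" by (intro contr) simp
    also have "(vec_norm2 ?v)\<^sup>2 = (norm (fvec_of d (coord v)))\<^sup>2"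
      by (simp add: vec_norm2_sq norm_fvec_of)
    also have "\<dots> \<le> (norm v)\<^sup>2" by (intro power_mono norm_fvec_of_coord_le) auto
    finally show ?thesis by simp
  qed
  define \<kappa> where "\<kappa> = sqrt (2 * exp 1 * real p * (L / real m))"
  have "\<kappa> \<le> sqrt ((\<delta> / 128)\<^sup>2)" unfolding \<kappa>_def by (intro real_sqrt_le_mono m_ge)
  \<comment> \<open>Markov's inequality at level \<open>1 / 8\<close> with failure
    \<open>\<delta>\<close> wants a mean of at most \<open>\<delta> / 8\<close>; the deviation lemma
    gives \<open>16 * \<kappa>\<close>, hence the 128.\<close>
  hence kap: "16 * \<kappa> \<le> \<delta> * (1 / 8)" using \<delta> by simp
  have small: "2 * exp 1 * real p * (L / real m) \<le> 1 / 64"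
  proof -
    have "(\<delta> / 128)\<^sup>2 \<le> (1 / 8)\<^sup>2" using \<delta> by (intro power_mono) auto
    thus ?thesis using m_ge by (simp add: power2_eq_square)
  qed
  have dev: "measure_pmf.expectation ?R (\<lambda>r. onorm (?D r)) \<le> 16 * \<kappa>"
    unfolding \<kappa>_def
  proof (rule sampled_form_deviation[OF N0 m fvec_of_spanned _ _ p _ form small])
    show "(norm (?z \<rho>))\<^sup>2 \<le> L / real m" if "\<rho> < N" for \<rho>
      using flat that m by (simp add: norm_fvec_of power_divide divide_right_mono flip: sum_divide_distrib)
  qed (use L m in auto)
  have "measure_pmf.prob ?R {r. onorm (?D r) \<le> 1 / 8} \<ge> 1 - \<delta>"
    using dev kap \<delta> by (intro markov_finite finR onorm_pos_le bl) auto
  also have "measure_pmf.prob ?R {r. onorm (?D r) \<le> 1 / 8} =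
      measure_pmf.prob ?R ({r. onorm (?D r) \<le> 1 / 8} \<inter> set_pmf ?R)"
    by (rule measure_Int_set_pmf[symmetric])
  also have "\<dots> \<le> measure_pmf.prob ?R
      {r. spectral_norm (W\<^sup>T * (srht_mat m N sg r)\<^sup>T * srht_mat m N sg r * W - W\<^sup>T * W) \<le> 1 / 8}"
  proof (intro measure_pmf.finite_measure_mono subsetI CollectI)
    fix r assume r: "r \<in> {r. onorm (?D r) \<le> 1 / 8} \<inter> set_pmf ?R"
    let ?S = "srht_mat m N sg r"
    let ?M = "W\<^sup>T * ?S\<^sup>T * ?S * W - W\<^sup>T * W"
    have rN: "r i < N" if "i < m" for i using rows_support[OF N0] r that by auto
    have GM: "W\<^sup>T * ?S\<^sup>T * ?S * W \<in> carrier_mat d d"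
      using W srht_carrier[of m N sg r] by (intro mult_carrier_mat) auto
    have WM: "W\<^sup>T * W \<in> carrier_mat d d" using W by auto
    have M: "?M \<in> carrier_mat d d" using WM by (rule minus_carrier_mat)
    have entry: "?M $$ (a, b) = (\<Sum>i<m. ?y (r i) a * ?y (r i) b) / real m - (\<Sum>\<rho><N. ?y \<rho> a * ?y \<rho> b) / real N"
      if "a < d" "b < d" for a b
    proof -
      have "?M $$ (a, b) = (W\<^sup>T * ?S\<^sup>T * ?S * W) $$ (a, b) - (W\<^sup>T * W) $$ (a, b)"
        using WM that by auto
      thus ?thesis using gramW[OF that] srht_gram_entry[OF W W that rN refl] by simp
    qed
    have "spectral_norm ?M \<le> onorm (?D r)"
    proof (rule spectral_norm_le)
      show "0 \<le> onorm (?D r)" by (rule onorm_pos_le[OF bl])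
      fix v :: "real vec" assume "v \<in> carrier_vec (dim_col ?M)"
      hence v: "v \<in> carrier_vec d" using carrier_matD(2)[OF M] by metis
      let ?v = "fvec_of d (\<lambda>i. v $ i)"
      have cz: "coord (rank_one_sum (\<lambda>i. ?z (f i)) {..<n} (\<lambda>_. c) ?v) a =
          (if a < d then c * (\<Sum>b<d. (\<Sum>i<n. ?y (f i) a * ?y (f i) b) * v $ b) / real m else 0)"
        for f :: "nat \<Rightarrow> nat" and n c a
      proof -
        have "coord (rank_one_sum (\<lambda>i. ?z (f i)) {..<n} (\<lambda>_. c) ?v) a =
            (\<Sum>i<n. c * ((\<Sum>b<d. ?y (f i) b * v $ b) / sqrt (real m)) * (if a < d then ?y (f i) a / sqrt (real m) else 0))"
          by (simp add: rank_one_sum_def coord_sum coord_simps inner_z coord_fvec_of)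
        also have "\<dots> = (if a < d then (\<Sum>i<n. \<Sum>b<d. c * (?y (f i) a * ?y (f i) b * v $ b) / real m) else 0)"
          using m by (auto intro!: sum.cong simp: sum_distrib_left sum_distrib_right sum_divide_distrib mult_ac)
        also have "\<dots> = (if a < d then (\<Sum>b<d. \<Sum>i<n. c * (?y (f i) a * ?y (f i) b * v $ b) / real m) else 0)"
          by (simp only: sum.swap[of _ "{..<n}"])
        also have "\<dots> = (if a < d then c * (\<Sum>b<d. (\<Sum>i<n. ?y (f i) a * ?y (f i) b) * v $ b) / real m else 0)"
          by (simp add: sum_distrib_left sum_distrib_right sum_divide_distrib mult_ac)
        finally show ?thesis .
      qed
      \<comment> \<open>The matrix error and the operator error agree in coordinates, which
        transfers the operator norm bound to \<open>spectral_norm\<close>.\<close>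
      have "fvec_of d (\<lambda>i. (?M *\<^sub>v v) $ i) = ?D r ?v"
      proof (rule fvec_eqI)
        fix a
        show "coord (fvec_of d (\<lambda>i. (?M *\<^sub>v v) $ i)) a = coord (?D r ?v) a"
        proof (cases "a < d")
          case True
          have "(?M *\<^sub>v v) $ a = (\<Sum>b<d. ?M $$ (a, b) * v $ b)"
            using True M v by (subst mult_mat_vec_entry) auto
          also have "\<dots> = (\<Sum>b<d. (\<Sum>i<m. ?y (r i) a * ?y (r i) b) * v $ b / real m -
              (\<Sum>\<rho><N. ?y \<rho> a * ?y \<rho> b) * v $ b / real N)"
            using True by (intro sum.cong refl) (simp add: entry algebra_simps)
          also have "\<dots> = (\<Sum>b<d. (\<Sum>i<m. ?y (r i) a * ?y (r i) b) * v $ b) / real m -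
              (\<Sum>b<d. (\<Sum>\<rho><N. ?y \<rho> a * ?y \<rho> b) * v $ b) / real N"
            by (simp only: sum_subtractf sum_divide_distrib)
          finally show ?thesis
            using True m cz[of r m 1 a] cz[of "\<lambda>\<rho>. \<rho>" N "real m / real N" a]
            by (simp only: coord_minus' coord_fvec_of) simp
        next
          case False
          thus ?thesis using cz[of r m 1 a] cz[of "\<lambda>\<rho>. \<rho>" N "real m / real N" a]
            by (simp only: coord_minus' coord_fvec_of) simp
        qed
      qed
      moreover have "?M *\<^sub>v v \<in> carrier_vec d" using M v by (rule mult_mat_vec_carrier)
      ultimately have "vec_norm2 (?M *\<^sub>v v) = norm (?D r ?v)" by (simp only: vec_norm2_fvec)
      also have "\<dots> \<le> onorm (?D r) * norm ?v" by (rule onorm[OF bl])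
      finally show "vec_norm2 (?M *\<^sub>v v) \<le> onorm (?D r) * vec_norm2 v" by (simp only: vec_norm2_fvec[OF v])
    qed
    thus "spectral_norm ?M \<le> 1 / 8" using r by simp
  qed simp
  finally show "1 - \<delta> \<le> measure_pmf.prob (map_pmf (srht_mat m N sg) ?R)
      {S. spectral_norm (W\<^sup>T * S\<^sup>T * S * W - W\<^sup>T * W) \<le> 1 / 8}" by simp
qed (use \<delta> in auto)

section \<open>Correctness of the program\<close>

text \<open>The two defaults are unrelated because \<open>bit_sign 0\<close> is \<open>-1\<close>:
  mapping bits to signs does not send the default of the bit table to the default of the sign
  table.\<close>

lemma Pi_pmf_map_default:
  assumes "finite A"
  shows "Pi_pmf A d' (\<lambda>_. map_pmf f q) = map_pmf (\<lambda>g x. if x \<in> A then f (g x) else d') (Pi_pmf A d (\<lambda>_. q))"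
proof -
  have "Pi_pmf A d' (\<lambda>_. map_pmf f q) =
      map_pmf (\<lambda>g x. if x \<in> A then g x else d') (Pi_pmf A (f d) (\<lambda>_. map_pmf f q))"
    by (rule Pi_pmf_default_swap[OF assms, symmetric])
  also have "Pi_pmf A (f d) (\<lambda>_. map_pmf f q) = map_pmf (\<lambda>h. f \<circ> h) (Pi_pmf A d (\<lambda>_. q))"
    by (rule Pi_pmf_map[OF assms refl])
  finally show ?thesis by (simp add: map_pmf_comp comp_def)
qed

lemma map_bit_sign: "map_pmf bit_sign (pmf_of_set {..<2}) = pmf_of_set {-1, 1}"
proof -
  have two: "{..<2 :: nat} = {0, 1}" by auto
  have "map_pmf bit_sign (pmf_of_set {..<2}) = pmf_of_set (bit_sign ` {..<2})"
    by (rule map_pmf_of_set_inj) (auto simp: inj_on_def bit_sign_def two)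
  thus ?thesis by (simp add: two bit_sign_def)
qed

lemma rademacher_bits:
  fixes N :: nat
  shows "rademacher {..<N} = map_pmf (\<lambda>g x. if x < N then bit_sign (g x) else 0) (Pi_pmf {..<N} 0 (\<lambda>_. pmf_of_set {..<2}))"
  unfolding rademacher_def map_bit_sign[symmetric]
  using Pi_pmf_map_default[of "{..<N}" 0 bit_sign "pmf_of_set {..<2}" 0] by simp

lemma column_bits: "column_pmf m = map_pmf (apsnd bit_sign) (bucket_pmf m)"
  by (simp add: column_pmf_def bucket_pmf_def map_bit_sign[symmetric] pair_map_pmf2)

lemma sketch_pmf_bits:
  "sketch_pmf m2 N n = bind_pmf (Pi_pmf {..<n} (0, 0) (\<lambda>_. bucket_pmf N)) (\<lambda>f.
     bind_pmf (Pi_pmf {..<N} 0 (\<lambda>_. pmf_of_set {..<2})) (\<lambda>g.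
     bind_pmf (Pi_pmf {..<m2} 0 (\<lambda>_. pmf_of_set {..<N})) (\<lambda>r.
       return_pmf (srht_mat m2 N (\<lambda>x. if x < N then bit_sign (g x) else 0) r *
         embedding_mat N n (\<lambda>x. if x < n then apsnd bit_sign (f x) else (0, 0))))))"
proof -
  have "Pi_pmf {..<n} (0, 0) (\<lambda>_. column_pmf N) =
      map_pmf (\<lambda>f x. if x < n then apsnd bit_sign (f x) else (0, 0)) (Pi_pmf {..<n} (0, 0) (\<lambda>_. bucket_pmf N))"
    unfolding column_bits
    using Pi_pmf_map_default[of "{..<n}" "(0, 0)" "apsnd bit_sign" "bucket_pmf N" "(0, 0)"] by simp
  thus ?thesis
    unfolding sketch_pmf_def sparse_embedding_alt srht_pmf_alt rademacher_bits
    by (simp add: bind_map_pmf bind_assoc_pmf bind_return_pmf map_pmf_def)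
qed

lemma sum_nonzeros_list:
  assumes A: "A \<in> carrier_mat n d" and xs: "lists_nonzeros xs A" and j: "j < d"
  shows "(\<Sum>k<length xs. if P (fst (xs ! k)) \<and> snd (xs ! k) = j then c (fst (xs ! k)) * A $$ (xs ! k) else 0) =
    (\<Sum>t<n. if P t then c t * A $$ (t, j) else 0)"
proof -
  let ?\<phi> = "\<lambda>z. if P (fst z) \<and> snd z = j then c (fst z) * A $$ z else 0"
  have "bij_betw ((!) xs) {..<length xs} (nonzeros A)"
    using xs bij_betw_nth[of xs "{..<length xs}" "nonzeros A"] by (simp add: lists_nonzeros_def)
  hence "(\<Sum>k<length xs. ?\<phi> (xs ! k)) = (\<Sum>z\<in>nonzeros A. ?\<phi> z)"
    by (rule sum.reindex_bij_betw)
  also have "\<dots> = (\<Sum>z\<in>{..<n} \<times> {..<d}. ?\<phi> z)"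
    using A by (intro sum.mono_neutral_left) (auto simp: nonzeros_def)
  also have "\<dots> = (\<Sum>t<n. \<Sum>y<d. ?\<phi> (t, y))"
    by (subst sum.cartesian_product) (auto intro!: sum.cong)
  also have "\<dots> = (\<Sum>t<n. \<Sum>y<d. if y = j then (if P t then c t * A $$ (t, j) else 0) else 0)"
    by (intro sum.cong refl) auto
  finally show ?thesis using j by simp
qed

text \<open>\<open>X\<close> stands for the rows that the program has hashed. Its tables are cut off
  outside \<open>X\<close>, where all entries of \<open>A\<close> are zero, while the matrix product
  uses the full tables.\<close>

lemma sketch_entry_correct:
  assumes A: "A \<in> carrier_mat n d" and xs: "lists_nonzeros xs A" and ij: "i < m2" "j < d"
    and r: "r i < 2 ^ q" and rows: "fst ` set xs \<subseteq> X"
  shows "(srht_mat m2 (2 ^ q) (\<lambda>x. if x < 2 ^ q then bit_sign (g x) else 0) r *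
      embedding_mat (2 ^ q) n (\<lambda>x. if x < n then apsnd bit_sign (f x) else (0, 0)) * A) $$ (i, j) =
    sketch_entry q m2 xs A (\<lambda>x. if x \<in> X then f x else (0, 0)) g r i j"
proof -
  let ?N = "2 ^ q :: nat"
  let ?sg = "\<lambda>x. if x < ?N then bit_sign (g x) else 0"
  let ?c = "\<lambda>x. if x < n then apsnd bit_sign (f x) else (0, 0)"
  let ?E = "embedding_mat ?N n ?c"
  have assoc: "srht_mat m2 ?N ?sg r * ?E * A = srht_mat m2 ?N ?sg r * (?E * A)"
    using A by (intro assoc_mult_mat[OF srht_carrier embedding_carrier])
  have EA: "?E * A \<in> carrier_mat ?N d" using embedding_carrier A by (rule mult_carrier_mat)
  have inner: "(\<Sum>t<length xs. if fst ((\<lambda>x. if x \<in> X then f x else (0, 0)) (fst (xs ! t))) = l \<and> snd (xs ! t) = j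
      then bit_sign (g l) * bit_sign (snd ((\<lambda>x. if x \<in> X then f x else (0, 0)) (fst (xs ! t)))) * A $$ (xs ! t) else 0) =
      bit_sign (g l) * (?E * A) $$ (l, j)" if l: "l < ?N" for l
  proof -
    have "(\<Sum>t<length xs. if fst ((\<lambda>x. if x \<in> X then f x else (0, 0)) (fst (xs ! t))) = l \<and> snd (xs ! t) = j
      then bit_sign (g l) * bit_sign (snd ((\<lambda>x. if x \<in> X then f x else (0, 0)) (fst (xs ! t)))) * A $$ (xs ! t) else 0) =
      (\<Sum>t<length xs. if fst (f (fst (xs ! t))) = l \<and> snd (xs ! t) = j
      then (bit_sign (g l) * bit_sign (snd (f (fst (xs ! t))))) * A $$ (xs ! t) else 0)"
    proof (intro sum.cong refl)
      fix t assume "t \<in> {..<length xs}"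
      hence "fst (xs ! t) \<in> X" using rows by auto
      thus "(if fst ((\<lambda>x. if x \<in> X then f x else (0, 0)) (fst (xs ! t))) = l \<and> snd (xs ! t) = j
        then bit_sign (g l) * bit_sign (snd ((\<lambda>x. if x \<in> X then f x else (0, 0)) (fst (xs ! t)))) * A $$ (xs ! t) else 0) =
        (if fst (f (fst (xs ! t))) = l \<and> snd (xs ! t) = j
        then (bit_sign (g l) * bit_sign (snd (f (fst (xs ! t))))) * A $$ (xs ! t) else 0)" by simp
    qed
    also have "\<dots> = (\<Sum>t<n. if fst (f t) = l then (bit_sign (g l) * bit_sign (snd (f t))) * A $$ (t, j) else 0)"
      by (rule sum_nonzeros_list[OF A xs ij(2)])
    also have "\<dots> = bit_sign (g l) * (?E * A) $$ (l, j)"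
      unfolding embedding_mult_entry[OF A l ij(2)] sum_distrib_left
      by (intro sum.cong refl) auto
    finally show ?thesis .
  qed
  have "sketch_entry q m2 xs A (\<lambda>x. if x \<in> X then f x else (0, 0)) g r i j =
      (\<Sum>l<?N. wh_sign (r i) l * (bit_sign (g l) * (?E * A) $$ (l, j))) / sqrt (real m2)"
    unfolding sketch_entry_def by (intro arg_cong2[where f = "(/)"] sum.cong refl) (simp only: inner lessThan_iff)
  also have "\<dots> = wht ?N ?sg (?E * A) (r i) j / sqrt (real m2)"
    unfolding wht_def by (intro arg_cong2[where f = "(/)"] sum.cong refl) auto
  finally show ?thesis
    unfolding assoc srht_mult_entry[where r = r, OF EA ij r] by (rule sym)
qed

theorem sketch_prog_correct:
  assumes A: "A \<in> carrier_mat n d" and B: "B \<in> carrier_mat n d'"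
    and xs: "lists_nonzeros xs A" and ys: "lists_nonzeros ys B" and m2: "0 < m2"
    and T: "sketch_time q m2 (length xs + length ys) (d + d') \<le> T"
  shows "halts_within T sketch_prog (input_store (2 ^ q) m2 A B xs ys)"
    and "map_pmf (\<lambda>(_, s). output_problem m2 d d' s) (run T sketch_prog (input_store (2 ^ q) m2 A B xs ys)) =
      map_pmf (\<lambda>S. (S * A, S * B)) (sketch_pmf m2 (2 ^ q) n)"
proof -
  let ?s0 = "input_store (2 ^ q) m2 A B xs ys"
  let ?X = "fst ` set xs \<union> fst ` set ys"
  let ?N = "2 ^ q :: nat"
  let ?G = "Pi_pmf {..<?N} (0 :: nat) (\<lambda>_. pmf_of_set {..<2 :: nat})"
  let ?R = "Pi_pmf {..<m2} (0 :: nat) (\<lambda>_. pmf_of_set {..<?N})"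
  let ?out = "\<lambda>f g r. (mat m2 d (\<lambda>(i, j). sketch_entry q m2 xs A f g r i j), mat m2 d' (\<lambda>(i, j). sketch_entry q m2 ys B f g r i j))"
  let ?S = "\<lambda>f g r. srht_mat m2 ?N (\<lambda>x. if x < ?N then bit_sign (g x) else 0) r *
         embedding_mat ?N n (\<lambda>x. if x < n then apsnd bit_sign (f x) else (0, 0))"
  let ?cut = "\<lambda>f x. if x \<in> ?X then f x else (0, 0)"
  have dims: "dim_col A = d" "dim_col B = d'" using A B by auto
  have XN: "?X \<subseteq> {..<n}"
    using A B xs ys by (auto simp: lists_nonzeros_def nonzeros_def)
  obtain D where D: "run T sketch_prog ?s0 = map_pmf (Pair []) D"
    "map_pmf (output_problem m2 d d') D =
      bind_pmf (Pi_pmf ?X (0, 0) (\<lambda>_. bucket_pmf ?N)) (\<lambda>f. bind_pmf ?G (\<lambda>g. bind_pmf ?R (\<lambda>r. return_pmf (?out f g r))))"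
    using run_sketch_prog[OF m2 _ refl, of q xs ys A B T] T unfolding dims by blast
  show "halts_within T sketch_prog ?s0" unfolding halts_within_def D(1) by auto
  have out: "?out (?cut f) g r = (?S f g r * A, ?S f g r * B)" if r: "r \<in> set_pmf ?R" for f g r
  proof -
    have rN: "r i < ?N" if "i < m2" for i using rows_support[OF _ r that] by simp
    have SA: "?S f g r * A \<in> carrier_mat m2 d" and SB: "?S f g r * B \<in> carrier_mat m2 d'"
      by (rule mult_carrier_mat[OF mult_carrier_mat[OF srht_carrier embedding_carrier]], fact)+
    have "mat m2 d (\<lambda>(i, j). sketch_entry q m2 xs A (?cut f) g r i j) = ?S f g r * A"
    proof (rule eq_matI)
      fix i j assume "i < dim_row (?S f g r * A)" "j < dim_col (?S f g r * A)"
      hence ij: "i < m2" "j < d" by (simp_all only: carrier_matD[OF SA])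
      have "(?S f g r * A) $$ (i, j) = sketch_entry q m2 xs A (?cut f) g r i j"
        by (rule sketch_entry_correct[OF A xs ij]) (use rN ij in auto)
      thus "mat m2 d (\<lambda>(i, j). sketch_entry q m2 xs A (?cut f) g r i j) $$ (i, j) = (?S f g r * A) $$ (i, j)"
        using ij by simp
    qed (use carrier_matD[OF SA] in \<open>simp_all only: dim_row_mat dim_col_mat\<close>)
    moreover have "mat m2 d' (\<lambda>(i, j). sketch_entry q m2 ys B (?cut f) g r i j) = ?S f g r * B"
    proof (rule eq_matI)
      fix i j assume "i < dim_row (?S f g r * B)" "j < dim_col (?S f g r * B)"
      hence ij: "i < m2" "j < d'" by (simp_all only: carrier_matD[OF SB])
      have "(?S f g r * B) $$ (i, j) = sketch_entry q m2 ys B (?cut f) g r i j"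
        by (rule sketch_entry_correct[OF B ys ij]) (use rN ij in auto)
      thus "mat m2 d' (\<lambda>(i, j). sketch_entry q m2 ys B (?cut f) g r i j) $$ (i, j) = (?S f g r * B) $$ (i, j)"
        using ij by simp
    qed (use carrier_matD[OF SB] in \<open>simp_all only: dim_row_mat dim_col_mat\<close>)
    ultimately show ?thesis by simp
  qed
  have "map_pmf (\<lambda>(_, s). output_problem m2 d d' s) (run T sketch_prog ?s0) = map_pmf (output_problem m2 d d') D"
    by (simp add: D(1) map_pmf_comp)
  \<comment> \<open>Cutting the product over all \<open>n\<close> rows down to the occurring ones
    yields its marginal, so the program draws from the right law without visiting zero rows.\<close>
  also have "\<dots> = bind_pmf (Pi_pmf {..<n} (0, 0) (\<lambda>_. bucket_pmf ?N)) (\<lambda>f. bind_pmf ?G (\<lambda>g. bind_pmf ?R (\<lambda>r. return_pmf (?out (?cut f) g r))))"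
    unfolding D(2) Pi_pmf_subset[OF finite_lessThan XN] bind_map_pmf ..
  also have "\<dots> = bind_pmf (Pi_pmf {..<n} (0, 0) (\<lambda>_. bucket_pmf ?N)) (\<lambda>f. bind_pmf ?G (\<lambda>g. bind_pmf ?R (\<lambda>r. return_pmf (?S f g r * A, ?S f g r * B))))"
    by (intro bind_pmf_cong refl) (simp only: out)
  also have "\<dots> = map_pmf (\<lambda>S. (S * A, S * B)) (sketch_pmf m2 ?N n)"
    unfolding sketch_pmf_bits map_bind_pmf map_return_pmf ..
  finally show "map_pmf (\<lambda>(_, s). output_problem m2 d d' s) (run T sketch_prog ?s0) =
      map_pmf (\<lambda>S. (S * A, S * B)) (sketch_pmf m2 ?N n)" .
qed

section \<open>The statistical dimension as a trace\<close>

text \<open>The characteristic polynomial is known to split over the complex numbers first, so the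
  eigenvalue is taken complex. It is the quotient of the squared norms of the image of an
  eigenvector under \<open>A\<close> and of the eigenvector, hence real and nonnegative.\<close>

lemma gram_eigenvalue_nonneg:
  fixes A :: "real mat" and a :: complex
  assumes A: "A \<in> carrier_mat n d" and ev: "eigenvalue (map_mat of_real (A\<^sup>T * A)) a"
  obtains e where "0 \<le> e" "a = of_real e"
proof -
  let ?C = "map_mat complex_of_real (A\<^sup>T * A)"
  have C: "?C \<in> carrier_mat d d" using A by auto
  obtain v where v: "v \<in> carrier_vec d" "v \<noteq> 0\<^sub>v d" "?C *\<^sub>v v = a \<cdot>\<^sub>v v"
    using ev A unfolding eigenvalue_def eigenvector_def by auto
  define s where "s = (\<Sum>i<d. (cmod (v $ i))\<^sup>2)"
  define w where "w = (\<lambda>k. \<Sum>j<d. of_real (A $$ (k, j)) * v $ j)"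
  have Cv: "(\<Sum>j<d. \<Sum>k<n. of_real (A $$ (k, i)) * (of_real (A $$ (k, j)) * v $ j)) = a * v $ i" if "i < d" for i
  proof -
    have "a * v $ i = (?C *\<^sub>v v) $ i" using v that by simp
    also have "\<dots> = (\<Sum>j<d. ?C $$ (i, j) * v $ j)"
      using A v that by (subst mult_mat_vec_entry) auto
    also have "\<dots> = (\<Sum>j<d. (\<Sum>k<n. of_real (A $$ (k, i)) * of_real (A $$ (k, j))) * v $ j)"
      using A that by (intro sum.cong refl) (simp add: transpose_mult_entry[OF A A])
    finally show ?thesis by (simp add: sum_distrib_right mult.assoc)
  qed
  have "a * of_real s = (\<Sum>i<d. cnj (v $ i) * (a * v $ i))"
    unfolding s_def of_real_sum complex_norm_square by (simp add: sum_distrib_left mult_ac)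
  also have "\<dots> = (\<Sum>i<d. cnj (v $ i) * (\<Sum>j<d. \<Sum>k<n. of_real (A $$ (k, i)) * (of_real (A $$ (k, j)) * v $ j)))"
    by (intro sum.cong refl) (simp add: Cv)
  also have "\<dots> = (\<Sum>i<d. \<Sum>k<n. of_real (A $$ (k, i)) * cnj (v $ i) * w k)"
    by (intro sum.cong refl, subst sum.swap) (simp add: w_def sum_distrib_left mult_ac)
  also have "\<dots> = (\<Sum>k<n. cnj (w k) * w k)"
    by (subst sum.swap) (simp add: w_def cnj_sum sum_distrib_right)
  also have "\<dots> = of_real (\<Sum>k<n. (cmod (w k))\<^sup>2)"
    unfolding of_real_sum complex_norm_square by (simp add: mult.commute)
  finally have eq: "a * of_real s = of_real (\<Sum>k<n. (cmod (w k))\<^sup>2)" .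
  have "0 < s"
  proof -
    obtain i where i: "i < d" "v $ i \<noteq> 0" using v by (metis eq_vecI carrier_vecD index_zero_vec)
    hence "0 < (cmod (v $ i))\<^sup>2" by simp
    also have "\<dots> \<le> s" unfolding s_def using i by (intro member_le_sum[where f = "\<lambda>i. (cmod (v $ i))\<^sup>2"]) auto
    finally show ?thesis .
  qed
  hence "a = of_real ((\<Sum>k<n. (cmod (w k))\<^sup>2) / s)" using eq by (simp add: field_simps)
  moreover have "0 \<le> (\<Sum>k<n. (cmod (w k))\<^sup>2) / s" using \<open>0 < s\<close> by (simp add: sum_nonneg)
  ultimately show thesis using that by blast
qed

lemma map_poly_linear_factors:
  "map_poly complex_of_real (\<Prod>e\<leftarrow>es. [:- e, 1:]) = (\<Prod>e\<leftarrow>es. [:- complex_of_real e, 1:])"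
proof -
  interpret h: map_poly_comm_ring_hom complex_of_real ..
  show ?thesis by (induction es) (simp_all only: list.map prod_list.Nil prod_list.Cons h.hom_mult h.hom_one,
    simp add: map_poly_pCons)
qed

text \<open>All complex roots are nonnegative reals, so the factorization descends to the reals, as
  \<open>schur_decomposition\<close> of the real Gram matrix requires.\<close>

lemma gram_char_poly_splits:
  fixes A :: "real mat"
  assumes A: "A \<in> carrier_mat n d"
  obtains es where "char_poly (A\<^sup>T * A) = (\<Prod>e\<leftarrow>es. [:- e, 1:])" "\<And>e. e \<in> set es \<Longrightarrow> 0 \<le> e"
proof -
  let ?C = "A\<^sup>T * A"
  let ?Cc = "map_mat complex_of_real ?C"
  have C: "?C \<in> carrier_mat d d" using A by auto
  have Cc: "?Cc \<in> carrier_mat d d" using C by auto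
  obtain as where as: "char_poly ?Cc = (\<Prod>a\<leftarrow>as. [:- a, 1:])" using char_poly_factorized[OF Cc] by blast
  have "\<exists>e. 0 \<le> e \<and> a = of_real e" if "a \<in> set as" for a
  proof -
    have "poly (char_poly ?Cc) a = 0"
      unfolding as using that by (auto simp: poly_prod_list prod_list_zero_iff)
    hence "eigenvalue ?Cc a" using eigenvalue_root_char_poly[OF Cc] by simp
    thus ?thesis using gram_eigenvalue_nonneg[OF A] by blast
  qed
  then obtain f where f: "\<And>a. a \<in> set as \<Longrightarrow> 0 \<le> f a \<and> a = of_real (f a)" by metis
  let ?es = "map f as"
  have "map_poly complex_of_real (char_poly ?C) = (\<Prod>a\<leftarrow>as. [:- a, 1:])"
    unfolding as[symmetric] by (rule of_real_hom.char_poly_hom[OF C, symmetric])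
  also have "\<dots> = map_poly complex_of_real (\<Prod>e\<leftarrow>?es. [:- e, 1:])"
    unfolding map_poly_linear_factors[of ?es] unfolding map_map comp_def using f
    by (intro arg_cong[where f = prod_list] map_cong refl) simp
  finally have eq: "map_poly complex_of_real (char_poly ?C) = map_poly complex_of_real (\<Prod>e\<leftarrow>?es. [:- e, 1:])" .
  have "char_poly ?C = (\<Prod>e\<leftarrow>?es. [:- e, 1:])"
  proof (rule poly_eqI)
    fix i
    show "coeff (char_poly ?C) i = coeff (\<Prod>e\<leftarrow>?es. [:- e, 1:]) i"
      using arg_cong[OF eq, of "\<lambda>p. coeff p i"] by (simp add: coeff_map_poly del: map_map)
  qed
  thus thesis using that[of ?es] f by auto
qed

text \<open>Back substitution from the last row shows that \<open>Y\<close> is upper triangular as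
  well, and then diagonal entries multiply.\<close>

lemma upper_triangular_right_inverse:
  fixes B Y :: "real mat"
  assumes B: "B \<in> carrier_mat d d" and Y: "Y \<in> carrier_mat d d" and ut: "upper_triangular B"
    and diag: "\<And>i. i < d \<Longrightarrow> B $$ (i, i) \<noteq> 0" and inv: "B * Y = 1\<^sub>m d" and i: "i < d"
  shows "Y $$ (i, i) = 1 / B $$ (i, i)"
proof -
  have row: "(\<Sum>k\<in>{i..<d}. B $$ (i, k) * Y $$ (k, j)) = (if i = j then 1 else 0)" if "i < d" "j < d" for i j
  proof -
    have "(if i = j then 1 else 0) = (B * Y) $$ (i, j)" using that by (simp add: inv)
    also have "\<dots> = (\<Sum>k<d. B $$ (i, k) * Y $$ (k, j))" using that B Y by (subst mult_mat_entry) auto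
    also have "\<dots> = (\<Sum>k\<in>{i..<d}. B $$ (i, k) * Y $$ (k, j))"
      using that B ut by (intro sum.mono_neutral_right) (auto simp: upper_triangular_def)
    finally show ?thesis by simp
  qed
  have low: "Y $$ (i, j) = 0" if "i < d" "j < i" for i j
    using that
  proof (induction "d - i" arbitrary: i rule: less_induct)
    case less
    have "(\<Sum>k\<in>{i..<d}. B $$ (i, k) * Y $$ (k, j)) = B $$ (i, i) * Y $$ (i, j) + (\<Sum>k\<in>{Suc i..<d}. B $$ (i, k) * Y $$ (k, j))"
      using less.prems by (simp add: sum.atLeast_Suc_lessThan)
    moreover have "(\<Sum>k\<in>{Suc i..<d}. B $$ (i, k) * Y $$ (k, j)) = 0"
      using less by (intro sum.neutral) auto
    ultimately show ?case using row[of i j] diag[of i] less.prems by simp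
  qed
  have "(\<Sum>k\<in>{i..<d}. B $$ (i, k) * Y $$ (k, i)) = B $$ (i, i) * Y $$ (i, i) + (\<Sum>k\<in>{Suc i..<d}. B $$ (i, k) * Y $$ (k, i))"
    using i by (simp add: sum.atLeast_Suc_lessThan)
  moreover have "(\<Sum>k\<in>{Suc i..<d}. B $$ (i, k) * Y $$ (k, i)) = 0"
    by (intro sum.neutral) (simp add: low)
  ultimately show ?thesis using row[of i i] diag[of i] i by (simp add: field_simps)
qed

definition tr :: "real mat \<Rightarrow> real" where
  "tr M = (\<Sum>i<dim_row M. M $$ (i, i))"

lemma tr_mult_commute:
  assumes "M \<in> carrier_mat n m" "L \<in> carrier_mat m n"
  shows "tr (M * L) = tr (L * M)"
proof -
  have "tr (M * L) = (\<Sum>i<n. \<Sum>k<m. M $$ (i, k) * L $$ (k, i))"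
    using assms by (simp add: tr_def mult_mat_entry)
  also have "\<dots> = (\<Sum>k<m. \<Sum>i<n. L $$ (k, i) * M $$ (i, k))"
    by (subst sum.swap) (simp add: mult.commute)
  also have "\<dots> = tr (L * M)" using assms by (simp add: tr_def mult_mat_entry)
  finally show ?thesis .
qed

lemma fro_norm_sq_tr:
  assumes "M \<in> carrier_mat n m"
  shows "(fro_norm M)\<^sup>2 = tr (M\<^sup>T * M)"
  unfolding fro_norm_sq_col_row[OF assms] using assms
  by (simp add: tr_def transpose_mult_entry[OF assms assms] power2_eq_square)

lemma proots_linear_factors: "proots (\<Prod>e\<leftarrow>es. [:- e, 1:]) = mset (es :: real list)"
proof (induction es)
  case (Cons e es)
  have "(\<Prod>e\<leftarrow>es. [:- e, 1:]) \<noteq> (0 :: real poly)" by (auto simp: prod_list_zero_iff)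
  thus ?case using Cons by (simp add: proots_mult del: mult_pCons_left)
qed simp

text \<open>The trace is invariant under similarity, so a triangular form is enough: the shifted
  triangular matrix carries the shifted eigenvalues on its diagonal, and its inverse their
  reciprocals.\<close>

lemma stat_dim_eq_trace:
  assumes A: "A \<in> carrier_mat n d" and lam: "0 < lam" and Y: "Y \<in> carrier_mat d d"
    and inv: "(A\<^sup>T * A + lam \<cdot>\<^sub>m 1\<^sub>m d) * Y = 1\<^sub>m d"
  shows "stat_dim lam A = tr (A\<^sup>T * A * Y)"
proof -
  let ?C = "A\<^sup>T * A"
  have C: "?C \<in> carrier_mat d d" using A by auto
  obtain es where es: "char_poly ?C = (\<Prod>e\<leftarrow>es. [:- e, 1:])" "\<And>e. e \<in> set es \<Longrightarrow> 0 \<le> e"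
    using gram_char_poly_splits[OF A] by blast
  obtain B P Q where BPQ: "schur_decomposition ?C es = (B, P, Q)" by (metis prod_cases3)
  from schur_decomposition[OF C es(1) this]
  have wit: "similar_mat_wit ?C B P Q" and ut: "upper_triangular B" and dg: "diag_mat B = es" by auto
  have dr: "dim_row ?C = d" using C by auto
  have mats: "B \<in> carrier_mat d d" "P \<in> carrier_mat d d" "Q \<in> carrier_mat d d"
    and PQ: "P * Q = 1\<^sub>m d" "Q * P = 1\<^sub>m d" and CB: "?C = P * B * Q"
    using wit unfolding similar_mat_wit_def Let_def dr by auto
  have len: "length es = d" and esB: "\<And>i. i < d \<Longrightarrow> es ! i = B $$ (i, i)"
    using dg mats by (auto simp: diag_mat_def)
  let ?Bl = "B + lam \<cdot>\<^sub>m 1\<^sub>m d"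
  let ?Z = "Q * Y * P"
  have Z: "?Z \<in> carrier_mat d d" using mats Y by auto
  have Cl: "?C + lam \<cdot>\<^sub>m 1\<^sub>m d = P * ?Bl * Q"
  proof -
    have "P * ?Bl * Q = (P * B + P * (lam \<cdot>\<^sub>m 1\<^sub>m d)) * Q"
      using mats by (subst mult_add_distrib_mat) auto
    also have "P * (lam \<cdot>\<^sub>m 1\<^sub>m d) = lam \<cdot>\<^sub>m P" using mats by (subst mult_smult_distrib[of _ d d _ d]) auto
    also have "(P * B + lam \<cdot>\<^sub>m P) * Q = P * B * Q + lam \<cdot>\<^sub>m P * Q"
      using mats by (intro add_mult_distrib_mat) auto
    also have "lam \<cdot>\<^sub>m P * Q = lam \<cdot>\<^sub>m 1\<^sub>m d" using mats by (simp add: mult_smult_assoc_mat PQ)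
    finally show ?thesis by (simp add: CB)
  qed
  have inv': "?Bl * ?Z = 1\<^sub>m d"
  proof -
    have "Q * ((P * ?Bl * Q) * Y) * P = Q * 1\<^sub>m d * P" using inv unfolding Cl by simp
    also have "\<dots> = 1\<^sub>m d" using mats PQ by simp
    also have "Q * ((P * ?Bl * Q) * Y) * P = (Q * P) * ?Bl * (Q * Y * P)"
      using mats Y by (simp add: assoc_mult_mat[where n\<^sub>1 = d and n\<^sub>2 = d and n\<^sub>3 = d and n\<^sub>4 = d]
          mult_carrier_mat[of _ d d _ d])
    finally show ?thesis using mats Y PQ by simp
  qed
  have Bl: "?Bl \<in> carrier_mat d d" using mats by auto
  have utl: "upper_triangular ?Bl" using ut mats by (auto simp: upper_triangular_def)
  have diag: "?Bl $$ (i, i) = es ! i + lam" if "i < d" for i using that mats esB by simp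
  have pos: "0 < es ! i + lam" if "i < d" for i
    using es(2)[of "es ! i"] that len lam by (simp add: add_nonneg_pos)
  have Zd: "?Z $$ (i, i) = 1 / (es ! i + lam)" if "i < d" for i
    using upper_triangular_right_inverse[OF Bl Z utl _ inv' that] diag pos that by force
  have trY: "tr Y = (\<Sum>i<d. 1 / (es ! i + lam))"
  proof -
    have "tr ?Z = tr (P * (Q * Y))" using mats Y by (intro tr_mult_commute) auto
    also have "P * (Q * Y) = Y"
      using mats Y PQ by (simp add: assoc_mult_mat[where n\<^sub>1 = d and n\<^sub>2 = d and n\<^sub>3 = d and n\<^sub>4 = d, symmetric])
    finally show ?thesis using Z Zd carrier_matD(1)[OF Z] unfolding tr_def[of ?Z] by simp
  qed
  \<comment> \<open>The defining equation of \<open>Y\<close> trades the Gram matrix for the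
    identity, leaving only the trace of \<open>Y\<close> to compute.\<close>
  have CY: "(?C * Y) $$ (i, i) = 1 - lam * Y $$ (i, i)" if "i < d" for i
  proof -
    have "1\<^sub>m d = ?C * Y + lam \<cdot>\<^sub>m 1\<^sub>m d * Y"
      using inv C Y by (subst (asm) add_mult_distrib_mat) auto
    also have "lam \<cdot>\<^sub>m 1\<^sub>m d * Y = lam \<cdot>\<^sub>m Y" using Y by (subst mult_smult_assoc_mat[of _ d d _ d]) auto
    finally have "1\<^sub>m d $$ (i, i) = (?C * Y + lam \<cdot>\<^sub>m Y) $$ (i, i)" by simp
    thus ?thesis using that Y by simp
  qed
  have "tr (?C * Y) = (\<Sum>i<d. 1 - lam * Y $$ (i, i))"
    unfolding tr_def using C A by (intro sum.cong) (auto simp: CY)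
  also have "\<dots> = real d - lam * tr Y" using Y by (simp add: tr_def sum_subtractf sum_distrib_left)
  also have "\<dots> = (\<Sum>i<d. es ! i / (es ! i + lam))"
  proof -
    have "es ! i / (es ! i + lam) = 1 - lam * (1 / (es ! i + lam))" if "i < d" for i
      using pos[OF that] by (simp add: field_simps)
    thus ?thesis by (simp add: trY sum_subtractf sum_distrib_left)
  qed
  also have "\<dots> = (\<Sum>e\<leftarrow>es. e / (e + lam))"
    by (simp add: sum_list_sum_nth len lessThan_atLeast0)
  also have "\<dots> = stat_dim lam A"
  proof -
    \<comment> \<open>Zero singular values are filtered out on the left and contribute zero summands
      on the right.\<close>
    have "(\<Sum>\<sigma>\<in>#filter_mset (\<lambda>\<sigma>. \<sigma> \<noteq> 0) (image_mset sqrt (mset es)). 1 / (1 + lam / \<sigma>\<^sup>2)) = (\<Sum>e\<leftarrow>es. e / (e + lam))"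
      using es(2)
    proof (induction es)
      case (Cons e es)
      have "0 \<le> e" using Cons by simp
      hence "e \<noteq> 0 \<Longrightarrow> 1 / (1 + lam / e) = e / (e + lam)" using lam by (simp add: field_simps)
      thus ?case using Cons \<open>0 \<le> e\<close> by auto
    qed simp
    thus ?thesis unfolding stat_dim_def singular_values_def es(1) proots_linear_factors by simp
  qed
  finally show ?thesis by simp
qed

section \<open>Ridge regression\<close>

subsection \<open>The Frobenius inner product\<close>

definition fip :: "real mat \<Rightarrow> real mat \<Rightarrow> real" where
  "fip M L = (\<Sum>i<dim_row M. \<Sum>j<dim_col M. M $$ (i, j) * L $$ (i, j))"

lemma fip_self: "fip M M = (fro_norm M)\<^sup>2"
  unfolding fip_def fro_norm_sq by (simp add: power2_eq_square)

lemma fip_add_right: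
  "M \<in> carrier_mat n k \<Longrightarrow> L \<in> carrier_mat n k \<Longrightarrow> K \<in> carrier_mat n k \<Longrightarrow> fip M (L + K) = fip M L + fip M K"
  by (simp add: fip_def algebra_simps sum.distrib)

lemma fip_minus_right:
  "M \<in> carrier_mat n k \<Longrightarrow> L \<in> carrier_mat n k \<Longrightarrow> K \<in> carrier_mat n k \<Longrightarrow> fip M (L - K) = fip M L - fip M K"
  by (simp add: fip_def algebra_simps sum_subtractf)

lemma fip_smult_right:
  "M \<in> carrier_mat n k \<Longrightarrow> L \<in> carrier_mat n k \<Longrightarrow> fip M (c \<cdot>\<^sub>m L) = c * fip M L"
  by (simp add: fip_def sum_distrib_left mult_ac)

lemma fip_zero_right: "M \<in> carrier_mat n k \<Longrightarrow> fip M (0\<^sub>m n k) = 0"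
  by (simp add: fip_def)

lemma fip_mult_left:
  assumes "A \<in> carrier_mat n d" "Z \<in> carrier_mat d k" "R \<in> carrier_mat n k"
  shows "fip (A * Z) R = fip Z (A\<^sup>T * R)"
proof -
  have "fip (A * Z) R = (\<Sum>i<n. \<Sum>j<k. \<Sum>l<d. A $$ (i, l) * Z $$ (l, j) * R $$ (i, j))"
    using assms by (simp add: fip_def mult_mat_entry sum_distrib_right)
  also have "\<dots> = (\<Sum>l<d. \<Sum>j<k. \<Sum>i<n. A $$ (i, l) * Z $$ (l, j) * R $$ (i, j))"
    by (subst sum.swap, subst (2) sum.swap, subst (1) sum.swap) (rule refl)
  also have "\<dots> = fip Z (A\<^sup>T * R)"
    using assms by (simp add: fip_def transpose_mult_entry[OF assms(1,3)] sum_distrib_left mult_ac)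
  finally show ?thesis .
qed

lemma fro_norm_add_sq:
  assumes "M \<in> carrier_mat n k" "L \<in> carrier_mat n k"
  shows "(fro_norm (M + L))\<^sup>2 = (fro_norm M)\<^sup>2 + 2 * fip M L + (fro_norm L)\<^sup>2"
  using assms by (simp add: fro_norm_sq fip_def power2_sum sum.distrib sum_distrib_left mult_ac)

lemma fip_cauchy_schwarz:
  assumes "M \<in> carrier_mat n k" "L \<in> carrier_mat n k"
  shows "\<bar>fip M L\<bar> \<le> fro_norm M * fro_norm L"
proof -
  have "\<bar>\<Sum>ij\<in>{..<n} \<times> {..<k}. M $$ ij * L $$ ij\<bar> \<le> (\<Sum>ij\<in>{..<n} \<times> {..<k}. \<bar>M $$ ij\<bar> * \<bar>L $$ ij\<bar>)"
    by (rule order_trans[OF sum_abs]) (simp add: abs_mult)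
  also have "\<dots> \<le> L2_set (\<lambda>ij. M $$ ij) ({..<n} \<times> {..<k}) * L2_set (\<lambda>ij. L $$ ij) ({..<n} \<times> {..<k})"
    by (rule L2_set_mult_ineq)
  finally show ?thesis
    using assms by (simp add: fip_def fro_norm_def L2_set_def sum.cartesian_product case_prod_unfold)
qed

lemma fro_norm_mult_le_spectral:
  assumes M: "M \<in> carrier_mat m n" and Z: "Z \<in> carrier_mat n k"
  shows "fro_norm (M * Z) \<le> spectral_norm M * fro_norm Z"
proof (rule power2_le_imp_le)
  have pos: "0 \<le> spectral_norm M"
  proof -
    have "0 \<le> vec_norm2 (M *\<^sub>v 0\<^sub>v n)" by (rule vec_norm2_nonneg)
    show ?thesis
    proof (cases "n = 0")
      case True
      have "vec_norm2 x \<ge> 0" for x by (rule vec_norm2_nonneg)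
      moreover have "{x \<in> carrier_vec (dim_col M). vec_norm2 x \<le> 1} = {0\<^sub>v 0}"
        using M True by (auto simp: vec_norm2_def)
      ultimately show ?thesis by (simp add: spectral_norm_def)
    next
      case False
      let ?e = "unit_vec n 0"
      have "vec_norm2 ?e = 1" using False by (simp add: vec_norm2_def)
      moreover have "vec_norm2 (M *\<^sub>v ?e) \<le> spectral_norm M * vec_norm2 ?e"
        using M by (intro spectral_norm_bound) auto
      ultimately show ?thesis using vec_norm2_nonneg[of "M *\<^sub>v ?e"] by simp
    qed
  qed
  have cols: "(fro_norm L)\<^sup>2 = (\<Sum>j<k. (vec_norm2 (col L j))\<^sup>2)" if "L \<in> carrier_mat r k" for L r
    unfolding fro_norm_sq_col_row[OF that] using that by (simp add: vec_norm2_sq)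
  have MZ: "M * Z \<in> carrier_mat m k" using M Z by simp
  have "(fro_norm (M * Z))\<^sup>2 = (\<Sum>j<k. (vec_norm2 (M *\<^sub>v col Z j))\<^sup>2)"
    unfolding cols[OF MZ] by (intro sum.cong refl) (simp only: col_mult2[OF M Z] lessThan_iff)
  also have "\<dots> \<le> (\<Sum>j<k. (spectral_norm M * vec_norm2 (col Z j))\<^sup>2)"
    using M Z by (intro sum_mono power_mono spectral_norm_bound vec_norm2_nonneg) auto
  also have "\<dots> = (spectral_norm M * fro_norm Z)\<^sup>2"
    by (simp add: power_mult_distrib cols[OF Z] sum_distrib_left)
  finally show "(fro_norm (M * Z))\<^sup>2 \<le> (spectral_norm M * fro_norm Z)\<^sup>2" .
  show "0 \<le> spectral_norm M * fro_norm Z" using pos fro_norm_nonneg by simp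
qed

lemma fip_mult_le_spectral:
  assumes "M \<in> carrier_mat n n" "Z \<in> carrier_mat n k"
  shows "\<bar>fip Z (M * Z)\<bar> \<le> spectral_norm M * (fro_norm Z)\<^sup>2"
proof -
  have "\<bar>fip Z (M * Z)\<bar> \<le> fro_norm Z * fro_norm (M * Z)"
    using assms by (intro fip_cauchy_schwarz) auto
  also have "\<dots> \<le> fro_norm Z * (spectral_norm M * fro_norm Z)"
    using assms by (intro mult_left_mono fro_norm_mult_le_spectral fro_norm_nonneg)
  finally show ?thesis by (simp add: power2_eq_square mult_ac)
qed

subsection \<open>The minimizer\<close>

definition normal_equation :: "real \<Rightarrow> real mat \<Rightarrow> real mat \<Rightarrow> real mat \<Rightarrow> bool" where
  "normal_equation lam A B X \<longleftrightarrow> A\<^sup>T * (A * X - B) + lam \<cdot>\<^sub>m X = 0\<^sub>m (dim_col A) (dim_col B)"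

text \<open>Stationarity of the cost along the direction \<open>D\<close>, the weak form in which
  the normal equation is used below.\<close>

lemma normal_equation_test:
  assumes A: "A \<in> carrier_mat n d" and B: "B \<in> carrier_mat n k" and X: "X \<in> carrier_mat d k"
    and D: "D \<in> carrier_mat d k" and ne: "normal_equation lam A B X"
  shows "fip (A * D) (A * X - B) + lam * fip D X = 0"
proof -
  have R: "A * X - B \<in> carrier_mat n k" using B by (rule minus_carrier_mat)
  have "0 = fip D (A\<^sup>T * (A * X - B) + lam \<cdot>\<^sub>m X)"
    using ne A B fip_zero_right[OF D] by (simp add: normal_equation_def)
  also have "\<dots> = fip D (A\<^sup>T * (A * X - B)) + fip D (lam \<cdot>\<^sub>m X)"
    using A R X D by (intro fip_add_right) auto
  finally show ?thesis using fip_mult_left[OF A D R] fip_smult_right[OF D X] by simp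
qed

lemma ridge_cost_expand:
  assumes A: "A \<in> carrier_mat n d" and B: "B \<in> carrier_mat n k" and X: "X \<in> carrier_mat d k"
    and Y: "Y \<in> carrier_mat d k" and ne: "normal_equation lam A B X"
  shows "ridge_cost lam A B Y = ridge_cost lam A B X + ((fro_norm (A * (Y - X)))\<^sup>2 + lam * (fro_norm (Y - X))\<^sup>2)"
proof -
  have D: "Y - X \<in> carrier_mat d k" using X by (rule minus_carrier_mat)
  have R: "A * X - B \<in> carrier_mat n k" using B by (rule minus_carrier_mat)
  have AD: "A * (Y - X) \<in> carrier_mat n k" using A D by auto
  have "A * Y - B = A * (Y - X) + (A * X - B)"
    using A B X Y by (simp add: mult_minus_distrib_mat) (intro eq_matI; auto)
  hence 1: "(fro_norm (A * Y - B))\<^sup>2 = (fro_norm (A * (Y - X)))\<^sup>2 + 2 * fip (A * (Y - X)) (A * X - B) + (fro_norm (A * X - B))\<^sup>2"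
    using fro_norm_add_sq[OF AD R] by simp
  have "Y = (Y - X) + X" using X Y by (intro eq_matI) auto
  hence 2: "(fro_norm Y)\<^sup>2 = (fro_norm (Y - X))\<^sup>2 + 2 * fip (Y - X) X + (fro_norm X)\<^sup>2"
    using fro_norm_add_sq[OF D X] by simp
  show ?thesis
    using normal_equation_test[OF A B X D ne] unfolding ridge_cost_def 1 2 by (simp add: algebra_simps)
qed

text \<open>A kernel vector of the shifted Gram matrix, tested against itself, makes
  \<open>lam\<close> times its squared norm at most zero; hence invertibility. The vector is viewed
  as a one-column matrix so that the Frobenius calculus applies.\<close>

lemma normal_equation_ex:
  assumes A: "A \<in> carrier_mat n d" and B: "B \<in> carrier_mat n k" and lam: "0 < lam"
  obtains X where "X \<in> carrier_mat d k" "normal_equation lam A B X"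
proof -
  let ?G = "A\<^sup>T * A + lam \<cdot>\<^sub>m 1\<^sub>m d"
  have C: "A\<^sup>T * A \<in> carrier_mat d d" using A by auto
  have G: "?G \<in> carrier_mat d d" using C by auto
  have "det ?G \<noteq> 0"
  proof
    assume "det ?G = 0"
    then obtain v where v: "v \<in> carrier_vec d" "v \<noteq> 0\<^sub>v d" "?G *\<^sub>v v = 0\<^sub>v d"
      using det_0_iff_vec_prod_zero_field[OF G] by blast
    let ?V = "mat d 1 (\<lambda>(i, j). v $ i)"
    have V: "?V \<in> carrier_mat d 1" by simp
    have GV: "?G * ?V = 0\<^sub>m d 1"
    proof (rule eq_matI)
      fix i j assume ij: "i < dim_row (0\<^sub>m d 1 :: real mat)" "j < dim_col (0\<^sub>m d 1 :: real mat)"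
      have "(?G * ?V) $$ (i, j) = (\<Sum>l<d. ?G $$ (i, l) * v $ l)"
        using ij G V by (subst mult_mat_entry) auto
      also have "\<dots> = (?G *\<^sub>v v) $ i" using ij G v by (subst mult_mat_vec_entry) auto
      finally show "(?G * ?V) $$ (i, j) = 0\<^sub>m d 1 $$ (i, j)" using ij v by simp
    qed (use G in auto)
    have "?G * ?V = A\<^sup>T * (A * ?V) + lam \<cdot>\<^sub>m ?V"
    proof -
      have "?G * ?V = A\<^sup>T * A * ?V + lam \<cdot>\<^sub>m 1\<^sub>m d * ?V" using C V by (intro add_mult_distrib_mat) auto
      also have "A\<^sup>T * A * ?V = A\<^sup>T * (A * ?V)" using A V by (intro assoc_mult_mat[of _ d n _ d _ 1]) auto
      also have "lam \<cdot>\<^sub>m 1\<^sub>m d * ?V = lam \<cdot>\<^sub>m ?V" using V by (subst mult_smult_assoc_mat[of _ d d _ 1]) auto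
      finally show ?thesis .
    qed
    hence "0 = fip ?V (A\<^sup>T * (A * ?V) + lam \<cdot>\<^sub>m ?V)" using fip_zero_right[OF V] GV by simp
    also have "\<dots> = fip ?V (A\<^sup>T * (A * ?V)) + lam * fip ?V ?V"
      using A V fip_smult_right[OF V V] by (subst fip_add_right[of _ d 1]) auto
    also have "fip ?V (A\<^sup>T * (A * ?V)) = fip (A * ?V) (A * ?V)"
      using A V by (intro fip_mult_left[symmetric]) auto
    finally have "lam * (fro_norm ?V)\<^sup>2 \<le> 0"
      unfolding fip_self using zero_le_power2[of "fro_norm (A * ?V)"] by linarith
    hence "(\<Sum>i<d. (v $ i)\<^sup>2) = 0"
      using lam by (simp add: fro_norm_sq mult_le_0_iff sum_nonneg antisym)
    hence "\<forall>i\<in>{..<d}. (v $ i)\<^sup>2 = 0" by (subst (asm) sum_nonneg_eq_0_iff) auto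
    hence "v = 0\<^sub>v d" using v by (intro eq_vecI) auto
    thus False using v by simp
  qed
  then obtain H where H: "H \<in> carrier_mat d d" "?G * H = 1\<^sub>m d"
    using det_non_zero_imp_unit[OF G, of "()"] unfolding Units_def ring_mat_def by auto
  let ?X = "H * (A\<^sup>T * B)"
  have X: "?X \<in> carrier_mat d k" using H A B by auto
  have AB: "A\<^sup>T * B \<in> carrier_mat d k" using A B by auto
  have "A\<^sup>T * (A * ?X - B) + lam \<cdot>\<^sub>m ?X = 0\<^sub>m d k"
  proof -
    have "A\<^sup>T * B = ?G * ?X"
    proof -
      have "?G * ?X = ?G * H * (A\<^sup>T * B)" using G H AB by (intro assoc_mult_mat[symmetric])
      thus ?thesis using H left_mult_one_mat[OF AB] by simp
    qed
    also have "\<dots> = A\<^sup>T * A * ?X + lam \<cdot>\<^sub>m 1\<^sub>m d * ?X" using C X by (intro add_mult_distrib_mat) auto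
    also have "A\<^sup>T * A * ?X = A\<^sup>T * (A * ?X)" using A X by (intro assoc_mult_mat[of _ d n _ d _ k]) auto
    also have "lam \<cdot>\<^sub>m 1\<^sub>m d * ?X = lam \<cdot>\<^sub>m ?X" using X by (subst mult_smult_assoc_mat[of _ d d _ k]) auto
    finally have eq: "A\<^sup>T * B = A\<^sup>T * (A * ?X) + lam \<cdot>\<^sub>m ?X" .
    have "A\<^sup>T * (A * ?X - B) = A\<^sup>T * (A * ?X) - A\<^sup>T * B"
      using A B X by (intro mult_minus_distrib_mat[of _ d n _ k]) auto
    hence "A\<^sup>T * (A * ?X - B) + lam \<cdot>\<^sub>m ?X =
        A\<^sup>T * (A * ?X) - (A\<^sup>T * (A * ?X) + lam \<cdot>\<^sub>m ?X) + lam \<cdot>\<^sub>m ?X" using eq by simp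
    also have "\<dots> = 0\<^sub>m d k"
    proof -
      have cancel: "M - (M + L) + L = 0\<^sub>m d k" if "M \<in> carrier_mat d k" "L \<in> carrier_mat d k" for M L :: "real mat"
        using that by (intro eq_matI) auto
      show ?thesis using A X by (intro cancel) auto
    qed
    finally show ?thesis .
  qed
  hence "normal_equation lam A B ?X" using A B by (simp add: normal_equation_def)
  thus thesis using that X by blast
qed

text \<open>The definition picks some minimizer. By the expansion around a solution of the normal
  equation, that solution minimizes, and any minimizer differs from it by a matrix of norm zero
  because \<open>lam\<close> is positive.\<close>

lemma ridge_sol_normal:
  assumes A: "A \<in> carrier_mat n d" and B: "B \<in> carrier_mat n k" and lam: "0 < lam"
  shows "ridge_sol lam A B \<in> carrier_mat d k" "normal_equation lam A B (ridge_sol lam A B)"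
proof -
  obtain X where X: "X \<in> carrier_mat d k" "normal_equation lam A B X"
    using normal_equation_ex[OF A B lam] .
  have dims: "dim_col A = d" "dim_col B = k" using A B by auto
  have le: "ridge_cost lam A B X \<le> ridge_cost lam A B Y" if "Y \<in> carrier_mat d k" for Y
    using ridge_cost_expand[OF A B X(1) that X(2)] lam by simp
  hence "is_arg_min (ridge_cost lam A B) (\<lambda>Y. Y \<in> carrier_mat d k) X"
    using X by (auto simp: is_arg_min_linorder)
  hence "is_arg_min (ridge_cost lam A B) (\<lambda>Y. Y \<in> carrier_mat d k) (ridge_sol lam A B)"
    unfolding ridge_sol_def arg_min_on_def arg_min_def dims by (rule someI)
  hence Y: "ridge_sol lam A B \<in> carrier_mat d k" and "ridge_cost lam A B (ridge_sol lam A B) \<le> ridge_cost lam A B X"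
    using X by (auto simp: is_arg_min_linorder)
  let ?Y = "ridge_sol lam A B"
  have "lam * (fro_norm (?Y - X))\<^sup>2 \<le> 0"
    using ridge_cost_expand[OF A B X(1) Y X(2)] \<open>ridge_cost lam A B ?Y \<le> _\<close>
      zero_le_power2[of "fro_norm (A * (?Y - X))"] by linarith
  hence "(\<Sum>i<d. \<Sum>j<k. ((?Y - X) $$ (i, j))\<^sup>2) = 0"
    using lam X Y by (simp add: fro_norm_sq mult_le_0_iff sum_nonneg antisym)
  hence "\<forall>i\<in>{..<d}. \<forall>j\<in>{..<k}. ((?Y - X) $$ (i, j))\<^sup>2 = 0"
    by (subst (asm) sum_nonneg_eq_0_iff) (auto intro: sum_nonneg simp: sum_nonneg_eq_0_iff)
  hence "?Y = X" using X Y by (intro eq_matI) auto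
  thus "ridge_sol lam A B \<in> carrier_mat d k" "normal_equation lam A B (ridge_sol lam A B)"
    using X by auto
qed

text \<open>The two cost functions are compared on the carrier only, so it is the minimizer
  predicates that coincide; the choice operator then returns the same matrix.\<close>

lemma sketched_ridge_sol_eq:
  assumes A: "A \<in> carrier_mat n d" and B: "B \<in> carrier_mat n k" and S: "S \<in> carrier_mat m n"
  shows "sketched_ridge_sol lam S A B = ridge_sol lam (S * A) (S * B)"
proof -
  let ?f = "\<lambda>X. (fro_norm (S * (A * X - B)))\<^sup>2 + lam * (fro_norm X)\<^sup>2"
  have dims: "dim_col A = d" "dim_col B = k" "dim_col (S * A) = d" "dim_col (S * B) = k" using A B by auto
  have eq: "?f X = ridge_cost lam (S * A) (S * B) X" if "X \<in> carrier_mat d k" for X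
  proof -
    have "S * (A * X - B) = S * (A * X) - S * B"
      using A B S that by (intro mult_minus_distrib_mat[of _ m n _ k]) auto
    also have "S * (A * X) = S * A * X" using A S that by (intro assoc_mult_mat[symmetric])
    finally show ?thesis by (simp add: ridge_cost_def)
  qed
  have "is_arg_min ?f (\<lambda>X. X \<in> carrier_mat d k) = is_arg_min (ridge_cost lam (S * A) (S * B)) (\<lambda>X. X \<in> carrier_mat d k)"
    by (rule ext) (auto simp: is_arg_min_def eq)
  thus ?thesis unfolding sketched_ridge_sol_def ridge_sol_def arg_min_on_def arg_min_def dims by simp
qed

subsection \<open>Orthonormal bases of the augmented matrix\<close>

lemma mult_unit_vec:
  fixes M :: "real mat"
  assumes "M \<in> carrier_mat r c" "j < c"
  shows "M *\<^sub>v unit_vec c j = col M j"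
proof (rule eq_vecI)
  fix i assume "i < dim_vec (col M j)"
  hence i: "i < r" using assms by simp
  have "(M *\<^sub>v unit_vec c j) $ i = (\<Sum>l<c. M $$ (i, l) * unit_vec c j $ l)"
    using assms i by (subst mult_mat_vec_entry) auto
  also have "\<dots> = (\<Sum>l<c. if l = j then M $$ (i, j) else 0)"
    using assms by (intro sum.cong) auto
  finally show "(M *\<^sub>v unit_vec c j) $ i = col M j $ i" using assms i by simp
qed (use assms in auto)

lemma col_space_factor:
  fixes M M' :: "real mat"
  assumes M: "M \<in> carrier_mat r c" and M': "M' \<in> carrier_mat r c'"
    and sub: "vec_space.col_space r M' \<subseteq> vec_space.col_space r M"
  obtains T where "T \<in> carrier_mat c c'" "M' = M * T"
proof -
  have "\<exists>x. x \<in> carrier_vec c \<and> M *\<^sub>v x = col M' j" if j: "j < c'" for j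
  proof -
    have "M' *\<^sub>v unit_vec c' j = col M' j" using M' j by (intro mult_unit_vec)
    hence "col M' j \<in> vec_space.col_space r M'"
      unfolding vec_space.col_space_eq[OF M'] using M' j by auto
    hence "col M' j \<in> vec_space.col_space r M" using sub by auto
    thus ?thesis unfolding vec_space.col_space_eq[OF M] using M by auto
  qed
  then obtain x where x: "\<And>j. j < c' \<Longrightarrow> x j \<in> carrier_vec c \<and> M *\<^sub>v x j = col M' j" by metis
  let ?T = "mat c c' (\<lambda>(i, j). x j $ i)"
  have "M' = M * ?T"
  proof (rule eq_matI)
    fix i j assume ij: "i < dim_row (M * ?T)" "j < dim_col (M * ?T)"
    hence ij': "i < r" "j < c'" using M by auto
    have "(M * ?T) $$ (i, j) = (\<Sum>l<c. M $$ (i, l) * x j $ l)"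
      using ij' M by (subst mult_mat_entry) auto
    also have "\<dots> = (M *\<^sub>v x j) $ i" using ij' M x by (subst mult_mat_vec_entry) auto
    also have "\<dots> = M' $$ (i, j)" using x[OF ij'(2)] M' ij' by simp
    finally show "M' $$ (i, j) = (M * ?T) $$ (i, j)" by simp
  qed (use M M' in auto)
  thus thesis using that[of ?T] by simp
qed

definition last_rows :: "nat \<Rightarrow> nat \<Rightarrow> real mat \<Rightarrow> real mat" where
  "last_rows n d U = mat d (dim_col U) (\<lambda>(i, j). U $$ (n + i, j))"

locale augmented_basis =
  fixes n d :: nat and A U :: "real mat" and lam :: real
  assumes A: "A \<in> carrier_mat n d" and lam: "0 < lam"
    and basis: "orthonormal_basis_of_col_space (n + d) d U (A @\<^sub>r (sqrt lam \<cdot>\<^sub>m 1\<^sub>m d))"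
begin

definition U1 :: "real mat" where "U1 = first_rows n U"
definition U2 :: "real mat" where "U2 = last_rows n d U"

lemma U: "U \<in> carrier_mat (n + d) d" "U\<^sup>T * U = 1\<^sub>m d"
  using basis by (auto simp: orthonormal_basis_of_col_space_def)

lemma U1: "U1 \<in> carrier_mat n d" and U2: "U2 \<in> carrier_mat d d"
  using U by (auto simp: U1_def U2_def first_rows_def last_rows_def)

lemma sum_split: "(\<Sum>k<n + d. f k) = (\<Sum>k<n. f k) + (\<Sum>k<d. f (n + k))" for f :: "nat \<Rightarrow> real"
  by (induction d) (simp_all add: add.assoc)

lemma U1_U2: "U1\<^sup>T * U1 + U2\<^sup>T * U2 = 1\<^sub>m d"
proof (rule eq_matI)
  fix i j assume "i < dim_row (1\<^sub>m d :: real mat)" "j < dim_col (1\<^sub>m d :: real mat)"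
  hence ij: "i < d" "j < d" by auto
  have "(U\<^sup>T * U) $$ (i, j) = (\<Sum>k<n + d. U $$ (k, i) * U $$ (k, j))"
    by (rule transpose_mult_entry[OF U(1) U(1) ij])
  also have "\<dots> = (\<Sum>k<n. U1 $$ (k, i) * U1 $$ (k, j)) + (\<Sum>k<d. U2 $$ (k, i) * U2 $$ (k, j))"
    using ij U(1) by (simp add: sum_split U1_def U2_def first_rows_def last_rows_def)
  also have "\<dots> = (U1\<^sup>T * U1) $$ (i, j) + (U2\<^sup>T * U2) $$ (i, j)"
    by (simp add: transpose_mult_entry[OF U1 U1 ij] transpose_mult_entry[OF U2 U2 ij])
  finally show "(U1\<^sup>T * U1 + U2\<^sup>T * U2) $$ (i, j) = 1\<^sub>m d $$ (i, j)"
    using U1 U2 ij by (simp add: U(2))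
qed (use U1 U2 in auto)

text \<open>Equal column spaces give factors in both directions, and orthonormality of
  \<open>U\<close> makes them inverse to each other. \<open>K\<close> takes a solution of the ridge
  problem to its coefficients in the basis; the upper block of the factorization recovers
  \<open>A\<close>, the lower one the regularizer.\<close>

lemma factor:
  obtains T K where "T \<in> carrier_mat d d" "K \<in> carrier_mat d d" "T * K = 1\<^sub>m d" "K * T = 1\<^sub>m d"
    "A = U1 * K" "sqrt lam \<cdot>\<^sub>m 1\<^sub>m d = U2 * K"
proof -
  let ?M = "A @\<^sub>r (sqrt lam \<cdot>\<^sub>m 1\<^sub>m d)"
  have M: "?M \<in> carrier_mat (n + d) d" using A by (intro carrier_append_rows) auto
  have cs: "vec_space.col_space (n + d) U = vec_space.col_space (n + d) ?M"
    using basis by (simp add: orthonormal_basis_of_col_space_def)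
  obtain T where T: "T \<in> carrier_mat d d" "U = ?M * T"
    using col_space_factor[OF M U(1)] cs by auto
  obtain K where K: "K \<in> carrier_mat d d" "?M = U * K"
    using col_space_factor[OF U(1) M] cs by auto
  have "K * T = (U\<^sup>T * U) * (K * T)" using K(1) T(1) U by (simp add: left_mult_one_mat)
  also have "\<dots> = U\<^sup>T * (U * (K * T))" using U(1) K(1) T(1) by (intro assoc_mult_mat[of _ d "n + d" _ d _ d]) auto
  also have "U * (K * T) = U * K * T" using U(1) K(1) T(1) by (intro assoc_mult_mat[symmetric])
  also have "\<dots> = U" using K(2) T(2) by simp
  finally have KT: "K * T = 1\<^sub>m d" using U by simp
  hence TK: "T * K = 1\<^sub>m d" using K(1) T(1) mat_mult_left_right_inverse by blast
  have entry: "?M $$ (i, j) = (if i < n then A $$ (i, j) else (sqrt lam \<cdot>\<^sub>m 1\<^sub>m d) $$ (i - n, j))"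
    if "i < n + d" "j < d" for i j
    using that A unfolding append_rows_def by (subst index_mat_four_block) auto
  have UK: "(U * K) $$ (i, j) = (\<Sum>l<d. U $$ (i, l) * K $$ (l, j))" if "i < n + d" "j < d" for i j
    using that U K(1) by (subst mult_mat_entry) auto
  have "A = U1 * K"
  proof (rule eq_matI)
    fix i j assume "i < dim_row (U1 * K)" "j < dim_col (U1 * K)"
    hence ij: "i < n" "j < d" using U1 K by auto
    have "A $$ (i, j) = (\<Sum>l<d. U $$ (i, l) * K $$ (l, j))"
      using entry[of i j] UK[of i j] K(2) ij by simp
    also have "\<dots> = (U1 * K) $$ (i, j)"
      using ij U1 K(1) U(1) by (subst mult_mat_entry) (auto simp: U1_def first_rows_def)
    finally show "A $$ (i, j) = (U1 * K) $$ (i, j)" .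
  qed (use U1 K A in auto)
  moreover have "sqrt lam \<cdot>\<^sub>m 1\<^sub>m d = U2 * K"
  proof (rule eq_matI)
    fix i j assume "i < dim_row (U2 * K)" "j < dim_col (U2 * K)"
    hence ij: "i < d" "j < d" using U2 K by auto
    have "(sqrt lam \<cdot>\<^sub>m 1\<^sub>m d) $$ (i, j) = (\<Sum>l<d. U $$ (n + i, l) * K $$ (l, j))"
      using entry[of "n + i" j] UK[of "n + i" j] K(2) ij by simp
    also have "\<dots> = (U2 * K) $$ (i, j)"
      using ij U2 K(1) U(1) by (subst mult_mat_entry) (auto simp: U2_def last_rows_def)
    finally show "(sqrt lam \<cdot>\<^sub>m 1\<^sub>m d) $$ (i, j) = (U2 * K) $$ (i, j)" .
  qed (use U2 K in auto)
  ultimately show thesis using that T(1) K(1) TK KT by blast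
qed

text \<open>With \<open>Z = K * D\<close> the left side is the quadratic part of the ridge cost at
  \<open>D\<close>, so the excess cost becomes a plain squared norm.\<close>

lemma parseval:
  assumes Z: "Z \<in> carrier_mat d k"
  shows "(fro_norm (U1 * Z))\<^sup>2 + (fro_norm (U2 * Z))\<^sup>2 = (fro_norm Z)\<^sup>2"
proof -
  have "fip Z (M\<^sup>T * M * Z) = (fro_norm (M * Z))\<^sup>2" if "M \<in> carrier_mat r d" for M r
  proof -
    have "M\<^sup>T * M * Z = M\<^sup>T * (M * Z)" using that Z by (intro assoc_mult_mat[of _ d r _ d _ k]) auto
    thus ?thesis using that Z by (simp add: fip_mult_left[symmetric] fip_self)
  qed
  note this[OF U1] this[OF U2]
  moreover have "fip Z ((U1\<^sup>T * U1 + U2\<^sup>T * U2) * Z) = fip Z (U1\<^sup>T * U1 * Z) + fip Z (U2\<^sup>T * U2 * Z)"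
    using U1 U2 Z by (subst add_mult_distrib_mat[of _ d d _ _ k]; auto intro!: fip_add_right[of _ d k])
  moreover have "fip Z ((U1\<^sup>T * U1 + U2\<^sup>T * U2) * Z) = (fro_norm Z)\<^sup>2"
    unfolding U1_U2 using Z by (simp add: fip_self)
  ultimately show ?thesis by simp
qed

text \<open>The shifted Gram matrix is \<open>K\<^sup>T * K\<close>, with inverse
  \<open>T * T\<^sup>T\<close>; as \<open>U1 = A * T\<close>, cyclicity turns the squared norm into
  the trace of \<open>stat_dim_eq_trace\<close>.\<close>

lemma fro_U1: "(fro_norm U1)\<^sup>2 = stat_dim lam A"
proof -
  obtain T K where TK: "T \<in> carrier_mat d d" "K \<in> carrier_mat d d" "T * K = 1\<^sub>m d" "K * T = 1\<^sub>m d"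
    "A = U1 * K" "sqrt lam \<cdot>\<^sub>m 1\<^sub>m d = U2 * K" using factor .
  note asc = assoc_mult_mat[where n\<^sub>1 = d and n\<^sub>2 = d and n\<^sub>3 = d and n\<^sub>4 = d]
  have TT: "T\<^sup>T \<in> carrier_mat d d" and KT: "K\<^sup>T \<in> carrier_mat d d" using TK by auto
  have gram: "(V * K)\<^sup>T * (V * K) = K\<^sup>T * (V\<^sup>T * V) * K" if V: "V \<in> carrier_mat r d" for V r
  proof -
    have "(V * K)\<^sup>T = K\<^sup>T * V\<^sup>T" using V TK(2) by (rule transpose_mult)
    moreover have "K\<^sup>T * V\<^sup>T * (V * K) = K\<^sup>T * V\<^sup>T * V * K"
      using V TK(2) by (intro assoc_mult_mat[of _ d r _ d _ d, symmetric]) auto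
    moreover have "K\<^sup>T * V\<^sup>T * V = K\<^sup>T * (V\<^sup>T * V)"
      using V TK(2) by (intro assoc_mult_mat[of _ d d _ r _ d]) auto
    ultimately show ?thesis by simp
  qed
  have UU: "U1\<^sup>T * U1 \<in> carrier_mat d d" "U2\<^sup>T * U2 \<in> carrier_mat d d" using U1 U2 by auto
  have "lam \<cdot>\<^sub>m 1\<^sub>m d = (sqrt lam \<cdot>\<^sub>m 1\<^sub>m d)\<^sup>T * (sqrt lam \<cdot>\<^sub>m 1\<^sub>m d)"
  proof -
    have "(sqrt lam \<cdot>\<^sub>m 1\<^sub>m d)\<^sup>T = sqrt lam \<cdot>\<^sub>m 1\<^sub>m d" by (intro eq_matI) auto
    moreover have "(sqrt lam \<cdot>\<^sub>m 1\<^sub>m d) * (sqrt lam \<cdot>\<^sub>m 1\<^sub>m d) = sqrt lam \<cdot>\<^sub>m (1\<^sub>m d * (sqrt lam \<cdot>\<^sub>m 1\<^sub>m d))"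
      by (subst mult_smult_assoc_mat[of _ d d _ d]) auto
    moreover have "sqrt lam \<cdot>\<^sub>m (1\<^sub>m d * (sqrt lam \<cdot>\<^sub>m 1\<^sub>m d)) = lam \<cdot>\<^sub>m 1\<^sub>m d"
      using lam by (intro eq_matI) auto
    ultimately show ?thesis by simp
  qed
  also have "\<dots> = K\<^sup>T * (U2\<^sup>T * U2) * K" unfolding TK(6) by (rule gram[OF U2])
  finally have "A\<^sup>T * A + lam \<cdot>\<^sub>m 1\<^sub>m d = K\<^sup>T * (U1\<^sup>T * U1) * K + K\<^sup>T * (U2\<^sup>T * U2) * K"
    using gram[OF U1] TK(5) by simp
  also have "\<dots> = (K\<^sup>T * (U1\<^sup>T * U1) + K\<^sup>T * (U2\<^sup>T * U2)) * K"
    using TK UU by (intro add_mult_distrib_mat[of _ d d _ _ d, symmetric]) auto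
  also have "K\<^sup>T * (U1\<^sup>T * U1) + K\<^sup>T * (U2\<^sup>T * U2) = K\<^sup>T * (U1\<^sup>T * U1 + U2\<^sup>T * U2)"
    using TK UU by (intro mult_add_distrib_mat[of _ d d _ d, symmetric]) auto
  also have "\<dots> = K\<^sup>T" unfolding U1_U2 using TK by simp
  finally have G: "A\<^sup>T * A + lam \<cdot>\<^sub>m 1\<^sub>m d = K\<^sup>T * K" .
  have KTT: "K\<^sup>T * T\<^sup>T = 1\<^sub>m d"
    using transpose_mult[OF TK(1,2)] TK(3) by simp
  have "K\<^sup>T * K * (T * T\<^sup>T) = K\<^sup>T * (K * (T * T\<^sup>T))" using TK TT by (intro asc) auto
  also have "K * (T * T\<^sup>T) = K * T * T\<^sup>T" using TK TT by (intro asc[symmetric]) auto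
  finally have inv: "(A\<^sup>T * A + lam \<cdot>\<^sub>m 1\<^sub>m d) * (T * T\<^sup>T) = 1\<^sub>m d"
    using TK TT KTT unfolding G by simp
  have AT: "A * T = U1"
  proof -
    have "U1 * K * T = U1 * (K * T)" using U1 TK by (intro assoc_mult_mat)
    thus ?thesis using TK U1 by simp
  qed
  have Cc: "A\<^sup>T * A \<in> carrier_mat d d" using A by auto
  have "(fro_norm U1)\<^sup>2 = tr (U1\<^sup>T * U1)" by (rule fro_norm_sq_tr[OF U1])
  also have "U1\<^sup>T * U1 = T\<^sup>T * (A\<^sup>T * A) * T"
  proof -
    have "U1\<^sup>T = T\<^sup>T * A\<^sup>T" using transpose_mult[OF A TK(1)] by (simp add: AT)
    moreover have "T\<^sup>T * A\<^sup>T * (A * T) = T\<^sup>T * A\<^sup>T * A * T"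
      using A TK(1) by (intro assoc_mult_mat[of _ d n _ d _ d, symmetric]) auto
    moreover have "T\<^sup>T * A\<^sup>T * A = T\<^sup>T * (A\<^sup>T * A)"
      using A TK(1) by (intro assoc_mult_mat[of _ d d _ n _ d]) auto
    ultimately show ?thesis using AT by simp
  qed
  also have "T\<^sup>T * (A\<^sup>T * A) * T = T\<^sup>T * (A\<^sup>T * A * T)" using TT Cc TK by (intro asc)
  also have "tr (T\<^sup>T * (A\<^sup>T * A * T)) = tr (A\<^sup>T * A * T * T\<^sup>T)" using TT Cc TK by (intro tr_mult_commute) auto
  also have "A\<^sup>T * A * T * T\<^sup>T = A\<^sup>T * A * (T * T\<^sup>T)" using TT Cc TK by (intro asc)
  also have "tr (A\<^sup>T * A * (T * T\<^sup>T)) = stat_dim lam A"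
    using TK TT inv by (intro stat_dim_eq_trace[OF A lam, symmetric]) auto
  finally show ?thesis .
qed

lemma sketch_norm:
  assumes S: "S \<in> carrier_mat m n" and Z: "Z \<in> carrier_mat d k"
  shows "\<bar>(fro_norm (S * U1 * Z))\<^sup>2 - (fro_norm (U1 * Z))\<^sup>2\<bar> \<le>
    spectral_norm (U1\<^sup>T * S\<^sup>T * S * U1 - U1\<^sup>T * U1) * (fro_norm Z)\<^sup>2"
proof -
  have SU: "S * U1 \<in> carrier_mat m d" using S U1 by auto
  have quad: "fip Z (M\<^sup>T * M * Z) = (fro_norm (M * Z))\<^sup>2" if "M \<in> carrier_mat r d" for M r
  proof -
    have "M\<^sup>T * M * Z = M\<^sup>T * (M * Z)" using that Z by (intro assoc_mult_mat[of _ d r _ d _ k]) auto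
    thus ?thesis using that Z by (simp add: fip_mult_left[symmetric] fip_self)
  qed
  have G: "U1\<^sup>T * S\<^sup>T * S * U1 = (S * U1)\<^sup>T * (S * U1)" by (rule gram_assoc[OF S U1 U1])
  have mats: "(S * U1)\<^sup>T * (S * U1) \<in> carrier_mat d d" "U1\<^sup>T * U1 \<in> carrier_mat d d"
    using SU U1 by auto
  have "fip Z (((S * U1)\<^sup>T * (S * U1) - U1\<^sup>T * U1) * Z) = fip Z ((S * U1)\<^sup>T * (S * U1) * Z) - fip Z (U1\<^sup>T * U1 * Z)"
    using mats Z by (subst minus_mult_distrib_mat[of _ d d _ _ k]; auto intro!: fip_minus_right[of _ d k])
  hence "fip Z ((U1\<^sup>T * S\<^sup>T * S * U1 - U1\<^sup>T * U1) * Z) = (fro_norm (S * U1 * Z))\<^sup>2 - (fro_norm (U1 * Z))\<^sup>2"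
    unfolding G quad[OF SU] quad[OF U1] .
  moreover have "\<bar>fip Z ((U1\<^sup>T * S\<^sup>T * S * U1 - U1\<^sup>T * U1) * Z)\<bar> \<le>
      spectral_norm (U1\<^sup>T * S\<^sup>T * S * U1 - U1\<^sup>T * U1) * (fro_norm Z)\<^sup>2"
    unfolding G using mats Z by (intro fip_mult_le_spectral[OF _ Z] minus_carrier_mat) auto
  ultimately show ?thesis by simp
qed

text \<open>Let \<open>D\<close> be the difference of the two solutions and
  \<open>Z = K * D\<close>, whose squared norm is the excess cost. Subtracting the normal equations
  tested with \<open>D\<close> equates \<open>fip Z F\<close>, with \<open>F\<close> the product
  error, to a quadratic form that the spectral bound keeps above \<open>3 / 4\<close> of
  \<open>(fro_norm Z)\<^sup>2\<close>. The excess is thus at most \<open>16 / 9\<close> of the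
  squared product error, and the \<open>\<epsilon> / 2\<close> in the hypothesis makes up for this
  factor.\<close>

lemma sketched_cost_le:
  assumes B: "B \<in> carrier_mat n k" and S: "S \<in> carrier_mat m n"
    and spec: "spectral_norm (U1\<^sup>T * S\<^sup>T * S * U1 - U1\<^sup>T * U1) \<le> 1 / 4"
    and prod: "(fro_norm (U1\<^sup>T * S\<^sup>T * S * (B - A * ridge_sol lam A B) - U1\<^sup>T * (B - A * ridge_sol lam A B)))\<^sup>2 \<le>
      \<epsilon> / 2 * ridge_cost lam A B (ridge_sol lam A B)"
    and "0 \<le> \<epsilon>"
  shows "ridge_cost lam A B (ridge_sol lam (S * A) (S * B)) \<le> (1 + \<epsilon>) * ridge_cost lam A B (ridge_sol lam A B)"
proof -
  let ?X = "ridge_sol lam A B" and ?Y = "ridge_sol lam (S * A) (S * B)"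
  obtain T K where TK: "T \<in> carrier_mat d d" "K \<in> carrier_mat d d" "T * K = 1\<^sub>m d" "K * T = 1\<^sub>m d"
    "A = U1 * K" "sqrt lam \<cdot>\<^sub>m 1\<^sub>m d = U2 * K" using factor .
  have SA: "S * A \<in> carrier_mat m d" and SB: "S * B \<in> carrier_mat m k" using S A B by auto
  note X = ridge_sol_normal[OF A B lam]
  note Y = ridge_sol_normal[OF SA SB lam]
  define D where "D = ?Y - ?X"
  define Z where "Z = K * D"
  define R where "R = B - A * ?X"
  have D: "D \<in> carrier_mat d k" unfolding D_def using X(1) by (rule minus_carrier_mat)
  have Z: "Z \<in> carrier_mat d k" unfolding Z_def using TK D by auto
  have AX: "A * ?X \<in> carrier_mat n k" using A X by auto
  have R: "R \<in> carrier_mat n k" unfolding R_def using AX by (rule minus_carrier_mat)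
  have AD: "A * D \<in> carrier_mat n k" using A D by auto
  have SAD: "S * (A * D) \<in> carrier_mat m k" using S AD by auto
  have SR: "S * R \<in> carrier_mat m k" using S R by auto
  have U1Z: "U1 * Z = A * D"
    unfolding Z_def TK(5) using U1 TK D by (intro assoc_mult_mat[symmetric])
  have U2Z: "U2 * Z = sqrt lam \<cdot>\<^sub>m D"
  proof -
    have "U2 * Z = U2 * K * D" unfolding Z_def using U2 TK D by (intro assoc_mult_mat[symmetric])
    also have "\<dots> = sqrt lam \<cdot>\<^sub>m 1\<^sub>m d * D" by (simp only: TK(6)[symmetric])
    also have "\<dots> = sqrt lam \<cdot>\<^sub>m D" using D by (subst mult_smult_assoc_mat[of _ d d _ k]) auto
    finally show ?thesis .
  qed
  have smult: "(fro_norm (sqrt lam \<cdot>\<^sub>m D))\<^sup>2 = lam * (fro_norm D)\<^sup>2"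
    using lam by (simp add: fro_norm_sq power_mult_distrib sum_distrib_left)
  have Zsq: "(fro_norm Z)\<^sup>2 = (fro_norm (A * D))\<^sup>2 + lam * (fro_norm D)\<^sup>2"
    using parseval[OF Z] by (simp add: U1Z U2Z smult)
  have cost: "ridge_cost lam A B ?Y = ridge_cost lam A B ?X + (fro_norm Z)\<^sup>2"
    using ridge_cost_expand[OF A B X(1) Y(1) X(2)] by (simp add: Zsq D_def)
  have SU: "S * U1 * Z = S * (A * D)"
    using S U1 Z by (subst assoc_mult_mat[of _ m n _ d _ k]) (auto simp: U1Z)
  have sketched: "\<bar>(fro_norm (S * (A * D)))\<^sup>2 - (fro_norm (A * D))\<^sup>2\<bar> \<le> 1 / 4 * (fro_norm Z)\<^sup>2"
    using sketch_norm[OF S Z] spec unfolding SU U1Z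
    by (rule order_trans[OF _ mult_right_mono]) auto
  have n1: "- fip (A * D) R + lam * fip D ?X = 0"
  proof -
    have "A * ?X - B \<in> carrier_mat n k" using B by (rule minus_carrier_mat)
    have "fip (A * D) (A * ?X - B) = - fip (A * D) R"
      unfolding R_def using AD AX B by (simp add: fip_minus_right)
    thus ?thesis using normal_equation_test[OF A B X(1) D X(2)] by simp
  qed
  have n2: "(fro_norm (S * (A * D)))\<^sup>2 - fip (S * (A * D)) (S * R) + lam * fip D ?Y = 0"
  proof -
    have SAD': "S * A * D = S * (A * D)" using S A D by (intro assoc_mult_mat)
    have eqn: "S * A * ?Y - S * B = S * (A * D) - S * R"
    proof -
      have "S * A * ?Y = S * (A * ?Y)" using S A Y by (intro assoc_mult_mat)
      moreover have "A * ?Y - B = A * D - R"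
      proof -
        have AY: "A * ?Y \<in> carrier_mat n k" using A Y by auto
        have "A * D = A * ?Y - A * ?X" unfolding D_def using A X Y by (intro mult_minus_distrib_mat)
        moreover have "A * ?Y - B = A * ?Y - A * ?X - (B - A * ?X)"
          using AX AY B by (intro eq_matI) (auto simp del: index_mult_mat(2,3))
        ultimately show ?thesis by (simp add: R_def)
      qed
      moreover have "S * (A * ?Y) - S * B = S * (A * ?Y - B)" "S * (A * D) - S * R = S * (A * D - R)"
        using S A B Y AD R by (auto intro!: mult_minus_distrib_mat[of _ m n _ k, symmetric])
      ultimately show ?thesis by simp
    qed
    show ?thesis
      using normal_equation_test[OF SA SB Y(1) D Y(2)] unfolding SAD' eqn
      using SAD SR by (simp add: fip_minus_right fip_self)
  qed
  have Dsq: "fip D ?Y - fip D ?X = (fro_norm D)\<^sup>2"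
    using fip_minus_right[OF D Y(1) X(1)] fip_self[of D] by (simp add: D_def)
  define F where "F = U1\<^sup>T * S\<^sup>T * S * R - U1\<^sup>T * R"
  have F: "F \<in> carrier_mat d k" unfolding F_def using U1 R by (intro minus_carrier_mat) auto
  have ZF: "fip Z F = fip (S * (A * D)) (S * R) - fip (A * D) R"
  proof -
    have G: "U1\<^sup>T * S\<^sup>T * S * R = (S * U1)\<^sup>T * (S * R)" by (rule gram_assoc[OF S U1 R])
    have "fip Z F = fip Z ((S * U1)\<^sup>T * (S * R)) - fip Z (U1\<^sup>T * R)"
      unfolding F_def G using Z U1 S R SR by (intro fip_minus_right[of _ d k]) auto
    also have "fip Z ((S * U1)\<^sup>T * (S * R)) = fip (S * U1 * Z) (S * R)"
      using S U1 Z SR by (intro fip_mult_left[symmetric, of _ m d _ k]) auto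
    also have "fip Z (U1\<^sup>T * R) = fip (U1 * Z) R" by (rule fip_mult_left[OF U1 Z R, symmetric])
    finally show ?thesis by (simp only: SU U1Z)
  qed
  have "(fro_norm (S * (A * D)))\<^sup>2 + lam * (fro_norm D)\<^sup>2 = fip Z F"
    using n1 n2 arg_cong[OF Dsq, of "(*) lam"] unfolding ZF by (simp add: algebra_simps)
  \<comment> \<open>The sketch perturbs only the data part of the form; the regularizer is
    exact.\<close>
  hence "3 / 4 * (fro_norm Z)\<^sup>2 \<le> fip Z F" using sketched Zsq by linarith
  also have "\<dots> \<le> fro_norm Z * fro_norm F" using fip_cauchy_schwarz[OF Z F] by simp
  finally have ZZ: "3 / 4 * (fro_norm Z)\<^sup>2 \<le> fro_norm Z * fro_norm F" .
  have "3 / 4 * fro_norm Z \<le> fro_norm F"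
  proof (cases "fro_norm Z = 0")
    case True
    thus ?thesis using fro_norm_nonneg[of F] by simp
  next
    case False
    hence "0 < fro_norm Z" using fro_norm_nonneg[of Z] by simp
    moreover have "fro_norm Z * (3 / 4 * fro_norm Z) \<le> fro_norm Z * fro_norm F"
      using ZZ by (simp add: power2_eq_square)
    ultimately show ?thesis by (simp only: mult_le_cancel_left_pos)
  qed
  hence "(3 / 4 * fro_norm Z)\<^sup>2 \<le> (fro_norm F)\<^sup>2"
    using fro_norm_nonneg[of Z] by (intro power_mono) auto
  also have "\<dots> \<le> \<epsilon> / 2 * ridge_cost lam A B ?X" using prod unfolding F_def R_def .
  finally have "9 / 16 * (fro_norm Z)\<^sup>2 \<le> \<epsilon> / 2 * ridge_cost lam A B ?X"
    by (simp add: power_mult_distrib power2_eq_square)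
  moreover have "0 \<le> \<epsilon> * ridge_cost lam A B ?X"
    using \<open>0 \<le> \<epsilon>\<close> lam unfolding ridge_cost_def by (intro mult_nonneg_nonneg add_nonneg_nonneg) auto
  ultimately have "(fro_norm Z)\<^sup>2 \<le> \<epsilon> * ridge_cost lam A B ?X" by linarith
  thus ?thesis unfolding cost by (simp add: algebra_simps)
qed

end

section \<open>The two-stage sketch\<close>

context augmented_basis
begin

text \<open>The constants are read off from Markov's inequality: 128 brings the first mean square
  error to \<open>\<delta> / 64\<close>, while 16 and 48 bring the product errors of the two stages
  to \<open>\<delta> * \<epsilon> * \<Delta> / 8\<close> each. Two of the factors
  \<open>1 / \<delta>\<close> in the bound on \<open>m2\<close> stem from the norms that the first
  stage may inflate. Four events of the first stage and three of the second exhaust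
  \<open>7 * \<delta>\<close>. The spectral estimate of the second stage is a hypothesis because it
  is obtained in two different ways.\<close>

lemma sketch_good:
  assumes B: "B \<in> carrier_mat n k" and \<epsilon>: "0 < \<epsilon>" and \<delta>: "0 < \<delta>" "\<delta> \<le> 1 / 7"
    and m1: "m1 = 2 ^ q" "128 * (stat_dim lam A)\<^sup>2 / \<delta> \<le> real m1" "16 * (stat_dim lam A / \<epsilon>) / \<delta> \<le> real m1"
    and m2: "0 < m2" "48 * (stat_dim lam A / \<epsilon>) / \<delta> ^ 3 \<le> real m2"
    and spectral: "\<And>W. W \<in> carrier_mat m1 d \<Longrightarrow>
      (\<And>v. v \<in> carrier_vec d \<Longrightarrow> (vec_norm2 (W *\<^sub>v v))\<^sup>2 \<le> 2 * (vec_norm2 v)\<^sup>2) \<Longrightarrow>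
      (fro_norm W)\<^sup>2 \<le> stat_dim lam A / \<delta> \<Longrightarrow>
      measure_pmf.prob (srht_pmf m2 m1) {S. spectral_norm (W\<^sup>T * S\<^sup>T * S * W - W\<^sup>T * W) \<le> 1 / 8} \<ge> 1 - (\<delta> + \<delta>)"
    and Xs: "Xs = ridge_sol lam A B" and Delta: "\<Delta> = ridge_cost lam A B Xs" and R: "R = B - A * Xs"
  shows "measure_pmf.prob (sketch_pmf m2 m1 n)
    {S. S \<in> carrier_mat m2 n \<and> spectral_norm (U1\<^sup>T * S\<^sup>T * S * U1 - U1\<^sup>T * U1) \<le> 1 / 4 \<and>
      (fro_norm (U1\<^sup>T * S\<^sup>T * S * R - U1\<^sup>T * R))\<^sup>2 \<le> \<epsilon> / 2 * \<Delta>} \<ge> 1 - 7 * \<delta>"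
    (is "measure_pmf.prob _ ?Good \<ge> _")
proof -
  let ?\<tau> = "stat_dim lam A"
  have m1pos: "0 < m1" using m1 by simp
  have \<tau>: "0 \<le> ?\<tau>" using fro_U1 by (metis zero_le_power2)
  have Xsc: "Xs \<in> carrier_mat d k" unfolding Xs by (rule ridge_sol_normal[OF A B lam])
  have AX: "A * Xs \<in> carrier_mat n k" using A Xsc by auto
  have Rc: "R \<in> carrier_mat n k" unfolding R using AX by (rule minus_carrier_mat)
  have Rle: "(fro_norm R)\<^sup>2 \<le> \<Delta>"
  proof -
    have "(fro_norm R)\<^sup>2 = (fro_norm (A * Xs - B))\<^sup>2"
      unfolding R fro_norm_sq using AX B
      by (intro sum.cong) (auto simp: power2_commute simp del: index_mult_mat)
    thus ?thesis using lam unfolding Delta ridge_cost_def by simp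
  qed
  have D0: "0 \<le> \<Delta>" using Rle by (rule order_trans[rotated]) simp
  let ?P1 = "sparse_embedding_pmf m1 n"
  note fin1 = finite_sparse_embedding[OF m1pos, of n]
  let ?E1 = "\<lambda>S. U1\<^sup>T * S\<^sup>T * S * U1 - U1\<^sup>T * U1"
  let ?F1 = "\<lambda>S. U1\<^sup>T * S\<^sup>T * S * R - U1\<^sup>T * R"
  have e1: "measure_pmf.prob ?P1 {S. (fro_norm (?E1 S))\<^sup>2 \<le> 1 / 64} \<ge> 1 - \<delta>"
  proof (rule markov_finite[OF fin1])
    have "measure_pmf.expectation ?P1 (\<lambda>S. (fro_norm (?E1 S))\<^sup>2) \<le> 2 / real m1 * (?\<tau> * ?\<tau>)"
      using sparse_embedding_product[OF m1pos U1 U1] by (simp add: fro_U1)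
    also have "\<dots> \<le> \<delta> * (1 / 64)"
      using m1(2) m1pos \<delta> by (simp add: field_simps power2_eq_square)
    finally show "measure_pmf.expectation ?P1 (\<lambda>S. (fro_norm (?E1 S))\<^sup>2) \<le> \<delta> * (1 / 64)" .
  qed (use \<delta> in auto)
  have e2: "measure_pmf.prob ?P1 {S. (fro_norm (?F1 S))\<^sup>2 \<le> \<epsilon> * \<Delta> / 8} \<ge> 1 - \<delta>"
  proof (rule markov_finite[OF fin1])
    have "measure_pmf.expectation ?P1 (\<lambda>S. (fro_norm (?F1 S))\<^sup>2) \<le> 2 / real m1 * (?\<tau> * (fro_norm R)\<^sup>2)"
      using sparse_embedding_product[OF m1pos U1 Rc] by (simp add: fro_U1)
    also have "\<dots> \<le> 2 / real m1 * (?\<tau> * \<Delta>)" using Rle \<tau> by (intro mult_left_mono) auto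
    also have "\<dots> = (2 * ?\<tau> / real m1) * \<Delta>" by simp
    also have "\<dots> \<le> (\<delta> * \<epsilon> / 8) * \<Delta>"
      using m1(3) m1pos \<delta> \<epsilon> D0 by (intro mult_right_mono) (simp_all add: field_simps)
    finally show "measure_pmf.expectation ?P1 (\<lambda>S. (fro_norm (?F1 S))\<^sup>2) \<le> \<delta> * (\<epsilon> * \<Delta> / 8)" by (simp add: mult_ac)
  qed (use \<delta> \<epsilon> D0 in auto)
  have e3: "measure_pmf.prob ?P1 {S. (fro_norm (S * U1))\<^sup>2 \<le> ?\<tau> / \<delta>} \<ge> 1 - \<delta>"
    using \<delta> \<tau> by (intro markov_finite fin1) (auto simp: sparse_embedding_fro[OF m1pos U1] fro_U1)
  have e4: "measure_pmf.prob ?P1 {S. (fro_norm (S * R))\<^sup>2 \<le> \<Delta> / \<delta>} \<ge> 1 - \<delta>"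
    using \<delta> D0 Rle by (intro markov_finite fin1) (auto simp: sparse_embedding_fro[OF m1pos Rc])
  let ?G = "({S. (fro_norm (?E1 S))\<^sup>2 \<le> 1 / 64} \<inter> {S. (fro_norm (?F1 S))\<^sup>2 \<le> \<epsilon> * \<Delta> / 8}) \<inter>
    ({S. (fro_norm (S * U1))\<^sup>2 \<le> ?\<tau> / \<delta>} \<inter> {S. (fro_norm (S * R))\<^sup>2 \<le> \<Delta> / \<delta>})"
  have G: "measure_pmf.prob ?P1 ?G \<ge> 1 - ((\<delta> + \<delta>) + (\<delta> + \<delta>))"
    by (intro prob_Int_ge e1 e2 e3 e4)
  have second: "measure_pmf.prob (map_pmf (\<lambda>S2. S2 * S1) (srht_pmf m2 m1)) ?Good \<ge> 1 - ((\<delta> + \<delta>) + \<delta>)"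
    if S1: "S1 \<in> set_pmf ?P1" "S1 \<in> ?G" for S1
  proof -
    have S1c: "S1 \<in> carrier_mat m1 n" using S1 by (auto simp: sparse_embedding_alt embedding_carrier)
    let ?W = "S1 * U1" and ?V = "S1 * R"
    have W: "?W \<in> carrier_mat m1 d" and V: "?V \<in> carrier_mat m1 k" using S1c U1 Rc by auto
    have WW: "U1\<^sup>T * S1\<^sup>T * S1 * U1 = ?W\<^sup>T * ?W" by (rule gram_assoc[OF S1c U1 U1])
    have WV: "U1\<^sup>T * S1\<^sup>T * S1 * R = ?W\<^sup>T * ?V" by (rule gram_assoc[OF S1c U1 Rc])
    have E1: "fro_norm (?E1 S1) \<le> 1 / 8"
    proof (rule power2_le_imp_le)
      show "(fro_norm (?E1 S1))\<^sup>2 \<le> (1 / 8)\<^sup>2" using S1 by (simp add: power2_eq_square)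
    qed simp
    hence spec1: "spectral_norm (?E1 S1) \<le> 1 / 8" using spectral_norm_le_fro[of "?E1 S1"] by linarith
    have F1: "(fro_norm (?W\<^sup>T * ?V - U1\<^sup>T * R))\<^sup>2 \<le> \<epsilon> * \<Delta> / 8"
      using S1(2) unfolding WV[symmetric] by blast
    \<comment> \<open>Since \<open>U1\<close> is a contraction by \<open>parseval\<close>, the
      first-stage error gives the bound \<open>9 / 8\<close>; this is the near-contraction that
      flattening and sampling ask for.\<close>
    have contr: "(vec_norm2 (?W *\<^sub>v v))\<^sup>2 \<le> 2 * (vec_norm2 v)\<^sup>2" if v: "v \<in> carrier_vec d" for v
    proof -
      let ?Z = "mat d 1 (\<lambda>(i, j). v $ i)"
      have Z: "?Z \<in> carrier_mat d 1" by simp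
      have vz: "(fro_norm ?Z)\<^sup>2 = (vec_norm2 v)\<^sup>2" using v by (simp add: fro_norm_sq vec_norm2_sq)
      have "(fro_norm (?W * ?Z))\<^sup>2 = (vec_norm2 (?W *\<^sub>v v))\<^sup>2"
      proof -
        have "(fro_norm (?W * ?Z))\<^sup>2 = (\<Sum>i<m1. ((?W * ?Z) $$ (i, 0))\<^sup>2)"
          by (simp only: fro_norm_sq carrier_matD[OF mult_carrier_mat[OF W Z]]) simp
        also have "\<dots> = (\<Sum>i<m1. ((?W *\<^sub>v v) $ i)\<^sup>2)"
          using W v by (intro sum.cong refl arg_cong[where f = "\<lambda>x. x\<^sup>2"])
            (simp add: mult_mat_entry mult_mat_vec_entry del: index_mult_mat_vec index_mult_mat)
        also have "\<dots> = (vec_norm2 (?W *\<^sub>v v))\<^sup>2" using W by (simp add: vec_norm2_sq del: index_mult_mat_vec index_mult_mat)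
        finally show ?thesis .
      qed
      moreover have "(fro_norm (?W * ?Z))\<^sup>2 \<le> (fro_norm (U1 * ?Z))\<^sup>2 + 1 / 8 * (fro_norm ?Z)\<^sup>2"
      proof -
        have "spectral_norm (?E1 S1) * (fro_norm ?Z)\<^sup>2 \<le> 1 / 8 * (fro_norm ?Z)\<^sup>2"
          using spec1 by (intro mult_right_mono) auto
        thus ?thesis using sketch_norm[OF S1c Z] by linarith
      qed
      moreover have "(fro_norm (U1 * ?Z))\<^sup>2 \<le> (fro_norm ?Z)\<^sup>2"
        using parseval[OF Z] zero_le_power2[of "fro_norm (U2 * ?Z)"] by linarith
      ultimately show ?thesis unfolding vz using zero_le_power2[of "vec_norm2 v"] by linarith
    qed
    have Wf: "(fro_norm ?W)\<^sup>2 \<le> ?\<tau> / \<delta>" and Vf: "(fro_norm ?V)\<^sup>2 \<le> \<Delta> / \<delta>" using S1 by auto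
    have f1: "measure_pmf.prob (srht_pmf m2 m1) {S. spectral_norm (?W\<^sup>T * S\<^sup>T * S * ?W - ?W\<^sup>T * ?W) \<le> 1 / 8} \<ge> 1 - (\<delta> + \<delta>)"
      by (rule spectral[OF W contr Wf])
    have f2: "measure_pmf.prob (srht_pmf m2 m1) {S. (fro_norm (?W\<^sup>T * S\<^sup>T * S * ?V - ?W\<^sup>T * ?V))\<^sup>2 \<le> \<epsilon> * \<Delta> / 8} \<ge> 1 - \<delta>"
    proof (rule markov_finite[OF finite_srht[OF m1pos]])
      have "measure_pmf.expectation (srht_pmf m2 m1) (\<lambda>S. (fro_norm (?W\<^sup>T * S\<^sup>T * S * ?V - ?W\<^sup>T * ?V))\<^sup>2) \<le>
          6 / real m2 * ((fro_norm ?W)\<^sup>2 * (fro_norm ?V)\<^sup>2)"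
        by (rule srht_product[OF m2(1) m1(1) W V])
      also have "\<dots> \<le> 6 / real m2 * ((?\<tau> / \<delta>) * (\<Delta> / \<delta>))"
        using Wf Vf \<tau> \<delta> by (intro mult_left_mono mult_mono) auto
      also have "\<dots> = (6 * ?\<tau> / (real m2 * \<delta>\<^sup>2)) * \<Delta>" by (simp add: power2_eq_square)
      also have "\<dots> \<le> (\<delta> * \<epsilon> / 8) * \<Delta>"
        using m2 \<delta> \<epsilon> D0 by (intro mult_right_mono) (simp_all add: field_simps power2_eq_square power3_eq_cube)
      finally show "measure_pmf.expectation (srht_pmf m2 m1) (\<lambda>S. (fro_norm (?W\<^sup>T * S\<^sup>T * S * ?V - ?W\<^sup>T * ?V))\<^sup>2) \<le>
        \<delta> * (\<epsilon> * \<Delta> / 8)" by (simp add: mult_ac)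
    qed (use \<delta> \<epsilon> D0 in auto)
    let ?H = "{S. spectral_norm (?W\<^sup>T * S\<^sup>T * S * ?W - ?W\<^sup>T * ?W) \<le> 1 / 8} \<inter>
      {S. (fro_norm (?W\<^sup>T * S\<^sup>T * S * ?V - ?W\<^sup>T * ?V))\<^sup>2 \<le> \<epsilon> * \<Delta> / 8}"
    have "1 - ((\<delta> + \<delta>) + \<delta>) \<le> measure_pmf.prob (srht_pmf m2 m1) ?H" by (rule prob_Int_ge[OF f1 f2])
    also have "\<dots> = measure_pmf.prob (srht_pmf m2 m1) (?H \<inter> set_pmf (srht_pmf m2 m1))"
      by (rule measure_Int_set_pmf[symmetric])
    also have "\<dots> \<le> measure_pmf.prob (srht_pmf m2 m1) ((\<lambda>S2. S2 * S1) -` ?Good)"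
    proof (rule measure_pmf.finite_measure_mono)
      show "?H \<inter> set_pmf (srht_pmf m2 m1) \<subseteq> (\<lambda>S2. S2 * S1) -` ?Good"
      proof
        fix S2 assume S2: "S2 \<in> ?H \<inter> set_pmf (srht_pmf m2 m1)"
        have S2c: "S2 \<in> carrier_mat m2 m1" using S2 by (auto simp: srht_pmf_alt srht_carrier)
        let ?S = "S2 * S1"
        have Sc: "?S \<in> carrier_mat m2 n" using S2c S1c by auto
        have SU: "?S * U1 = S2 * ?W" using S2c S1c U1 by (intro assoc_mult_mat)
        have SR: "?S * R = S2 * ?V" using S2c S1c Rc by (intro assoc_mult_mat)
        have GU: "U1\<^sup>T * ?S\<^sup>T * ?S * U1 = ?W\<^sup>T * S2\<^sup>T * S2 * ?W"
          unfolding gram_assoc[OF Sc U1 U1] gram_assoc[OF S2c W W] SU ..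
        have GR: "U1\<^sup>T * ?S\<^sup>T * ?S * R = ?W\<^sup>T * S2\<^sup>T * S2 * ?V"
          unfolding gram_assoc[OF Sc U1 Rc] gram_assoc[OF S2c W V] SU SR ..
        have telescope: "M - L = (M - K) + (K - L)" if "M \<in> carrier_mat a b" "K \<in> carrier_mat a b" "L \<in> carrier_mat a b"
          for M K L :: "real mat" and a b using that by (intro eq_matI) auto
        have gram_carrier: "M\<^sup>T * L \<in> carrier_mat a b" if "M \<in> carrier_mat c a" "L \<in> carrier_mat c b"
          for M L :: "real mat" and a b c
          using that by auto
        have mW: "?W\<^sup>T * S2\<^sup>T * S2 * ?W \<in> carrier_mat d d" "?W\<^sup>T * ?W \<in> carrier_mat d d" "U1\<^sup>T * U1 \<in> carrier_mat d d"
          "?W\<^sup>T * S2\<^sup>T * S2 * ?V \<in> carrier_mat d k" "?W\<^sup>T * ?V \<in> carrier_mat d k" "U1\<^sup>T * R \<in> carrier_mat d k"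
          unfolding gram_assoc[OF S2c W W] gram_assoc[OF S2c W V]
          by (rule gram_carrier; rule W V U1 Rc mult_carrier_mat[OF S2c W] mult_carrier_mat[OF S2c V])+
        have "spectral_norm (U1\<^sup>T * ?S\<^sup>T * ?S * U1 - U1\<^sup>T * U1) \<le>
            spectral_norm (?W\<^sup>T * S2\<^sup>T * S2 * ?W - ?W\<^sup>T * ?W) + spectral_norm (?W\<^sup>T * ?W - U1\<^sup>T * U1)"
          unfolding GU telescope[OF mW(1,2,3)] by (intro spectral_norm_add_le[of _ d d] minus_carrier_mat mW)
        also have "\<dots> \<le> 1 / 8 + 1 / 8" using S2 spec1 unfolding WW by (intro add_mono) auto
        finally have spec: "spectral_norm (U1\<^sup>T * ?S\<^sup>T * ?S * U1 - U1\<^sup>T * U1) \<le> 1 / 4" by simp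
        let ?t = "sqrt (\<epsilon> * \<Delta> / 8)"
        have root: "fro_norm M \<le> ?t" if "(fro_norm M)\<^sup>2 \<le> \<epsilon> * \<Delta> / 8" for M
          using that by (rule real_le_rsqrt)
        have "fro_norm (U1\<^sup>T * ?S\<^sup>T * ?S * R - U1\<^sup>T * R) \<le>
            fro_norm (?W\<^sup>T * S2\<^sup>T * S2 * ?V - ?W\<^sup>T * ?V) + fro_norm (?W\<^sup>T * ?V - U1\<^sup>T * R)"
          unfolding GR telescope[OF mW(4,5,6)] by (intro fro_norm_add_le[of _ d k] minus_carrier_mat mW)
        \<comment> \<open>Each stage contributes the root of
          \<open>\<epsilon> * \<Delta> / 8\<close>; squaring the sum gives
          \<open>\<epsilon> / 2 * \<Delta>\<close>.\<close>
        also have "\<dots> \<le> ?t + ?t" using S2 F1 by (intro add_mono root) auto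
        finally have "(fro_norm (U1\<^sup>T * ?S\<^sup>T * ?S * R - U1\<^sup>T * R))\<^sup>2 \<le> (?t + ?t)\<^sup>2"
          by (intro power_mono fro_norm_nonneg)
        also have "\<dots> = \<epsilon> / 2 * \<Delta>" using \<epsilon> D0 by (simp add: power2_eq_square algebra_simps flip: real_sqrt_mult)
        finally show "S2 \<in> (\<lambda>S2. S2 * S1) -` ?Good" using Sc spec by simp
      qed
    qed simp
    finally show ?thesis by simp
  qed
  have "sketch_pmf m2 m1 n = bind_pmf ?P1 (\<lambda>S1. map_pmf (\<lambda>S2. S2 * S1) (srht_pmf m2 m1))"
    by (simp add: sketch_pmf_def map_pmf_def)
  moreover have "measure_pmf.prob (bind_pmf ?P1 (\<lambda>S1. map_pmf (\<lambda>S2. S2 * S1) (srht_pmf m2 m1))) ?Good \<ge>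
      1 - (((\<delta> + \<delta>) + (\<delta> + \<delta>)) + ((\<delta> + \<delta>) + \<delta>))"
    using \<delta> by (intro prob_bind_ge[OF fin1 G] second) auto
  ultimately show ?thesis by (simp add: algebra_simps)
qed

end

text \<open>Bounding the spectral error by the Frobenius error costs \<open>\<tau>\<^sup>2\<close>
  rows instead of a logarithm, which is affordable while \<open>\<tau>\<close> is bounded.\<close>

lemma srht_spectral_small:
  assumes "0 < m2" "m1 = 2 ^ q" and W: "W \<in> carrier_mat m1 d" and Wf: "(fro_norm W)\<^sup>2 \<le> \<tau> / \<delta>"
    and \<delta>: "0 < \<delta>" and \<tau>: "0 \<le> \<tau>" and m2: "384 * \<tau>\<^sup>2 / \<delta> ^ 3 \<le> real m2"
  shows "measure_pmf.prob (srht_pmf m2 m1) {S. spectral_norm (W\<^sup>T * S\<^sup>T * S * W - W\<^sup>T * W) \<le> 1 / 8} \<ge> 1 - \<delta>"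
proof -
  have m1pos: "0 < m1" using assms by simp
  have "measure_pmf.prob (srht_pmf m2 m1) {S. (fro_norm (W\<^sup>T * S\<^sup>T * S * W - W\<^sup>T * W))\<^sup>2 \<le> 1 / 64} \<ge> 1 - \<delta>"
  proof (rule markov_finite[OF finite_srht[OF m1pos]])
    have "measure_pmf.expectation (srht_pmf m2 m1) (\<lambda>S. (fro_norm (W\<^sup>T * S\<^sup>T * S * W - W\<^sup>T * W))\<^sup>2) \<le>
        6 / real m2 * ((fro_norm W)\<^sup>2 * (fro_norm W)\<^sup>2)"
      by (rule srht_product[OF assms(1,2) W W])
    also have "\<dots> \<le> 6 / real m2 * ((\<tau> / \<delta>) * (\<tau> / \<delta>))"
      using Wf \<tau> \<delta> by (intro mult_left_mono mult_mono) auto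
    also have "\<dots> \<le> \<delta> * (1 / 64)"
      using m2 \<delta> \<open>0 < m2\<close> by (simp add: field_simps power2_eq_square power3_eq_cube)
    finally show "measure_pmf.expectation (srht_pmf m2 m1) (\<lambda>S. (fro_norm (W\<^sup>T * S\<^sup>T * S * W - W\<^sup>T * W))\<^sup>2) \<le> \<delta> * (1 / 64)" .
  qed (use \<delta> in auto)
  also have "measure_pmf.prob (srht_pmf m2 m1) {S. (fro_norm (W\<^sup>T * S\<^sup>T * S * W - W\<^sup>T * W))\<^sup>2 \<le> 1 / 64} \<le>
      measure_pmf.prob (srht_pmf m2 m1) {S. spectral_norm (W\<^sup>T * S\<^sup>T * S * W - W\<^sup>T * W) \<le> 1 / 8}"
  proof (intro measure_pmf.finite_measure_mono subsetI CollectI)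
    fix S assume "S \<in> {S. (fro_norm (W\<^sup>T * S\<^sup>T * S * W - W\<^sup>T * W))\<^sup>2 \<le> 1 / 64}"
    hence "(fro_norm (W\<^sup>T * S\<^sup>T * S * W - W\<^sup>T * W))\<^sup>2 \<le> (1 / 8)\<^sup>2" by (simp add: power2_eq_square)
    hence "fro_norm (W\<^sup>T * S\<^sup>T * S * W - W\<^sup>T * W) \<le> 1 / 8" by (rule power2_le_imp_le) simp
    thus "spectral_norm (W\<^sup>T * S\<^sup>T * S * W - W\<^sup>T * W) \<le> 1 / 8"
      using spectral_norm_le_fro order_trans by blast
  qed simp
  finally show ?thesis .
qed

section \<open>Choice of the dimensions\<close>

lemma ln_ge_one:
  assumes "3 \<le> (x :: real)"
  shows "1 \<le> ln x"
  using exp_le assms by (simp add: ln_ge_iff)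

lemma ex_power_two_between:
  assumes "1 \<le> (x :: real)"
  shows "\<exists>q. x \<le> 2 ^ q \<and> 2 ^ q \<le> 2 * x"
proof -
  define q where "q = (LEAST q. x \<le> 2 ^ q)"
  have ex: "\<exists>q. x \<le> 2 ^ q" using real_arch_pow[of 2 x] by (auto intro: less_imp_le)
  have "x \<le> 2 ^ q" unfolding q_def by (rule LeastI_ex[OF ex])
  moreover have "2 ^ q \<le> 2 * x"
  proof (cases q)
    case 0
    thus ?thesis using assms by simp
  next
    case (Suc r)
    have "\<not> x \<le> 2 ^ r" using Suc not_less_Least[of r "\<lambda>q. x \<le> 2 ^ q"] unfolding q_def by simp
    thus ?thesis using Suc by simp
  qed
  ultimately show ?thesis by blast
qed

text \<open>The power of two is sought above \<open>128 / \<delta>\<close> times the target;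
  rounding up at most doubles it, hence 256.\<close>

lemma ex_sparse_embedding_size:
  assumes "0 < \<delta>" "\<delta> \<le> 1" "0 \<le> \<tau>" "0 \<le> x"
  shows "\<exists>q. 128 * \<tau>\<^sup>2 / \<delta> \<le> real (2 ^ q) \<and> 16 * x / \<delta> \<le> real (2 ^ q) \<and>
    real (2 ^ q) \<le> 256 / \<delta> * max 1 (x + \<tau>\<^sup>2)"
proof -
  define y where "y = max 1 (x + \<tau>\<^sup>2)"
  have y: "1 \<le> y" "x + \<tau>\<^sup>2 \<le> y" by (simp_all add: y_def)
  have "1 * 1 \<le> 128 / \<delta> * y"
    using assms y by (intro mult_mono) (auto simp: field_simps)
  then obtain q where q: "128 / \<delta> * y \<le> 2 ^ q" "2 ^ q \<le> 2 * (128 / \<delta> * y)"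
    using ex_power_two_between[of "128 / \<delta> * y"] by auto
  have "\<tau>\<^sup>2 \<le> y" "16 * x \<le> 128 * y" using assms y zero_le_power2[of \<tau>] by linarith+
  hence "128 * \<tau>\<^sup>2 / \<delta> \<le> 128 / \<delta> * y" "16 * x / \<delta> \<le> 128 / \<delta> * y"
    using assms by (simp_all add: divide_right_mono)
  thus ?thesis using q unfolding y_def[symmetric] by (intro exI[of _ q]) auto
qed

text \<open>The numbers 3096 and 6195 are the constants in the bounds on \<open>L\<close> and
  \<open>p\<close> in \<open>ex_srht_size_large\<close>, \<open>2 * 3\<close> bounds
  \<open>2 * exp 1\<close>, and 16384 is the square of the 128 in the deviation condition. The
  fourth power of \<open>\<delta>\<close> collects one factor each from \<open>L\<close> and
  \<open>p\<close> and two from that condition. The summand 1 pays for rounding up, the outer factor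
  2 for passing to the soft bound.\<close>

definition srht_size_const :: "real \<Rightarrow> real" where
  "srht_size_const \<delta> = 2 * (2 * 3 * 6195 * 3096 * 16384 / \<delta> ^ 4 + 1)"

text \<open>Below \<open>\<tau> / \<epsilon> = 3\<close> the logarithm in the size bound may be
  small or negative, but then a constant number of rows suffices; from 3 on it is at least one and
  the bound dominates \<open>\<tau> / \<epsilon>\<close>. The assumption
  \<open>\<tau> \<le> 3\<close> makes \<open>\<tau>\<^sup>2\<close> at most
  \<open>3 * (\<tau> / \<epsilon>)\<close>.\<close>

lemma ex_srht_size_small:
  assumes \<delta>: "0 < \<delta>" "\<delta> \<le> 1" and \<epsilon>: "0 < \<epsilon>" "\<epsilon> \<le> 1" and \<tau>: "0 \<le> \<tau>" "\<tau> \<le> 3"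
  shows "\<exists>m :: nat. 0 < m \<and> 48 * (\<tau> / \<epsilon>) / \<delta> ^ 3 \<le> real m \<and> 384 * \<tau>\<^sup>2 / \<delta> ^ 3 \<le> real m \<and>
    real m \<le> srht_size_const \<delta> * max 1 (1 / \<epsilon> * (\<tau> + ln (1 / \<epsilon>)) * ln (\<tau> / \<epsilon>)) \<and>
    real m \<le> srht_size_const \<delta> * max 1 (\<tau> / \<epsilon>)"
proof -
  define x where "x = \<tau> / \<epsilon>"
  \<comment> \<open>The 1200 in \<open>m\<close> exceeds both 48 and \<open>3 * 384\<close>; the
    further 2 pays for the maximum with 1 and for rounding up.\<close>
  define c where "c = 1202 / \<delta> ^ 3"
  define m where "m = nat \<lceil>max 1 (1200 * x / \<delta> ^ 3)\<rceil>"
  have x: "0 \<le> x" "\<tau> \<le> x" using \<epsilon> \<tau> by (auto simp: x_def field_simps intro: mult_right_mono[of \<epsilon> 1 \<tau>, simplified])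
  have d3: "0 < \<delta> ^ 3" "\<delta> ^ 3 \<le> 1" "\<delta> ^ 4 \<le> \<delta> ^ 3" "0 < \<delta> ^ 4"
    using \<delta> by (auto simp: power_le_one power_decreasing)
  have m: "max 1 (1200 * x / \<delta> ^ 3) \<le> real m" unfolding m_def by linarith
  have m_le: "real m \<le> max 1 (1200 * x / \<delta> ^ 3) + 1" unfolding m_def by linarith
  have "0 < m" using m by (cases m) auto
  have "max 1 (1200 * x / \<delta> ^ 3) + 1 \<le> c * max 1 x"
  proof -
    have "1200 * x / \<delta> ^ 3 + 2 \<le> 1200 / \<delta> ^ 3 * max 1 x + 2 / \<delta> ^ 3 * max 1 x"
    proof (rule add_mono)
      show "1200 * x / \<delta> ^ 3 \<le> 1200 / \<delta> ^ 3 * max 1 x" using d3 by (simp add: divide_right_mono)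
      have "2 * 1 \<le> 2 / \<delta> ^ 3 * max 1 x" using d3 by (intro mult_mono) (auto simp: field_simps)
      thus "2 \<le> 2 / \<delta> ^ 3 * max 1 x" by simp
    qed
    moreover have "0 \<le> 1200 * x / \<delta> ^ 3" using x d3 by simp
    ultimately show ?thesis unfolding c_def by (simp add: add_divide_distrib[symmetric] ring_distribs[symmetric])
  qed
  hence mc: "real m \<le> c * max 1 x" using m_le by linarith
  have c3: "3 * c \<le> srht_size_const \<delta>"
  proof -
    have "3 * c \<le> 3606 / \<delta> ^ 4" unfolding c_def using d3 by (simp add: frac_le)
    also have "\<dots> \<le> 2 * (2 * 3 * 6195 * 3096 * 16384) / \<delta> ^ 4" using d3 by (intro divide_right_mono) auto
    also have "\<dots> \<le> srht_size_const \<delta>" unfolding srht_size_const_def by (simp add: algebra_simps)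
    finally show ?thesis .
  qed
  have c0: "0 < c" unfolding c_def using d3 by simp
  have "real m \<le> 3 * c * max 1 (1 / \<epsilon> * (\<tau> + ln (1 / \<epsilon>)) * ln x)"
  proof (cases "3 \<le> x")
    case True
    have "x * 1 \<le> 1 / \<epsilon> * (\<tau> + ln (1 / \<epsilon>)) * ln x"
      using ln_ge_one[OF True] \<epsilon> x by (intro mult_mono) (auto simp: x_def field_simps ln_ge_zero)
    hence "c * max 1 x \<le> 3 * c * max 1 (1 / \<epsilon> * (\<tau> + ln (1 / \<epsilon>)) * ln x)"
      using True c0 by (intro mult_mono) auto
    thus ?thesis using mc by linarith
  next
    case False
    have "c * max 1 x \<le> c * 3" using False c0 by (intro mult_left_mono) auto
    also have "\<dots> \<le> 3 * c * max 1 (1 / \<epsilon> * (\<tau> + ln (1 / \<epsilon>)) * ln x)" using c0 by simp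
    finally show ?thesis using mc by linarith
  qed
  also have "\<dots> \<le> srht_size_const \<delta> * max 1 (1 / \<epsilon> * (\<tau> + ln (1 / \<epsilon>)) * ln x)"
    by (rule mult_right_mono[OF c3]) simp
  finally have b1: "real m \<le> srht_size_const \<delta> * max 1 (1 / \<epsilon> * (\<tau> + ln (1 / \<epsilon>)) * ln x)" .
  have "c * max 1 x \<le> srht_size_const \<delta> * max 1 x" using c3 c0 by (intro mult_right_mono) auto
  hence b2: "real m \<le> srht_size_const \<delta> * max 1 x" using mc by linarith
  have "48 * x / \<delta> ^ 3 \<le> 1200 * x / \<delta> ^ 3" using x d3 by (intro divide_right_mono) auto
  hence b3: "48 * x / \<delta> ^ 3 \<le> real m" using m by linarith
  have "\<tau>\<^sup>2 \<le> 3 * x" unfolding power2_eq_square using \<tau> x by (intro mult_mono) auto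
  hence "384 * \<tau>\<^sup>2 / \<delta> ^ 3 \<le> 1200 * x / \<delta> ^ 3" using x d3 by (intro divide_right_mono) auto
  hence b4: "384 * \<tau>\<^sup>2 / \<delta> ^ 3 \<le> real m" using m by linarith
  show ?thesis using \<open>0 < m\<close> b1 b2 b3 b4 unfolding x_def by blast
qed

text \<open>\<open>N\<close> is polynomial in \<open>x = \<tau> / \<epsilon>\<close> and
  \<open>ln x\<close> is at most \<open>s = \<tau> + ln (1 / \<epsilon>)\<close>, so
  \<open>L\<close> is of order \<open>s\<close> and \<open>p\<close> of order \<open>ln x\<close>.
  Up to constants the deviation condition asks for \<open>s * ln x\<close> rows and the product
  estimate for \<open>x\<close>; both are at most \<open>g\<close>, whose factor
  \<open>1 / \<epsilon>\<close> serves the second demand.\<close>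

lemma ex_srht_size_large:
  assumes \<delta>: "0 < \<delta>" "\<delta> \<le> 1" and \<epsilon>: "0 < \<epsilon>" "\<epsilon> \<le> 1" and \<tau>: "3 < \<tau>"
    and N: "1 \<le> real N" "real N \<le> 256 / \<delta> * max 1 (\<tau> / \<epsilon> + \<tau>\<^sup>2)"
  shows "\<exists>(m :: nat) (p :: nat) L. 0 < m \<and> 48 * (\<tau> / \<epsilon>) / \<delta> ^ 3 \<le> real m \<and>
    0 < L \<and> real N * exp (\<tau> / \<delta> / 2) \<le> \<delta> * exp (L / 6) \<and> L \<le> exp (real p) \<and> 0 < p \<and>
    2 * exp 1 * real p * (L / real m) \<le> (\<delta> / 128)\<^sup>2 \<and>
    real m \<le> srht_size_const \<delta> * max 1 (1 / \<epsilon> * (\<tau> + ln (1 / \<epsilon>)) * ln (\<tau> / \<epsilon>)) \<and>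
    real m \<le> srht_size_const \<delta> * (max 1 (\<tau> / \<epsilon>) * ln (2 + max 1 (\<tau> / \<epsilon>)) ^ 2)"
proof -
  define x where "x = \<tau> / \<epsilon>"
  define s where "s = \<tau> + ln (1 / \<epsilon>)"
  \<comment> \<open>Solves the failure condition of the flattening step with equality.\<close>
  define L where "L = 6 * (ln (real N) + ln (1 / \<delta>) + \<tau> / \<delta> / 2)"
  \<comment> \<open>Rounding \<open>ln L\<close> up meets \<open>L \<le> exp (real p)\<close>; the
    summand 1 keeps \<open>p\<close> positive.\<close>
  define p where "p = nat \<lceil>max 0 (ln L)\<rceil> + 1"
  define c where "c = 2 * 3 * 6195 * 3096 * 16384 / \<delta> ^ 4"
  define g where "g = 1 / \<epsilon> * s * ln x"
  define m where "m = nat \<lceil>c * g\<rceil>"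
  have e1: "1 \<le> 1 / \<epsilon>" using \<epsilon> by simp
  have lne: "0 \<le> ln (1 / \<epsilon>)" using e1 by (rule ln_ge_zero)
  have x: "\<tau> \<le> x" "1 / \<epsilon> \<le> x" "3 < x"
  proof -
    show "\<tau> \<le> x" using \<tau> mult_left_mono[OF e1, of \<tau>] by (simp add: x_def)
    thus "3 < x" using \<tau> by simp
    show "1 / \<epsilon> \<le> x" unfolding x_def using \<epsilon> \<tau> by (intro divide_right_mono) auto
  qed
  have lnx: "1 \<le> ln x" using x by (intro ln_ge_one) simp
  have s: "3 < s" "\<tau> \<le> s" using \<tau> lne by (auto simp: s_def)
  have d1: "1 \<le> 1 / \<delta>" using \<delta> by simp
  have lnd: "0 \<le> ln (1 / \<delta>)" "ln (1 / \<delta>) \<le> 1 / \<delta>" using d1 \<delta> ln_bound[of "1 / \<delta>"] by (auto simp del: ln_div)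
  have lnxs: "ln x \<le> s"
  proof -
    have "ln x = ln \<tau> + ln (1 / \<epsilon>)" using \<tau> \<epsilon> by (simp add: x_def ln_div)
    thus ?thesis using ln_bound[of \<tau>] \<tau> by (simp add: s_def)
  qed
  have s2x: "s \<le> 2 * x" using x ln_bound[of "1 / \<epsilon>"] \<epsilon> by (simp add: s_def del: ln_div)
  have lnN: "ln (real N) \<le> 512 / \<delta> + 2 * ln x"
  proof -
    have "x \<le> x\<^sup>2" "\<tau>\<^sup>2 \<le> x\<^sup>2" "1 \<le> x + \<tau>\<^sup>2"
      using x \<tau> by (auto simp: power2_eq_square intro!: mult_mono add_increasing2)
    hence "max 1 (x + \<tau>\<^sup>2) \<le> 2 * x\<^sup>2" by simp
    hence "256 / \<delta> * max 1 (x + \<tau>\<^sup>2) \<le> 256 / \<delta> * (2 * x\<^sup>2)" using \<delta> by (intro mult_left_mono) auto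
    hence "real N \<le> (512 / \<delta>) * x\<^sup>2" using N(2) unfolding x_def[symmetric] by simp
    hence "ln (real N) \<le> ln ((512 / \<delta>) * x\<^sup>2)" using N by (intro ln_mono) auto
    also have "\<dots> = ln (512 / \<delta>) + 2 * ln x" using \<delta> x
      by (subst ln_mult) (auto simp: ln_realpow simp del: ln_div times_divide_eq_left)
    also have "ln (512 / \<delta>) \<le> 512 / \<delta>" using \<delta> by (intro ln_bound) auto
    finally show ?thesis by simp
  qed
  have L: "0 < L" "L \<le> 3096 / \<delta> * s"
  proof -
    have "0 < \<tau> / \<delta> / 2" "0 \<le> ln (real N)" using \<tau> \<delta> N by auto
    thus "0 < L" unfolding L_def using lnd by simp
    have "512 / \<delta> + 1 / \<delta> \<le> 513 * (s / \<delta>)" using s \<delta> by (simp add: field_simps)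
    moreover have "s \<le> s / \<delta>" using mult_left_mono[OF d1, of s] s by simp
    moreover have "\<tau> / \<delta> / 2 \<le> s / \<delta>" using s \<tau> \<delta> by (simp add: field_simps)
    ultimately have "ln (real N) + ln (1 / \<delta>) + \<tau> / \<delta> / 2 \<le> 516 * (s / \<delta>)" using lnN lnd lnxs by linarith
    thus "L \<le> 3096 / \<delta> * s" by (simp add: L_def)
  qed
  have p: "0 < p" "L \<le> exp (real p)" "real p \<le> 6195 / \<delta> * ln x"
  proof -
    show "0 < p" by (simp add: p_def)
    have "ln L \<le> real p" unfolding p_def by linarith
    thus "L \<le> exp (real p)" using L(1) by (metis exp_ln exp_le_cancel_iff)
    have "3096 / \<delta> * s \<le> 3096 / \<delta> * (2 * x)" using s2x \<delta> by (intro mult_left_mono) auto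
    hence "L \<le> 6192 / \<delta> * x" using L(2) by simp
    hence "ln L \<le> ln (6192 / \<delta> * x)" using L(1) by (intro ln_mono) auto
    also have "\<dots> = ln (6192 / \<delta>) + ln x"
      using \<delta> x by (subst ln_mult) (auto simp del: ln_div times_divide_eq_left)
    also have "ln (6192 / \<delta>) \<le> 6192 / \<delta>" using \<delta> by (intro ln_bound) auto
    finally have "ln L \<le> 6192 / \<delta> + ln x" by simp
    moreover have "0 < 6192 / \<delta>" using \<delta> by simp
    ultimately have "max 0 (ln L) \<le> 6192 / \<delta> + ln x" using lnx by linarith
    hence "real p \<le> 6192 / \<delta> + ln x + 2" unfolding p_def by linarith
    also have "\<dots> \<le> 6192 / \<delta> * ln x + 1 / \<delta> * ln x + 2 / \<delta> * ln x"
    proof (intro add_mono)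
      show "6192 / \<delta> \<le> 6192 / \<delta> * ln x" using lnx \<delta> mult_left_mono[OF lnx, of "6192 / \<delta>"] by simp
      show "ln x \<le> 1 / \<delta> * ln x" using mult_right_mono[OF d1, of "ln x"] lnx by simp
      have "2 * 1 \<le> 2 / \<delta> * ln x" using lnx \<delta> by (intro mult_mono) (auto simp: field_simps)
      thus "2 \<le> 2 / \<delta> * ln x" by simp
    qed
    also have "\<dots> = 6195 / \<delta> * ln x" by (simp add: field_simps)
    finally show "real p \<le> 6195 / \<delta> * ln x" .
  qed
  have NL: "real N * exp (\<tau> / \<delta> / 2) \<le> \<delta> * exp (L / 6)"
  proof -
    have "L / 6 = ln (real N) + ln (1 / \<delta>) + \<tau> / \<delta> / 2" by (simp add: L_def del: ln_div)
    hence "exp (L / 6) = real N * (1 / \<delta>) * exp (\<tau> / \<delta> / 2)"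
      using N \<delta> by (simp only: exp_add) (simp del: ln_div)
    thus ?thesis using \<delta> by simp
  qed
  have d4: "0 < \<delta> ^ 4" "\<delta> ^ 4 \<le> 1" "\<delta> ^ 4 \<le> \<delta> ^ 3" "0 < \<delta> ^ 3" using \<delta> by (auto simp: power_le_one power_decreasing)
  have c: "1 \<le> c"
  proof -
    have "1 \<le> 1 / \<delta> ^ 4" using d4 by simp
    also have "\<dots> \<le> c" unfolding c_def using d4 by (intro divide_right_mono) auto
    finally show ?thesis .
  qed
  have xg: "x \<le> g"
  proof -
    have "x = 1 / \<epsilon> * \<tau> * 1" by (simp add: x_def)
    also have "\<dots> \<le> g" unfolding g_def using \<epsilon> s \<tau> lnx by (intro mult_mono) auto
    finally show ?thesis .
  qed
  have sg: "s * ln x \<le> g"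
  proof -
    have "1 * s * ln x \<le> g" unfolding g_def using e1 s lnx by (intro mult_right_mono) auto
    thus ?thesis by simp
  qed
  have g: "1 \<le> g" using xg x by simp
  have m: "c * g \<le> real m" unfolding m_def by linarith
  have m_le: "real m \<le> (c + 1) * g"
  proof -
    have "0 \<le> c * g" using c g by simp
    hence "real m \<le> c * g + 1" unfolding m_def by linarith
    also have "\<dots> \<le> (c + 1) * g" using g by (simp add: algebra_simps)
    finally show ?thesis .
  qed
  have "1 * 1 \<le> c * g" using c g by (intro mult_mono) auto
  hence m0: "0 < m" using m by (cases m) auto
  have m48: "48 * x / \<delta> ^ 3 \<le> real m"
  proof -
    have "48 / \<delta> ^ 3 \<le> c" unfolding c_def using d4 by (intro frac_le) auto
    hence "48 / \<delta> ^ 3 * x \<le> c * g" using xg x c by (intro mult_mono) auto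
    thus ?thesis using m by simp
  qed
  have dev: "2 * exp 1 * real p * (L / real m) \<le> (\<delta> / 128)\<^sup>2"
  proof -
    have "2 * exp 1 * real p * L \<le> 2 * 3 * (6195 / \<delta> * ln x) * (3096 / \<delta> * s)"
      using p L exp_le \<delta> lnx by (intro mult_mono) auto
    also have "\<dots> = (\<delta> / 128)\<^sup>2 * (c * (s * ln x))"
      using \<delta> by (simp add: c_def field_simps power2_eq_square power4_eq_xxxx)
    also have "\<dots> \<le> (\<delta> / 128)\<^sup>2 * real m"
    proof -
      have "c * (s * ln x) \<le> c * g" using sg c by (intro mult_left_mono) auto
      thus ?thesis using m by (intro mult_left_mono) auto
    qed
    finally show ?thesis using m0 by (simp add: field_simps)
  qed
  have b1: "real m \<le> srht_size_const \<delta> * max 1 g"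
  proof -
    have "(c + 1) * g \<le> srht_size_const \<delta> * max 1 g"
      unfolding srht_size_const_def c_def[symmetric] using c g by (intro mult_mono) auto
    thus ?thesis using m_le by linarith
  qed
  have b2: "real m \<le> srht_size_const \<delta> * (max 1 x * ln (2 + max 1 x) ^ 2)"
  proof -
    have "1 / \<epsilon> * ln (1 / \<epsilon>) \<le> x * ln x" using x \<epsilon> lne lnx by (intro mult_mono ln_mono) (auto simp del: ln_div)
    moreover have "1 / \<epsilon> * s = x + 1 / \<epsilon> * ln (1 / \<epsilon>)" by (simp add: s_def x_def add_divide_distrib)
    moreover have "x \<le> x * ln x" using x lnx mult_left_mono[OF lnx, of x] by simp
    ultimately have "1 / \<epsilon> * s \<le> 2 * (x * ln x)" by linarith
    hence "g \<le> 2 * (x * ln x) * ln x" unfolding g_def using lnx by (intro mult_right_mono) auto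
    also have "\<dots> = 2 * (x * ln x ^ 2)" by (simp add: power2_eq_square)
    also have "\<dots> \<le> 2 * (x * ln (2 + x) ^ 2)" using x lnx by (intro mult_left_mono power_mono ln_mono) auto
    finally have "(c + 1) * g \<le> (c + 1) * (2 * (x * ln (2 + x) ^ 2))" using c by (intro mult_left_mono) auto
    also have "\<dots> = srht_size_const \<delta> * (max 1 x * ln (2 + max 1 x) ^ 2)"
      using x by (simp add: srht_size_const_def c_def max_def)
    finally show ?thesis using m_le by linarith
  qed
  show ?thesis using m0 m48 L(1) NL p(1,2) dev b1 b2 unfolding g_def s_def x_def by blast
qed

context augmented_basis
begin

text \<open>The split at \<open>\<tau> = 3\<close> decides which spectral estimate is fed to
  \<open>sketch_good\<close>; above it \<open>\<tau> / \<epsilon>\<close> exceeds 3 as well, and its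
  logarithm is at least one.\<close>

lemma ex_sketch_sizes:
  assumes B: "B \<in> carrier_mat n k" and \<epsilon>: "0 < \<epsilon>" "\<epsilon> \<le> 1" and \<delta>: "0 < \<delta>" "\<delta> \<le> 1 / 7"
    and Xs: "Xs = ridge_sol lam A B" and Delta: "\<Delta> = ridge_cost lam A B Xs"
    and \<tau>: "\<tau> = stat_dim lam A"
  shows "\<exists>q m2. 0 < m2 \<and> real (2 ^ q) \<le> 256 / \<delta> * max 1 (\<tau> / \<epsilon> + \<tau>\<^sup>2) \<and>
    real m2 \<le> srht_size_const \<delta> * max 1 (1 / \<epsilon> * (\<tau> + ln (1 / \<epsilon>)) * ln (\<tau> / \<epsilon>)) \<and>
    real m2 \<le> srht_size_const \<delta> * (max 1 (\<tau> / \<epsilon>) * ln (2 + max 1 (\<tau> / \<epsilon>)) ^ 2) \<and>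
    measure_pmf.prob (sketch_pmf m2 (2 ^ q) n)
      {S. S \<in> carrier_mat m2 n \<and> spectral_norm (U1\<^sup>T * S\<^sup>T * S * U1 - U1\<^sup>T * U1) \<le> 1 / 4 \<and>
        (fro_norm (U1\<^sup>T * S\<^sup>T * S * (B - A * Xs) - U1\<^sup>T * (B - A * Xs)))\<^sup>2 \<le> \<epsilon> / 2 * \<Delta>} \<ge> 1 - 7 * \<delta>"
proof -
  have \<tau>0: "0 \<le> \<tau>" using fro_U1 unfolding \<tau> by (metis zero_le_power2)
  have \<delta>1: "\<delta> \<le> 1" using \<delta> by simp
  obtain q where q: "128 * \<tau>\<^sup>2 / \<delta> \<le> real (2 ^ q)" "16 * (\<tau> / \<epsilon>) / \<delta> \<le> real (2 ^ q)"
    "real (2 ^ q) \<le> 256 / \<delta> * max 1 (\<tau> / \<epsilon> + \<tau>\<^sup>2)"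
    using ex_sparse_embedding_size[OF \<delta>(1) \<delta>1 \<tau>0, of "\<tau> / \<epsilon>"] \<tau>0 \<epsilon> by auto
  let ?good = "\<lambda>m2. \<forall>W. W \<in> carrier_mat (2 ^ q) d \<longrightarrow>
      (\<forall>v. v \<in> carrier_vec d \<longrightarrow> (vec_norm2 (W *\<^sub>v v))\<^sup>2 \<le> 2 * (vec_norm2 v)\<^sup>2) \<longrightarrow>
      (fro_norm W)\<^sup>2 \<le> \<tau> / \<delta> \<longrightarrow>
      measure_pmf.prob (srht_pmf m2 (2 ^ q)) {S. spectral_norm (W\<^sup>T * S\<^sup>T * S * W - W\<^sup>T * W) \<le> 1 / 8} \<ge> 1 - (\<delta> + \<delta>)"
  have "\<exists>m2. 0 < m2 \<and> 48 * (\<tau> / \<epsilon>) / \<delta> ^ 3 \<le> real m2 \<and>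
    real m2 \<le> srht_size_const \<delta> * max 1 (1 / \<epsilon> * (\<tau> + ln (1 / \<epsilon>)) * ln (\<tau> / \<epsilon>)) \<and>
    real m2 \<le> srht_size_const \<delta> * (max 1 (\<tau> / \<epsilon>) * ln (2 + max 1 (\<tau> / \<epsilon>)) ^ 2) \<and> ?good m2"
  proof (cases "\<tau> \<le> 3")
    case True
    obtain m2 :: nat where m2: "0 < m2" "48 * (\<tau> / \<epsilon>) / \<delta> ^ 3 \<le> real m2" "384 * \<tau>\<^sup>2 / \<delta> ^ 3 \<le> real m2"
      "real m2 \<le> srht_size_const \<delta> * max 1 (1 / \<epsilon> * (\<tau> + ln (1 / \<epsilon>)) * ln (\<tau> / \<epsilon>))"
      "real m2 \<le> srht_size_const \<delta> * max 1 (\<tau> / \<epsilon>)"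
      using ex_srht_size_small[OF \<delta>(1) \<delta>1 \<epsilon> \<tau>0 True] by blast
    have "?good m2"
    proof (intro allI impI)
      fix W assume W: "W \<in> carrier_mat (2 ^ q) d" and Wf: "(fro_norm W)\<^sup>2 \<le> \<tau> / \<delta>"
      show "measure_pmf.prob (srht_pmf m2 (2 ^ q)) {S. spectral_norm (W\<^sup>T * S\<^sup>T * S * W - W\<^sup>T * W) \<le> 1 / 8} \<ge> 1 - (\<delta> + \<delta>)"
        using srht_spectral_small[OF m2(1) refl W Wf \<delta>(1) \<tau>0 m2(3)] \<delta>(1) by linarith
    qed
    moreover have "real m2 \<le> srht_size_const \<delta> * (max 1 (\<tau> / \<epsilon>) * ln (2 + max 1 (\<tau> / \<epsilon>)) ^ 2)"
    proof -
      have "max 1 (\<tau> / \<epsilon>) * 1 \<le> max 1 (\<tau> / \<epsilon>) * ln (2 + max 1 (\<tau> / \<epsilon>)) ^ 2"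
        by (intro mult_left_mono one_le_power ln_ge_one) auto
      hence "srht_size_const \<delta> * max 1 (\<tau> / \<epsilon>) \<le> srht_size_const \<delta> * (max 1 (\<tau> / \<epsilon>) * ln (2 + max 1 (\<tau> / \<epsilon>)) ^ 2)"
        using \<delta> by (intro mult_left_mono) (auto simp: srht_size_const_def)
      thus ?thesis using m2(5) by linarith
    qed
    ultimately show ?thesis using m2 by blast
  next
    case False
    obtain m2 p :: nat and L where m2: "0 < m2" "48 * (\<tau> / \<epsilon>) / \<delta> ^ 3 \<le> real m2"
      and L: "0 < L" "real (2 ^ q) * exp (\<tau> / \<delta> / 2) \<le> \<delta> * exp (L / 6)" "L \<le> exp (real p)" "0 < p"
        "2 * exp 1 * real p * (L / real m2) \<le> (\<delta> / 128)\<^sup>2"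
      and m2_le: "real m2 \<le> srht_size_const \<delta> * max 1 (1 / \<epsilon> * (\<tau> + ln (1 / \<epsilon>)) * ln (\<tau> / \<epsilon>))"
      "real m2 \<le> srht_size_const \<delta> * (max 1 (\<tau> / \<epsilon>) * ln (2 + max 1 (\<tau> / \<epsilon>)) ^ 2)"
      using ex_srht_size_large[OF \<delta>(1) \<delta>1 \<epsilon> _ _ q(3)] False by auto
    have "?good m2"
    proof (intro allI impI)
      fix W assume W: "W \<in> carrier_mat (2 ^ q) d" and Wf: "(fro_norm W)\<^sup>2 \<le> \<tau> / \<delta>"
        and contr: "\<forall>v. v \<in> carrier_vec d \<longrightarrow> (vec_norm2 (W *\<^sub>v v))\<^sup>2 \<le> 2 * (vec_norm2 v)\<^sup>2"
      have "real (2 ^ q) * exp ((fro_norm W)\<^sup>2 / 2) \<le> real (2 ^ q) * exp (\<tau> / \<delta> / 2)"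
        using Wf by (intro mult_left_mono) auto
      hence "real (2 ^ q) * exp ((fro_norm W)\<^sup>2 / 2) \<le> \<delta> * exp (L / 6)" using L(2) by linarith
      thus "measure_pmf.prob (srht_pmf m2 (2 ^ q)) {S. spectral_norm (W\<^sup>T * S\<^sup>T * S * W - W\<^sup>T * W) \<le> 1 / 8} \<ge> 1 - (\<delta> + \<delta>)"
        by (intro srht_spectral[OF m2(1) refl W _ _ \<delta>(1) \<delta>1 L(1,3,4,5)]) (use contr in auto)
    qed
    thus ?thesis using m2 m2_le by blast
  qed
  then obtain m2 where m2: "0 < m2" "48 * (\<tau> / \<epsilon>) / \<delta> ^ 3 \<le> real m2"
    "real m2 \<le> srht_size_const \<delta> * max 1 (1 / \<epsilon> * (\<tau> + ln (1 / \<epsilon>)) * ln (\<tau> / \<epsilon>))"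
    "real m2 \<le> srht_size_const \<delta> * (max 1 (\<tau> / \<epsilon>) * ln (2 + max 1 (\<tau> / \<epsilon>)) ^ 2)" and good: "?good m2"
    by blast
  have "measure_pmf.prob (sketch_pmf m2 (2 ^ q) n)
      {S. S \<in> carrier_mat m2 n \<and> spectral_norm (U1\<^sup>T * S\<^sup>T * S * U1 - U1\<^sup>T * U1) \<le> 1 / 4 \<and>
        (fro_norm (U1\<^sup>T * S\<^sup>T * S * (B - A * Xs) - U1\<^sup>T * (B - A * Xs)))\<^sup>2 \<le> \<epsilon> / 2 * \<Delta>} \<ge> 1 - 7 * \<delta>"
    by (rule sketch_good[OF B \<epsilon>(1) \<delta> refl q(1,2)[unfolded \<tau>] m2(1) m2(2)[unfolded \<tau>] _ Xs Delta refl])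
      (use good[unfolded \<tau>] in blast)
  thus ?thesis using m2 q(3) by blast
qed

end

section \<open>Running time and assembly\<close>

lemma lists_nonzeros_length:
  assumes "lists_nonzeros xs A"
  shows "length xs = nnz A"
  using assms distinct_card[of xs] by (auto simp: lists_nonzeros_def nnz_def)

lemma soft_bound_mono:
  assumes "C \<le> C'" "0 \<le> x"
  shows "soft_bound C k x \<le> soft_bound C' k x"
  using assms unfolding soft_bound_def by (intro mult_right_mono) auto

text \<open>Each column costs \<open>q\<close> transform levels of length \<open>2 ^ q\<close> and
  \<open>m\<close> sampled rows. As \<open>2 ^ q\<close> is at most a constant times
  \<open>y\<close>, \<open>q\<close> is logarithmic in the argument of the soft bound, while the
  bound on \<open>m\<close> already carries the square of that logarithm; hence the exponent
  2.\<close>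

lemma sketch_time_le:
  assumes N: "real (2 ^ q) \<le> C1 * y" and m: "real m \<le> C2 * (x * ln (2 + x) ^ 2)"
    and x: "1 \<le> x" "x \<le> y" and D: "1 \<le> D" and C: "0 < C1" "0 < C2"
  shows "real (sketch_time q m K D) \<le> 10 * real K + soft_bound (8 * C2 + C1 * (50 + 18 * C1)) 2 (real D * y)"
proof -
  let ?Y = "real D * y" and ?N = "2 ^ q :: real"
  let ?l = "ln (2 + ?Y)"
  have "1 \<le> y" "y \<le> ?Y" using x D mult_right_mono[of 1 "real D" y] by auto
  hence y: "y \<le> ?Y" "1 \<le> y" "1 \<le> ?Y" by linarith+
  have l: "1 \<le> ?l" using y by (intro ln_ge_one) auto
  have q: "real q \<le> 2 * C1 + 2 * ?l"
  proof -
    have "real q * (1 / 2) \<le> real q * ln 2" using ln2_ge_two_thirds by (intro mult_left_mono) auto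
    also have "\<dots> = ln ?N" by (simp add: ln_realpow)
    also have "\<dots> \<le> ln (C1 * y)" using N by (intro ln_mono) auto
    also have "\<dots> = ln C1 + ln y" using C y by (simp add: ln_mult)
    also have "\<dots> \<le> C1 + ?l"
    proof (intro add_mono ln_mono ln_bound)
      show "y \<le> 2 + ?Y" using y by linarith
    qed (use C y in auto)
    finally show ?thesis by simp
  qed
  have half: "2 * 2 ^ (q - 1) \<le> 2 * ?N"
    by (intro mult_left_mono power_increasing) auto
  have N1: "1 \<le> ?N" by simp
  have "real (sketch_time q m K D) = 10 * real K + 5 * ?N + 5 * real m + 2 * 2 ^ (q - 1) +
      real D * (real q * (2 * (2 * 2 ^ (q - 1)) + 5) + 3 * real m + 7) + 18"
    by (simp add: sketch_time_def column_time_def)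
  also have "\<dots> \<le> 10 * real K + 5 * (real D * ?N) + 5 * (real D * real m) + 2 * (real D * ?N) +
      real D * (real q * (2 * (2 * ?N) + 5 * ?N) + 3 * real m + 7 * ?N) + 18 * (real D * ?N)"
  proof -
    have DN: "?N \<le> real D * ?N" "real m \<le> real D * real m"
      using D mult_right_mono[of 1 "real D" ?N] mult_right_mono[of 1 "real D" "real m"] by auto
    have "18 \<le> 18 * (real D * ?N)" using DN N1 by linarith
    moreover have "real D * (real q * (2 * (2 * 2 ^ (q - 1)) + 5) + 3 * real m + 7) \<le>
        real D * (real q * (2 * (2 * ?N) + 5 * ?N) + 3 * real m + 7 * ?N)"
      using half N1 by (intro mult_left_mono add_mono) auto
    ultimately show ?thesis using DN half by linarith
  qed
  also have "\<dots> = 10 * real K + 8 * (real D * real m) + real D * ?N * (32 + 9 * real q)"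
    by (simp add: algebra_simps)
  also have "\<dots> \<le> 10 * real K + 8 * (C2 * (?Y * ?l ^ 2)) + C1 * ?Y * ((50 + 18 * C1) * ?l ^ 2)"
  proof (intro add_mono mult_left_mono)
    have "real m \<le> C2 * (y * ?l ^ 2)"
    proof (rule order_trans[OF m], intro mult_left_mono mult_mono power_mono ln_mono)
      show "2 + x \<le> 2 + ?Y" using x y by linarith
    qed (use x y C in auto)
    thus "real D * real m \<le> C2 * (?Y * ?l ^ 2)"
      using mult_left_mono[of "real m" "C2 * (y * ?l ^ 2)" "real D"] by (simp add: mult_ac)
    show "real D * ?N * (32 + 9 * real q) \<le> C1 * ?Y * ((50 + 18 * C1) * ?l ^ 2)"
    proof (rule mult_mono)
      show "real D * ?N \<le> C1 * ?Y" using mult_left_mono[OF N, of "real D"] by (simp add: mult_ac)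
      have "32 + 9 * real q \<le> 32 + 18 * C1 + 18 * ?l" using q by simp
      also have "\<dots> \<le> (32 + 18 * C1) * ?l + 18 * ?l" using l C mult_left_mono[OF l, of "32 + 18 * C1"] by simp
      also have "\<dots> = (50 + 18 * C1) * ?l" by (simp add: algebra_simps)
      also have "\<dots> \<le> (50 + 18 * C1) * ?l ^ 2"
        using l C by (intro mult_left_mono) (auto simp: power2_eq_square)
      finally show "32 + 9 * real q \<le> (50 + 18 * C1) * ?l ^ 2" .
    qed (use C y in auto)
  qed auto
  also have "\<dots> = 10 * real K + soft_bound (8 * C2 + C1 * (50 + 18 * C1)) 2 ?Y"
    by (simp add: soft_bound_def algebra_simps)
  finally show ?thesis .
qed

theorem theorem2p10:
  fixes p :: real
  assumes "0 < p" and "p < 1"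
  shows "\<exists>(C :: real) (k :: nat) (prog :: stmt list). 0 < C \<and>
    (\<forall>(n :: nat) (d :: nat) (d' :: nat) (A :: real mat) (B :: real mat)
      (lam :: real) (eps :: real) (U :: real mat).
      0 < n \<longrightarrow> 0 < d \<longrightarrow> 0 < d' \<longrightarrow>
      A \<in> carrier_mat n d \<longrightarrow> B \<in> carrier_mat n d' \<longrightarrow>
      0 < lam \<longrightarrow> 0 < eps \<longrightarrow> eps \<le> 1 \<longrightarrow>
      orthonormal_basis_of_col_space (n + d) d U (A @\<^sub>r (sqrt lam \<cdot>\<^sub>m 1\<^sub>m d)) \<longrightarrow>
      (let sd = stat_dim lam A;
           Xs = ridge_sol lam A B;
           Delta = ridge_cost lam A B Xs;
           U1 = first_rows n U
       in \<exists>(m1 :: nat) (m2 :: nat).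
         0 < m1 \<and> (\<exists>q. m1 = 2 ^ q) \<and> 0 < m2 \<and>
         real m1 \<le> C * max 1 (sd / eps + sd\<^sup>2) \<and>
         real m2 \<le> C * max 1 (1 / eps * (sd + ln (1 / eps)) * ln (sd / eps)) \<and>
         measure_pmf.prob (sketch_pmf m2 m1 n)
           {S. spectral_norm (U1\<^sup>T * S\<^sup>T * S * U1 - U1\<^sup>T * U1) \<le> 1 / 4 \<and>
               fro_norm (U1\<^sup>T * S\<^sup>T * S * (B - A * Xs) - U1\<^sup>T * (B - A * Xs))
                 \<le> sqrt (eps * Delta)} \<ge> p \<and>
         measure_pmf.prob (sketch_pmf m2 m1 n)
           {S. ridge_cost lam A B (sketched_ridge_sol lam S A B) \<le> (1 + eps) * Delta} \<ge> p \<and>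
         real m2 \<le> soft_bound C k (max 1 (sd / eps)) \<and>
         (\<forall>xs ys. lists_nonzeros xs A \<longrightarrow> lists_nonzeros ys B \<longrightarrow>
           (\<exists>T :: nat.
             real T \<le> C * real (nnz A + nnz B)
               + soft_bound C k (real (d + d') * max 1 (sd / eps + sd\<^sup>2)) \<and>
             halts_within T prog (input_store m1 m2 A B xs ys) \<and>
             map_pmf (\<lambda>(_, s). output_problem m2 d d' s)
                 (run T prog (input_store m1 m2 A B xs ys))
               = map_pmf (\<lambda>S. (S * A, S * B)) (sketch_pmf m2 m1 n) \<and>
             measure_pmf.prob (run T prog (input_store m1 m2 A B xs ys))
               {(_, s). case output_problem m2 d d' s of (A', B') \<Rightarrow>
                 ridge_cost lam A B (ridge_sol lam A' B') \<le> (1 + eps) * Delta} \<ge> p))))"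
proof -
  \<comment> \<open>\<open>sketch_good\<close> fails with probability at most
    \<open>7 * \<delta>\<close>.\<close>
  define \<delta> where "\<delta> = (1 - p) / 7"
  define C1 where "C1 = 256 / \<delta>"
  define C2 where "C2 = srht_size_const \<delta>"
  define C where "C = 10 + C1 + C2 + (8 * C2 + C1 * (50 + 18 * C1))"
  have \<delta>: "0 < \<delta>" "\<delta> \<le> 1 / 7" "1 - 7 * \<delta> = p"
    unfolding \<delta>_def using assms by argo+
  have C12: "0 < C1" "0 < C2" using \<delta> by (auto simp: C1_def C2_def srht_size_const_def add_pos_pos)
  have C34: "0 < 8 * C2 + C1 * (50 + 18 * C1)" using C12 by (intro add_pos_pos mult_pos_pos) auto
  have C: "0 < C" "10 \<le> C" "C1 \<le> C" "C2 \<le> C" "8 * C2 + C1 * (50 + 18 * C1) \<le> C"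
    using C12 C34 unfolding C_def by linarith+
  show ?thesis
  proof (rule exI[of _ C], rule exI[of _ 2], rule exI[of _ sketch_prog], intro conjI allI impI)
    fix n d d' :: nat and A B :: "real mat" and lam eps :: real and U :: "real mat"
    assume "0 < n" and d: "0 < d" and "0 < d'" and A: "A \<in> carrier_mat n d" and B: "B \<in> carrier_mat n d'"
      and lam: "0 < lam" and eps: "0 < eps" "eps \<le> 1"
      and U: "orthonormal_basis_of_col_space (n + d) d U (A @\<^sub>r (sqrt lam \<cdot>\<^sub>m 1\<^sub>m d))"
    interpret augmented_basis n d A U lam by unfold_locales (fact A lam U)+
    define sd where "sd = stat_dim lam A"
    define Xs where "Xs = ridge_sol lam A B"
    define Delta where "Delta = ridge_cost lam A B Xs"
    have sd: "0 \<le> sd" using fro_U1 unfolding sd_def by (metis zero_le_power2)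
    have Delta: "0 \<le> Delta" using lam unfolding Delta_def ridge_cost_def by simp
    obtain q m2 where m2: "0 < m2" and m1: "real (2 ^ q) \<le> C1 * max 1 (sd / eps + sd\<^sup>2)"
      and m2_le: "real m2 \<le> C2 * max 1 (1 / eps * (sd + ln (1 / eps)) * ln (sd / eps))"
      and m2_soft: "real m2 \<le> C2 * (max 1 (sd / eps) * ln (2 + max 1 (sd / eps)) ^ 2)"
      and good: "measure_pmf.prob (sketch_pmf m2 (2 ^ q) n)
        {S. S \<in> carrier_mat m2 n \<and> spectral_norm (U1\<^sup>T * S\<^sup>T * S * U1 - U1\<^sup>T * U1) \<le> 1 / 4 \<and>
          (fro_norm (U1\<^sup>T * S\<^sup>T * S * (B - A * Xs) - U1\<^sup>T * (B - A * Xs)))\<^sup>2 \<le> eps / 2 * Delta} \<ge> p"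
      (is "measure_pmf.prob _ ?Good \<ge> _")
      using ex_sketch_sizes[OF B eps \<delta>(1,2) Xs_def Delta_def sd_def] unfolding C1_def C2_def \<delta>(3) by blast
    let ?D = "sketch_pmf m2 (2 ^ q) n"
    have approx: "ridge_cost lam A B (ridge_sol lam (S * A) (S * B)) \<le> (1 + eps) * Delta" if "S \<in> ?Good" for S
      using that sketched_cost_le[OF B, of S m2 eps] eps unfolding Delta_def Xs_def by auto
    have p1: "measure_pmf.prob ?D
        {S. spectral_norm (U1\<^sup>T * S\<^sup>T * S * U1 - U1\<^sup>T * U1) \<le> 1 / 4 \<and>
          fro_norm (U1\<^sup>T * S\<^sup>T * S * (B - A * Xs) - U1\<^sup>T * (B - A * Xs)) \<le> sqrt (eps * Delta)} \<ge> p"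
    proof (rule order_trans[OF good], rule measure_pmf.finite_measure_mono)
      have "eps / 2 * Delta \<le> eps * Delta" using eps Delta by (intro mult_right_mono) auto
      thus "?Good \<subseteq> {S. spectral_norm (U1\<^sup>T * S\<^sup>T * S * U1 - U1\<^sup>T * U1) \<le> 1 / 4 \<and>
          fro_norm (U1\<^sup>T * S\<^sup>T * S * (B - A * Xs) - U1\<^sup>T * (B - A * Xs)) \<le> sqrt (eps * Delta)}"
        using real_le_rsqrt order_trans by blast
    qed simp
    have p2: "measure_pmf.prob ?D {S. ridge_cost lam A B (sketched_ridge_sol lam S A B) \<le> (1 + eps) * Delta} \<ge> p"
    proof (rule order_trans[OF good], rule measure_pmf.finite_measure_mono)
      show "?Good \<subseteq> {S. ridge_cost lam A B (sketched_ridge_sol lam S A B) \<le> (1 + eps) * Delta}"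
      proof
        fix S assume S: "S \<in> ?Good"
        hence "S \<in> carrier_mat m2 n" by blast
        from sketched_ridge_sol_eq[OF A B this, of lam] approx[OF S]
        show "S \<in> {S. ridge_cost lam A B (sketched_ridge_sol lam S A B) \<le> (1 + eps) * Delta}" by simp
      qed
    qed simp
    let ?T = "\<lambda>xs ys. sketch_time q m2 (length xs + length ys) (d + d')"
    let ?run = "\<lambda>xs ys. run (?T xs ys) sketch_prog (input_store (2 ^ q) m2 A B xs ys)"
    have prog: "\<exists>T :: nat. real T \<le> C * real (nnz A + nnz B) +
          soft_bound C 2 (real (d + d') * max 1 (sd / eps + sd\<^sup>2)) \<and>
        halts_within T sketch_prog (input_store (2 ^ q) m2 A B xs ys) \<and>
        map_pmf (\<lambda>(_, s). output_problem m2 d d' s) (run T sketch_prog (input_store (2 ^ q) m2 A B xs ys)) = map_pmf (\<lambda>S. (S * A, S * B)) ?D \<and>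
        measure_pmf.prob (run T sketch_prog (input_store (2 ^ q) m2 A B xs ys))
          {(_, s). case output_problem m2 d d' s of (A', B') \<Rightarrow>
            ridge_cost lam A B (ridge_sol lam A' B') \<le> (1 + eps) * Delta} \<ge> p"
      if xs: "lists_nonzeros xs A" and ys: "lists_nonzeros ys B" for xs ys
    proof (rule exI[of _ "?T xs ys"], intro conjI)
      let ?y = "max 1 (sd / eps + sd\<^sup>2)"
      note len = lists_nonzeros_length[OF xs] lists_nonzeros_length[OF ys]
      have "real (?T xs ys) \<le> 10 * real (nnz A + nnz B) + soft_bound (8 * C2 + C1 * (50 + 18 * C1)) 2 (real (d + d') * ?y)"
        unfolding len
      proof (rule sketch_time_le[OF m1 m2_soft])
        show "max 1 (sd / eps) \<le> ?y" by (rule max.mono) auto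
      qed (use d C12 in auto)
      moreover have "10 * real (nnz A + nnz B) \<le> C * real (nnz A + nnz B)"
        using C by (intro mult_right_mono) auto
      moreover have "soft_bound (8 * C2 + C1 * (50 + 18 * C1)) 2 (real (d + d') * ?y) \<le>
          soft_bound C 2 (real (d + d') * ?y)"
        using C by (intro soft_bound_mono mult_nonneg_nonneg) auto
      ultimately show "real (?T xs ys) \<le> C * real (nnz A + nnz B) + soft_bound C 2 (real (d + d') * ?y)" by linarith
      note correct = sketch_prog_correct[OF A B xs ys m2 order_refl, of q]
      show "halts_within (?T xs ys) sketch_prog (input_store (2 ^ q) m2 A B xs ys)" by (rule correct)
      show out: "map_pmf (\<lambda>(_, s). output_problem m2 d d' s) (?run xs ys) = map_pmf (\<lambda>S. (S * A, S * B)) ?D"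
        by (rule correct)
      let ?Q = "{(A', B'). ridge_cost lam A B (ridge_sol lam A' B') \<le> (1 + eps) * Delta}"
      \<comment> \<open>The output problem has the law of \<open>(S * A, S * B)\<close>, so the
        success probability is computed over sketches and pulled back to runs.\<close>
      have "p \<le> measure_pmf.prob ?D ((\<lambda>S. (S * A, S * B)) -` ?Q)"
        using approx by (intro order_trans[OF good] measure_pmf.finite_measure_mono) auto
      also have "\<dots> = measure_pmf.prob (map_pmf (\<lambda>S. (S * A, S * B)) ?D) ?Q" by (simp only: measure_map_pmf)
      also have "\<dots> = measure_pmf.prob (?run xs ys) ((\<lambda>(_, s). output_problem m2 d d' s) -` ?Q)"
        unfolding out[symmetric] by (simp only: measure_map_pmf)
      also have "(\<lambda>(_, s). output_problem m2 d d' s) -` ?Q = {(_, s). case output_problem m2 d d' s of (A', B') \<Rightarrow>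
            ridge_cost lam A B (ridge_sol lam A' B') \<le> (1 + eps) * Delta}"
        by auto
      finally show "p \<le> measure_pmf.prob (?run xs ys) {(_, s). case output_problem m2 d d' s of (A', B') \<Rightarrow>
            ridge_cost lam A B (ridge_sol lam A' B') \<le> (1 + eps) * Delta}" .
    qed
    have b1: "real (2 ^ q) \<le> C * max 1 (sd / eps + sd\<^sup>2)"
      by (rule order_trans[OF m1 mult_right_mono[OF C(3)]]) simp
    have b2: "real m2 \<le> C * max 1 (1 / eps * (sd + ln (1 / eps)) * ln (sd / eps))"
      by (rule order_trans[OF m2_le mult_right_mono[OF C(4)]]) simp
    have b3: "real m2 \<le> soft_bound C 2 (max 1 (sd / eps))"
      using order_trans[OF m2_soft mult_right_mono[OF C(4)]] by (simp add: soft_bound_def mult.assoc)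
    show "let sd = stat_dim lam A; Xs = ridge_sol lam A B; Delta = ridge_cost lam A B Xs; U1 = first_rows n U
      in \<exists>(m1 :: nat) (m2 :: nat).
         0 < m1 \<and> (\<exists>q. m1 = 2 ^ q) \<and> 0 < m2 \<and>
         real m1 \<le> C * max 1 (sd / eps + sd\<^sup>2) \<and>
         real m2 \<le> C * max 1 (1 / eps * (sd + ln (1 / eps)) * ln (sd / eps)) \<and>
         measure_pmf.prob (sketch_pmf m2 m1 n)
           {S. spectral_norm (U1\<^sup>T * S\<^sup>T * S * U1 - U1\<^sup>T * U1) \<le> 1 / 4 \<and>
               fro_norm (U1\<^sup>T * S\<^sup>T * S * (B - A * Xs) - U1\<^sup>T * (B - A * Xs))
                 \<le> sqrt (eps * Delta)} \<ge> p \<and>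
         measure_pmf.prob (sketch_pmf m2 m1 n)
           {S. ridge_cost lam A B (sketched_ridge_sol lam S A B) \<le> (1 + eps) * Delta} \<ge> p \<and>
         real m2 \<le> soft_bound C 2 (max 1 (sd / eps)) \<and>
         (\<forall>xs ys. lists_nonzeros xs A \<longrightarrow> lists_nonzeros ys B \<longrightarrow>
           (\<exists>T :: nat.
             real T \<le> C * real (nnz A + nnz B)
               + soft_bound C 2 (real (d + d') * max 1 (sd / eps + sd\<^sup>2)) \<and>
             halts_within T sketch_prog (input_store m1 m2 A B xs ys) \<and>
             map_pmf (\<lambda>(_, s). output_problem m2 d d' s)
                 (run T sketch_prog (input_store m1 m2 A B xs ys))
               = map_pmf (\<lambda>S. (S * A, S * B)) (sketch_pmf m2 m1 n) \<and>
             measure_pmf.prob (run T sketch_prog (input_store m1 m2 A B xs ys))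
               {(_, s). case output_problem m2 d d' s of (A', B') \<Rightarrow>
                 ridge_cost lam A B (ridge_sol lam A' B') \<le> (1 + eps) * Delta} \<ge> p))"
      unfolding Let_def sd_def[symmetric] Xs_def[symmetric] Delta_def[symmetric] U1_def[symmetric]
      by (rule exI[of _ "2 ^ q"], rule exI[of _ m2], intro conjI allI impI)
        (assumption | rule m2 b1 b2 b3 p1 p2 prog exI[of _ q] refl zero_less_power[OF zero_less_numeral])+
  qed (rule C)
qed

end
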